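(* Let $0<p,q,p_1,p_2,q_1,q_2\le\infty$ and $\tau\in(0,1)$. Then $$W_\tau:\mathcal{M}^{p_1,q_1}(\mathbb{R}^d)\times\mathcal{M}^{p_2,q_2}(\mathbb{R}^d)\longrightarrow W(\mathscr{F}L^p,L^q)(\mathbb{R}^{2d})$$ if and only if $$p_i,q_i\le q\quad(i=1,2)\qquad\text{and}\qquad\frac1{p_1}+\frac1{p_2}\ge\frac1p+\frac1q,\quad\frac1{q_1}+\frac1{q_2}\ge\frac1p+\frac1q.$$ Moreover, if these conditions hold, then for every $s\in\mathbb{R}$ $$W_\tau:\mathcal{M}^{p_1,q_1}_{v_{|s|}}(\mathbb{R}^d)\times\mathcal{M}^{p_2,q_2}_{v_s}(\mathbb{R}^d)\longrightarrow W(\mathscr{F}L^p,L^q_s)(\mathbb{R}^{2d}).$$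
   Context: $\tau$-Wigner distribution: for $f_1,f_2\in L^2(\mathbb{R}^d)$, $W_\tau(f_1,f_2)(x,\xi)=\int_{\mathbb{R}^d}f_1(x+\tau t)\overline{f_2(x-(1-\tau)t)}e^{-2\pi i\xi\cdot t}\,dt$. Power weights: $v_s(z)=\langle z\rangle^s=(1+|z|^2)^{s/2}$ for $z\in\mathbb{R}^{2d}$. Function spaces: for $f\in\mathcal{S}'(\mathbb{R}^n)$ and a fixed nonzero $\phi\in\mathcal{S}(\mathbb{R}^n)$, $V_\phi f(x,\xi)=\langle f,M_\xi T_x\phi\rangle$ with $T_xg(t)=g(t-x)$, $M_\xi g(t)=e^{2\pi it\cdot\xi}g(t)$. $M^{p,q}_m(\mathbb{R}^n)$ is the set of $f\in\mathcal{S}'(\mathbb{R}^n)$ with $\|f\|_{M^{p,q}_m}=\big(\int(\int|V_\phi f(x,\xi)|^pm(x,\xi)^pdx)^{q/p}d\xi\big)^{1/q}<\infty$ (usual modification if $p$ or $q$ is $\infty$; different $\phi$ give equivalent quasi-norms). $\mathcal{M}^{p,q}_m(\mathbb{R}^n)$ is the closure of $\mathcal{S}(\mathbb{R}^n)$ in $M^{p,q}_m(\mathbb{R}^n)$; the subscript is omitted when $m\equiv1$. The Wiener amalgam space $W(\mathscr{F}L^p,L^q_s)(\mathbb{R}^{2d})=\mathscr{F}M^{p,q}_{1\otimes v_s}(\mathbb{R}^{2d})$ is the set of $F\in\mathcal{S}'(\mathbb{R}^{2d})$ with $\|F\|=\|\mathscr{F}^{-1}F\|_{M^{p,q}_{1\otimes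 v_s}}$, i.e. (up to equivalence) $\big(\int_{\mathbb{R}^{2d}}(\int_{\mathbb{R}^{2d}}|V_\Phi F(\zeta,-z)|^pdz)^{q/p}\langle\zeta\rangle^{sq}d\zeta\big)^{1/q}<\infty$ for a nonzero $\Phi\in\mathcal{S}(\mathbb{R}^{2d})$, where $(1\otimes v_s)(z,\zeta)=v_s(\zeta)$; $W(\mathscr{F}L^p,L^q)$ is the case $s=0$. Boundedness notation: $W_\tau:\mathcal{M}^{p_1,q_1}_{m_1}\times\mathcal{M}^{p_2,q_2}_{m_2}\to X$ means there is $C>0$ with $\|W_\tau(f_1,f_2)\|_X\le C\|f_1\|_{M^{p_1,q_1}_{m_1}}\|f_2\|_{M^{p_2,q_2}_{m_2}}$ for all $f_1,f_2\in\mathcal{S}(\mathbb{R}^d)$. *)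

theory Defs
  imports "HOL-Analysis.Analysis" "HOL-Probability.Essential_Supremum"
begin

section \<open>Schwartz functions and tempered distributions\<close>

fun iterated_deriv :: "'a::euclidean_space list \<Rightarrow> ('a \<Rightarrow> complex) \<Rightarrow> 'a \<Rightarrow> complex" where
  "iterated_deriv [] f = f"
| "iterated_deriv (b # bs) f = (\<lambda>x. frechet_derivative (iterated_deriv bs f) (at x) b)"

definition schwartz :: "('a::euclidean_space \<Rightarrow> complex) set" where
  "schwartz = {f. \<forall>bs. set bs \<subseteq> Basis \<longrightarrow>
     (\<forall>x. iterated_deriv bs f differentiable (at x)) \<and>
     (\<forall>k::nat. \<exists>C. \<forall>x. (1 + norm x) ^ k * norm (iterated_deriv bs f x) \<le> C)}"

definition schwartz_seminorm :: "nat \<Rightarrow> ('a::euclidean_space \<Rightarrow> complex) \<Rightarrow> real" where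
  "schwartz_seminorm k f =
     (\<Sum>bs | set bs \<subseteq> Basis \<and> length bs \<le> k. SUP x. (1 + norm x) ^ k * norm (iterated_deriv bs f x))"

text \<open>
  The pairing \<open>\<langle>u, g\<rangle>\<close> of time-frequency analysis extends the \<open>L\<^sup>2\<close> inner product, so it is
  conjugate-linear in \<open>g\<close>. A tempered distribution \<open>u\<close> is represented by the functional
  \<open>g \<mapsto> \<langle>u, g\<rangle>\<close>; only its values on \<^const>\<open>schwartz\<close> matter.
\<close>

definition tempered_distribution :: "((('a::euclidean_space \<Rightarrow> complex) \<Rightarrow> complex)) set" where
  "tempered_distribution = {u.
     (\<forall>f\<in>schwartz. \<forall>g\<in>schwartz. u (\<lambda>x. f x + g x) = u f + u g) \<and>
     (\<forall>c. \<forall>f\<in>schwartz. u (\<lambda>x. c * f x) = cnj c * u f) \<and>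
     (\<exists>C k. \<forall>f\<in>schwartz. norm (u f) \<le> C * schwartz_seminorm k f)}"

definition distr_of :: "('a::euclidean_space \<Rightarrow> complex) \<Rightarrow> ('a \<Rightarrow> complex) \<Rightarrow> complex" where
  "distr_of f = (\<lambda>g. LINT t|lborel. f t * cnj (g t))"

section \<open>Short-time Fourier transform and modulation spaces\<close>

definition translation :: "'a::euclidean_space \<Rightarrow> ('a \<Rightarrow> complex) \<Rightarrow> 'a \<Rightarrow> complex" where
  "translation x g = (\<lambda>t. g (t - x))"

definition modulation :: "'a::euclidean_space \<Rightarrow> ('a \<Rightarrow> complex) \<Rightarrow> 'a \<Rightarrow> complex" where
  "modulation \<xi> g = (\<lambda>t. exp (2 * pi * \<i> * (t \<bullet> \<xi>)) * g t)"

definition stft :: "('a::euclidean_space \<Rightarrow> complex) \<Rightarrow> (('a \<Rightarrow> complex) \<Rightarrow> complex) \<Rightarrow> 'a \<Rightarrow> 'a \<Rightarrow> complex" where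
  "stft \<phi> u x \<xi> = u (modulation \<xi> (translation x \<phi>))"

text \<open>Real power of an extended nonnegative number, used for exponents \<open>r > 0\<close> only.\<close>

definition ennreal_powr :: "ennreal \<Rightarrow> real \<Rightarrow> ennreal" where
  "ennreal_powr a r = (if a = top then top else ennreal (enn2real a powr r))"

definition Lp_qnorm :: "ennreal \<Rightarrow> ('a::euclidean_space \<Rightarrow> ennreal) \<Rightarrow> ennreal" where
  "Lp_qnorm p h =
     (if p = top then esssup lborel h
      else ennreal_powr (\<integral>\<^sup>+x. ennreal_powr (h x) (enn2real p) \<partial>lborel) (1 / enn2real p))"

definition modulation_qnorm ::
  "('a::euclidean_space \<Rightarrow> complex) \<Rightarrow> ennreal \<Rightarrow> ennreal \<Rightarrow> ('a \<times> 'a \<Rightarrow> real) \<Rightarrow>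
   (('a \<Rightarrow> complex) \<Rightarrow> complex) \<Rightarrow> ennreal" where
  "modulation_qnorm \<phi> p q m u =
     Lp_qnorm q (\<lambda>\<xi>. Lp_qnorm p (\<lambda>x. ennreal (norm (stft \<phi> u x \<xi>) * m (x, \<xi>))))"

definition modulation_space ::
  "('a::euclidean_space \<Rightarrow> complex) \<Rightarrow> ennreal \<Rightarrow> ennreal \<Rightarrow> ('a \<times> 'a \<Rightarrow> real) \<Rightarrow>
   (('a \<Rightarrow> complex) \<Rightarrow> complex) set" where
  "modulation_space \<phi> p q m = {u \<in> tempered_distribution. modulation_qnorm \<phi> p q m u < top}"

definition modulation_space_closure ::
  "('a::euclidean_space \<Rightarrow> complex) \<Rightarrow> ennreal \<Rightarrow> ennreal \<Rightarrow> ('a \<times> 'a \<Rightarrow> real) \<Rightarrow>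
   (('a \<Rightarrow> complex) \<Rightarrow> complex) set" where
  "modulation_space_closure \<phi> p q m = {u \<in> modulation_space \<phi> p q m.
     \<forall>\<epsilon>>0. \<exists>f\<in>schwartz. modulation_qnorm \<phi> p q m (\<lambda>g. u g - distr_of f g) < \<epsilon>}"

definition power_weight :: "real \<Rightarrow> 'a::euclidean_space \<Rightarrow> real" where
  "power_weight s z = (1 + (norm z)\<^sup>2) powr (s / 2)"

section \<open>Wiener amalgam spaces\<close>

definition fourier :: "('a::euclidean_space \<Rightarrow> complex) \<Rightarrow> 'a \<Rightarrow> complex" where
  "fourier g = (\<lambda>\<xi>. LINT t|lborel. g t * exp (- (2 * pi * \<i> * (t \<bullet> \<xi>))))"

text \<open>
  The transpose of the inverse Fourier transform under the sesquilinear pairing is the Fourier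
  transform (Parseval): \<open>\<langle>F\<^sup>-\<^sup>1 u, g\<rangle> = \<langle>u, F g\<rangle>\<close>.
\<close>

definition inverse_fourier_distr ::
  "(('a::euclidean_space \<Rightarrow> complex) \<Rightarrow> complex) \<Rightarrow> ('a \<Rightarrow> complex) \<Rightarrow> complex" where
  "inverse_fourier_distr u = (\<lambda>g. u (fourier g))"

definition wiener_amalgam_qnorm ::
  "('a::euclidean_space \<Rightarrow> complex) \<Rightarrow> ennreal \<Rightarrow> ennreal \<Rightarrow> real \<Rightarrow>
   (('a \<Rightarrow> complex) \<Rightarrow> complex) \<Rightarrow> ennreal" where
  "wiener_amalgam_qnorm \<Phi> p q s u =
     modulation_qnorm \<Phi> p q (\<lambda>(z, \<zeta>). power_weight s \<zeta>) (inverse_fourier_distr u)"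

definition wiener_amalgam ::
  "('a::euclidean_space \<Rightarrow> complex) \<Rightarrow> ennreal \<Rightarrow> ennreal \<Rightarrow> real \<Rightarrow>
   (('a \<Rightarrow> complex) \<Rightarrow> complex) set" where
  "wiener_amalgam \<Phi> p q s = {u \<in> tempered_distribution. wiener_amalgam_qnorm \<Phi> p q s u < top}"

section \<open>The \<open>\<tau>\<close>-Wigner distribution and its boundedness\<close>

definition tau_wigner ::
  "real \<Rightarrow> ('a::euclidean_space \<Rightarrow> complex) \<Rightarrow> ('a \<Rightarrow> complex) \<Rightarrow> 'a \<times> 'a \<Rightarrow> complex" where
  "tau_wigner \<tau> f\<^sub>1 f\<^sub>2 = (\<lambda>(x, \<xi>). LINT t|lborel.
     f\<^sub>1 (x + \<tau> *\<^sub>R t) * cnj (f\<^sub>2 (x - (1 - \<tau>) *\<^sub>R t)) * exp (- (2 * pi * \<i> * (\<xi> \<bullet> t))))"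

text \<open>
  Boundedness on \<^const>\<open>modulation_space_closure\<close> of the two factors into
  \<^const>\<open>wiener_amalgam\<close> is by convention the quasi-norm estimate on the dense class of Schwartz
  functions, with windows \<open>\<phi>\<close> on the source side and \<open>\<Phi>\<close> on the target side.
\<close>

definition tau_wigner_bounded ::
  "('a::euclidean_space \<Rightarrow> complex) \<Rightarrow> ('a \<times> 'a \<Rightarrow> complex) \<Rightarrow> real \<Rightarrow>
   ennreal \<Rightarrow> ennreal \<Rightarrow> ('a \<times> 'a \<Rightarrow> real) \<Rightarrow> ennreal \<Rightarrow> ennreal \<Rightarrow> ('a \<times> 'a \<Rightarrow> real) \<Rightarrow>
   ennreal \<Rightarrow> ennreal \<Rightarrow> real \<Rightarrow> bool" where
  "tau_wigner_bounded \<phi> \<Phi> \<tau> p\<^sub>1 q\<^sub>1 m\<^sub>1 p\<^sub>2 q\<^sub>2 m\<^sub>2 p q s \<longleftrightarrow>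
     (\<exists>C::real. C > 0 \<and> (\<forall>f\<^sub>1\<in>schwartz. \<forall>f\<^sub>2\<in>schwartz.
        wiener_amalgam_qnorm \<Phi> p q s (distr_of (tau_wigner \<tau> f\<^sub>1 f\<^sub>2))
          \<le> ennreal C * modulation_qnorm \<phi> p\<^sub>1 q\<^sub>1 m\<^sub>1 (distr_of f\<^sub>1)
              * modulation_qnorm \<phi> p\<^sub>2 q\<^sub>2 m\<^sub>2 (distr_of f\<^sub>2)))"

end

theory Submission
  imports Defs "HOL-Probability.Probability"
begin

text \<open>
  The inverse Fourier transform of the \<open>\<tau>\<close>-Wigner distribution is a cross-ambiguity function. For
  suitable Gaussian windows the modulus of its short-time Fourier transform at position \<open>\<zeta>\<close> is a
  product of the moduli for \<open>f\<^sub>1\<close> and \<open>f\<^sub>2\<close>, at arguments that differ by skew translations. Hence the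
  claim is a convolution inequality \<open>L\<^sup>p\<^sup>1 * L\<^sup>p\<^sup>2 \<subseteq> L\<^sup>q\<close> of Young type, in mixed norms and after taking
  \<open>p\<close>-th powers. Outside the classical Young range it remains true because a short-time Fourier
  transform is dominated by a function of the same norm that is comparable to itself on unit balls,
  and for such functions the \<open>L\<^sup>p\<close> norms decrease in \<open>p\<close>. The same domination yields independence of
  the windows, also below exponent \<open>1\<close>. Necessity follows from Gaussians \<open>exp (-\<pi> \<epsilon>\<^sub>i |t|\<^sup>2)\<close>, for which all
  norms are explicit powers, by letting \<open>\<epsilon>\<^sub>1\<close> and \<open>\<epsilon>\<^sub>2\<close> tend to \<open>0\<close> or to infinity, together or separately.
\<close>

section \<open>Powers and norms of extended nonnegative functions\<close>

text \<open>Two obstacles shape the argument. In the target norm the \<open>p\<close>-norm in z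
  stands inside the \<open>q\<close>-norm in \<zeta>, but the product of the two transforms couples
  the first half of \<zeta> with the second half of z and vice versa. One Young inequality is used
  per pair, with \<open>p1\<close>, \<open>p2\<close> for positions and \<open>q1\<close>,
  \<open>q2\<close> for frequencies; between them Minkowski's inequality interchanges a
  \<open>q\<close>-norm with a \<open>p\<close>-norm, for which \<open>p \<le> q\<close> is
  required. The range \<open>q < p\<close> reduces to \<open>p = q\<close> by the embedding for
  locally comparable functions, and for \<open>p = q = top\<close> a pointwise bound suffices.
  Secondly, below exponent 1 the change of windows cannot rest on convolution with an integrable
  kernel; an L^r quasi-norm with r at most 1, p and q replaces it, since Minkowski's inequality
  survives in that form. The weights are absorbed because \<zeta> combines the two shifted arguments
  with coefficients \<tau> and 1 - \<tau>, neither of which is zero. For necessity both Gaussian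
  parameters are powers of one small \<delta>, so that only exponents of \<delta> are
  compared.\<close>

lemma ennreal_powr_zero [simp]: "ennreal_powr 0 r = 0"
  by (simp add: ennreal_powr_def)

lemma ennreal_powr_top [simp]: "ennreal_powr top r = top"
  by (simp add: ennreal_powr_def)

lemma ennreal_powr_ennreal: "0 \<le> x \<Longrightarrow> ennreal_powr (ennreal x) r = ennreal (x powr r)"
  by (simp add: ennreal_powr_def)

lemma ennreal_powr_one [simp]: "ennreal_powr a 1 = a"
  by (cases a) (auto simp: ennreal_powr_ennreal)

lemma ennreal_powr_one_base [simp]: "ennreal_powr 1 r = 1"
  using ennreal_powr_ennreal[of 1 r] by simp

lemma ennreal_powr_powr: "ennreal_powr (ennreal_powr a r) s = ennreal_powr a (r * s)"
  by (cases a) (auto simp: ennreal_powr_ennreal powr_powr)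

lemma ennreal_powr_add: "ennreal_powr a (r + s) = ennreal_powr a r * ennreal_powr a s"
  by (cases a) (auto simp: ennreal_powr_ennreal powr_add ennreal_mult)

text \<open>The conventions \<open>0 * top = 0\<close> and \<open>0 powr r = 0\<close> agree here:
  both sides vanish as soon as one factor does, for every real \<open>r\<close>.\<close>

lemma ennreal_powr_mult:
  "ennreal_powr (a * b) r = ennreal_powr a r * ennreal_powr b r"
proof (cases a)
  case (real x)
  show ?thesis
  proof (cases b)
    case (real y)
    then show ?thesis using \<open>a = ennreal x\<close> \<open>0 \<le> x\<close>
      by (simp add: ennreal_powr_ennreal powr_mult flip: ennreal_mult)
  next
    case top
    then show ?thesis using \<open>a = ennreal x\<close> \<open>0 \<le> x\<close>
      by (cases "x = 0") (auto simp: ennreal_powr_ennreal ennreal_mult_top)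
  qed
next
  case top
  then show ?thesis
  proof (cases b)
    case (real y)
    then show ?thesis using top
      by (cases "y = 0") (auto simp: ennreal_powr_ennreal ennreal_top_mult)
  qed auto
qed

lemma ennreal_powr_mono: "a \<le> b \<Longrightarrow> 0 \<le> r \<Longrightarrow> ennreal_powr a r \<le> ennreal_powr b r"
  by (cases a; cases b) (auto simp: ennreal_powr_ennreal top_unique powr_mono2 intro!: ennreal_leI)

lemma ennreal_powr_inverse:
  "0 < r \<Longrightarrow> ennreal_powr (ennreal_powr a r) (1 / r) = a"
  "0 < r \<Longrightarrow> ennreal_powr (ennreal_powr a (1 / r)) r = a"
  by (simp_all add: ennreal_powr_powr)

lemma ennreal_powr_eq_zero_iff [simp]: "ennreal_powr a r = 0 \<longleftrightarrow> a = 0"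
  by (cases a) (auto simp: ennreal_powr_ennreal)

lemma ennreal_powr_eq_top_iff [simp]: "ennreal_powr a r = top \<longleftrightarrow> a = top"
  by (cases a) (auto simp: ennreal_powr_ennreal)

lemma ennreal_powr_measurable [measurable]: "(\<lambda>a. ennreal_powr a r) \<in> borel_measurable borel"
  unfolding ennreal_powr_def by measurable

lemma ennreal_powr_measurable' [measurable (raw)]:
  "f \<in> borel_measurable M \<Longrightarrow> (\<lambda>x. ennreal_powr (f x) r) \<in> borel_measurable M"
  by simp

lemma exponent_cases:
  fixes p :: ennreal
  assumes "0 < p"
  obtains "p = top" | r where "0 < r" "p = ennreal r"
  using assms by (cases p) auto

lemma Lp_qnorm_top: "Lp_qnorm top h = esssup lborel h"
  by (simp add: Lp_qnorm_def)

lemma Lp_qnorm_ennreal: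
  "0 < r \<Longrightarrow> Lp_qnorm (ennreal r) h = ennreal_powr (\<integral>\<^sup>+x. ennreal_powr (h x) r \<partial>lborel) (1 / r)"
  by (simp add: Lp_qnorm_def)

lemma Lp_qnorm_AE_mono:
  fixes h k :: "'a::euclidean_space \<Rightarrow> ennreal"
  assumes "0 < p" "h \<in> borel_measurable borel" "AE x in lborel. h x \<le> k x"
  shows "Lp_qnorm p h \<le> Lp_qnorm p k"
  using assms(1)
proof (cases p rule: exponent_cases)
  case 1
  then show ?thesis using assms by (simp add: Lp_qnorm_top esssup_AE_mono)
next
  case (2 r)
  have "(\<integral>\<^sup>+x. ennreal_powr (h x) r \<partial>lborel) \<le> (\<integral>\<^sup>+x. ennreal_powr (k x) r \<partial>lborel)"
    using assms(3) by (intro nn_integral_mono_AE) (auto elim!: eventually_mono intro: ennreal_powr_mono less_imp_le[OF 2(1)])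
  with 2 show ?thesis by (simp add: Lp_qnorm_ennreal ennreal_powr_mono)
qed

lemma Lp_qnorm_mono:
  fixes h k :: "'a::euclidean_space \<Rightarrow> ennreal"
  assumes "0 < p" "h \<in> borel_measurable borel" "\<And>x. h x \<le> k x"
  shows "Lp_qnorm p h \<le> Lp_qnorm p k"
  using assms by (intro Lp_qnorm_AE_mono) auto

lemma Lp_qnorm_cmult_le:
  fixes h :: "'a::euclidean_space \<Rightarrow> ennreal"
  assumes "0 < p" and [measurable]: "h \<in> borel_measurable borel"
  shows "Lp_qnorm p (\<lambda>x. c * h x) \<le> c * Lp_qnorm p h"
  using assms(1)
proof (cases p rule: exponent_cases)
  case 1
  have "esssup lborel (\<lambda>x. c * h x) \<le> c * esssup lborel h"
    using esssup_AE[of h lborel] by (intro esssup_I) (auto elim!: eventually_mono intro: mult_left_mono)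
  then show ?thesis using 1 by (simp add: Lp_qnorm_top)
next
  case (2 r)
  then show ?thesis
    by (simp add: Lp_qnorm_ennreal ennreal_powr_mult nn_integral_cmult ennreal_powr_inverse)
qed

lemma Lp_qnorm_cmult:
  fixes h :: "'a::euclidean_space \<Rightarrow> ennreal"
  assumes "0 < p" and [measurable]: "h \<in> borel_measurable borel" and "0 < c"
  shows "Lp_qnorm p (\<lambda>x. ennreal c * h x) = ennreal c * Lp_qnorm p h"
proof (rule antisym[OF Lp_qnorm_cmult_le[OF assms(1,2)]])
  have eq: "ennreal (1 / c) * (ennreal c * y) = y" for y
    using \<open>0 < c\<close> by (simp add: mult.assoc[symmetric] ennreal_mult'[symmetric])
  have "Lp_qnorm p h = Lp_qnorm p (\<lambda>x. ennreal (1 / c) * (ennreal c * h x))"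
    by (simp add: eq)
  also have "\<dots> \<le> ennreal (1 / c) * Lp_qnorm p (\<lambda>x. ennreal c * h x)"
    by (intro Lp_qnorm_cmult_le assms) simp
  finally have "ennreal c * Lp_qnorm p h \<le> ennreal c * (ennreal (1 / c) * Lp_qnorm p (\<lambda>x. ennreal c * h x))"
    by (rule mult_left_mono) simp
  also have "\<dots> = Lp_qnorm p (\<lambda>x. ennreal c * h x)"
    using \<open>0 < c\<close> by (simp add: mult.assoc[symmetric] ennreal_mult'[symmetric])
  finally show "ennreal c * Lp_qnorm p h \<le> Lp_qnorm p (\<lambda>x. ennreal c * h x)" .
qed

lemma esssup_le_iff:
  assumes [measurable]: "f \<in> borel_measurable M"
  shows "esssup M f \<le> (c::ennreal) \<longleftrightarrow> (AE x in M. f x \<le> c)"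
proof
  assume "esssup M f \<le> c"
  then show "AE x in M. f x \<le> c"
    using esssup_AE[of f M] by (auto elim!: eventually_mono)
qed (rule esssup_I, auto)

text \<open>The delicate case is \<open>p = top\<close>: an essential supremum is at most
  \<open>c\<close> exactly if the set where the function exceeds \<open>c\<close> has measure zero,
  and that measure depends measurably on the parameter by Tonelli.\<close>

lemma Lp_qnorm_measurable [measurable (raw)]:
  fixes h :: "'b \<Rightarrow> 'a::euclidean_space \<Rightarrow> ennreal"
  assumes [measurable]: "case_prod h \<in> borel_measurable (M \<Otimes>\<^sub>M borel)"
  shows "(\<lambda>x. Lp_qnorm p (h x)) \<in> borel_measurable M"
proof (cases "p = top")
  case False
  have "case_prod h \<in> borel_measurable (M \<Otimes>\<^sub>M lborel)"
    using assms by (simp cong: measurable_cong_sets)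
  then show ?thesis using False unfolding Lp_qnorm_def by simp
next
  case True
  have *[measurable]: "case_prod h \<in> borel_measurable (M \<Otimes>\<^sub>M lborel)"
    using assms by (simp cong: measurable_cong_sets)
  have h: "h x \<in> borel_measurable borel" if "x \<in> space M" for x
    using measurable_compose[OF measurable_Pair1'[OF that] assms] by (simp add: comp_def)
  show ?thesis unfolding True Lp_qnorm_top
  proof (rule borel_measurableI_le)
    fix c
    have "{x \<in> space M. esssup lborel (h x) \<le> c}
        = {x \<in> space M. (\<integral>\<^sup>+y. indicator {c<..} (h x y) \<partial>lborel) = 0}"
    proof (intro Collect_cong conj_cong refl)
      fix x assume x: "x \<in> space M"
      note [measurable] = h[OF x]
      show "esssup lborel (h x) \<le> c \<longleftrightarrow> (\<integral>\<^sup>+y. indicator {c<..} (h x y) \<partial>lborel) = 0"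
        by (subst esssup_le_iff, simp, subst nn_integral_0_iff_AE, measurable)
           (simp add: indicator_def not_less)
    qed
    also have "\<dots> \<in> sets M" by measurable
    finally show "{x \<in> space M. esssup lborel (h x) \<le> c} \<in> sets M" .
  qed
qed

section \<open>Product spaces and iterated norms\<close>

lemma borel_measurable_fst [measurable]:
  "fst \<in> borel_measurable (borel :: ('a::second_countable_topology \<times> 'b::second_countable_topology) measure)"
  unfolding borel_prod[symmetric] by simp

lemma borel_measurable_snd [measurable]:
  "snd \<in> borel_measurable (borel :: ('a::second_countable_topology \<times> 'b::second_countable_topology) measure)"
  unfolding borel_prod[symmetric] by simp

lemma AE_lborel_commute:
  fixes P :: "'a::euclidean_space \<Rightarrow> 'b::euclidean_space \<Rightarrow> bool"
  assumes "Measurable.pred (borel \<Otimes>\<^sub>M borel) (\<lambda>x. P (fst x) (snd x))"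
  shows "(AE x in lborel. AE y in lborel. P x y) \<longleftrightarrow> (AE y in lborel. AE x in lborel. P x y)"
  by (rule lborel_pair.AE_commute) (use assms in \<open>unfold lborel_prod borel_prod pred_def, simp\<close>)

text \<open>Tonelli for finite \<open>p\<close>. For \<open>p = top\<close> both sides have the same
  upper bounds, by Fubini for almost-everywhere statements.\<close>

lemma Lp_qnorm_pair:
  fixes h :: "'a::euclidean_space \<times> 'b::euclidean_space \<Rightarrow> ennreal"
  assumes "0 < p" and [measurable]: "h \<in> borel_measurable borel"
  shows "Lp_qnorm p h = Lp_qnorm p (\<lambda>x. Lp_qnorm p (\<lambda>y. h (x, y)))"
  using assms(1)
proof (cases p rule: exponent_cases)
  case 1
  have [measurable]: "h \<in> borel_measurable (borel \<Otimes>\<^sub>M borel)"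
    using assms(2) by (simp add: borel_prod)
  have [measurable]: "(\<lambda>x. esssup lborel (\<lambda>y. h (x, y))) \<in> borel_measurable borel"
    unfolding Lp_qnorm_top[symmetric] by measurable
  have "esssup lborel h \<le> c \<longleftrightarrow> esssup lborel (\<lambda>x. esssup lborel (\<lambda>y. h (x, y))) \<le> c" for c
  proof -
    have "esssup lborel h \<le> c \<longleftrightarrow> (AE z in lborel \<Otimes>\<^sub>M lborel. h (fst z, snd z) \<le> c)"
      unfolding lborel_prod by (subst esssup_le_iff) simp_all
    also have "\<dots> \<longleftrightarrow> (AE x in lborel. AE y in lborel. h (x, y) \<le> c)"
      by (rule lborel_pair.AE_pair_iff[symmetric]) measurable
    also have "\<dots> \<longleftrightarrow> esssup lborel (\<lambda>x. esssup lborel (\<lambda>y. h (x, y))) \<le> c"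
      by (subst esssup_le_iff, simp, subst esssup_le_iff) simp_all
    finally show ?thesis .
  qed
  then show ?thesis unfolding 1 Lp_qnorm_top by (meson antisym order_refl)
next
  case (2 r)
  have "h \<in> borel_measurable (lborel \<Otimes>\<^sub>M lborel)" by (simp add: lborel_prod)
  then have "(\<integral>\<^sup>+z. ennreal_powr (h z) r \<partial>lborel)
     = (\<integral>\<^sup>+x. (\<integral>\<^sup>+y. ennreal_powr (h (x, y)) r \<partial>lborel) \<partial>lborel)"
    unfolding lborel_prod[symmetric] by (subst lborel.nn_integral_fst[symmetric]) auto
  with 2 show ?thesis by (simp add: Lp_qnorm_ennreal ennreal_powr_inverse)
qed

section \<open>Affine changes of variables\<close>

lemma nn_integral_lborel_affine:
  fixes f :: "'a::euclidean_space \<Rightarrow> ennreal"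
  assumes "c \<noteq> 0" and [measurable]: "f \<in> borel_measurable borel"
  shows "(\<integral>\<^sup>+x. f x \<partial>lborel) = ennreal (\<bar>c\<bar> ^ DIM('a)) * (\<integral>\<^sup>+x. f (t + c *\<^sub>R x) \<partial>lborel)"
  by (subst lborel_affine[OF assms(1), of t])
     (simp add: nn_integral_density nn_integral_distr nn_integral_cmult)

lemma nn_integral_lborel_translate:
  fixes f :: "'a::euclidean_space \<Rightarrow> ennreal"
  assumes [measurable]: "f \<in> borel_measurable borel"
  shows "(\<integral>\<^sup>+x. f (t + x) \<partial>lborel) = (\<integral>\<^sup>+x. f x \<partial>lborel)"
    and "(\<integral>\<^sup>+x. f (t - x) \<partial>lborel) = (\<integral>\<^sup>+x. f x \<partial>lborel)"
  using nn_integral_lborel_affine[of 1 f t] nn_integral_lborel_affine[of "-1" f t] by auto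

lemma AE_lborel_affine:
  assumes "c \<noteq> 0" "{x::'a::euclidean_space. P x} \<in> sets borel"
  shows "(AE x in lborel. P (t + c *\<^sub>R x)) \<longleftrightarrow> (AE x in lborel. P x)"
proof -
  have [measurable]: "Measurable.pred borel P"
    using assms(2) by (simp add: pred_def)
  have "(AE x in lborel. P x) \<longleftrightarrow> (\<integral>\<^sup>+x. indicator {x. \<not> P x} x \<partial>(lborel::'a measure)) = 0"
    by (subst nn_integral_0_iff_AE) (auto simp: indicator_def)
  also have "\<dots> \<longleftrightarrow> (\<integral>\<^sup>+x. indicator {x. \<not> P x} (t + c *\<^sub>R x) \<partial>(lborel::'a measure)) = 0"
    using assms(1) by (subst nn_integral_lborel_affine[of c _ t]) auto
  also have "\<dots> \<longleftrightarrow> (AE x in lborel. P (t + c *\<^sub>R x))"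
    by (subst nn_integral_0_iff_AE) (auto simp: indicator_def)
  finally show ?thesis by simp
qed

text \<open>For \<open>p = top\<close> the scaling factor is read as \<open>1\<close>, since then \<open>enn2real p = 0\<close> and division by
  zero yields zero.\<close>

lemma Lp_qnorm_affine:
  fixes h :: "'a::euclidean_space \<Rightarrow> ennreal"
  assumes "0 < p" "c \<noteq> 0" and [measurable]: "h \<in> borel_measurable borel"
  shows "Lp_qnorm p (\<lambda>x. h (t + c *\<^sub>R x)) = ennreal (\<bar>c\<bar> powr (- real DIM('a) / enn2real p)) * Lp_qnorm p h"
  using assms(1)
proof (cases p rule: exponent_cases)
  case 1
  have "esssup lborel (\<lambda>x. h (t + c *\<^sub>R x)) \<le> s \<longleftrightarrow> esssup lborel h \<le> s" for s
    using AE_lborel_affine[OF \<open>c \<noteq> 0\<close>, of "\<lambda>x. h x \<le> s" t] by (simp add: esssup_le_iff)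
  then have "esssup lborel (\<lambda>x. h (t + c *\<^sub>R x)) = esssup lborel h"
    by (meson antisym order_refl)
  then show ?thesis using \<open>c \<noteq> 0\<close> by (simp add: 1 Lp_qnorm_top)
next
  case (2 r)
  let ?I = "\<integral>\<^sup>+x. ennreal_powr (h (t + c *\<^sub>R x)) r \<partial>lborel"
  let ?n = "DIM('a)"
  have e: "(\<bar>c\<bar> powr (- real ?n / r)) * ((\<bar>c\<bar> ^ ?n) powr (1/r)) = 1"
    using \<open>c \<noteq> 0\<close> by (simp add: powr_realpow[symmetric] powr_powr powr_add[symmetric])
  have "Lp_qnorm p h = ennreal_powr (ennreal (\<bar>c\<bar> ^ ?n) * ?I) (1 / r)"
    using 2 by (simp add: Lp_qnorm_ennreal) (subst nn_integral_lborel_affine[OF \<open>c \<noteq> 0\<close>, of _ t], auto)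
  also have "\<dots> = ennreal ((\<bar>c\<bar> ^ ?n) powr (1/r)) * ennreal_powr ?I (1 / r)"
    using 2 by (simp add: ennreal_powr_mult ennreal_powr_ennreal)
  finally show ?thesis
    using 2 e by (simp add: Lp_qnorm_ennreal mult.assoc[symmetric] ennreal_mult'[symmetric])
qed

lemma Lp_qnorm_translate:
  fixes h :: "'a::euclidean_space \<Rightarrow> ennreal"
  assumes "0 < p" "h \<in> borel_measurable borel"
  shows "Lp_qnorm p (\<lambda>x. h (t + x)) = Lp_qnorm p h" "Lp_qnorm p (\<lambda>x. h (x - t)) = Lp_qnorm p h"
    "Lp_qnorm p (\<lambda>x. h (t - x)) = Lp_qnorm p h"
  using Lp_qnorm_affine[of p 1 h t] Lp_qnorm_affine[of p 1 h "-t"] Lp_qnorm_affine[of p "-1" h t] assms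
  by simp_all

subsection \<open>The inequalities of Hoelder and Minkowski\<close>

text \<open>Finiteness matters at the endpoints: for \<open>a = 0\<close> and \<open>x = top\<close>
  the left side contains \<open>ennreal_powr top 0 = top\<close>, whereas \<open>0 * top = 0\<close>
  on the right.\<close>

lemma ennreal_powr_young:
  assumes "0 \<le> a" "0 \<le> b" "a + b = (1::real)" "x \<noteq> top" "y \<noteq> top"
  shows "ennreal_powr x a * ennreal_powr y b \<le> ennreal a * x + ennreal b * y"
proof (cases "x = 0 \<or> y = 0")
  case True
  then show ?thesis by auto
next
  case False
  then obtain u v where "x = ennreal u" "y = ennreal v" "0 < u" "0 < v"
    using assms by (cases x; cases y) auto
  then show ?thesis using Youngs_inequality_0[of a b u v] assms
    by (simp add: ennreal_powr_ennreal ennreal_mult'[symmetric] ennreal_plus[symmetric] ennreal_leI del: ennreal_plus)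
qed

text \<open>Weights with \<open>a + b = 1\<close> replace conjugate exponents, which includes the
  endpoints without an infinite exponent. The proof applies the weighted arithmetic-geometric
  inequality pointwise to \<open>f\<close> and \<open>g\<close> divided by their integrals, after
  the cases of a zero or infinite integral are settled.\<close>

lemma nn_integral_Hoelder:
  fixes f g :: "'a \<Rightarrow> ennreal"
  assumes ab: "0 \<le> a" "0 \<le> b" "a + b = (1::real)"
    and [measurable]: "f \<in> borel_measurable M" "g \<in> borel_measurable M"
  shows "(\<integral>\<^sup>+x. ennreal_powr (f x) a * ennreal_powr (g x) b \<partial>M)
    \<le> ennreal_powr (\<integral>\<^sup>+x. f x \<partial>M) a * ennreal_powr (\<integral>\<^sup>+x. g x \<partial>M) b"
proof -
  let ?F = "\<integral>\<^sup>+x. f x \<partial>M" and ?G = "\<integral>\<^sup>+x. g x \<partial>M"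
  consider "?F = 0 \<or> ?G = 0" | "?F \<noteq> 0" "?G \<noteq> 0" "?F = top \<or> ?G = top"
    | "?F \<noteq> 0" "?G \<noteq> 0" "?F \<noteq> top" "?G \<noteq> top" by auto
  then show ?thesis
  proof cases
    case 1
    then have "AE x in M. ennreal_powr (f x) a * ennreal_powr (g x) b = 0"
      by (auto simp: nn_integral_0_iff_AE elim!: eventually_mono)
    then have "(\<integral>\<^sup>+x. ennreal_powr (f x) a * ennreal_powr (g x) b \<partial>M) = 0"
      by (subst nn_integral_0_iff_AE) auto
    then show ?thesis by simp
  next
    case 2
    then show ?thesis by (auto simp: ennreal_mult_top ennreal_top_mult)
  next
    case 3
    then obtain F G where FG: "?F = ennreal F" "?G = ennreal G" "0 < F" "0 < G"
      by (cases ?F; cases ?G) auto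
    have s: "ennreal (1 / c) * ennreal c = 1" if "0 < c" for c :: real
      using that by (simp add: ennreal_mult'[symmetric])
    have inv: "x = ennreal c * (ennreal (1 / c) * x)" if "0 < c" for c :: real and x
      using s[OF that] by (metis mult.assoc mult.commute mult_1)
    let ?k = "ennreal_powr (ennreal F) a * ennreal_powr (ennreal G) b"
    have le: "ennreal_powr (f x) a * ennreal_powr (g x) b
      \<le> ?k * (ennreal a * (ennreal (1 / F) * f x) + ennreal b * (ennreal (1 / G) * g x))"
      if "f x \<noteq> top" "g x \<noteq> top" for x
    proof -
      have e1: "ennreal_powr (f x) a = ennreal_powr (ennreal F) a * ennreal_powr (ennreal (1 / F) * f x) a"
        by (subst ennreal_powr_mult[symmetric], subst inv[OF FG(3), symmetric]) (rule refl)
      have e2: "ennreal_powr (g x) b = ennreal_powr (ennreal G) b * ennreal_powr (ennreal (1 / G) * g x) b"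
        by (subst ennreal_powr_mult[symmetric], subst inv[OF FG(4), symmetric]) (rule refl)
      have "ennreal_powr (f x) a * ennreal_powr (g x) b
        = ?k * (ennreal_powr (ennreal (1 / F) * f x) a * ennreal_powr (ennreal (1 / G) * g x) b)"
        by (subst e1, subst e2) (simp only: mult_ac)
      also have "\<dots> \<le> ?k * (ennreal a * (ennreal (1 / F) * f x) + ennreal b * (ennreal (1 / G) * g x))"
        using that by (intro mult_left_mono ennreal_powr_young ab) (auto simp: ennreal_mult_eq_top_iff)
      finally show ?thesis .
    qed
    have "AE x in M. f x \<noteq> top" "AE x in M. g x \<noteq> top"
      using 3 nn_integral_noteq_infinite[of f M] nn_integral_noteq_infinite[of g M] by auto
    then have "AE x in M. ennreal_powr (f x) a * ennreal_powr (g x) b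
      \<le> ?k * (ennreal a * (ennreal (1 / F) * f x) + ennreal b * (ennreal (1 / G) * g x))"
      by eventually_elim (rule le)
    then have "(\<integral>\<^sup>+x. ennreal_powr (f x) a * ennreal_powr (g x) b \<partial>M)
      \<le> (\<integral>\<^sup>+x. ?k * (ennreal a * (ennreal (1 / F) * f x) + ennreal b * (ennreal (1 / G) * g x)) \<partial>M)"
      by (rule nn_integral_mono_AE)
    also have "\<dots> = ?k * (ennreal a * (ennreal (1 / F) * ?F) + ennreal b * (ennreal (1 / G) * ?G))"
      by (simp add: nn_integral_cmult nn_integral_add)
    also have "\<dots> = ?k * (ennreal a + ennreal b)"
      using FG s by simp
    also have "\<dots> = ?k"
      using ab by (simp add: ennreal_plus[symmetric] del: ennreal_plus)
    finally show ?thesis using FG by simp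
  qed
qed

text \<open>Two-factor inequality twice, first with weights \<open>a\<close> and
  \<open>b + c\<close>, then inside the second factor; \<open>0 < c\<close> keeps
  \<open>b + c\<close> away from zero.\<close>

lemma nn_integral_Hoelder3:
  fixes f g h :: "'a \<Rightarrow> ennreal"
  assumes ab: "0 \<le> a" "0 \<le> b" "0 < c" "a + b + c = (1::real)"
    and [measurable]: "f \<in> borel_measurable M" "g \<in> borel_measurable M" "h \<in> borel_measurable M"
  shows "(\<integral>\<^sup>+x. ennreal_powr (f x) a * (ennreal_powr (g x) b * ennreal_powr (h x) c) \<partial>M)
    \<le> ennreal_powr (\<integral>\<^sup>+x. f x \<partial>M) a * (ennreal_powr (\<integral>\<^sup>+x. g x \<partial>M) b * ennreal_powr (\<integral>\<^sup>+x. h x \<partial>M) c)"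
proof -
  define d where "d = b + c"
  have d: "0 < d" "a + d = 1" "b / d + c / d = 1"
    using ab by (auto simp: d_def add_divide_distrib[symmetric])
  have split: "ennreal_powr x b * ennreal_powr y c
    = ennreal_powr (ennreal_powr x (b / d) * ennreal_powr y (c / d)) d" for x y
    using d by (simp add: ennreal_powr_mult ennreal_powr_powr)
  have "(\<integral>\<^sup>+x. ennreal_powr (f x) a * (ennreal_powr (g x) b * ennreal_powr (h x) c) \<partial>M)
    \<le> ennreal_powr (\<integral>\<^sup>+x. f x \<partial>M) a * ennreal_powr (\<integral>\<^sup>+x. ennreal_powr (g x) (b / d) * ennreal_powr (h x) (c / d) \<partial>M) d"
    unfolding split using ab d by (intro nn_integral_Hoelder) auto
  also have "\<dots> \<le> ennreal_powr (\<integral>\<^sup>+x. f x \<partial>M) a *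
     ennreal_powr (ennreal_powr (\<integral>\<^sup>+x. g x \<partial>M) (b / d) * ennreal_powr (\<integral>\<^sup>+x. h x \<partial>M) (c / d)) d"
    using ab d by (intro mult_left_mono ennreal_powr_mono nn_integral_Hoelder) auto
  finally show ?thesis unfolding split .
qed

text \<open>With \<open>N y\<close> the \<open>Q\<close>-norm of \<open>H\<close> in
  \<open>x\<close>, write H = (H^Q N^(1-Q))^(1/Q) N^(1-1/Q) and apply Hoelder in \<open>y\<close>.
  Then the \<open>Q\<close>-th power of the inner integral is at most I^(Q-1) times the integral of
  H^Q N^(1-Q), where I is the integral of \<open>N\<close>; integrating in \<open>x\<close> gives
  I^(Q-1) I. There is no division by the left side, which may be infinite.\<close>

lemma nn_integral_Minkowski:
  fixes H :: "'a::euclidean_space \<Rightarrow> 'b::euclidean_space \<Rightarrow> ennreal"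
  assumes "1 \<le> Q" and m: "case_prod H \<in> borel_measurable borel"
  shows "(\<integral>\<^sup>+x. ennreal_powr (\<integral>\<^sup>+y. H x y \<partial>lborel) Q \<partial>lborel)
    \<le> ennreal_powr (\<integral>\<^sup>+y. ennreal_powr (\<integral>\<^sup>+x. ennreal_powr (H x y) Q \<partial>lborel) (1 / Q) \<partial>lborel) Q"
proof (cases "Q = 1")
  case True
  have "case_prod H \<in> borel_measurable (lborel \<Otimes>\<^sub>M lborel)" using m by (simp add: lborel_prod)
  then show ?thesis using True lborel_pair.Fubini'[of H] by simp
next
  case False
  with assms have Q: "1 < Q" by simp
  have [measurable]: "case_prod H \<in> borel_measurable (borel \<Otimes>\<^sub>M borel)"
    "case_prod H \<in> borel_measurable (lborel \<Otimes>\<^sub>M lborel)"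
    using m by (simp_all add: borel_prod lborel_prod)
  have [measurable]: "case_prod (\<lambda>y x. H x y) \<in> borel_measurable (borel \<Otimes>\<^sub>M borel)"
    by (subst measurable_pair_swap_iff) (simp add: case_prod_beta')
  define N where "N y = ennreal_powr (\<integral>\<^sup>+x. ennreal_powr (H x y) Q \<partial>lborel) (1 / Q)" for y
  have [measurable]: "N \<in> borel_measurable borel"
    unfolding N_def by measurable
  define I where "I = (\<integral>\<^sup>+y. N y \<partial>lborel)"
  \<comment> \<open>This is N^(1-Q). Where \<open>N y = 0\<close> the function \<open>H\<close>
    vanishes for almost all \<open>x\<close>, and the value 0 keeps the reciprocal from becoming
    \<open>top\<close>.\<close>
  define k where "k y = (if N y = 0 then 0 else inverse (ennreal_powr (N y) (Q - 1)))" for y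
  have [measurable]: "k \<in> borel_measurable borel" unfolding k_def by measurable
  show ?thesis
  proof (cases "I = top")
    case True
    then show ?thesis unfolding N_def[symmetric] I_def[symmetric] by simp
  next
    case False
    have fin: "AE y in lborel. N y \<noteq> top"
      using False nn_integral_noteq_infinite[of N lborel] unfolding I_def by simp
    have le: "H x y \<le> ennreal_powr (ennreal_powr (H x y) Q * k y) (1 / Q) * ennreal_powr (N y) (1 - 1 / Q)"
      if y: "N y \<noteq> top" and 0: "N y = 0 \<Longrightarrow> H x y = 0" for x y
    proof (cases "N y = 0")
      case False
      with y obtain n where n: "N y = ennreal n" "0 < n" by (cases "N y") auto
      have "k y = ennreal (n powr (1 - Q))"
        using n by (simp add: k_def ennreal_powr_ennreal inverse_ennreal powr_minus[symmetric])
      then have "ennreal_powr (k y) (1 / Q) * ennreal_powr (N y) (1 - 1 / Q) = 1"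
        using n Q by (simp add: ennreal_powr_ennreal powr_powr ennreal_mult'[symmetric] powr_add[symmetric])
           (simp add: field_simps)
      then show ?thesis using Q
        by (simp add: ennreal_powr_mult ennreal_powr_powr mult.assoc)
    qed (use 0 in simp)
    have zero: "AE x in lborel. N y = 0 \<longrightarrow> H x y = 0" for y
    proof (cases "N y = 0")
      case True
      then have "(\<integral>\<^sup>+x. ennreal_powr (H x y) Q \<partial>lborel) = 0" by (simp add: N_def)
      then have "AE x in lborel. ennreal_powr (H x y) Q = 0"
        by (subst (asm) nn_integral_0_iff_AE) auto
      then show ?thesis by (auto elim!: eventually_mono)
    qed simp
    \<comment> \<open>Hoelder is applied in \<open>y\<close> for fixed \<open>x\<close>, so the null
      sets, known for each fixed \<open>y\<close>, have to be regrouped.\<close>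
    have "AE x in lborel. AE y in lborel. N y = 0 \<longrightarrow> H x y = 0"
      by (subst AE_lborel_commute) (use zero in auto)
    then have "AE x in lborel. AE y in lborel.
      H x y \<le> ennreal_powr (ennreal_powr (H x y) Q * k y) (1 / Q) * ennreal_powr (N y) (1 - 1 / Q)"
    proof (eventually_elim)
      case (elim x)
      show ?case using elim fin by eventually_elim (rule le, auto)
    qed
    then have "AE x in lborel. ennreal_powr (\<integral>\<^sup>+y. H x y \<partial>lborel) Q
      \<le> (\<integral>\<^sup>+y. ennreal_powr (H x y) Q * k y \<partial>lborel) * ennreal_powr I (Q - 1)"
    proof eventually_elim
      case (elim x)
      have "(\<integral>\<^sup>+y. H x y \<partial>lborel)
        \<le> (\<integral>\<^sup>+y. ennreal_powr (ennreal_powr (H x y) Q * k y) (1 / Q) * ennreal_powr (N y) (1 - 1 / Q) \<partial>lborel)"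
        using elim by (rule nn_integral_mono_AE)
      also have "\<dots> \<le> ennreal_powr (\<integral>\<^sup>+y. ennreal_powr (H x y) Q * k y \<partial>lborel) (1 / Q)
         * ennreal_powr I (1 - 1 / Q)"
        unfolding I_def using Q by (intro nn_integral_Hoelder) auto
      finally have "ennreal_powr (\<integral>\<^sup>+y. H x y \<partial>lborel) Q
        \<le> ennreal_powr (ennreal_powr (\<integral>\<^sup>+y. ennreal_powr (H x y) Q * k y \<partial>lborel) (1 / Q)
         * ennreal_powr I (1 - 1 / Q)) Q"
        using Q by (intro ennreal_powr_mono) auto
      also have "\<dots> = (\<integral>\<^sup>+y. ennreal_powr (H x y) Q * k y \<partial>lborel) * ennreal_powr I (Q - 1)"
        using Q by (simp add: ennreal_powr_mult ennreal_powr_powr algebra_simps)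
      finally show ?case .
    qed
    then have "(\<integral>\<^sup>+x. ennreal_powr (\<integral>\<^sup>+y. H x y \<partial>lborel) Q \<partial>lborel)
      \<le> (\<integral>\<^sup>+x. (\<integral>\<^sup>+y. ennreal_powr (H x y) Q * k y \<partial>lborel) * ennreal_powr I (Q - 1) \<partial>lborel)"
      by (rule nn_integral_mono_AE)
    also have "\<dots> = (\<integral>\<^sup>+x. (\<integral>\<^sup>+y. ennreal_powr (H x y) Q * k y \<partial>lborel) \<partial>lborel) * ennreal_powr I (Q - 1)"
      by (rule nn_integral_multc) measurable
    also have "(\<integral>\<^sup>+x. (\<integral>\<^sup>+y. ennreal_powr (H x y) Q * k y \<partial>lborel) \<partial>lborel)
       = (\<integral>\<^sup>+y. (\<integral>\<^sup>+x. ennreal_powr (H x y) Q * k y \<partial>lborel) \<partial>lborel)"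
      by (rule lborel_pair.Fubini'[symmetric]) measurable
    also have "\<dots> = (\<integral>\<^sup>+y. ennreal_powr (N y) Q * k y \<partial>lborel)"
      using Q by (intro nn_integral_cong, subst nn_integral_multc)
        (measurable, simp add: N_def ennreal_powr_powr)
    also have "\<dots> \<le> (\<integral>\<^sup>+y. N y \<partial>lborel)"
    proof (rule nn_integral_mono_AE)
      show "AE y in lborel. ennreal_powr (N y) Q * k y \<le> N y"
        using fin
      proof eventually_elim
        case (elim y)
        show ?case
        proof (cases "N y = 0")
          case False
          with elim obtain n where n: "N y = ennreal n" "0 < n" by (cases "N y") auto
          then show ?thesis
            by (simp add: k_def ennreal_powr_ennreal inverse_ennreal powr_minus[symmetric]
                ennreal_mult'[symmetric] powr_add[symmetric])
        qed simp
      qed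
    qed
    also have "(\<integral>\<^sup>+y. N y \<partial>lborel) * ennreal_powr I (Q - 1) = ennreal_powr I Q"
      using ennreal_powr_add[of I 1 "Q - 1"] by (simp add: I_def)
    finally show ?thesis unfolding I_def N_def by (simp add: mult_right_mono)
  qed
qed

text \<open>The integral form is applied to the \<open>p\<close>-th power of \<open>h\<close> with
  exponent q/p, which is at least 1. Hence only the order of \<open>p\<close> and \<open>q\<close>
  matters and both may lie below 1.\<close>

lemma Lp_qnorm_Minkowski:
  fixes h :: "'a::euclidean_space \<Rightarrow> 'b::euclidean_space \<Rightarrow> ennreal"
  assumes "0 < p" "p \<le> q" and m: "case_prod h \<in> borel_measurable borel"
  shows "Lp_qnorm q (\<lambda>x. Lp_qnorm p (\<lambda>y. h x y)) \<le> Lp_qnorm p (\<lambda>y. Lp_qnorm q (\<lambda>x. h x y))"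
proof (cases "q = top")
  case True
  have [measurable]: "case_prod h \<in> borel_measurable (borel \<Otimes>\<^sub>M borel)"
    using m by (simp_all add: borel_prod)
  have [measurable]: "case_prod (\<lambda>y x. h x y) \<in> borel_measurable (borel \<Otimes>\<^sub>M borel)"
    by (subst measurable_pair_swap_iff) (simp add: case_prod_beta')
  define S where "S y = Lp_qnorm top (\<lambda>x. h x y)" for y
  have [measurable]: "S \<in> borel_measurable borel"
    unfolding S_def by measurable
  have "AE y in lborel. AE x in lborel. h x y \<le> S y"
    unfolding S_def Lp_qnorm_top by (intro AE_I2 esssup_AE)
  then have "AE x in lborel. AE y in lborel. h x y \<le> S y"
    by (subst AE_lborel_commute) auto
  then have "AE x in lborel. Lp_qnorm p (\<lambda>y. h x y) \<le> Lp_qnorm p S"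
    by eventually_elim (rule Lp_qnorm_AE_mono[OF \<open>0 < p\<close>], auto)
  then show ?thesis unfolding True Lp_qnorm_top[of "\<lambda>x. Lp_qnorm p (h x)"] S_def[symmetric]
    by (intro esssup_I) auto
next
  case False
  with assms obtain r t where rt: "p = ennreal r" "q = ennreal t" "0 < r" "r \<le> t"
    by (cases p; cases q) (auto simp: top_unique)
  have [measurable]: "case_prod h \<in> borel_measurable (borel \<Otimes>\<^sub>M borel)"
    using m by (simp_all add: borel_prod)
  have mm: "case_prod (\<lambda>x y. ennreal_powr (h x y) r) \<in> borel_measurable borel"
    unfolding borel_prod[symmetric] by measurable
  have "(\<integral>\<^sup>+x. ennreal_powr (\<integral>\<^sup>+y. ennreal_powr (h x y) r \<partial>lborel) (t / r) \<partial>lborel)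
    \<le> ennreal_powr (\<integral>\<^sup>+y. ennreal_powr (\<integral>\<^sup>+x. ennreal_powr (ennreal_powr (h x y) r) (t / r) \<partial>lborel) (1 / (t / r)) \<partial>lborel) (t / r)"
    using rt by (intro nn_integral_Minkowski mm) auto
  then have "ennreal_powr (\<integral>\<^sup>+x. ennreal_powr (\<integral>\<^sup>+y. ennreal_powr (h x y) r \<partial>lborel) (t / r) \<partial>lborel) (1 / t)
    \<le> ennreal_powr (ennreal_powr (\<integral>\<^sup>+y. ennreal_powr (\<integral>\<^sup>+x. ennreal_powr (ennreal_powr (h x y) r) (t / r) \<partial>lborel) (1 / (t / r)) \<partial>lborel) (t / r)) (1 / t)"
    using rt by (intro ennreal_powr_mono) auto
  then show ?thesis using rt by (simp add: Lp_qnorm_ennreal ennreal_powr_powr)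
qed

text \<open>For equal exponents Minkowski's inequality holds in both directions, so the order of the
  two norms may be exchanged.\<close>

lemma Lp_qnorm_pair':
  fixes h :: "'a::euclidean_space \<times> 'b::euclidean_space \<Rightarrow> ennreal"
  assumes "0 < p" and [measurable]: "h \<in> borel_measurable borel"
  shows "Lp_qnorm p h = Lp_qnorm p (\<lambda>y. Lp_qnorm p (\<lambda>x. h (x, y)))"
proof -
  have [measurable]: "h \<in> borel_measurable (borel \<Otimes>\<^sub>M borel)"
    using assms(2) by (simp add: borel_prod)
  have "Lp_qnorm p h = Lp_qnorm p (\<lambda>x. Lp_qnorm p (\<lambda>y. h (x, y)))"
    using assms by (rule Lp_qnorm_pair)
  also have "\<dots> = Lp_qnorm p (\<lambda>y. Lp_qnorm p (\<lambda>x. h (x, y)))"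
    using assms(1) by (intro antisym Lp_qnorm_Minkowski) (auto simp: borel_prod[symmetric])
  finally show ?thesis .
qed

section \<open>Locally comparable functions\<close>

text \<open>A Harnack-type condition at unit scale. Functions of this kind behave like sequences on
  a lattice, for which the l^p norms decrease in p; this is what extends Young's inequality beyond
  its classical range.\<close>

definition locally_comparable :: "real \<Rightarrow> ('a::euclidean_space \<Rightarrow> ennreal) \<Rightarrow> bool" where
  "locally_comparable C G \<longleftrightarrow> (\<forall>x y. norm (x - y) \<le> 1 \<longrightarrow> G x \<le> ennreal C * G y)"

lemma locally_comparableD:
  "locally_comparable C G \<Longrightarrow> norm (x - y) \<le> 1 \<Longrightarrow> G x \<le> ennreal C * G y"
  by (simp add: locally_comparable_def)

lemma emeasure_lborel_cball_pos:
  obtains v where "0 < v" "\<And>x::'a::euclidean_space. emeasure lborel (cball x 1) = ennreal v"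
  by (rule that[of "unit_ball_vol (real DIM('a))"]) (simp_all add: emeasure_cball)

lemma Lp_qnorm_cmult_indicator_ge:
  fixes A :: "'a::euclidean_space set"
  assumes "0 < p" "emeasure lborel A = ennreal v" "0 < v" and [measurable]: "A \<in> sets borel"
  shows "c * ennreal (v powr (1 / enn2real p)) \<le> Lp_qnorm p (\<lambda>y. c * indicator A y)"
  using assms(1)
proof (cases p rule: exponent_cases)
  case 1
  have "AE y in lborel. c * indicator A y \<le> esssup lborel (\<lambda>y. c * indicator A y)"
    by (rule esssup_AE)
  moreover have "\<not> (AE y in lborel. y \<notin> A)"
    using assms AE_iff_null_sets[of A lborel] by (auto simp: null_sets_def)
  ultimately obtain y where "y \<in> A" "c * indicator A y \<le> esssup lborel (\<lambda>y. c * indicator A y)"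
    by (metis (mono_tags, lifting) eventually_mono)
  then show ?thesis using assms by (simp add: 1 Lp_qnorm_top)
next
  case (2 r)
  have "ennreal_powr (c * indicator A y) r = ennreal_powr c r * indicator A y" for y
    by (simp add: indicator_def)
  then show ?thesis using 2 assms
    by (simp add: Lp_qnorm_ennreal nn_integral_cmult_indicator ennreal_powr_mult ennreal_powr_inverse ennreal_powr_ennreal)
qed

text \<open>On the unit ball about \<open>x\<close> the function is at least \<open>G x / C\<close>,
  so its norm dominates that of a multiple of the indicator of the ball. The volume of the ball does
  not depend on \<open>x\<close>, hence neither does \<open>K\<close>.\<close>

lemma locally_comparable_le_Lp_qnorm:
  assumes "0 < p" "0 < C"
  obtains K where "0 < K" "\<And>G x. G \<in> borel_measurable borel \<Longrightarrow> locally_comparable C G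
    \<Longrightarrow> G (x::'a::euclidean_space) \<le> ennreal K * Lp_qnorm p G"
proof -
  obtain v where v: "0 < v" "\<And>x::'a. emeasure lborel (cball x 1) = ennreal v"
    using emeasure_lborel_cball_pos by blast
  define \<kappa> where "\<kappa> = v powr (1 / enn2real p)"
  have \<kappa>: "0 < \<kappa>" using v by (simp add: \<kappa>_def)
  show thesis
  proof
    show "0 < C / \<kappa>" using assms \<kappa> by simp
    fix G :: "'a \<Rightarrow> ennreal" and x
    assume [measurable]: "G \<in> borel_measurable borel" and G: "locally_comparable C G"
    have "G x * ennreal \<kappa> \<le> Lp_qnorm p (\<lambda>y. G x * indicator (cball x 1) y)"
      unfolding \<kappa>_def using v assms by (intro Lp_qnorm_cmult_indicator_ge) auto
    also have "\<dots> \<le> Lp_qnorm p (\<lambda>y. ennreal C * G y)"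
      using assms by (intro Lp_qnorm_mono)
        (auto simp: indicator_def dist_norm intro!: locally_comparableD[OF G])
    also have "\<dots> \<le> ennreal C * Lp_qnorm p G"
      using assms by (intro Lp_qnorm_cmult_le) auto
    finally have "ennreal (1 / \<kappa>) * (G x * ennreal \<kappa>) \<le> ennreal (1 / \<kappa>) * (ennreal C * Lp_qnorm p G)"
      by (rule mult_left_mono) simp
    moreover have "ennreal (1 / \<kappa>) * (G x * ennreal \<kappa>) = G x * (ennreal (1 / \<kappa>) * ennreal \<kappa>)"
      by (simp add: mult_ac)
    ultimately show "G x \<le> ennreal (C / \<kappa>) * Lp_qnorm p G"
      using \<kappa> assms by (simp add: ennreal_mult'[symmetric] mult.assoc[symmetric])
  qed
qed

text \<open>For finite exponents r < t split G^t = G^(t-r) G^r and bound the first factor by its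
  supremum, which the \<open>p\<close>-norm controls up to the factor \<open>K\<close>.\<close>

lemma locally_comparable_Lp_qnorm_embed:
  assumes "0 < p" "p \<le> p'" "0 < C"
  obtains K where "0 < K" "\<And>G. G \<in> borel_measurable borel \<Longrightarrow> locally_comparable C G
    \<Longrightarrow> Lp_qnorm p' G \<le> ennreal K * Lp_qnorm p (G::'a::euclidean_space \<Rightarrow> ennreal)"
proof -
  obtain K where K: "0 < K" "\<And>G x. G \<in> borel_measurable borel \<Longrightarrow> locally_comparable C G
    \<Longrightarrow> G (x::'a) \<le> ennreal K * Lp_qnorm p G"
    using locally_comparable_le_Lp_qnorm[OF assms(1,3)] by blast
  consider "p' = top" | "p = p'" | r t where "p = ennreal r" "p' = ennreal t" "0 < r" "r < t"
    using assms by (cases p; cases p') (auto simp: top_unique order_le_less ennreal_less_iff)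
  then show thesis
  proof cases
    case 1
    show thesis
    proof
      show "0 < K" by fact
    next
      fix G :: "'a \<Rightarrow> ennreal" assume "G \<in> borel_measurable borel" "locally_comparable C G"
      then show "Lp_qnorm p' G \<le> ennreal K * Lp_qnorm p G"
        using K unfolding 1 Lp_qnorm_top by (intro esssup_I) auto
    qed
  next
    case 2
    show thesis by (rule that[of 1]) (auto simp: 2)
  next
    case (3 r t)
    define L where "L = K powr ((t - r) / t)"
    show thesis
    proof
      show "0 < L" using K by (simp add: L_def)
      fix G :: "'a \<Rightarrow> ennreal" assume [measurable]: "G \<in> borel_measurable borel" and G: "locally_comparable C G"
      let ?N = "Lp_qnorm p G"
      have "(\<integral>\<^sup>+x. ennreal_powr (G x) t \<partial>lborel)
        = (\<integral>\<^sup>+x. ennreal_powr (G x) (t - r) * ennreal_powr (G x) r \<partial>lborel)"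
        by (simp add: ennreal_powr_add[symmetric])
      also have "\<dots> \<le> (\<integral>\<^sup>+x. ennreal_powr (ennreal K * ?N) (t - r) * ennreal_powr (G x) r \<partial>lborel)"
        using 3 G K by (intro nn_integral_mono mult_right_mono ennreal_powr_mono) auto
      also have "\<dots> = ennreal_powr (ennreal K * ?N) (t - r) * ennreal_powr ?N r"
        using 3 by (simp add: nn_integral_cmult Lp_qnorm_ennreal ennreal_powr_inverse)
      also have "\<dots> = ennreal_powr (ennreal K) (t - r) * ennreal_powr ?N t"
        by (simp add: ennreal_powr_mult mult.assoc ennreal_powr_add[symmetric])
      finally have "Lp_qnorm p' G \<le> ennreal_powr (ennreal_powr (ennreal K) (t - r) * ennreal_powr ?N t) (1 / t)"
        using 3 by (simp add: Lp_qnorm_ennreal ennreal_powr_mono)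
      also have "\<dots> = ennreal L * ?N"
        using 3 K by (simp add: ennreal_powr_mult ennreal_powr_powr ennreal_powr_ennreal L_def powr_powr)
      finally show "Lp_qnorm p' G \<le> ennreal L * ?N" .
    qed
  qed
qed

lemma locally_comparable_Lp_qnorm:
  fixes G :: "'a::euclidean_space \<times> 'b::euclidean_space \<Rightarrow> ennreal"
  assumes "0 < p" "locally_comparable C G" and [measurable]: "G \<in> borel_measurable borel"
  shows "locally_comparable C (\<lambda>\<xi>. Lp_qnorm p (\<lambda>x. G (x, \<xi>)))"
  unfolding locally_comparable_def
proof (intro allI impI)
  have [measurable]: "G \<in> borel_measurable (borel \<Otimes>\<^sub>M borel)"
    using assms(3) by (simp add: borel_prod)
  fix \<xi> \<eta> :: 'b assume "norm (\<xi> - \<eta>) \<le> 1"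
  then have "Lp_qnorm p (\<lambda>x. G (x, \<xi>)) \<le> Lp_qnorm p (\<lambda>x. ennreal C * G (x, \<eta>))"
    using assms(1) by (intro Lp_qnorm_mono) (auto intro!: locally_comparableD[OF assms(2)] simp: norm_Pair)
  also have "\<dots> \<le> ennreal C * Lp_qnorm p (\<lambda>x. G (x, \<eta>))"
    using assms(1) by (intro Lp_qnorm_cmult_le) auto
  finally show "Lp_qnorm p (\<lambda>x. G (x, \<xi>)) \<le> ennreal C * Lp_qnorm p (\<lambda>x. G (x, \<eta>))" .
qed

section \<open>Mixed norms\<close>

definition mixed_qnorm ::
  "ennreal \<Rightarrow> ennreal \<Rightarrow> ('a::euclidean_space \<times> 'b::euclidean_space \<Rightarrow> ennreal) \<Rightarrow> ennreal" where
  "mixed_qnorm p q G = Lp_qnorm q (\<lambda>\<xi>. Lp_qnorm p (\<lambda>x. G (x, \<xi>)))"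

lemma borel_measurable_swapped_pair:
  fixes h :: "'a::euclidean_space \<times> 'b::euclidean_space \<Rightarrow> ennreal"
  assumes "h \<in> borel_measurable borel"
  shows "(\<lambda>(y, x). h (x, y)) \<in> borel_measurable (borel \<Otimes>\<^sub>M borel)"
  using assms by (subst measurable_pair_swap_iff) (simp add: case_prod_beta' borel_prod)

lemma Lp_qnorm_fst_measurable:
  fixes h :: "'a::euclidean_space \<times> 'b::euclidean_space \<Rightarrow> ennreal"
  assumes "h \<in> borel_measurable borel"
  shows "(\<lambda>y. Lp_qnorm p (\<lambda>x. h (x, y))) \<in> borel_measurable borel"
    "(\<lambda>x. h (x, y)) \<in> borel_measurable borel"
  using borel_measurable_swapped_pair[OF assms] assms
  by (auto intro!: Lp_qnorm_measurable simp: case_prod_beta')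

lemma mixed_qnorm_mono:
  assumes "0 < p" "0 < q" and [measurable]: "G \<in> borel_measurable borel" "H \<in> borel_measurable borel"
    and "\<And>z. G z \<le> H z"
  shows "mixed_qnorm p q G \<le> mixed_qnorm p q H"
  unfolding mixed_qnorm_def using assms by (intro Lp_qnorm_mono Lp_qnorm_fst_measurable) auto

lemma mixed_qnorm_cmult_le:
  assumes "0 < p" "0 < q" and [measurable]: "G \<in> borel_measurable borel"
  shows "mixed_qnorm p q (\<lambda>z. c * G z) \<le> c * mixed_qnorm p q G"
proof -
  have "mixed_qnorm p q (\<lambda>z. c * G z) \<le> Lp_qnorm q (\<lambda>\<xi>. c * Lp_qnorm p (\<lambda>x. G (x, \<xi>)))"
    unfolding mixed_qnorm_def using assms
    by (intro Lp_qnorm_mono Lp_qnorm_cmult_le Lp_qnorm_fst_measurable) auto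
  also have "\<dots> \<le> c * mixed_qnorm p q G"
    unfolding mixed_qnorm_def using assms by (intro Lp_qnorm_cmult_le Lp_qnorm_fst_measurable) auto
  finally show ?thesis .
qed

text \<open>The inner norm of a locally comparable function is again locally comparable in the outer
  variable, so the one-variable embedding applies twice.\<close>

lemma locally_comparable_mixed_qnorm_embed:
  assumes "0 < p" "p \<le> p'" "0 < q" "q \<le> q'" "0 < C"
  obtains K where "0 < K" "\<And>G. G \<in> borel_measurable borel \<Longrightarrow> locally_comparable C G
    \<Longrightarrow> mixed_qnorm p' q' G \<le> ennreal K * mixed_qnorm p q (G::'a::euclidean_space \<times> 'b::euclidean_space \<Rightarrow> ennreal)"
proof -
  obtain K1 where K1: "0 < K1" "\<And>G. G \<in> borel_measurable borel \<Longrightarrow> locally_comparable C G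
    \<Longrightarrow> Lp_qnorm p' G \<le> ennreal K1 * Lp_qnorm p (G::'a \<Rightarrow> ennreal)"
    using locally_comparable_Lp_qnorm_embed[OF assms(1,2,5)] by blast
  obtain K2 where K2: "0 < K2" "\<And>G. G \<in> borel_measurable borel \<Longrightarrow> locally_comparable C G
    \<Longrightarrow> Lp_qnorm q' G \<le> ennreal K2 * Lp_qnorm q (G::'b \<Rightarrow> ennreal)"
    using locally_comparable_Lp_qnorm_embed[OF assms(3,4,5)] by blast
  have pq: "0 < p'" "0 < q'" using assms by auto
  show thesis
  proof
    show "0 < K1 * K2" using K1 K2 by simp
    fix G :: "'a \<times> 'b \<Rightarrow> ennreal"
    assume G[measurable]: "G \<in> borel_measurable borel" and c: "locally_comparable C G"
    have "locally_comparable C (\<lambda>x. G (x, \<xi>))" for \<xi>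
      unfolding locally_comparable_def by (auto intro!: locally_comparableD[OF c] simp: norm_Pair)
    then have "mixed_qnorm p' q' G \<le> Lp_qnorm q' (\<lambda>\<xi>. ennreal K1 * Lp_qnorm p (\<lambda>x. G (x, \<xi>)))"
      unfolding mixed_qnorm_def using pq
      by (intro Lp_qnorm_mono K1 Lp_qnorm_fst_measurable G) auto
    also have "\<dots> \<le> ennreal K1 * Lp_qnorm q' (\<lambda>\<xi>. Lp_qnorm p (\<lambda>x. G (x, \<xi>)))"
      using pq by (intro Lp_qnorm_cmult_le Lp_qnorm_fst_measurable G)
    also have "\<dots> \<le> ennreal K1 * (ennreal K2 * mixed_qnorm p q G)"
      unfolding mixed_qnorm_def
      by (intro mult_left_mono K2 Lp_qnorm_fst_measurable G locally_comparable_Lp_qnorm assms c) simp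
    also have "\<dots> = ennreal (K1 * K2) * mixed_qnorm p q G"
      using K1 K2 by (simp add: ennreal_mult mult.assoc)
    finally show "mixed_qnorm p' q' G \<le> ennreal (K1 * K2) * mixed_qnorm p q G" .
  qed
qed

section \<open>A skew form of Young's convolution inequality\<close>

lemma enn2real_inverse_ennreal: "0 < r \<Longrightarrow> 1 / ennreal r = ennreal (1 / r)"
  using divide_ennreal[of 1 r] by simp

text \<open>Young's relation for \<open>p\<close>-th powers: with the exponents p1/p, p2/p and q/p,
  all at least 1, it reads 1/(p1/p) + 1/(p2/p) = 1 + 1/(q/p).\<close>

definition young_exponents :: "ennreal \<Rightarrow> ennreal \<Rightarrow> ennreal \<Rightarrow> ennreal \<Rightarrow> bool" where
  "young_exponents p q p1 p2 \<longleftrightarrow> 0 < p \<and> p < top \<and> p \<le> p1 \<and> p1 \<le> q \<and> p \<le> p2 \<and> p2 \<le> q \<and>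
     1 / p1 + 1 / p2 = 1 / p + 1 / q"

lemma young_exponents_sym: "young_exponents p q p1 p2 \<Longrightarrow> young_exponents p q p2 p1"
  by (simp add: young_exponents_def add.commute)

text \<open>Exponents may be raised, at the price of local comparability, until the inequality
  between reciprocals becomes an equality. If one of them is at most \<open>p\<close>, the pair is
  raised to \<open>p\<close> and \<open>q\<close>; otherwise \<open>p1\<close> is kept and the
  second exponent is solved for.\<close>

lemma young_exponents_exist:
  assumes "0 < p" "p < top" "p \<le> q" "0 < p1" "p1 \<le> q" "0 < p2" "p2 \<le> q" "1 / p + 1 / q \<le> 1 / p1 + 1 / p2"
  obtains p1' p2' where "p1 \<le> p1'" "p2 \<le> p2'" "young_exponents p q p1' p2'"
proof -
  consider "p1 \<le> p" | "p2 \<le> p" | "p < p1" "p < p2" by force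
  then show thesis
  proof cases
    case 1
    then show thesis using assms by (intro that[of p q]) (auto simp: young_exponents_def)
  next
    case 2
    then show thesis using assms by (intro that[of q p]) (auto simp: young_exponents_def add.commute)
  next
    case 3
    obtain r where r: "p = ennreal r" "0 < r" using assms by (cases p) auto
    define i where "i x = (if x = top then 0 else 1 / enn2real x)" for x :: ennreal
    have i: "1 / x = ennreal (i x)" "0 \<le> i x" if "0 < x" for x
      using that by (cases x) (auto simp: i_def enn2real_inverse_ennreal)
    have less: "i y < i x" if "x < y" "0 < x" for x y
      using that by (cases x; cases y) (auto simp: i_def ennreal_less_iff field_simps)
    have le: "i y \<le> i x" if "x \<le> y" "0 < x" for x y
      using that less[of x y] by (cases "x = y") (auto intro: less_imp_le)
    have ilt: "i p1 < i p" "i p2 < i p"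
      using 3 assms by (auto intro: less)
    \<comment> \<open>The reciprocal of the new second exponent. It is positive because
      \<open>p < p1\<close>, also if \<open>q = top\<close>, so that its inverse is a finite
      exponent.\<close>
    define b where "b = i p + i q - i p1"
    have pos: "0 < p1" "0 < p2" "0 < q" "0 < p" using assms by auto
    have ge: "i p + i q \<le> i p1 + i p2"
      using assms(8) i[OF pos(1)] i[OF pos(2)] i[OF pos(3)] i[OF pos(4)]
      by (simp add: ennreal_plus[symmetric] del: ennreal_plus)
    have iq: "i q \<le> i p1" "i q \<le> i p2"
      using assms by (auto intro: le)
    have b: "0 < b" "i q \<le> b" "b \<le> i p2" "b \<le> i p"
      using ilt i[OF pos(3)] ge iq by (auto simp: b_def)
    have ib: "i (ennreal (1 / b)) = b" using b by (simp add: i_def)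
    have cmp: "x \<le> y" if "0 < x" "0 < y" "i y \<le> i x" for x y
      using that by (cases x; cases y) (auto simp: i_def field_simps split: if_splits)
    show thesis
    proof (rule that[of p1 "ennreal (1 / b)"])
      show "p2 \<le> ennreal (1 / b)" using b pos by (intro cmp) (auto simp: ib)
      have "p \<le> ennreal (1 / b)" "ennreal (1 / b) \<le> q"
        using b pos by (auto intro!: cmp simp: ib)
      moreover have "1 / ennreal (1 / b) = ennreal b" "i p1 + b = i p + i q"
        using i(1)[of "ennreal (1 / b)"] b ib by (simp_all add: b_def)
      then have "1 / p1 + 1 / ennreal (1 / b) = 1 / p + 1 / q"
        using i[OF pos(1)] i[OF pos(3)] i[OF pos(4)] b
        by (simp add: ennreal_plus[symmetric] del: ennreal_plus)
      ultimately show "young_exponents p q p1 (ennreal (1 / b))"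
        using assms 3 by (auto simp: young_exponents_def)
    qed simp
  qed
qed

lemma Lp_qnorm_Hoelder:
  fixes g1 g2 :: "'a::euclidean_space \<Rightarrow> ennreal"
  assumes "0 < p" "p < top" "0 < p1" "0 < p2" "1 / p1 + 1 / p2 = 1 / p"
    and [measurable]: "g1 \<in> borel_measurable borel" "g2 \<in> borel_measurable borel"
  shows "Lp_qnorm p (\<lambda>y. g1 y * g2 y) \<le> Lp_qnorm p1 g1 * Lp_qnorm p2 g2"
proof -
  obtain r where r: "p = ennreal r" "0 < r" using assms by (cases p) auto
  have top: "Lp_qnorm p (\<lambda>y. f y * g y) \<le> Lp_qnorm top f * Lp_qnorm p g"
    if [measurable]: "f \<in> borel_measurable borel" "g \<in> borel_measurable borel" for f g :: "'a \<Rightarrow> ennreal"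
  proof -
    have "AE y in lborel. f y * g y \<le> Lp_qnorm top f * g y"
      using esssup_AE[of f lborel] unfolding Lp_qnorm_top
      by eventually_elim (auto intro: mult_right_mono)
    then have "Lp_qnorm p (\<lambda>y. f y * g y) \<le> Lp_qnorm p (\<lambda>y. Lp_qnorm top f * g y)"
      using assms(1) by (intro Lp_qnorm_AE_mono) auto
    also have "\<dots> \<le> Lp_qnorm top f * Lp_qnorm p g"
      using assms(1) by (intro Lp_qnorm_cmult_le) auto
    finally show ?thesis .
  qed
  have inj: "x = p" if "1 / x = 1 / p" "0 < x" for x
    using that r by (cases x) (auto simp: enn2real_inverse_ennreal)
  consider "p1 = top" | "p2 = top" | r1 r2 where "p1 = ennreal r1" "p2 = ennreal r2" "0 < r1" "0 < r2"
    using assms by (cases p1; cases p2) auto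
  then show ?thesis
  proof cases
    case 1
    then have "p2 = p" using assms inj by simp
    then show ?thesis using 1 top[of g1 g2] by simp
  next
    case 2
    then have "p1 = p" using assms inj by simp
    then show ?thesis using 2 top[of g2 g1] by (simp add: mult.commute)
  next
    case (3 r1 r2)
    have e: "1 / r1 + 1 / r2 = 1 / r"
      using assms 3 r by (simp add: enn2real_inverse_ennreal ennreal_plus[symmetric] del: ennreal_plus)
    have e': "r / r1 + r / r2 = 1"
      using arg_cong[OF e, of "\<lambda>x. r * x"] r by (simp add: distrib_left)
    have "(\<integral>\<^sup>+y. ennreal_powr (g1 y * g2 y) r \<partial>lborel)
      = (\<integral>\<^sup>+y. ennreal_powr (ennreal_powr (g1 y) r1) (r / r1) * ennreal_powr (ennreal_powr (g2 y) r2) (r / r2) \<partial>lborel)"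
      using 3 by (simp add: ennreal_powr_powr ennreal_powr_mult)
    also have "\<dots> \<le> ennreal_powr (\<integral>\<^sup>+y. ennreal_powr (g1 y) r1 \<partial>lborel) (r / r1)
       * ennreal_powr (\<integral>\<^sup>+y. ennreal_powr (g2 y) r2 \<partial>lborel) (r / r2)"
      using r 3 e' by (intro nn_integral_Hoelder) auto
    finally have "ennreal_powr (\<integral>\<^sup>+y. ennreal_powr (g1 y * g2 y) r \<partial>lborel) (1 / r)
      \<le> ennreal_powr (ennreal_powr (\<integral>\<^sup>+y. ennreal_powr (g1 y) r1 \<partial>lborel) (r / r1)
       * ennreal_powr (\<integral>\<^sup>+y. ennreal_powr (g2 y) r2 \<partial>lborel) (r / r2)) (1 / r)"
      using r by (intro ennreal_powr_mono) auto
    then show ?thesis using r 3 by (simp add: Lp_qnorm_ennreal ennreal_powr_mult ennreal_powr_powr)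
  qed
qed

text \<open>Three-factor Hoelder in \<open>y\<close> for g1^p g2^p = X1^\<alpha> X2^\<beta> (X1
  X2)^\<gamma> with X1 = g1^p1 and X2 = g2^p2. The integrals of \<open>X1\<close> and
  \<open>X2\<close> do not depend on \<open>z\<close>, and only the last factor remains to be
  integrated in \<open>z\<close>. The powers of \<open>s\<close> and \<open>r\<close> come from
  rescaling \<open>y\<close> in those two integrals.\<close>

lemma skew_Young_finite:
  fixes g1 g2 :: "'a::euclidean_space \<Rightarrow> ennreal"
  assumes "0 < p" "p \<le> p1" "p1 \<le> q" "p \<le> p2" "p2 \<le> q" and e: "1 / p1 + 1 / p2 = 1 / p + 1 / (q::real)"
    and s: "s \<noteq> 0" "r \<noteq> 0" "s + r = 1"
    and [measurable]: "g1 \<in> borel_measurable borel" "g2 \<in> borel_measurable borel"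
  shows "Lp_qnorm (ennreal q) (\<lambda>z. Lp_qnorm (ennreal p) (\<lambda>y. g1 (z + s *\<^sub>R y) * g2 (z - r *\<^sub>R y)))
    \<le> ennreal (\<bar>s\<bar> powr (- real DIM('a) * (1 / p1 - 1 / q)) * \<bar>r\<bar> powr (- real DIM('a) * (1 / p2 - 1 / q)))
      * Lp_qnorm (ennreal p1) g1 * Lp_qnorm (ennreal p2) g2"
proof -
  \<comment> \<open>The weights for Hoelder: they sum to 1 by the relation \<open>e\<close>, and the
    first two are nonnegative because \<open>p1\<close> and \<open>p2\<close> are at most
    \<open>q\<close>.\<close>
  define \<alpha> \<beta> \<gamma> where "\<alpha> = p / p1 - p / q" and "\<beta> = p / p2 - p / q" and "\<gamma> = p / q"
  have pos: "0 < p1" "0 < p2" "0 < q" using assms by auto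
  have ex: "0 \<le> \<alpha>" "0 \<le> \<beta>" "0 < \<gamma>"
    using assms pos by (auto simp: \<alpha>_def \<beta>_def \<gamma>_def intro!: divide_left_mono)
  have "p / p1 + p / p2 = 1 + p / q"
    using arg_cong[OF e, of "\<lambda>x. p * x"] \<open>0 < p\<close> by (simp add: distrib_left)
  then have ex1: "\<alpha> + \<beta> + \<gamma> = 1" by (simp add: \<alpha>_def \<beta>_def \<gamma>_def)
  define X1 X2 where "X1 x = ennreal_powr (g1 x) p1" and "X2 x = ennreal_powr (g2 x) p2" for x
  have [measurable]: "X1 \<in> borel_measurable borel" "X2 \<in> borel_measurable borel"
    unfolding X1_def X2_def by measurable
  define A1 A2 where "A1 = (\<integral>\<^sup>+x. X1 x \<partial>lborel)" and "A2 = (\<integral>\<^sup>+x. X2 x \<partial>lborel)"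
  define d where "d = real DIM('a)"
  have aff: "(\<integral>\<^sup>+y. X (z + c *\<^sub>R y) \<partial>lborel) = ennreal (\<bar>c\<bar> powr (- d)) * (\<integral>\<^sup>+y. X y \<partial>lborel)"
    if "c \<noteq> 0" and [measurable]: "X \<in> borel_measurable borel" for c z and X :: "'a \<Rightarrow> ennreal"
    by (subst nn_integral_lborel_affine[OF that, of z])
       (use that in \<open>simp add: d_def powr_minus powr_realpow mult.assoc[symmetric] ennreal_mult'[symmetric]\<close>)
  have A1: "(\<integral>\<^sup>+y. X1 (z + s *\<^sub>R y) \<partial>lborel) = ennreal (\<bar>s\<bar> powr (- d)) * A1" for z
    using aff[of s X1 z] s by (simp add: A1_def)
  have A2: "(\<integral>\<^sup>+y. X2 (z - r *\<^sub>R y) \<partial>lborel) = ennreal (\<bar>r\<bar> powr (- d)) * A2" for z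
    using aff[of "-r" X2 z] s by (simp add: A2_def)
  let ?B = "\<lambda>z. \<integral>\<^sup>+y. X1 (z + s *\<^sub>R y) * X2 (z - r *\<^sub>R y) \<partial>lborel"
  define c where "c = ennreal_powr (ennreal (\<bar>s\<bar> powr (- d)) * A1) \<alpha> * ennreal_powr (ennreal (\<bar>r\<bar> powr (- d)) * A2) \<beta>"
  have inner: "(\<integral>\<^sup>+y. ennreal_powr (g1 (z + s *\<^sub>R y) * g2 (z - r *\<^sub>R y)) p \<partial>lborel) \<le> c * ennreal_powr (?B z) \<gamma>" for z
  proof -
    have "ennreal_powr (a * b) p = ennreal_powr (ennreal_powr a p1) \<alpha> *
       (ennreal_powr (ennreal_powr b p2) \<beta> * ennreal_powr (ennreal_powr a p1 * ennreal_powr b p2) \<gamma>)" for a b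
    proof -
      have "p = p1 * \<alpha> + p1 * \<gamma>" "p = p2 * \<beta> + p2 * \<gamma>"
        using pos by (simp_all add: \<alpha>_def \<beta>_def \<gamma>_def algebra_simps)
      then have "ennreal_powr a p = ennreal_powr a (p1 * \<alpha>) * ennreal_powr a (p1 * \<gamma>)"
         "ennreal_powr b p = ennreal_powr b (p2 * \<beta>) * ennreal_powr b (p2 * \<gamma>)"
        by (metis ennreal_powr_add)+
      then show ?thesis by (simp add: ennreal_powr_mult ennreal_powr_powr mult_ac)
    qed
    then have "(\<integral>\<^sup>+y. ennreal_powr (g1 (z + s *\<^sub>R y) * g2 (z - r *\<^sub>R y)) p \<partial>lborel)
      = (\<integral>\<^sup>+y. ennreal_powr (X1 (z + s *\<^sub>R y)) \<alpha> * (ennreal_powr (X2 (z - r *\<^sub>R y)) \<beta>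
          * ennreal_powr (X1 (z + s *\<^sub>R y) * X2 (z - r *\<^sub>R y)) \<gamma>) \<partial>lborel)"
      by (simp add: X1_def X2_def)
    also have "\<dots> \<le> ennreal_powr (\<integral>\<^sup>+y. X1 (z + s *\<^sub>R y) \<partial>lborel) \<alpha> *
       (ennreal_powr (\<integral>\<^sup>+y. X2 (z - r *\<^sub>R y) \<partial>lborel) \<beta> * ennreal_powr (?B z) \<gamma>)"
      using ex ex1 by (intro nn_integral_Hoelder3) auto
    finally show ?thesis by (simp add: A1 A2 c_def mult.assoc)
  qed
  \<comment> \<open>Since \<open>s + r = 1\<close>, the map (z, y) -> (z + s y, z - r y) preserves
    volume, so the double integral factors without a constant. It is carried out as two translations
    and two exchanges of the order of integration.\<close>
  have "(\<integral>\<^sup>+z. ?B z \<partial>lborel) = (\<integral>\<^sup>+y. (\<integral>\<^sup>+z. X1 (z + s *\<^sub>R y) * X2 (z - r *\<^sub>R y) \<partial>lborel) \<partial>lborel)"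
    by (rule lborel_pair.Fubini'[symmetric]) measurable
  also have "\<dots> = (\<integral>\<^sup>+y. (\<integral>\<^sup>+z. X1 z * X2 (z - y) \<partial>lborel) \<partial>lborel)"
  proof (rule nn_integral_cong)
    fix y :: 'a
    have "s *\<^sub>R y + r *\<^sub>R y = y" using s by (simp add: scaleR_left_distrib[symmetric])
    then have eq: "z - s *\<^sub>R y - r *\<^sub>R y = z - y" for z by (metis diff_diff_eq)
    show "(\<integral>\<^sup>+z. X1 (z + s *\<^sub>R y) * X2 (z - r *\<^sub>R y) \<partial>lborel) = (\<integral>\<^sup>+z. X1 z * X2 (z - y) \<partial>lborel)"
      using nn_integral_lborel_translate(1)[of "\<lambda>z. X1 (z + s *\<^sub>R y) * X2 (z - r *\<^sub>R y)" "- (s *\<^sub>R y)", symmetric]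
      by (simp add: eq)
  qed
  also have "\<dots> = (\<integral>\<^sup>+z. (\<integral>\<^sup>+y. X1 z * X2 (z - y) \<partial>lborel) \<partial>lborel)"
    by (rule lborel_pair.Fubini') measurable
  also have "\<dots> = A1 * A2"
    by (simp add: nn_integral_cmult nn_integral_multc nn_integral_lborel_translate A1_def A2_def)
  finally have B: "(\<integral>\<^sup>+z. ?B z \<partial>lborel) = A1 * A2" .
  have "Lp_qnorm (ennreal q) (\<lambda>z. Lp_qnorm (ennreal p) (\<lambda>y. g1 (z + s *\<^sub>R y) * g2 (z - r *\<^sub>R y)))
     = ennreal_powr (\<integral>\<^sup>+z. ennreal_powr (\<integral>\<^sup>+y. ennreal_powr (g1 (z + s *\<^sub>R y) * g2 (z - r *\<^sub>R y)) p \<partial>lborel) (q / p) \<partial>lborel) (1 / q)"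
    using pos \<open>0 < p\<close> by (simp add: Lp_qnorm_ennreal ennreal_powr_powr)
  also have "\<dots> \<le> ennreal_powr (\<integral>\<^sup>+z. ennreal_powr (c * ennreal_powr (?B z) \<gamma>) (q / p) \<partial>lborel) (1 / q)"
    using pos \<open>0 < p\<close> inner by (intro ennreal_powr_mono nn_integral_mono) auto
  also have "\<dots> = ennreal_powr (ennreal_powr c (q / p) * (A1 * A2)) (1 / q)"
    using pos \<open>0 < p\<close> by (simp add: ennreal_powr_mult ennreal_powr_powr \<gamma>_def nn_integral_cmult B)
  also have "\<dots> = ennreal_powr c (1 / p) * (ennreal_powr A1 (1 / q) * ennreal_powr A2 (1 / q))"
    using pos by (simp add: ennreal_powr_mult ennreal_powr_powr)
  also have "\<dots> = ennreal_powr (ennreal (\<bar>s\<bar> powr (- d))) (\<alpha> / p) * ennreal_powr (ennreal (\<bar>r\<bar> powr (- d))) (\<beta> / p)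
      * (ennreal_powr A1 (\<alpha> / p) * ennreal_powr A1 (1 / q)) * (ennreal_powr A2 (\<beta> / p) * ennreal_powr A2 (1 / q))"
    by (simp add: c_def ennreal_powr_mult ennreal_powr_powr mult_ac)
  also have "ennreal_powr A1 (\<alpha> / p) * ennreal_powr A1 (1 / q) = Lp_qnorm (ennreal p1) g1"
    using pos \<open>0 < p\<close> by (simp add: ennreal_powr_add[symmetric] Lp_qnorm_ennreal A1_def X1_def \<alpha>_def diff_divide_distrib)
  also have "ennreal_powr A2 (\<beta> / p) * ennreal_powr A2 (1 / q) = Lp_qnorm (ennreal p2) g2"
    using pos \<open>0 < p\<close> by (simp add: ennreal_powr_add[symmetric] Lp_qnorm_ennreal A2_def X2_def \<beta>_def diff_divide_distrib)
  also have "ennreal_powr (ennreal (\<bar>s\<bar> powr (- d))) (\<alpha> / p) * ennreal_powr (ennreal (\<bar>r\<bar> powr (- d))) (\<beta> / p)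
    = ennreal (\<bar>s\<bar> powr (- d * (1 / p1 - 1 / q)) * \<bar>r\<bar> powr (- d * (1 / p2 - 1 / q)))"
    using pos \<open>0 < p\<close> by (simp add: ennreal_powr_ennreal powr_powr ennreal_mult \<alpha>_def \<beta>_def diff_divide_distrib)
  finally show ?thesis unfolding d_def by simp
qed

text \<open>For \<open>q = top\<close> the relation reads 1/p1 + 1/p2 = 1/p, and Hoelder's
  inequality at each single \<open>z\<close> suffices, followed by rescaling.\<close>

lemma skew_Young:
  assumes Y: "young_exponents p q p1 p2" and s: "s \<noteq> 0" "r \<noteq> 0" "s + r = 1"
  obtains K where "0 < K" "\<And>g1 g2 :: 'a::euclidean_space \<Rightarrow> ennreal. g1 \<in> borel_measurable borel \<Longrightarrow> g2 \<in> borel_measurable borel \<Longrightarrow>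
    Lp_qnorm q (\<lambda>z. Lp_qnorm p (\<lambda>y. g1 (z + s *\<^sub>R y) * g2 (z - r *\<^sub>R y)))
    \<le> ennreal K * Lp_qnorm p1 g1 * Lp_qnorm p2 g2"
proof -
  have pos: "0 < p" "p < top" "0 < p1" "0 < p2" "0 < q" using Y by (auto simp: young_exponents_def)
  show thesis
  proof (cases "q = top")
    case False
    with Y obtain u t u1 u2 where u: "p = ennreal u" "q = ennreal t" "p1 = ennreal u1" "p2 = ennreal u2"
      "0 < u" "u \<le> u1" "u \<le> u2" "u1 \<le> t" "u2 \<le> t"
      by (cases p; cases q; cases p1; cases p2) (auto simp: young_exponents_def top_unique)
    have e: "1 / u1 + 1 / u2 = 1 / u + 1 / t"
      using Y u by (simp add: young_exponents_def enn2real_inverse_ennreal ennreal_plus[symmetric] del: ennreal_plus)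
    show thesis
    proof (rule that)
      show "0 < \<bar>s\<bar> powr (- real DIM('a) * (1 / u1 - 1 / t)) * \<bar>r\<bar> powr (- real DIM('a) * (1 / u2 - 1 / t))"
        using s by simp
      fix g1 g2 :: "'a \<Rightarrow> ennreal"
      assume g: "g1 \<in> borel_measurable borel" "g2 \<in> borel_measurable borel"
      show "Lp_qnorm q (\<lambda>z. Lp_qnorm p (\<lambda>y. g1 (z + s *\<^sub>R y) * g2 (z - r *\<^sub>R y)))
        \<le> ennreal (\<bar>s\<bar> powr (- real DIM('a) * (1 / u1 - 1 / t)) * \<bar>r\<bar> powr (- real DIM('a) * (1 / u2 - 1 / t)))
          * Lp_qnorm p1 g1 * Lp_qnorm p2 g2"
        unfolding u(1-4) by (rule skew_Young_finite[OF u(5,6,8,7,9) e s g])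
    qed
  next
    case True
    define K where "K = (\<bar>s\<bar> powr (- real DIM('a) / enn2real p1)) * (\<bar>r\<bar> powr (- real DIM('a) / enn2real p2))"
    show thesis
    proof
      show "0 < K" using s by (simp add: K_def)
      fix g1 g2 :: "'a \<Rightarrow> ennreal"
      assume [measurable]: "g1 \<in> borel_measurable borel" "g2 \<in> borel_measurable borel"
      have "Lp_qnorm p (\<lambda>y. g1 (z + s *\<^sub>R y) * g2 (z - r *\<^sub>R y)) \<le> ennreal K * Lp_qnorm p1 g1 * Lp_qnorm p2 g2" for z
      proof -
        have "Lp_qnorm p (\<lambda>y. g1 (z + s *\<^sub>R y) * g2 (z - r *\<^sub>R y))
          \<le> Lp_qnorm p1 (\<lambda>y. g1 (z + s *\<^sub>R y)) * Lp_qnorm p2 (\<lambda>y. g2 (z - r *\<^sub>R y))"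
          using Y pos True by (intro Lp_qnorm_Hoelder) (auto simp: young_exponents_def)
        also have "\<dots> = ennreal K * Lp_qnorm p1 g1 * Lp_qnorm p2 g2"
          using Lp_qnorm_affine[OF pos(3) s(1), of g1 z] Lp_qnorm_affine[OF pos(4), of "-r" g2 z] s
          by (simp add: K_def ennreal_mult mult_ac)
        finally show ?thesis .
      qed
      then show "Lp_qnorm q (\<lambda>z. Lp_qnorm p (\<lambda>y. g1 (z + s *\<^sub>R y) * g2 (z - r *\<^sub>R y)))
         \<le> ennreal K * Lp_qnorm p1 g1 * Lp_qnorm p2 g2"
        unfolding True Lp_qnorm_top[of "\<lambda>z. Lp_qnorm p (f z)" for f]
        by (intro esssup_I AE_I2) auto
    qed
  qed
qed

section \<open>The bilinear estimate\<close>

text \<open>The shape of the right side of \<open>vstft_ambiguity\<close>. The coordinates cross: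
  the position arguments involve the first half of \<zeta> and the second half of z, the frequency
  arguments the other two halves.\<close>

definition skew_product ::
  "real \<Rightarrow> ('a::euclidean_space \<times> 'a \<Rightarrow> ennreal) \<Rightarrow> ('a \<times> 'a \<Rightarrow> ennreal) \<Rightarrow> 'a \<times> 'a \<Rightarrow> 'a \<times> 'a \<Rightarrow> ennreal" where
  "skew_product \<tau> G1 G2 \<zeta> z =
     G1 (fst \<zeta> + \<tau> *\<^sub>R snd z, snd \<zeta> - (1 - \<tau>) *\<^sub>R fst z) *
     G2 (fst \<zeta> - (1 - \<tau>) *\<^sub>R snd z, snd \<zeta> + \<tau> *\<^sub>R fst z)"

lemma skew_product_measurable [measurable]:
  assumes [measurable]: "G1 \<in> borel_measurable borel" "G2 \<in> borel_measurable borel"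
  shows "case_prod (skew_product \<tau> G1 G2) \<in> borel_measurable (borel \<Otimes>\<^sub>M borel)"
    "skew_product \<tau> G1 G2 \<zeta> \<in> borel_measurable borel"
  unfolding skew_product_def[abs_def] by measurable

text \<open>For fixed frequency variables Young's inequality in the position pair leaves the inner
  norms \<open>n1\<close> and \<open>n2\<close>; Young's inequality in the frequency pair is then
  applied to these.\<close>

lemma skew_product_young:
  fixes \<tau> :: real
  assumes Yp: "young_exponents p q p1 p2" and Yq: "young_exponents p q q1 q2" and \<tau>: "0 < \<tau>" "\<tau> < 1"
  obtains K where "0 < K" "\<And>G1 G2 :: 'a::euclidean_space \<times> 'a \<Rightarrow> ennreal.
    G1 \<in> borel_measurable borel \<Longrightarrow> G2 \<in> borel_measurable borel \<Longrightarrow>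
    Lp_qnorm q (\<lambda>\<zeta>. Lp_qnorm p (skew_product \<tau> G1 G2 \<zeta>))
      \<le> ennreal K * mixed_qnorm p1 q1 G1 * mixed_qnorm p2 q2 G2"
proof -
  have pos: "0 < p" "0 < q" "p \<le> q" "0 < p1" "0 < p2"
    using Yp by (auto simp: young_exponents_def)
  obtain K1 where K1: "0 < K1" "\<And>g1 g2 :: 'a \<Rightarrow> ennreal. g1 \<in> borel_measurable borel \<Longrightarrow> g2 \<in> borel_measurable borel \<Longrightarrow>
    Lp_qnorm q (\<lambda>z. Lp_qnorm p (\<lambda>y. g1 (z + \<tau> *\<^sub>R y) * g2 (z - (1 - \<tau>) *\<^sub>R y)))
    \<le> ennreal K1 * Lp_qnorm p1 g1 * Lp_qnorm p2 g2"
    using skew_Young[OF Yp, of \<tau> "1 - \<tau>"] \<tau> by auto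
  \<comment> \<open>In the frequency pair the signs are exchanged: \<open>G2\<close> is shifted by
    +\<tau> and \<open>G1\<close> by -(1 - \<tau>). Hence the factors appear in the other order,
    \<open>q2\<close> before \<open>q1\<close>.\<close>
  obtain K2 where K2: "0 < K2" "\<And>g1 g2 :: 'a \<Rightarrow> ennreal. g1 \<in> borel_measurable borel \<Longrightarrow> g2 \<in> borel_measurable borel \<Longrightarrow>
    Lp_qnorm q (\<lambda>z. Lp_qnorm p (\<lambda>y. g1 (z + \<tau> *\<^sub>R y) * g2 (z - (1 - \<tau>) *\<^sub>R y)))
    \<le> ennreal K2 * Lp_qnorm q2 g1 * Lp_qnorm q1 g2"
    using skew_Young[OF young_exponents_sym[OF Yq], of \<tau> "1 - \<tau>"] \<tau> by auto
  show thesis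
  proof
    show "0 < K1 * K2" using K1 K2 by simp
    fix G1 G2 :: "'a \<times> 'a \<Rightarrow> ennreal"
    assume G[measurable]: "G1 \<in> borel_measurable borel" "G2 \<in> borel_measurable borel"
    define F where "F a b x y = G1 (a + \<tau> *\<^sub>R y, b - (1 - \<tau>) *\<^sub>R x) * G2 (a - (1 - \<tau>) *\<^sub>R y, b + \<tau> *\<^sub>R x)"
      for a b x y
    define n1 n2 where "n1 \<beta> = Lp_qnorm p1 (\<lambda>u. G1 (u, \<beta>))" and "n2 \<beta> = Lp_qnorm p2 (\<lambda>u. G2 (u, \<beta>))" for \<beta>
    have [measurable]: "n1 \<in> borel_measurable borel" "n2 \<in> borel_measurable borel"
      unfolding n1_def n2_def by (intro Lp_qnorm_fst_measurable G)+
    have [measurable]: "(\<lambda>(a, x). Lp_qnorm p (F a b x)) \<in> borel_measurable (borel \<Otimes>\<^sub>M borel)" for b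
      unfolding F_def by measurable
    have "Lp_qnorm q (\<lambda>\<zeta>. Lp_qnorm p (skew_product \<tau> G1 G2 \<zeta>))
      = Lp_qnorm q (\<lambda>b. Lp_qnorm q (\<lambda>a. Lp_qnorm p (skew_product \<tau> G1 G2 (a, b))))"
      using pos by (intro Lp_qnorm_pair') auto
    also have "\<dots> = Lp_qnorm q (\<lambda>b. Lp_qnorm q (\<lambda>a. Lp_qnorm p (\<lambda>x. Lp_qnorm p (F a b x))))"
      using pos by (subst Lp_qnorm_pair[of p]) (auto simp: skew_product_def F_def[abs_def])
    \<comment> \<open>Here \<open>p \<le> q\<close> enters: the \<open>q\<close>-norm in
      \<open>a\<close> moves inside the \<open>p\<close>-norm in \<open>x\<close>, which groups the
      variables into the pairs \<open>a\<close>, \<open>y\<close> and \<open>b\<close>,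
      \<open>x\<close>.\<close>
    also have "\<dots> \<le> Lp_qnorm q (\<lambda>b. Lp_qnorm p (\<lambda>x. Lp_qnorm q (\<lambda>a. Lp_qnorm p (F a b x))))"
    proof (intro Lp_qnorm_mono Lp_qnorm_Minkowski pos)
      show "(\<lambda>b. Lp_qnorm q (\<lambda>a. Lp_qnorm p (\<lambda>x. Lp_qnorm p (F a b x)))) \<in> borel_measurable borel"
        unfolding F_def by measurable
      show "(\<lambda>(a, x). Lp_qnorm p (F a b x)) \<in> borel_measurable borel" for b
        unfolding borel_prod[symmetric] by measurable
    qed
    also have "\<dots> \<le> Lp_qnorm q (\<lambda>b. Lp_qnorm p (\<lambda>x. ennreal K1 * (n2 (b + \<tau> *\<^sub>R x) * n1 (b - (1 - \<tau>) *\<^sub>R x))))"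
    proof (intro Lp_qnorm_mono pos)
      show "(\<lambda>b. Lp_qnorm p (\<lambda>x. Lp_qnorm q (\<lambda>a. Lp_qnorm p (F a b x)))) \<in> borel_measurable borel"
        unfolding F_def by measurable
      show "(\<lambda>x. Lp_qnorm q (\<lambda>a. Lp_qnorm p (F a b x))) \<in> borel_measurable borel" for b
        unfolding F_def by measurable
      show "Lp_qnorm q (\<lambda>a. Lp_qnorm p (F a b x)) \<le> ennreal K1 * (n2 (b + \<tau> *\<^sub>R x) * n1 (b - (1 - \<tau>) *\<^sub>R x))" for b x
        using K1(2)[of "\<lambda>u. G1 (u, b - (1 - \<tau>) *\<^sub>R x)" "\<lambda>u. G2 (u, b + \<tau> *\<^sub>R x)"]
        by (simp add: F_def[abs_def] n1_def n2_def mult_ac)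
    qed
    also have "\<dots> \<le> Lp_qnorm q (\<lambda>b. ennreal K1 * Lp_qnorm p (\<lambda>x. n2 (b + \<tau> *\<^sub>R x) * n1 (b - (1 - \<tau>) *\<^sub>R x)))"
      by (intro Lp_qnorm_mono Lp_qnorm_cmult_le pos) measurable
    also have "\<dots> \<le> ennreal K1 * Lp_qnorm q (\<lambda>b. Lp_qnorm p (\<lambda>x. n2 (b + \<tau> *\<^sub>R x) * n1 (b - (1 - \<tau>) *\<^sub>R x)))"
      by (intro Lp_qnorm_cmult_le pos) measurable
    also have "\<dots> \<le> ennreal K1 * (ennreal K2 * Lp_qnorm q2 n2 * Lp_qnorm q1 n1)"
      by (intro mult_left_mono K2) auto
    also have "\<dots> = ennreal (K1 * K2) * mixed_qnorm p1 q1 G1 * mixed_qnorm p2 q2 G2"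
      using K1 K2 by (simp add: ennreal_mult mixed_qnorm_def n1_def[abs_def] n2_def[abs_def] mult_ac)
    finally show "Lp_qnorm q (\<lambda>\<zeta>. Lp_qnorm p (skew_product \<tau> G1 G2 \<zeta>))
      \<le> ennreal (K1 * K2) * mixed_qnorm p1 q1 G1 * mixed_qnorm p2 q2 G2" .
  qed
qed

text \<open>As \<tau> and 1 - \<tau> lie in [0, 1], both arguments move by at most
  \<open>norm (z - w)\<close>; each factor contributes one \<open>C\<close>.\<close>

lemma locally_comparable_skew_product:
  assumes "locally_comparable C G1" "locally_comparable C G2" "0 < C" "0 < \<tau>" "\<tau> < 1"
  shows "locally_comparable (C * C) (skew_product \<tau> G1 G2 \<zeta>)"
  unfolding locally_comparable_def
proof (intro allI impI)
  fix z w :: "'a \<times> 'a" assume zw: "norm (z - w) \<le> 1"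
  obtain z1 z2 w1 w2 where z: "z = (z1, z2)" "w = (w1, w2)" by (cases z; cases w) auto
  have n: "norm (a *\<^sub>R (z2 - w2), b *\<^sub>R (z1 - w1)) \<le> 1" if "\<bar>a\<bar> \<le> 1" "\<bar>b\<bar> \<le> 1" for a b
  proof -
    have "norm (a *\<^sub>R (z2 - w2), b *\<^sub>R (z1 - w1)) \<le> norm (z - w)"
      unfolding norm_Pair z diff_Pair
    proof (rule real_sqrt_le_mono)
      have "(norm (a *\<^sub>R (z2 - w2)))\<^sup>2 \<le> (norm (z2 - w2))\<^sup>2" "(norm (b *\<^sub>R (z1 - w1)))\<^sup>2 \<le> (norm (z1 - w1))\<^sup>2"
        using that by (auto intro!: power_mono mult_left_le_one_le)
      then show "(norm (a *\<^sub>R (z2 - w2)))\<^sup>2 + (norm (b *\<^sub>R (z1 - w1)))\<^sup>2 \<le> (norm (z1 - w1))\<^sup>2 + (norm (z2 - w2))\<^sup>2"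
        by linarith
    qed
    with zw show ?thesis by simp
  qed
  have "skew_product \<tau> G1 G2 \<zeta> z \<le>
     (ennreal C * G1 (fst \<zeta> + \<tau> *\<^sub>R snd w, snd \<zeta> - (1 - \<tau>) *\<^sub>R fst w)) *
     (ennreal C * G2 (fst \<zeta> - (1 - \<tau>) *\<^sub>R snd w, snd \<zeta> + \<tau> *\<^sub>R fst w))"
    unfolding skew_product_def
  proof (intro mult_mono locally_comparableD[OF assms(1)] locally_comparableD[OF assms(2)])
    have "(fst \<zeta> + \<tau> *\<^sub>R snd z, snd \<zeta> - (1 - \<tau>) *\<^sub>R fst z) - (fst \<zeta> + \<tau> *\<^sub>R snd w, snd \<zeta> - (1 - \<tau>) *\<^sub>R fst w)
      = (\<tau> *\<^sub>R (z2 - w2), (- (1 - \<tau>)) *\<^sub>R (z1 - w1))"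
      by (simp add: z algebra_simps)
    then show "norm ((fst \<zeta> + \<tau> *\<^sub>R snd z, snd \<zeta> - (1 - \<tau>) *\<^sub>R fst z) - (fst \<zeta> + \<tau> *\<^sub>R snd w, snd \<zeta> - (1 - \<tau>) *\<^sub>R fst w)) \<le> 1"
      using n[of \<tau> "- (1 - \<tau>)"] assms(4,5) by simp
    have "(fst \<zeta> - (1 - \<tau>) *\<^sub>R snd z, snd \<zeta> + \<tau> *\<^sub>R fst z) - (fst \<zeta> - (1 - \<tau>) *\<^sub>R snd w, snd \<zeta> + \<tau> *\<^sub>R fst w)
      = ((- (1 - \<tau>)) *\<^sub>R (z2 - w2), \<tau> *\<^sub>R (z1 - w1))"
      by (simp add: z algebra_simps)
    then show "norm ((fst \<zeta> - (1 - \<tau>) *\<^sub>R snd z, snd \<zeta> + \<tau> *\<^sub>R fst z) - (fst \<zeta> - (1 - \<tau>) *\<^sub>R snd w, snd \<zeta> + \<tau> *\<^sub>R fst w)) \<le> 1"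
      using n[of "- (1 - \<tau>)" \<tau>] assms(4,5) by simp
  qed auto
  also have "\<dots> = ennreal (C * C) * skew_product \<tau> G1 G2 \<zeta> w"
    using assms by (simp add: skew_product_def ennreal_mult mult_ac)
  finally show "skew_product \<tau> G1 G2 \<zeta> z \<le> ennreal (C * C) * skew_product \<tau> G1 G2 \<zeta> w" .
qed

definition admissible :: "ennreal \<Rightarrow> ennreal \<Rightarrow> ennreal \<Rightarrow> ennreal \<Rightarrow> ennreal \<Rightarrow> ennreal \<Rightarrow> bool" where
  "admissible p q p1 q1 p2 q2 \<longleftrightarrow> p1 \<le> q \<and> q1 \<le> q \<and> p2 \<le> q \<and> q2 \<le> q \<and>
     1 / p + 1 / q \<le> 1 / p1 + 1 / p2 \<and> 1 / p + 1 / q \<le> 1 / q1 + 1 / q2"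

text \<open>The given exponents are raised to Young exponents, separately for positions and
  frequencies. The larger norms of the raised exponents are bounded by the given ones through local
  comparability.\<close>

lemma skew_product_estimate_le:
  fixes \<tau> :: real
  assumes pos: "0 < p" "0 < p1" "0 < q1" "0 < p2" "0 < q2" and \<tau>: "0 < \<tau>" "\<tau> < 1" and "0 < C"
    and "p < top" "p \<le> q" "admissible p q p1 q1 p2 q2"
  obtains K where "0 < K" "\<And>G1 G2 :: 'a::euclidean_space \<times> 'a \<Rightarrow> ennreal.
    G1 \<in> borel_measurable borel \<Longrightarrow> G2 \<in> borel_measurable borel \<Longrightarrow>
    locally_comparable C G1 \<Longrightarrow> locally_comparable C G2 \<Longrightarrow>
    Lp_qnorm q (\<lambda>\<zeta>. Lp_qnorm p (skew_product \<tau> G1 G2 \<zeta>))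
      \<le> ennreal K * mixed_qnorm p1 q1 G1 * mixed_qnorm p2 q2 G2"
proof -
  obtain p1' p2' where P: "p1 \<le> p1'" "p2 \<le> p2'" "young_exponents p q p1' p2'"
    using assms young_exponents_exist[of p q p1 p2] unfolding admissible_def by metis
  obtain q1' q2' where Q: "q1 \<le> q1'" "q2 \<le> q2'" "young_exponents p q q1' q2'"
    using assms young_exponents_exist[of p q q1 q2] unfolding admissible_def by metis
  obtain K where K: "0 < K" "\<And>G1 G2 :: 'a \<times> 'a \<Rightarrow> ennreal.
    G1 \<in> borel_measurable borel \<Longrightarrow> G2 \<in> borel_measurable borel \<Longrightarrow>
    Lp_qnorm q (\<lambda>\<zeta>. Lp_qnorm p (skew_product \<tau> G1 G2 \<zeta>))
      \<le> ennreal K * mixed_qnorm p1' q1' G1 * mixed_qnorm p2' q2' G2"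
    using skew_product_young[OF P(3) Q(3) \<tau>] by blast
  obtain K1 where K1: "0 < K1" "\<And>G. G \<in> borel_measurable borel \<Longrightarrow> locally_comparable C G
    \<Longrightarrow> mixed_qnorm p1' q1' G \<le> ennreal K1 * mixed_qnorm p1 q1 (G::'a \<times> 'a \<Rightarrow> ennreal)"
    using locally_comparable_mixed_qnorm_embed[OF pos(2) P(1) pos(3) Q(1) \<open>0 < C\<close>] by blast
  obtain K2 where K2: "0 < K2" "\<And>G. G \<in> borel_measurable borel \<Longrightarrow> locally_comparable C G
    \<Longrightarrow> mixed_qnorm p2' q2' G \<le> ennreal K2 * mixed_qnorm p2 q2 (G::'a \<times> 'a \<Rightarrow> ennreal)"
    using locally_comparable_mixed_qnorm_embed[OF pos(4) P(2) pos(5) Q(2) \<open>0 < C\<close>] by blast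
  show thesis
  proof
    show "0 < K * K1 * K2" using K K1 K2 by simp
    fix G1 G2 :: "'a \<times> 'a \<Rightarrow> ennreal"
    assume G: "G1 \<in> borel_measurable borel" "G2 \<in> borel_measurable borel" "locally_comparable C G1" "locally_comparable C G2"
    have "Lp_qnorm q (\<lambda>\<zeta>. Lp_qnorm p (skew_product \<tau> G1 G2 \<zeta>))
      \<le> ennreal K * mixed_qnorm p1' q1' G1 * mixed_qnorm p2' q2' G2"
      using G by (intro K)
    also have "\<dots> \<le> ennreal K * (ennreal K1 * mixed_qnorm p1 q1 G1) * (ennreal K2 * mixed_qnorm p2 q2 G2)"
      using G by (intro mult_mono K1 K2) auto
    also have "\<dots> = ennreal (K * K1 * K2) * mixed_qnorm p1 q1 G1 * mixed_qnorm p2 q2 G2"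
      using K K1 K2 by (simp add: ennreal_mult mult_ac)
    finally show "Lp_qnorm q (\<lambda>\<zeta>. Lp_qnorm p (skew_product \<tau> G1 G2 \<zeta>))
      \<le> ennreal (K * K1 * K2) * mixed_qnorm p1 q1 G1 * mixed_qnorm p2 q2 G2" .
  qed
qed

theorem skew_product_estimate:
  fixes \<tau> :: real
  assumes pos: "0 < p" "0 < q" "0 < p1" "0 < q1" "0 < p2" "0 < q2" and \<tau>: "0 < \<tau>" "\<tau> < 1" and "0 < C"
    and adm: "admissible p q p1 q1 p2 q2"
  obtains K where "0 < K" "\<And>G1 G2 :: 'a::euclidean_space \<times> 'a \<Rightarrow> ennreal.
    G1 \<in> borel_measurable borel \<Longrightarrow> G2 \<in> borel_measurable borel \<Longrightarrow>
    locally_comparable C G1 \<Longrightarrow> locally_comparable C G2 \<Longrightarrow>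
    Lp_qnorm q (\<lambda>\<zeta>. Lp_qnorm p (skew_product \<tau> G1 G2 \<zeta>))
      \<le> ennreal K * mixed_qnorm p1 q1 G1 * mixed_qnorm p2 q2 G2"
proof -
  consider "p < top" "p \<le> q" | "q < p" | "p = top" "q = top"
    by (metis linorder_not_le top.not_eq_extremum top_unique)
  then show thesis
  proof cases
    case 1
    then show thesis
      using skew_product_estimate_le[OF pos(1,3-6) \<tau> \<open>0 < C\<close> 1 adm] that by blast
  next
    case 2
    obtain K1 where K1: "0 < K1" "\<And>G. G \<in> borel_measurable borel \<Longrightarrow> locally_comparable (C * C) G
      \<Longrightarrow> Lp_qnorm p G \<le> ennreal K1 * Lp_qnorm q (G::'a \<times> 'a \<Rightarrow> ennreal)"
      using locally_comparable_Lp_qnorm_embed[of q p "C * C"] pos 2 \<open>0 < C\<close> by (metis less_imp_le mult_pos_pos)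
    have rec: "1 / q \<le> 1 / x" if "x \<le> q" "0 < x" for x
      using that by (cases x; cases q) (auto simp: enn2real_inverse_ennreal top_unique frac_le intro!: ennreal_leI)
    \<comment> \<open>With \<open>p\<close> replaced by \<open>q\<close> the two sum conditions
      follow from the bounds of the single exponents by \<open>q\<close>. Passing back to the
      \<open>p\<close>-norm in \<open>z\<close> uses that the skew product is locally comparable
      there.\<close>
    have "admissible q q p1 q1 p2 q2"
      using adm pos by (auto simp: admissible_def intro!: add_mono rec)
    moreover have "q < top" using 2 by (simp add: order_less_le_trans)
    ultimately obtain K where K: "0 < K" "\<And>G1 G2 :: 'a \<times> 'a \<Rightarrow> ennreal.
      G1 \<in> borel_measurable borel \<Longrightarrow> G2 \<in> borel_measurable borel \<Longrightarrow>
      locally_comparable C G1 \<Longrightarrow> locally_comparable C G2 \<Longrightarrow>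
      Lp_qnorm q (\<lambda>\<zeta>. Lp_qnorm q (skew_product \<tau> G1 G2 \<zeta>))
        \<le> ennreal K * mixed_qnorm p1 q1 G1 * mixed_qnorm p2 q2 G2"
      using skew_product_estimate_le[OF pos(2,3-6) \<tau> \<open>0 < C\<close>, of q] by auto
    show thesis
    proof
      show "0 < K1 * K" using K K1 by simp
      fix G1 G2 :: "'a \<times> 'a \<Rightarrow> ennreal"
      assume G[measurable]: "G1 \<in> borel_measurable borel" "G2 \<in> borel_measurable borel"
        and c: "locally_comparable C G1" "locally_comparable C G2"
      have "Lp_qnorm q (\<lambda>\<zeta>. Lp_qnorm p (skew_product \<tau> G1 G2 \<zeta>))
         \<le> Lp_qnorm q (\<lambda>\<zeta>. ennreal K1 * Lp_qnorm q (skew_product \<tau> G1 G2 \<zeta>))"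
        using pos c \<tau> \<open>0 < C\<close> by (intro Lp_qnorm_mono K1 locally_comparable_skew_product) auto
      also have "\<dots> \<le> ennreal K1 * Lp_qnorm q (\<lambda>\<zeta>. Lp_qnorm q (skew_product \<tau> G1 G2 \<zeta>))"
        using pos by (intro Lp_qnorm_cmult_le) auto
      also have "\<dots> \<le> ennreal K1 * (ennreal K * mixed_qnorm p1 q1 G1 * mixed_qnorm p2 q2 G2)"
        using c by (intro mult_left_mono K) auto
      also have "\<dots> = ennreal (K1 * K) * mixed_qnorm p1 q1 G1 * mixed_qnorm p2 q2 G2"
        using K K1 by (simp add: ennreal_mult mult_ac)
      finally show "Lp_qnorm q (\<lambda>\<zeta>. Lp_qnorm p (skew_product \<tau> G1 G2 \<zeta>))
        \<le> ennreal (K1 * K) * mixed_qnorm p1 q1 G1 * mixed_qnorm p2 q2 G2" .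
    qed
  next
    case 3
    \<comment> \<open>Both target norms are suprema, so each factor only has to be bounded pointwise
      by its mixed norm: once in the position variable and once in the frequency variable.\<close>
    have sup: "\<exists>K>0. \<forall>G x. G \<in> borel_measurable borel \<longrightarrow> locally_comparable C G
        \<longrightarrow> G x \<le> ennreal K * mixed_qnorm r t (G :: 'a \<times> 'a \<Rightarrow> ennreal)" if rt: "0 < r" "0 < t" for r t
    proof -
      obtain K1 where K1: "0 < K1" "\<And>G x. G \<in> borel_measurable borel \<Longrightarrow> locally_comparable C G
        \<Longrightarrow> G (x::'a) \<le> ennreal K1 * Lp_qnorm r G"
        using locally_comparable_le_Lp_qnorm[OF rt(1) \<open>0 < C\<close>] by blast
      obtain K2 where K2: "0 < K2" "\<And>G x. G \<in> borel_measurable borel \<Longrightarrow> locally_comparable C G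
        \<Longrightarrow> G (x::'a) \<le> ennreal K2 * Lp_qnorm t G"
        using locally_comparable_le_Lp_qnorm[OF rt(2) \<open>0 < C\<close>] by blast
      have "G x \<le> ennreal (K1 * K2) * mixed_qnorm r t G"
        if G: "G \<in> borel_measurable borel" and c: "locally_comparable C G" for G and x :: "'a \<times> 'a"
      proof -
        obtain u \<xi> where x: "x = (u, \<xi>)" by (cases x)
        have "locally_comparable C (\<lambda>x. G (x, \<xi>))"
          unfolding locally_comparable_def by (auto intro!: locally_comparableD[OF c] simp: norm_Pair)
        then have "G x \<le> ennreal K1 * Lp_qnorm r (\<lambda>u. G (u, \<xi>))"
          unfolding x using G by (intro K1(2)[of "\<lambda>x. G (x, \<xi>)"] Lp_qnorm_fst_measurable) auto
        also have "\<dots> \<le> ennreal K1 * (ennreal K2 * mixed_qnorm r t G)"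
          unfolding mixed_qnorm_def
          by (intro mult_left_mono K2 Lp_qnorm_fst_measurable locally_comparable_Lp_qnorm G c \<open>0 < r\<close>) simp
        finally show ?thesis using K1 K2 by (simp add: ennreal_mult mult.assoc)
      qed
      then show ?thesis using K1 K2 by (intro exI[of _ "K1 * K2"]) auto
    qed
    obtain K1 where K1: "0 < K1" "\<And>G x. G \<in> borel_measurable borel \<Longrightarrow> locally_comparable C G
        \<Longrightarrow> G x \<le> ennreal K1 * mixed_qnorm p1 q1 (G :: 'a \<times> 'a \<Rightarrow> ennreal)"
      using sup[OF pos(3,4)] by blast
    obtain K2 where K2: "0 < K2" "\<And>G x. G \<in> borel_measurable borel \<Longrightarrow> locally_comparable C G
        \<Longrightarrow> G x \<le> ennreal K2 * mixed_qnorm p2 q2 (G :: 'a \<times> 'a \<Rightarrow> ennreal)"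
      using sup[OF pos(5,6)] by blast
    show thesis
    proof
      show "0 < K1 * K2" using K1 K2 by simp
      fix G1 G2 :: "'a \<times> 'a \<Rightarrow> ennreal"
      assume G[measurable]: "G1 \<in> borel_measurable borel" "G2 \<in> borel_measurable borel"
        and c: "locally_comparable C G1" "locally_comparable C G2"
      have "skew_product \<tau> G1 G2 \<zeta> z \<le> (ennreal K1 * mixed_qnorm p1 q1 G1) * (ennreal K2 * mixed_qnorm p2 q2 G2)" for \<zeta> z
        unfolding skew_product_def by (intro mult_mono K1 K2 G c) auto
      then have "skew_product \<tau> G1 G2 \<zeta> z \<le> ennreal (K1 * K2) * mixed_qnorm p1 q1 G1 * mixed_qnorm p2 q2 G2" for \<zeta> z
        using K1 K2 by (simp add: ennreal_mult mult_ac)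
      then have "Lp_qnorm p (skew_product \<tau> G1 G2 \<zeta>) \<le> ennreal (K1 * K2) * mixed_qnorm p1 q1 G1 * mixed_qnorm p2 q2 G2" for \<zeta>
        unfolding 3 Lp_qnorm_top by (intro esssup_I) auto
      then show "Lp_qnorm q (\<lambda>\<zeta>. Lp_qnorm p (skew_product \<tau> G1 G2 \<zeta>))
        \<le> ennreal (K1 * K2) * mixed_qnorm p1 q1 G1 * mixed_qnorm p2 q2 G2"
        unfolding 3 Lp_qnorm_top[of "\<lambda>\<zeta>. Lp_qnorm top (f \<zeta>)" for f] by (intro esssup_I) auto
    qed
  qed
qed

section \<open>Integration on Euclidean spaces\<close>

lemma lborel_integral_affine:
  fixes f :: "'a::euclidean_space \<Rightarrow> 'b::{banach, second_countable_topology}"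
  assumes "c \<noteq> 0" and [measurable]: "f \<in> borel_measurable borel"
  shows "(LINT x|lborel. f x) = \<bar>c\<bar> ^ DIM('a) *\<^sub>R (LINT x|lborel. f (t + c *\<^sub>R x))"
proof -
  have e: "lborel = density (distr lborel borel (\<lambda>x::'a. t + c *\<^sub>R x)) (\<lambda>_. ennreal (\<bar>c\<bar> ^ DIM('a)))"
    using lborel_affine[OF assms(1), of t] by (simp add: ennreal_power)
  show ?thesis
    by (subst e) (simp add: integral_density integral_distr)
qed

lemma lborel_integrable_affine:
  fixes f :: "'a::euclidean_space \<Rightarrow> 'b::{banach, second_countable_topology}"
  assumes "c \<noteq> 0" and f: "integrable lborel f"
  shows "integrable lborel (\<lambda>x. f (t + c *\<^sub>R x))"
proof -
  have [measurable]: "f \<in> borel_measurable borel" using f by auto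
  have "ennreal (\<bar>c\<bar> ^ DIM('a)) * (\<integral>\<^sup>+x. norm (f (t + c *\<^sub>R x)) \<partial>lborel) < \<infinity>"
    using f nn_integral_lborel_affine[OF assms(1), of "\<lambda>x. ennreal (norm (f x))" t]
    by (simp add: integrable_iff_bounded)
  then have "(\<integral>\<^sup>+x. norm (f (t + c *\<^sub>R x)) \<partial>lborel) < \<infinity>"
    using assms(1) by (auto simp: ennreal_mult_less_top)
  then show ?thesis by (simp add: integrable_iff_bounded)
qed

lemma lborel_integral_translate:
  fixes f :: "'a::euclidean_space \<Rightarrow> 'b::{banach, second_countable_topology}"
  assumes [measurable]: "f \<in> borel_measurable borel"
  shows "(LINT x|lborel. f (t + x)) = (LINT x|lborel. f x)"
    "(LINT x|lborel. f (x + t)) = (LINT x|lborel. f x)"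
    "(LINT x|lborel. f (x - t)) = (LINT x|lborel. f x)"
    "(LINT x|lborel. f (t - x)) = (LINT x|lborel. f x)"
  using lborel_integral_affine[of 1 f t] lborel_integral_affine[of 1 f "-t"] lborel_integral_affine[of "-1" f t]
  by (simp_all add: add.commute)

lemma lborel_integrable_translate:
  fixes f :: "'a::euclidean_space \<Rightarrow> 'b::{banach, second_countable_topology}"
  assumes "integrable lborel f"
  shows "integrable lborel (\<lambda>x. f (x - t))" "integrable lborel (\<lambda>x. f (t - x))"
  using lborel_integrable_affine[of 1 f "-t"] lborel_integrable_affine[of "-1" f t] assms by simp_all

lemma integrable_pair_mult:
  fixes f :: "'a::euclidean_space \<Rightarrow> complex" and g :: "'b::euclidean_space \<Rightarrow> complex"
  assumes f: "integrable lborel f" and g: "integrable lborel g"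
  shows "integrable lborel (\<lambda>z. f (fst z) * g (snd z))"
proof -
  have [measurable]: "f \<in> borel_measurable borel" "g \<in> borel_measurable borel" using f g by auto
  have "integrable (lborel \<Otimes>\<^sub>M lborel) (\<lambda>z. f (fst z) * g (snd z))"
    using f g by (intro lborel_pair.Fubini_integrable) (simp_all add: norm_mult)
  then show ?thesis by (simp add: lborel_prod)
qed

lemma lborel_Fubini:
  fixes f :: "'a::euclidean_space \<times> 'b::euclidean_space \<Rightarrow> complex"
  assumes "integrable lborel f"
  shows "(LINT z|lborel. f z) = (LINT x|lborel. LINT y|lborel. f (x, y))"
    "(LINT z|lborel. f z) = (LINT y|lborel. LINT x|lborel. f (x, y))"
    "(LINT x|lborel. LINT y|lborel. f (x, y)) = (LINT y|lborel. LINT x|lborel. f (x, y))"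
proof -
  have i: "integrable (lborel \<Otimes>\<^sub>M lborel) f" using assms by (simp add: lborel_prod)
  show 1: "(LINT z|lborel. f z) = (LINT x|lborel. LINT y|lborel. f (x, y))"
    using lborel_pair.integral_fst'[OF i] by (simp add: lborel_prod)
  show 2: "(LINT x|lborel. LINT y|lborel. f (x, y)) = (LINT y|lborel. LINT x|lborel. f (x, y))"
    using lborel_pair.Fubini_integral[of "curry f"] i by (simp add: curry_def)
  show "(LINT z|lborel. f z) = (LINT y|lborel. LINT x|lborel. f (x, y))"
    using 1 2 by simp
qed

text \<open>\<open>lborel\<close> is by definition the image of a product of one-dimensional
  measures under the map from coordinates to vectors, so the integral of a product of functions of
  single coordinates factors.\<close>

lemma lborel_prod_integral:
  fixes f :: "'a::euclidean_space \<Rightarrow> real \<Rightarrow> complex"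
  assumes f: "\<And>b. b \<in> Basis \<Longrightarrow> integrable lborel (f b)"
  shows "integrable lborel (\<lambda>x::'a. \<Prod>b\<in>Basis. f b (x \<bullet> b))"
    and "(LINT x|lborel. (\<Prod>b\<in>Basis. f b (x \<bullet> b))) = (\<Prod>b\<in>Basis. LINT s|lborel. f b s)"
proof -
  interpret product_sigma_finite "\<lambda>_::'a. interval_measure (\<lambda>x. x)"
    by (rule product_sigma_finite.intro) (auto intro: sigma_finite_interval_measure continuous_ident)
  have m: "\<And>b. b \<in> Basis \<Longrightarrow> f b \<in> borel_measurable borel" using f by auto
  have i: "\<And>b. b \<in> Basis \<Longrightarrow> integrable (interval_measure (\<lambda>x. x)) (f b)"
    using f by (simp add: lborel_eq_real)
  have [measurable]: "(\<lambda>x::'a. \<Prod>b\<in>Basis. f b (x \<bullet> b)) \<in> borel_measurable borel"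
    using m by (intro borel_measurable_prod) (auto intro: measurable_compose[rotated])
  have [measurable]: "(\<lambda>g. \<Sum>b\<in>Basis. g b *\<^sub>R b) \<in> Pi\<^sub>M (Basis::'a set) (\<lambda>_. interval_measure (\<lambda>x. x)) \<rightarrow>\<^sub>M borel"
    by measurable
  have e: "(\<Prod>b\<in>Basis. f b ((\<Sum>c\<in>Basis. g c *\<^sub>R c) \<bullet> b)) = (\<Prod>b\<in>(Basis::'a set). f b (g b))" for g
    by (intro prod.cong) auto
  show "integrable lborel (\<lambda>x::'a. \<Prod>b\<in>Basis. f b (x \<bullet> b))"
    unfolding lborel_def using product_integrable_prod[OF finite_Basis i]
    by (subst integrable_distr_eq) (simp_all add: e del: inner_sum_left_Basis)
  show "(LINT x|lborel. (\<Prod>b\<in>Basis. f b (x \<bullet> b))) = (\<Prod>b\<in>Basis. LINT s|lborel. f b s)"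
    using product_integral_prod[OF finite_Basis i]
    by (subst lborel_def, subst integral_distr) (simp_all add: e lborel_eq_real del: inner_sum_left_Basis)
qed

lemma le_suminf_ennreal: "g k \<le> (\<Sum>k. g k :: ennreal)"
  using sum_le_suminf[of g "{k}"] by (simp add: summableI)

text \<open>Dyadic domination: for the least \<open>k\<close> with norm x \<le> 2^k one has 2^k
  \<le> 2 (1 + norm x), which explains the factor 2^(n+1). The ball of radius 2^k has volume v
  2^(kn), so the bounds add up to a geometric series.\<close>

lemma lborel_integrable_inverse_power:
  "integrable lborel (\<lambda>x::'a::euclidean_space. 1 / (1 + norm x) ^ (DIM('a) + 1))"
proof -
  define n where "n = DIM('a)"
  obtain v where v: "\<And>r. 0 \<le> r \<Longrightarrow> emeasure lborel (cball (0::'a) r) = ennreal (v * r ^ n)" "0 < v"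
    by (rule that[of "unit_ball_vol (real DIM('a))"]) (simp_all add: emeasure_cball n_def)
  have [measurable]: "cball (0::'a) r \<in> sets borel" for r by simp
  have pt: "ennreal (1 / (1 + norm x) ^ (n + 1))
    \<le> (\<Sum>k. ennreal (2 ^ (n + 1) / (2 ^ k) ^ (n + 1)) * indicator (cball 0 (2 ^ k)) x)" for x :: 'a
  proof -
    obtain m where "norm x < 2 ^ m" using real_arch_pow[of 2 "norm x"] by auto
    then have ex: "norm x \<le> 2 ^ m" by simp
    define k where "k = (LEAST k. norm x \<le> 2 ^ k)"
    have k: "norm x \<le> 2 ^ k" unfolding k_def using ex by (rule LeastI)
    have "2 ^ k \<le> 2 * (1 + norm x)"
    proof (cases k)
      case (Suc j)
      then have "\<not> norm x \<le> 2 ^ j" using not_less_Least[of j "\<lambda>k. norm x \<le> 2 ^ k"] by (simp add: k_def)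
      then show ?thesis using Suc by simp
    qed simp
    then have "(2 ^ k) ^ (n + 1) \<le> (2 * (1 + norm x)) ^ (n + 1)"
      by (intro power_mono) auto
    then have "1 / (1 + norm x) ^ (n + 1) \<le> 2 ^ (n + 1) / (2 ^ k) ^ (n + 1)"
      unfolding power_mult_distrib by (simp add: field_simps add_pos_nonneg)
    then have "ennreal (1 / (1 + norm x) ^ (n + 1))
      \<le> ennreal (2 ^ (n + 1) / (2 ^ k) ^ (n + 1)) * indicator (cball 0 (2 ^ k)) x"
      using k by (simp add: ennreal_leI)
    also have "\<dots> \<le> (\<Sum>k. ennreal (2 ^ (n + 1) / (2 ^ k) ^ (n + 1)) * indicator (cball 0 (2 ^ k)) x)"
      by (rule le_suminf_ennreal)
    finally show ?thesis .
  qed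
  have "(\<integral>\<^sup>+x. ennreal (1 / (1 + norm (x::'a)) ^ (n + 1)) \<partial>lborel)
    \<le> (\<integral>\<^sup>+x. (\<Sum>k. ennreal (2 ^ (n + 1) / (2 ^ k) ^ (n + 1)) * indicator (cball (0::'a) (2 ^ k)) x) \<partial>lborel)"
    by (intro nn_integral_mono pt)
  also have "\<dots> = (\<Sum>k. \<integral>\<^sup>+x. ennreal (2 ^ (n + 1) / (2 ^ k) ^ (n + 1)) * indicator (cball (0::'a) (2 ^ k)) x \<partial>lborel)"
    by (rule nn_integral_suminf) measurable
  also have "\<dots> = (\<Sum>k. ennreal (2 ^ (n + 1) / (2 ^ k) ^ (n + 1)) * ennreal (v * (2 ^ k) ^ n))"
    by (intro suminf_cong, subst nn_integral_cmult_indicator) (use v in auto)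
  also have "\<dots> = (\<Sum>k. ennreal (2 ^ (n + 1) * v * (1 / 2) ^ k))"
    using v(2) by (intro suminf_cong) (simp add: ennreal_mult'[symmetric] power_divide field_simps)
  also have "\<dots> < \<infinity>"
  proof -
    have "(\<lambda>k. 2 ^ (n + 1) * v * (1 / 2) ^ k) sums (2 ^ (n + 1) * v * (1 / (1 - 1 / 2)))"
      by (intro sums_mult geometric_sums) simp
    then show ?thesis using v(2) by (subst suminf_ennreal_eq) auto
  qed
  finally show ?thesis by (simp add: integrable_iff_bounded n_def)
qed

section \<open>Polynomial decay\<close>

definition decay :: "real \<Rightarrow> 'a::real_normed_vector \<Rightarrow> real" where
  "decay M x = (1 + norm x) powr (- M)"

lemma one_plus_norm_neq_zero [simp]: "1 + norm x \<noteq> 0"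
  using norm_ge_zero[of x] by linarith

lemma decay_pos: "0 < decay M x"
  unfolding decay_def by simp

lemma decay_nonneg [simp]: "0 \<le> decay M x"
  using decay_pos[of M x] by simp

lemma decay_le_one: "0 \<le> M \<Longrightarrow> decay M x \<le> 1"
  unfolding decay_def using powr_mono[of "-M" 0 "1 + norm x"] by simp

lemma decay_antimono: "M \<le> N \<Longrightarrow> decay N x \<le> decay M x"
  unfolding decay_def by (intro powr_mono) auto

lemma decay_add: "decay (M + N) x = decay M x * decay N x"
  unfolding decay_def by (simp add: powr_add[symmetric])

lemma decay_minus [simp]: "decay M (- x) = decay M x"
  by (simp add: decay_def)

lemma decay_powr: "decay M x powr r = decay (M * r) x"
  unfolding decay_def by (simp add: powr_powr)

lemma decay_nat: "decay (real k) x = 1 / (1 + norm x) ^ k"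
  unfolding decay_def by (simp add: powr_minus powr_realpow add_pos_nonneg divide_inverse)

text \<open>Peetre's inequality, from the submultiplicativity of \<open>1 + norm\<close>. It moves
  decay from one base point to another and serves wherever kernels or weights are shifted.\<close>

lemma decay_mult_le:
  assumes "0 \<le> M" shows "decay M x * decay M y \<le> decay M (x + y)"
proof -
  have "1 + norm (x + y) \<le> (1 + norm x) * (1 + norm y)"
  proof -
    have "(1 + norm x) * (1 + norm y) = 1 + norm x + norm y + norm x * norm y"
      by (simp add: algebra_simps)
    moreover have "0 \<le> norm x * norm y" by simp
    ultimately show ?thesis using norm_triangle_ineq[of x y] by linarith
  qed
  then have "((1 + norm x) * (1 + norm y)) powr (- M) \<le> (1 + norm (x + y)) powr (- M)"
    using assms by (intro powr_mono2') (auto simp: add_pos_nonneg)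
  then show ?thesis unfolding decay_def by (simp add: powr_mult)
qed

lemma decay_measurable [measurable]: "decay M \<in> borel_measurable borel"
  unfolding decay_def[abs_def] by measurable

lemma decay_integrable:
  assumes "real DIM('a) + 1 \<le> M"
  shows "integrable lborel (decay M :: 'a::euclidean_space \<Rightarrow> real)"
proof (rule Bochner_Integration.integrable_bound[OF lborel_integrable_inverse_power])
  have "decay M x \<le> 1 / (1 + norm x) ^ (DIM('a) + 1)" for x :: 'a
    using decay_antimono[OF assms, of x] by (simp only: decay_nat[symmetric] of_nat_add of_nat_1)
  then show "AE x in lborel. norm (decay M (x::'a)) \<le> norm (1 / (1 + norm x) ^ (DIM('a) + 1))"
    by (auto simp: add_nonneg_nonneg)
qed simp

section \<open>Gaussians and the Fourier inversion formula\<close>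

definition gaussian :: "real \<Rightarrow> 'a::real_inner \<Rightarrow> real" where
  "gaussian a t = exp (- (pi * a * (norm t)\<^sup>2))"

lemma gaussian_measurable [measurable]: "gaussian a \<in> borel_measurable borel"
  unfolding gaussian_def[abs_def] by measurable

lemma gaussian_pos: "0 < gaussian a t"
  by (simp add: gaussian_def)

text \<open>Obtained from the characteristic function of the standard normal distribution by
  rescaling the variable.\<close>

lemma gaussian_fourier_real:
  assumes "0 < a"
  shows "integrable lborel (\<lambda>x. complex_of_real (exp (- (pi * a * x\<^sup>2))) * exp (- (2 * pi * \<i> * complex_of_real (x * \<xi>))))"
    and "(LINT x|lborel. complex_of_real (exp (- (pi * a * x\<^sup>2))) * exp (- (2 * pi * \<i> * complex_of_real (x * \<xi>))))
      = complex_of_real (a powr (- 1 / 2) * exp (- (pi * \<xi>\<^sup>2 / a)))"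
proof -
  define \<sigma> where "\<sigma> = 1 / sqrt (2 * pi * a)"
  have \<sigma>: "0 < \<sigma>" "2 * \<sigma>\<^sup>2 = 1 / (pi * a)" using assms by (auto simp: \<sigma>_def power_divide)
  have d: "exp (- (pi * a * x\<^sup>2)) = sqrt (2 * pi * \<sigma>\<^sup>2) * normal_density 0 \<sigma> x" for x
    using \<sigma> assms by (simp add: normal_density_def field_simps)
  have "integrable lborel (\<lambda>x. exp (- (pi * a * x\<^sup>2)))"
    unfolding d using \<sigma> by (intro integrable_mult_right integrable_normal_density) auto
  then show "integrable lborel (\<lambda>x. complex_of_real (exp (- (pi * a * x\<^sup>2))) * exp (- (2 * pi * \<i> * complex_of_real (x * \<xi>))))"
    by (rule Bochner_Integration.integrable_bound) (auto simp: norm_mult)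
  \<comment> \<open>The scaling by \<open>c\<close> turns the exponent x^2/2 of the normal density
    into \<pi> a x^2, and \<open>t\<close> is chosen such that t c x = -2 \<pi> x \<xi>.\<close>
  define c where "c = sqrt (2 * pi * a)"
  have c: "0 < c" "c\<^sup>2 = 2 * pi * a" using assms by (auto simp: c_def)
  define t where "t = - (2 * pi * \<xi> / c)"
  have "complex_of_real (exp (- (t\<^sup>2) / 2)) = char std_normal_distribution t"
    by (simp add: char_std_normal_distribution)
  also have "\<dots> = (LINT x|lborel. std_normal_density x *\<^sub>R iexp (t * x))"
    unfolding char_def by (subst integral_density) auto
  also have "\<dots> = c *\<^sub>R (LINT x|lborel. std_normal_density (c * x) *\<^sub>R iexp (t * (c * x)))"
    using c by (subst lborel_integral_real_affine[of c _ 0]) auto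
  also have "\<dots> = c *\<^sub>R (LINT x|lborel. (1 / sqrt (2 * pi)) *\<^sub>R (complex_of_real (exp (- (pi * a * x\<^sup>2))) * exp (- (2 * pi * \<i> * complex_of_real (x * \<xi>)))))"
  proof (rule arg_cong[where f="\<lambda>z. c *\<^sub>R z"], intro Bochner_Integration.integral_cong refl)
    fix x
    have "std_normal_density (c * x) = (1 / sqrt (2 * pi)) * exp (- (pi * a * x\<^sup>2))"
      using c by (simp add: std_normal_density_def power_mult_distrib)
    moreover have "iexp (t * (c * x)) = exp (- (2 * pi * \<i> * complex_of_real (x * \<xi>)))"
      using c by (simp add: t_def mult_ac)
    ultimately show "std_normal_density (c * x) *\<^sub>R iexp (t * (c * x)) =
      (1 / sqrt (2 * pi)) *\<^sub>R (complex_of_real (exp (- (pi * a * x\<^sup>2))) * exp (- (2 * pi * \<i> * complex_of_real (x * \<xi>))))"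
      by (simp add: scaleR_conv_of_real)
  qed
  also have "\<dots> = (c / sqrt (2 * pi)) *\<^sub>R (LINT x|lborel. complex_of_real (exp (- (pi * a * x\<^sup>2))) * exp (- (2 * pi * \<i> * complex_of_real (x * \<xi>))))"
    by simp
  also have "c / sqrt (2 * pi) = sqrt a" by (simp add: c_def real_sqrt_mult)
  finally have "complex_of_real (1 / sqrt a * exp (- (t\<^sup>2) / 2))
    = (LINT x|lborel. complex_of_real (exp (- (pi * a * x\<^sup>2))) * exp (- (2 * pi * \<i> * complex_of_real (x * \<xi>))))"
    using assms by (simp add: scaleR_conv_of_real field_simps)
  moreover have "- (t\<^sup>2) / 2 = - (pi * \<xi>\<^sup>2 / a)"
    using c assms by (simp add: t_def power_divide power_mult_distrib power2_eq_square field_simps)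
  moreover have "1 / sqrt a = a powr (- 1 / 2)"
    using assms powr_minus[of a "1 / 2"] powr_half_sqrt[of a] by (simp add: inverse_eq_divide)
  ultimately show "(LINT x|lborel. complex_of_real (exp (- (pi * a * x\<^sup>2))) * exp (- (2 * pi * \<i> * complex_of_real (x * \<xi>))))
      = complex_of_real (a powr (- 1 / 2) * exp (- (pi * \<xi>\<^sup>2 / a)))" by simp
qed

lemma gaussian_fourier:
  fixes \<xi> :: "'a::euclidean_space"
  assumes "0 < a"
  shows "integrable lborel (\<lambda>t. complex_of_real (gaussian a t) * exp (- (2 * pi * \<i> * (t \<bullet> \<xi>))))"
    and "(LINT t|lborel. complex_of_real (gaussian a t) * exp (- (2 * pi * \<i> * (t \<bullet> \<xi>))))
      = complex_of_real (a powr (- real DIM('a) / 2) * gaussian (1 / a) \<xi>)"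
proof -
  let ?f = "\<lambda>b s. complex_of_real (exp (- (pi * a * s\<^sup>2))) * exp (- (2 * pi * \<i> * complex_of_real (s * (\<xi> \<bullet> b))))"
  have n2: "(norm x)\<^sup>2 = (\<Sum>b\<in>Basis. (x \<bullet> b)\<^sup>2)" for x :: 'a
    by (subst power2_norm_eq_inner, subst euclidean_inner) (simp add: power2_eq_square)
  have e: "complex_of_real (gaussian a t) * exp (- (2 * pi * \<i> * (t \<bullet> \<xi>))) = (\<Prod>b\<in>Basis. ?f b (t \<bullet> b))" for t
    by (simp add: prod.distrib exp_sum[symmetric] gaussian_def n2 euclidean_inner[of t \<xi>]
        sum_distrib_left sum_negf[symmetric] flip: of_real_prod)
  show "integrable lborel (\<lambda>t. complex_of_real (gaussian a t) * exp (- (2 * pi * \<i> * (t \<bullet> \<xi>))))"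
    unfolding e using gaussian_fourier_real[OF assms] by (intro lborel_prod_integral)
  have "(LINT t|lborel. complex_of_real (gaussian a t) * exp (- (2 * pi * \<i> * (t \<bullet> \<xi>))))
    = (\<Prod>b\<in>(Basis::'a set). complex_of_real (a powr (- 1 / 2) * exp (- (pi * (\<xi> \<bullet> b)\<^sup>2 / a))))"
    unfolding e using gaussian_fourier_real[OF assms] by (subst lborel_prod_integral(2)) auto
  also have "\<dots> = complex_of_real (a powr (- real DIM('a) / 2) * gaussian (1 / a) \<xi>)"
    using assms by (simp add: prod.distrib exp_sum[symmetric] gaussian_def n2 sum_distrib_left sum_negf sum_divide_distrib
        powr_realpow[symmetric] powr_powr flip: of_real_prod of_real_mult of_real_power)
  finally show "(LINT t|lborel. complex_of_real (gaussian a t) * exp (- (2 * pi * \<i> * (t \<bullet> \<xi>))))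
      = complex_of_real (a powr (- real DIM('a) / 2) * gaussian (1 / a) \<xi>)" .
qed

lemma gaussian_integrable:
  assumes "0 < a" shows "integrable lborel (gaussian a :: 'a::euclidean_space \<Rightarrow> real)"
    "(LINT t|lborel. gaussian a (t::'a)) = a powr (- real DIM('a) / 2)"
proof -
  have "integrable lborel (\<lambda>t::'a. complex_of_real (gaussian a t))"
    using gaussian_fourier(1)[OF assms, of 0] by simp
  then show "integrable lborel (gaussian a :: 'a \<Rightarrow> real)" by (simp only: complex_of_real_integrable_eq)
  have "complex_of_real (LINT t|lborel. gaussian a (t::'a)) = complex_of_real (a powr (- real DIM('a) / 2))"
    using gaussian_fourier(2)[OF assms, of "0::'a"] by (simp add: gaussian_def)
  then show "(LINT t|lborel. gaussian a (t::'a)) = a powr (- real DIM('a) / 2)" by (simp only: of_real_eq_iff)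
qed

lemma gaussian_scale: "gaussian a (c *\<^sub>R t) = gaussian (a * c\<^sup>2) t"
  by (simp add: gaussian_def power_mult_distrib)

text \<open>The integral is regularised by the factor \<open>gaussian (e\<^sup>2)\<close>; by Fubini this averages \<open>h\<close> over
  a Gaussian of width \<open>e\<close> around \<open>t\<close>, and \<open>e\<close> tends to \<open>0\<close>.\<close>

lemma fourier_inversion:
  fixes h :: "'a::euclidean_space \<Rightarrow> complex"
  assumes cont: "continuous_on UNIV h" and bd: "\<And>t. norm (h t) \<le> B"
    and h: "integrable lborel h" and hf: "integrable lborel (fourier h)"
  shows "(LINT \<xi>|lborel. fourier h \<xi> * exp (2 * pi * \<i> * (t \<bullet> \<xi>))) = h t"
proof -
  have [measurable]: "h \<in> borel_measurable borel" "fourier h \<in> borel_measurable borel" using h hf by auto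
  define e where "e k = 1 / real (Suc k)" for k
  have e: "0 < e k" for k by (simp add: e_def)
  have e0: "e \<longlonglongrightarrow> 0" unfolding e_def[abs_def] by (rule LIMSEQ_Suc) (rule lim_1_over_n)
  let ?A = "\<lambda>k. LINT \<xi>|lborel. fourier h \<xi> * exp (2 * pi * \<i> * (t \<bullet> \<xi>)) * complex_of_real (gaussian ((e k)\<^sup>2) \<xi>)"
  have "?A \<longlonglongrightarrow> (LINT \<xi>|lborel. fourier h \<xi> * exp (2 * pi * \<i> * (t \<bullet> \<xi>)))"
  proof (rule integral_dominated_convergence[where w="\<lambda>\<xi>. norm (fourier h \<xi>)"])
    show "AE \<xi> in lborel. (\<lambda>k. fourier h \<xi> * exp (2 * pi * \<i> * (t \<bullet> \<xi>)) * complex_of_real (gaussian ((e k)\<^sup>2) \<xi>))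
      \<longlonglongrightarrow> fourier h \<xi> * exp (2 * pi * \<i> * (t \<bullet> \<xi>))"
    proof (rule AE_I2)
      fix \<xi> :: 'a
      have "(\<lambda>k. gaussian ((e k)\<^sup>2) \<xi>) \<longlonglongrightarrow> exp (- (pi * 0\<^sup>2 * (norm \<xi>)\<^sup>2))"
        unfolding gaussian_def by (intro tendsto_intros e0)
      then have "(\<lambda>k. complex_of_real (gaussian ((e k)\<^sup>2) \<xi>)) \<longlonglongrightarrow> complex_of_real 1"
        by (intro tendsto_of_real) simp
      from tendsto_mult[OF tendsto_const this]
      show "(\<lambda>k. fourier h \<xi> * exp (2 * pi * \<i> * (t \<bullet> \<xi>)) * complex_of_real (gaussian ((e k)\<^sup>2) \<xi>))
        \<longlonglongrightarrow> fourier h \<xi> * exp (2 * pi * \<i> * (t \<bullet> \<xi>))" by simp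
    qed
    show "AE \<xi> in lborel. norm (fourier h \<xi> * exp (2 * pi * \<i> * (t \<bullet> \<xi>)) * complex_of_real (gaussian ((e k)\<^sup>2) \<xi>)) \<le> norm (fourier h \<xi>)" for k
      by (rule AE_I2) (auto simp: norm_mult gaussian_def mult_left_le)
  qed (use hf in auto)
  moreover have A: "?A k = (LINT v|lborel. h (t + e k *\<^sub>R v) * complex_of_real (gaussian 1 v))" for k
  proof -
    define a where "a = (e k)\<^sup>2"
    have a: "0 < a" using e[of k] by (simp add: a_def)
    have iF: "integrable lborel (\<lambda>z. (h (fst z) * complex_of_real (gaussian a (snd z))) * exp (2 * pi * \<i> * ((t - fst z) \<bullet> snd z)))"
      by (rule Bochner_Integration.integrable_bound[OF integrable_pair_mult[OF h, of "\<lambda>x. complex_of_real (gaussian a x)"]])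
        (use gaussian_integrable[OF a] in \<open>auto simp: norm_mult\<close>)
    have "?A k = (LINT \<xi>|lborel. LINT s|lborel. (h s * complex_of_real (gaussian a \<xi>)) * exp (2 * pi * \<i> * ((t - s) \<bullet> \<xi>)))"
    proof (intro Bochner_Integration.integral_cong refl)
      fix \<xi>
      have "fourier h \<xi> * exp (2 * pi * \<i> * (t \<bullet> \<xi>)) * complex_of_real (gaussian ((e k)\<^sup>2) \<xi>)
        = (LINT s|lborel. h s * exp (- (2 * pi * \<i> * (s \<bullet> \<xi>))) * (exp (2 * pi * \<i> * (t \<bullet> \<xi>)) * complex_of_real (gaussian a \<xi>)))"
        unfolding fourier_def a_def integral_mult_left_zero by (simp only: mult.assoc)
      also have "\<dots> = (LINT s|lborel. (h s * complex_of_real (gaussian a \<xi>)) * exp (2 * pi * \<i> * ((t - s) \<bullet> \<xi>)))"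
        by (intro Bochner_Integration.integral_cong refl)
          (simp add: inner_diff_left right_diff_distrib exp_diff exp_minus divide_inverse mult_ac)
      finally show "fourier h \<xi> * exp (2 * pi * \<i> * (t \<bullet> \<xi>)) * complex_of_real (gaussian ((e k)\<^sup>2) \<xi>)
        = (LINT s|lborel. (h s * complex_of_real (gaussian a \<xi>)) * exp (2 * pi * \<i> * ((t - s) \<bullet> \<xi>)))" .
    qed
    also have "\<dots> = (LINT s|lborel. LINT \<xi>|lborel. (h s * complex_of_real (gaussian a \<xi>)) * exp (2 * pi * \<i> * ((t - s) \<bullet> \<xi>)))"
      using lborel_Fubini(3)[OF iF] by simp
    also have "\<dots> = (LINT s|lborel. h s * complex_of_real (a powr (- real DIM('a) / 2) * gaussian (1 / a) (s - t)))"
    proof (intro Bochner_Integration.integral_cong refl)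
      fix s
      have "(LINT \<xi>|lborel. (h s * complex_of_real (gaussian a \<xi>)) * exp (2 * pi * \<i> * ((t - s) \<bullet> \<xi>)))
        = (LINT \<xi>|lborel. h s * (complex_of_real (gaussian a \<xi>) * exp (- (2 * pi * \<i> * (\<xi> \<bullet> (s - t))))))"
        by (intro Bochner_Integration.integral_cong refl)
          (simp add: inner_diff_left inner_diff_right inner_commute algebra_simps)
      also have "\<dots> = h s * complex_of_real (a powr (- real DIM('a) / 2) * gaussian (1 / a) (s - t))"
        using gaussian_fourier(2)[OF a, of "s - t"] by simp
      finally show "(LINT \<xi>|lborel. (h s * complex_of_real (gaussian a \<xi>)) * exp (2 * pi * \<i> * ((t - s) \<bullet> \<xi>)))
        = h s * complex_of_real (a powr (- real DIM('a) / 2) * gaussian (1 / a) (s - t))" .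
    qed
    also have "\<dots> = \<bar>e k\<bar> ^ DIM('a) *\<^sub>R (LINT v|lborel. h (t + e k *\<^sub>R v)
        * complex_of_real (a powr (- real DIM('a) / 2) * gaussian (1 / a) ((t + e k *\<^sub>R v) - t)))"
      using e[of k] by (intro lborel_integral_affine) auto
    also have "\<dots> = \<bar>e k\<bar> ^ DIM('a) *\<^sub>R (LINT v|lborel. (a powr (- real DIM('a) / 2)) *\<^sub>R (h (t + e k *\<^sub>R v) * complex_of_real (gaussian 1 v)))"
      using a by (intro arg_cong2[of _ _ _ _ "(*\<^sub>R)"] refl Bochner_Integration.integral_cong)
        (simp add: gaussian_scale a_def[symmetric] scaleR_conv_of_real mult_ac)
    also have "\<dots> = (\<bar>e k\<bar> ^ DIM('a) * a powr (- real DIM('a) / 2)) *\<^sub>R (LINT v|lborel. h (t + e k *\<^sub>R v) * complex_of_real (gaussian 1 v))"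
      by simp
    also have "\<bar>e k\<bar> ^ DIM('a) * a powr (- real DIM('a) / 2) = 1"
      using e[of k] by (simp add: a_def powr_realpow[symmetric] powr_powr powr_add[symmetric] flip: powr_numeral)
    finally show ?thesis by simp
  qed
  moreover have "(\<lambda>k. LINT v|lborel. h (t + e k *\<^sub>R v) * complex_of_real (gaussian 1 v))
     \<longlonglongrightarrow> (LINT v|lborel. h t * complex_of_real (gaussian 1 (v::'a)))"
  proof (rule integral_dominated_convergence[where w="\<lambda>v. B * gaussian 1 v"])
    show "AE v in lborel. (\<lambda>k. h (t + e k *\<^sub>R v) * complex_of_real (gaussian 1 v)) \<longlonglongrightarrow> h t * complex_of_real (gaussian 1 v)"
    proof (intro AE_I2 tendsto_mult tendsto_const)
      fix v :: 'a
      have "(\<lambda>k. t + e k *\<^sub>R v) \<longlonglongrightarrow> t + 0 *\<^sub>R v"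
        by (intro tendsto_intros e0)
      then show "(\<lambda>k. h (t + e k *\<^sub>R v)) \<longlonglongrightarrow> h t"
        using cont by (intro isCont_tendsto_compose[of _ h]) (auto simp: continuous_on_eq_continuous_at)
    qed
    show "AE v in lborel. norm (h (t + e k *\<^sub>R v) * complex_of_real (gaussian 1 v)) \<le> B * gaussian 1 v" for k
      by (intro AE_I2) (simp add: norm_mult abs_of_pos[OF gaussian_pos] less_imp_le[OF gaussian_pos] mult_right_mono bd)
  qed (use gaussian_integrable[of 1] in auto)
  moreover have "(LINT v|lborel. h t * complex_of_real (gaussian 1 (v::'a))) = h t"
    using gaussian_integrable(2)[of 1, where 'a='a] by simp
  ultimately show ?thesis
    using LIMSEQ_unique by fastforce
qed

section \<open>Schwartz functions\<close>

definition dir_deriv :: "'a::euclidean_space \<Rightarrow> ('a \<Rightarrow> complex) \<Rightarrow> 'a \<Rightarrow> complex" where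
  "dir_deriv b f = (\<lambda>x. frechet_derivative f (at x) b)"

lemma iterated_deriv_append:
  "iterated_deriv (bs @ [b]) f = iterated_deriv bs (dir_deriv b f)"
  by (induction bs) (simp_all add: dir_deriv_def)

lemma schwartz_dir_deriv:
  assumes "f \<in> schwartz" "b \<in> Basis" shows "dir_deriv b f \<in> schwartz"
  unfolding schwartz_def
proof (intro CollectI allI impI)
  fix bs :: "'a list" assume "set bs \<subseteq> Basis"
  then have "set (bs @ [b]) \<subseteq> Basis" using assms(2) by simp
  then show "(\<forall>x. iterated_deriv bs (dir_deriv b f) differentiable at x) \<and>
    (\<forall>k. \<exists>C. \<forall>x. (1 + norm x) ^ k * norm (iterated_deriv bs (dir_deriv b f) x) \<le> C)"
    using assms(1) unfolding schwartz_def iterated_deriv_append[symmetric] by blast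
qed

lemma schwartz_has_derivative:
  "f \<in> schwartz \<Longrightarrow> (f has_derivative frechet_derivative f (at x)) (at x)"
  unfolding schwartz_def frechet_derivative_works[symmetric] by (drule CollectD, drule spec[of _ "[]"]) simp

lemma schwartz_continuous: "f \<in> schwartz \<Longrightarrow> continuous_on UNIV f"
  by (intro continuous_at_imp_continuous_on ballI has_derivative_continuous[OF schwartz_has_derivative])

lemma schwartz_measurable [measurable_dest]: "f \<in> schwartz \<Longrightarrow> f \<in> borel_measurable borel"
  by (intro borel_measurable_continuous_onI schwartz_continuous)

lemma schwartz_decay:
  assumes "f \<in> schwartz"
  obtains C where "0 < C" "\<And>x. norm (f x) \<le> C * decay M x"
proof -
  define k where "k = nat \<lceil>M\<rceil>"
  have "\<forall>k. \<exists>C. \<forall>x. (1 + norm x) ^ k * norm (f x) \<le> C"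
    using assms unfolding schwartz_def by (auto dest!: spec[of _ "[]"])
  then obtain C where C: "\<And>x. (1 + norm x) ^ k * norm (f x) \<le> C" by blast
  show thesis
  proof
    show "0 < max C 1" by simp
    fix x
    have "norm (f x) \<le> max C 1 / (1 + norm x) ^ k"
      using C[of x] by (simp add: field_simps add_pos_nonneg max.coboundedI1)
    also have "\<dots> = max C 1 * decay (real k) x" by (simp add: decay_nat)
    also have "\<dots> \<le> max C 1 * decay M x"
      by (intro mult_left_mono decay_antimono) (auto simp: k_def real_nat_ceiling_ge)
    finally show "norm (f x) \<le> max C 1 * decay M x" .
  qed
qed

lemma schwartz_bounded:
  assumes "f \<in> schwartz" obtains B where "0 < B" "\<And>x. norm (f x) \<le> B"
proof -
  obtain C where "0 < C" "\<And>x. norm (f x) \<le> C * decay 0 x" using schwartz_decay[OF assms] by blast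
  then show thesis by (intro that[of C]) (auto simp: decay_def)
qed

lemma schwartz_integrable: 
  assumes "f \<in> schwartz" shows "integrable lborel (f :: 'a::euclidean_space \<Rightarrow> complex)"
proof -
  obtain C where C: "0 < C" "\<And>x. norm (f x) \<le> C * decay (real DIM('a) + 1) x" using schwartz_decay[OF assms] by blast
  have [measurable]: "f \<in> borel_measurable borel" using assms by measurable
  show ?thesis
    by (rule Bochner_Integration.integrable_bound[of _ "\<lambda>x. C * decay (real DIM('a) + 1) x"])
      (use C in \<open>auto intro!: integrable_mult_right decay_integrable simp: abs_of_nonneg\<close>)
qed

text \<open>Difference quotients have integral zero by translation invariance. They converge to the
  derivative, and the mean value inequality along the segment provides an integrable
  majorant.\<close>

lemma integral_directional_derivative_zero:
  fixes h :: "'a::euclidean_space \<Rightarrow> complex"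
  assumes der: "\<And>t. (h has_derivative h' t) (at t)" and b: "b \<in> Basis"
    and bd: "\<And>t. norm (h' t b) \<le> C * decay M t" and M: "real DIM('a) + 1 \<le> M"
    and h: "integrable lborel h" and [measurable]: "(\<lambda>t. h' t b) \<in> borel_measurable borel"
  shows "(LINT t|lborel. h' t b) = 0"
proof -
  have [measurable]: "h \<in> borel_measurable borel" using h by auto
  have nb: "norm b = 1" using b by simp
  have "b \<noteq> 0" using b by auto
  have "0 \<le> C * decay M (0::'a)" using bd[of 0] norm_ge_zero[of "h' 0 b"] by linarith
  then have C: "0 \<le> C" using decay_pos[of M "0::'a"] by (meson mult_neg_pos not_le)
  define s where "s k = 1 / real (Suc k)" for k
  have s: "0 < s k" "s k \<le> 1" for k by (auto simp: s_def)
  have s0: "s \<longlonglongrightarrow> 0" unfolding s_def[abs_def] by (rule LIMSEQ_Suc) (rule lim_1_over_n)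
  define q where "q k t = (1 / s k) *\<^sub>R (h (t + s k *\<^sub>R b) - h t)" for k t
  have [measurable]: "q k \<in> borel_measurable borel" for k unfolding q_def by measurable
  have lim: "(\<lambda>k. q k t) \<longlonglongrightarrow> h' t b" for t
  proof -
    have bl: "bounded_linear (h' t)" using der[of t] by (rule has_derivative_bounded_linear)
    have "(\<lambda>v. norm (h (t + v) - h t - h' t v) / norm v) \<midarrow>0\<rightarrow> 0"
      using der[of t] unfolding has_derivative_at by simp
    moreover have "filterlim (\<lambda>k. s k *\<^sub>R b) (at 0) sequentially"
      unfolding filterlim_at using tendsto_scaleR[OF s0 tendsto_const[of b]] s(1) \<open>b \<noteq> 0\<close>
      by (auto simp: less_imp_neq[symmetric])
    ultimately have "(\<lambda>k. norm (h (t + s k *\<^sub>R b) - h t - h' t (s k *\<^sub>R b)) / norm (s k *\<^sub>R b)) \<longlonglongrightarrow> 0"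
      by (rule filterlim_compose)
    moreover have "norm (h (t + s k *\<^sub>R b) - h t - h' t (s k *\<^sub>R b)) / norm (s k *\<^sub>R b) = norm (q k t - h' t b)" for k
    proof -
      have "h (t + s k *\<^sub>R b) - h t - h' t (s k *\<^sub>R b) = s k *\<^sub>R (q k t - h' t b)"
        using s(1)[of k] by (simp add: q_def scaleR_right_diff_distrib linear_cmul[OF bounded_linear.linear[OF bl]])
      then show ?thesis using s(1)[of k] nb by simp
    qed
    ultimately have "(\<lambda>k. norm (q k t - h' t b)) \<longlonglongrightarrow> 0" by simp
    then show ?thesis by (simp add: LIM_zero_iff tendsto_norm_zero_iff)
  qed
  have M0: "0 \<le> M" using M by simp
  \<comment> \<open>All steps \<open>s k\<close> are at most 1, so by Peetre's inequality the decay
    at points of the segment exceeds that at \<open>t\<close> by at most the factor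
    \<open>2 powr M\<close>.\<close>
  have qb: "norm (q k t) \<le> C * 2 powr M * decay M t" for k t
  proof -
    have near: "C * decay M (t + r *\<^sub>R b) \<le> C * 2 powr M * decay M t" if "0 \<le> r" "r \<le> 1" for r
    proof -
      have "decay M (t + r *\<^sub>R b) * decay M (- (r *\<^sub>R b)) \<le> decay M t"
        using decay_mult_le[OF M0, of "t + r *\<^sub>R b" "- (r *\<^sub>R b)"] by simp
      moreover have "2 powr (- M) \<le> decay M (- (r *\<^sub>R b))"
        unfolding decay_def using that nb M0 by (intro powr_mono2') auto
      ultimately have "decay M (t + r *\<^sub>R b) * 2 powr (- M) \<le> decay M t"
        by (meson decay_nonneg mult_left_mono order_trans)
      then have "decay M (t + r *\<^sub>R b) \<le> 2 powr M * decay M t"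
        by (simp add: powr_minus field_simps)
      then show ?thesis using C by (simp add: mult_left_mono mult.assoc)
    qed
    have "norm (h (t + s k *\<^sub>R b) - h (t + 0 *\<^sub>R b)) \<le> (C * 2 powr M * decay M t) * norm (s k - 0)"
    proof (rule differentiable_bound[of "{0..s k}" "\<lambda>r. h (t + r *\<^sub>R b)" "\<lambda>r v. v *\<^sub>R h' (t + r *\<^sub>R b) b"])
      fix r assume r: "r \<in> {0..s k}"
      have "((\<lambda>r. t + r *\<^sub>R b) has_derivative (\<lambda>r. r *\<^sub>R b)) (at r within {0..s k})"
        by (auto intro!: derivative_eq_intros)
      from has_derivative_compose[OF this der]
      show "((\<lambda>r. h (t + r *\<^sub>R b)) has_derivative (\<lambda>v. v *\<^sub>R h' (t + r *\<^sub>R b) b)) (at r within {0..s k})"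
        using linear_cmul[OF bounded_linear.linear[OF has_derivative_bounded_linear[OF der]]] by simp
      have "norm (h' (t + r *\<^sub>R b) b) \<le> C * 2 powr M * decay M t"
        using r s(2)[of k] near[of r] by (intro order_trans[OF bd]) auto
      then show "onorm (\<lambda>v. v *\<^sub>R h' (t + r *\<^sub>R b) b) \<le> C * 2 powr M * decay M t"
        using C by (intro onorm_bound) (auto simp: mult.commute[of "\<bar>_\<bar>"] intro: mult_right_mono)
    qed (use s(1)[of k] in auto)
    then have "norm (h (t + s k *\<^sub>R b) - h t) \<le> (C * 2 powr M * decay M t) * s k" using s(1)[of k] by simp
    moreover have "norm (q k t) = norm (h (t + s k *\<^sub>R b) - h t) / s k"
      unfolding q_def norm_scaleR using s(1)[of k] by simp
    ultimately show ?thesis using s(1)[of k] by (simp add: pos_divide_le_eq)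
  qed
  have q0: "(LINT t|lborel. q k t) = 0" for k
  proof -
    have i: "integrable lborel (\<lambda>t. h (t + s k *\<^sub>R b))"
      using lborel_integrable_translate(1)[OF h, of "- (s k *\<^sub>R b)"] by simp
    show ?thesis unfolding q_def using h i lborel_integral_translate(2)[of h "s k *\<^sub>R b"] by simp
  qed
  have "(\<lambda>k. LINT t|lborel. q k t) \<longlonglongrightarrow> (LINT t|lborel. h' t b)"
    by (rule integral_dominated_convergence[where w="\<lambda>t. C * 2 powr M * decay M t"])
      (use lim qb decay_integrable[OF M] in auto)
  then show ?thesis unfolding q0 by (simp add: LIMSEQ_const_iff)
qed

section \<open>The short-time Fourier transform\<close>

text \<open>The transform of a function, taken as a function of one point of phase space, to which
  measurability, Fubini and norms on the product space apply directly.\<close>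

definition vstft :: "('a::euclidean_space \<Rightarrow> complex) \<Rightarrow> ('a \<Rightarrow> complex) \<Rightarrow> 'a \<times> 'a \<Rightarrow> complex" where
  "vstft \<phi> f w = stft \<phi> (distr_of f) (fst w) (snd w)"

lemma vstft_pairing:
  "vstft \<phi> f (x, \<xi>) = (LINT t|lborel. f t * cnj (modulation \<xi> (translation x \<phi>) t))"
  by (simp add: vstft_def stft_def distr_of_def)

lemma vstft_eq:
  "vstft \<phi> f (x, \<xi>) = (LINT t|lborel. f t * cnj (\<phi> (t - x)) * exp (- (2 * pi * \<i> * (t \<bullet> \<xi>))))"
  unfolding vstft_pairing modulation_def translation_def
  by (intro Bochner_Integration.integral_cong refl) (simp add: exp_cnj mult_ac)

lemma vstft_fourier: "vstft \<phi> f (x, \<xi>) = fourier (\<lambda>t. f t * cnj (\<phi> (t - x))) \<xi>"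
  unfolding vstft_eq fourier_def ..

lemma cnj_measurable [measurable (raw)]:
  "f \<in> borel_measurable M \<Longrightarrow> (\<lambda>x. cnj (f x)) \<in> borel_measurable M"
  by (rule measurable_compose[of f]) (auto intro!: borel_measurable_continuous_onI continuous_intros)

lemma vstft_measurable [measurable]:
  assumes [measurable]: "\<phi> \<in> borel_measurable borel" "f \<in> borel_measurable borel"
  shows "vstft \<phi> f \<in> borel_measurable borel"
proof -
  have "(\<lambda>w. LINT t|lborel. f t * cnj (\<phi> (t - fst w)) * exp (- (2 * pi * \<i> * (t \<bullet> snd w)))) \<in> borel_measurable borel"
    by measurable
  moreover have "vstft \<phi> f w = (LINT t|lborel. f t * cnj (\<phi> (t - fst w)) * exp (- (2 * pi * \<i> * (t \<bullet> snd w))))" for w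
    using vstft_eq[of \<phi> f "fst w" "snd w"] by simp
  ultimately show ?thesis by (simp cong: measurable_cong)
qed

section \<open>Boundedness and rapid decay of the short-time Fourier transform\<close>

lemma vstft_bounded:
  assumes "integrable lborel f" "\<And>x. norm (\<phi> x) \<le> B"
  shows "norm (vstft \<phi> f w) \<le> B * (LINT t|lborel. norm (f t))"
proof -
  obtain x \<xi> where w: "w = (x, \<xi>)" by (cases w)
  have "norm (vstft \<phi> f w) \<le> (LINT t|lborel. norm (f t * cnj (\<phi> (t - x)) * exp (- (2 * pi * \<i> * (t \<bullet> \<xi>)))))"
    unfolding w vstft_eq by (rule integral_norm_bound)
  also have "\<dots> \<le> (LINT t|lborel. B * norm (f t))"
    using assms order_trans[OF norm_ge_zero assms(2)[of 0]]
    by (intro integral_mono') (auto simp: norm_mult mult.commute[of "norm (f _)"] intro: mult_right_mono)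
  finally show ?thesis by simp
qed

text \<open>By Peetre's inequality the decay of order \<open>M\<close> of \<phi> at \<open>t\<close>
  and of \<psi> at \<open>t - x\<close> combine to decay in \<open>x\<close>; the additional decay
  of \<phi> makes the integral over \<open>t\<close> finite.\<close>

lemma vstft_decay_time:
  fixes \<phi> \<psi> :: "'a::euclidean_space \<Rightarrow> complex"
  assumes "\<phi> \<in> schwartz" "\<psi> \<in> schwartz" "0 \<le> M"
  obtains C where "0 < C" "\<And>x \<xi>. norm (vstft \<psi> \<phi> (x, \<xi>)) \<le> C * decay M x"
proof -
  let ?n = "real DIM('a) + 1"
  obtain C1 where C1: "0 < C1" "\<And>x. norm (\<phi> x) \<le> C1 * decay (M + ?n) x" using schwartz_decay[OF assms(1)] by blast
  obtain C2 where C2: "0 < C2" "\<And>x. norm (\<psi> x) \<le> C2 * decay M x" using schwartz_decay[OF assms(2)] by blast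
  define D where "D = (LINT t|lborel. decay ?n (t::'a))"
  have D: "0 \<le> D" unfolding D_def by (intro integral_nonneg_AE) auto
  show thesis
  proof
    show "0 < C1 * C2 * D + 1" using C1 C2 D by (simp add: add_nonneg_pos)
    fix x \<xi> :: 'a
    have i: "integrable lborel (\<lambda>t::'a. C1 * C2 * decay M x * decay ?n t)"
      by (intro integrable_mult_right decay_integrable) simp
    have "norm (vstft \<psi> \<phi> (x, \<xi>)) \<le> (LINT t|lborel. norm (\<phi> t * cnj (\<psi> (t - x)) * exp (- (2 * pi * \<i> * (t \<bullet> \<xi>)))))"
      unfolding vstft_eq by (rule integral_norm_bound)
    also have "\<dots> \<le> (LINT t|lborel. C1 * C2 * decay M x * decay ?n (t::'a))"
    proof (intro integral_mono'[OF i])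
      fix t
      have "norm (\<phi> t * cnj (\<psi> (t - x)) * exp (- (2 * pi * \<i> * (t \<bullet> \<xi>)))) = norm (\<phi> t) * norm (\<psi> (t - x))"
        by (simp add: norm_mult)
      also have "\<dots> \<le> (C1 * decay (M + ?n) t) * (C2 * decay M (t - x))"
        by (intro mult_mono C1 C2) (use C1 in auto)
      also have "\<dots> = C1 * C2 * decay ?n t * (decay M t * decay M (- (t - x)))"
        by (simp only: decay_add decay_minus mult_ac)
      also have "\<dots> \<le> C1 * C2 * decay ?n t * decay M x"
        using decay_mult_le[OF assms(3), of t "- (t - x)"] C1 C2 by (intro mult_left_mono) auto
      finally show "norm (\<phi> t * cnj (\<psi> (t - x)) * exp (- (2 * pi * \<i> * (t \<bullet> \<xi>)))) \<le> C1 * C2 * decay M x * decay ?n t"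
        by (simp add: mult_ac)
    qed (use C1 C2 in auto)
    also have "\<dots> = (C1 * C2 * D) * decay M x" by (simp add: D_def)
    also have "\<dots> \<le> (C1 * C2 * D + 1) * decay M x" by (intro mult_right_mono) auto
    finally show "norm (vstft \<psi> \<phi> (x, \<xi>)) \<le> (C1 * C2 * D + 1) * decay M x" .
  qed
qed

lemma vstft_integrable_factor:
  fixes \<phi> \<psi> :: "'a::euclidean_space \<Rightarrow> complex"
  assumes f: "integrable lborel f" and [measurable]: "\<psi> \<in> borel_measurable borel" and "\<And>x. norm (\<psi> x) \<le> B"
  shows "integrable lborel (\<lambda>t. f t * cnj (\<psi> (t - x)) * exp (- (2 * pi * \<i> * (t \<bullet> \<xi>))))"
proof (rule Bochner_Integration.integrable_bound[of _ "\<lambda>t. B * norm (f t)"])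
  have [measurable]: "f \<in> borel_measurable borel" using f by auto
  show "(\<lambda>t. f t * cnj (\<psi> (t - x)) * exp (- (2 * pi * \<i> * (t \<bullet> \<xi>)))) \<in> borel_measurable lborel"
    by measurable
  show "AE t in lborel. norm (f t * cnj (\<psi> (t - x)) * exp (- (2 * pi * \<i> * (t \<bullet> \<xi>)))) \<le> norm (B * norm (f t))"
  proof (rule AE_I2)
    fix t
    have "norm (f t) * norm (\<psi> (t - x)) \<le> norm (f t) * B" by (intro mult_left_mono assms) simp
    also have "\<dots> \<le> norm (B * norm (f t))" by (simp add: abs_mult mult.commute mult_right_mono)
    finally show "norm (f t * cnj (\<psi> (t - x)) * exp (- (2 * pi * \<i> * (t \<bullet> \<xi>)))) \<le> norm (B * norm (f t))"
      by (simp add: norm_mult)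
  qed
qed (use f in simp)

text \<open>Integration by parts: the derivative of the integrand in direction \<open>b\<close> has
  integral zero, and its three terms come from \<phi>, the window and the exponential.\<close>

lemma vstft_dir_deriv:
  fixes \<phi> \<psi> :: "'a::euclidean_space \<Rightarrow> complex"
  assumes \<phi>: "\<phi> \<in> schwartz" and \<psi>: "\<psi> \<in> schwartz" and b: "b \<in> Basis"
  shows "2 * pi * \<i> * (\<xi> \<bullet> b) * vstft \<psi> \<phi> (x, \<xi>) = vstft \<psi> (dir_deriv b \<phi>) (x, \<xi>) + vstft (dir_deriv b \<psi>) \<phi> (x, \<xi>)"
proof -
  note d\<phi> = schwartz_dir_deriv[OF \<phi> b] and d\<psi> = schwartz_dir_deriv[OF \<psi> b]
  define e where "e t = exp (- (2 * pi * \<i> * (t \<bullet> \<xi>)))" for t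
  define h where "h t = \<phi> t * cnj (\<psi> (t - x)) * e t" for t
  define h1 h2 where "h1 t = dir_deriv b \<phi> t * cnj (\<psi> (t - x)) * e t" and "h2 t = \<phi> t * cnj (dir_deriv b \<psi> (t - x)) * e t" for t
  define h' where "h' t v = \<phi> t * cnj (\<psi> (t - x)) * (- (2 * pi * \<i> * (v \<bullet> \<xi>)) * e t) + (\<phi> t * cnj (frechet_derivative \<psi> (at (t - x)) v)
     + frechet_derivative \<phi> (at t) v * cnj (\<psi> (t - x))) * e t" for t v
  have der: "(h has_derivative h' t) (at t)" for t
  proof -
    have 1: "((\<lambda>t. \<psi> (t - x)) has_derivative frechet_derivative \<psi> (at (t - x))) (at t)"
    proof -
      have "((\<lambda>t. t - x) has_derivative (\<lambda>v. v)) (at t)" by (auto intro!: derivative_eq_intros)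
      from has_derivative_compose[OF this schwartz_has_derivative[OF \<psi>]] show ?thesis by simp
    qed
    have 2: "((\<lambda>t. cnj (\<psi> (t - x))) has_derivative (\<lambda>v. cnj (frechet_derivative \<psi> (at (t - x)) v))) (at t)"
      by (rule bounded_linear.has_derivative[OF bounded_linear_cnj 1])
    have 3: "(e has_derivative (\<lambda>v. - (2 * pi * \<i> * (v \<bullet> \<xi>)) * e t)) (at t)"
    proof -
      have "((\<lambda>t. - (2 * pi * \<i> * (t \<bullet> \<xi>))) has_derivative (\<lambda>v. - (2 * pi * \<i> * (v \<bullet> \<xi>)))) (at t)"
        by (auto intro!: derivative_eq_intros)
      from has_derivative_compose[OF this DERIV_exp[unfolded has_field_derivative_def]]
      show ?thesis unfolding e_def by (simp add: mult.commute)
    qed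
    show ?thesis unfolding h_def h'_def
      by (rule has_derivative_mult[OF has_derivative_mult[OF schwartz_has_derivative[OF \<phi>] 2] 3])
  qed
  have ne: "norm (e t) = 1" for t by (simp add: e_def)
  have h'b: "h' t b = - (2 * pi * \<i> * (\<xi> \<bullet> b)) * h t + h2 t + h1 t" for t
    by (simp add: h'_def h_def h1_def h2_def dir_deriv_def inner_commute algebra_simps)
  obtain B where B: "0 < B" "\<And>x. norm (\<psi> x) \<le> B" using schwartz_bounded[OF \<psi>] by blast
  obtain B' where B': "0 < B'" "\<And>x. norm (dir_deriv b \<psi> x) \<le> B'" using schwartz_bounded[OF d\<psi>] by blast
  have m: "\<psi> \<in> borel_measurable borel" "dir_deriv b \<psi> \<in> borel_measurable borel" using \<psi> d\<psi> by measurable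
  have ih: "integrable lborel h"
    unfolding h_def e_def by (rule vstft_integrable_factor[OF schwartz_integrable[OF \<phi>] m(1) B(2)])
  have ih1: "integrable lborel h1"
    unfolding h1_def e_def by (rule vstft_integrable_factor[OF schwartz_integrable[OF d\<phi>] m(1) B(2)])
  have ih2: "integrable lborel h2"
    unfolding h2_def e_def by (rule vstft_integrable_factor[OF schwartz_integrable[OF \<phi>] m(2) B'(2)])
  have [measurable]: "h \<in> borel_measurable borel" "h1 \<in> borel_measurable borel" "h2 \<in> borel_measurable borel"
    using ih ih1 ih2 by auto
  let ?n = "real DIM('a) + 1"
  obtain C1 where C1: "0 < C1" "\<And>x. norm (\<phi> x) \<le> C1 * decay ?n x" using schwartz_decay[OF \<phi>] by blast
  obtain C2 where C2: "0 < C2" "\<And>x. norm (dir_deriv b \<phi> x) \<le> C2 * decay ?n x" using schwartz_decay[OF d\<phi>] by blast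
  define c where "c = norm (2 * pi * \<i> * (\<xi> \<bullet> b))"
  have "(LINT t|lborel. h' t b) = 0"
  proof (rule integral_directional_derivative_zero[OF der b _ order_refl ih])
    show "(\<lambda>t. h' t b) \<in> borel_measurable borel" unfolding h'b by measurable
    show "norm (h' t b) \<le> (c * C1 * B + C1 * B' + C2 * B) * decay ?n t" for t
    proof -
      have "norm (h' t b) \<le> c * (norm (\<phi> t) * norm (\<psi> (t - x))) + norm (\<phi> t) * norm (dir_deriv b \<psi> (t - x))
         + norm (dir_deriv b \<phi> t) * norm (\<psi> (t - x))"
        unfolding h'b h_def h1_def h2_def
        by (intro order_trans[OF norm_triangle_ineq] add_mono) (auto simp: norm_mult ne c_def)
      also have "\<dots> \<le> c * ((C1 * decay ?n t) * B) + (C1 * decay ?n t) * B' + (C2 * decay ?n t) * B"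
        by (intro add_mono mult_mono mult_left_mono C1 C2 B B') (use C1 C2 B B' in \<open>auto simp: c_def\<close>)
      finally show ?thesis by (simp add: algebra_simps)
    qed
  qed
  then have "- (2 * pi * \<i> * (\<xi> \<bullet> b)) * (LINT t|lborel. h t) + (LINT t|lborel. h2 t) + (LINT t|lborel. h1 t) = 0"
    unfolding h'b using ih ih1 ih2 by simp
  then show ?thesis
    unfolding vstft_eq h_def h1_def h2_def e_def by (simp add: algebra_simps)
qed

text \<open>Each factor of the frequency coordinate is exchanged for a derivative of \<phi> or of
  the window, so the induction has to run over all pairs of Schwartz functions. The factor 2 \<pi>
  is at least 1 and is dropped.\<close>

lemma vstft_decay_direction:
  fixes b :: "'a::euclidean_space"
  assumes b: "b \<in> Basis" and M: "0 \<le> M" and "\<phi> \<in> schwartz" "\<psi> \<in> schwartz"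
  shows "\<exists>C>0. \<forall>x \<xi>. \<bar>\<xi> \<bullet> b\<bar> ^ k * norm (vstft \<psi> \<phi> (x, \<xi>)) \<le> C * decay M x"
  using assms(3,4)
proof (induction k arbitrary: \<phi> \<psi>)
  case 0
  then obtain C where "0 < C" "\<And>x \<xi>. norm (vstft \<psi> \<phi> (x, \<xi>)) \<le> C * decay M x"
    using vstft_decay_time[OF _ _ M] by metis
  then show ?case by auto
next
  case (Suc k)
  note d\<phi> = schwartz_dir_deriv[OF Suc.prems(1) b] and d\<psi> = schwartz_dir_deriv[OF Suc.prems(2) b]
  obtain C1 where C1: "0 < C1" "\<And>x \<xi>. \<bar>\<xi> \<bullet> b\<bar> ^ k * norm (vstft \<psi> (dir_deriv b \<phi>) (x, \<xi>)) \<le> C1 * decay M x"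
    using Suc.IH[OF d\<phi> Suc.prems(2)] by blast
  obtain C2 where C2: "0 < C2" "\<And>x \<xi>. \<bar>\<xi> \<bullet> b\<bar> ^ k * norm (vstft (dir_deriv b \<psi>) \<phi> (x, \<xi>)) \<le> C2 * decay M x"
    using Suc.IH[OF Suc.prems(1) d\<psi>] by blast
  have "\<bar>\<xi> \<bullet> b\<bar> ^ Suc k * norm (vstft \<psi> \<phi> (x, \<xi>)) \<le> (C1 + C2) * decay M x" for x \<xi>
  proof -
    have "2 * pi * (\<bar>\<xi> \<bullet> b\<bar> * norm (vstft \<psi> \<phi> (x, \<xi>)))
      \<le> norm (vstft \<psi> (dir_deriv b \<phi>) (x, \<xi>)) + norm (vstft (dir_deriv b \<psi>) \<phi> (x, \<xi>))"
      using norm_triangle_ineq[of "vstft \<psi> (dir_deriv b \<phi>) (x, \<xi>)" "vstft (dir_deriv b \<psi>) \<phi> (x, \<xi>)"]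
      unfolding vstft_dir_deriv[OF Suc.prems b, symmetric] by (simp add: norm_mult)
    moreover have "1 * (\<bar>\<xi> \<bullet> b\<bar> * norm (vstft \<psi> \<phi> (x, \<xi>))) \<le> 2 * pi * (\<bar>\<xi> \<bullet> b\<bar> * norm (vstft \<psi> \<phi> (x, \<xi>)))"
      using pi_gt3 by (intro mult_right_mono) auto
    ultimately have "\<bar>\<xi> \<bullet> b\<bar> ^ k * (\<bar>\<xi> \<bullet> b\<bar> * norm (vstft \<psi> \<phi> (x, \<xi>)))
      \<le> \<bar>\<xi> \<bullet> b\<bar> ^ k * (norm (vstft \<psi> (dir_deriv b \<phi>) (x, \<xi>)) + norm (vstft (dir_deriv b \<psi>) \<phi> (x, \<xi>)))"
      by (intro mult_left_mono) auto
    also have "\<dots> \<le> (C1 + C2) * decay M x"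
      using C1(2)[of \<xi> x] C2(2)[of \<xi> x] by (simp add: distrib_left distrib_right)
    finally show ?thesis by (simp add: mult_ac)
  qed
  then show ?case using C1 C2 by (intro exI[of _ "C1 + C2"]) auto
qed

lemma norm_power_le_sum:
  fixes \<xi> :: "'a::euclidean_space"
  shows "(1 + norm \<xi>) ^ k \<le> 2 ^ k * (1 + real DIM('a) ^ k * (\<Sum>b\<in>Basis. \<bar>\<xi> \<bullet> b\<bar> ^ k))"
proof -
  obtain b where b: "b \<in> Basis" "norm \<xi> \<le> real DIM('a) * \<bar>\<xi> \<bullet> b\<bar>"
  proof -
    have fin: "finite ((\<lambda>b. \<bar>\<xi> \<bullet> b\<bar>) ` Basis)" "(\<lambda>b. \<bar>\<xi> \<bullet> b\<bar>) ` Basis \<noteq> {}" by auto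
    obtain b where b: "b \<in> Basis" "Max ((\<lambda>b. \<bar>\<xi> \<bullet> b\<bar>) ` Basis) = \<bar>\<xi> \<bullet> b\<bar>"
      using imageE[OF Max_in[OF fin]] by metis
    have "norm \<xi> \<le> (\<Sum>c\<in>Basis. \<bar>\<xi> \<bullet> c\<bar>)" by (rule norm_le_l1)
    also have "\<dots> \<le> (\<Sum>c\<in>(Basis::'a set). \<bar>\<xi> \<bullet> b\<bar>)"
      using Max_ge[OF fin(1)] b by (intro sum_mono) auto
    finally show thesis using b(1) by (intro that) auto
  qed
  have "(1 + norm \<xi>) ^ k \<le> (2 * max 1 (norm \<xi>)) ^ k" by (intro power_mono) auto
  also have "\<dots> = 2 ^ k * (max 1 (norm \<xi>)) ^ k" by (simp add: power_mult_distrib)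
  also have "(max 1 (norm \<xi>)) ^ k \<le> 1 + norm \<xi> ^ k" by (auto simp: max_def)
  also have "norm \<xi> ^ k \<le> (real DIM('a) * \<bar>\<xi> \<bullet> b\<bar>) ^ k" by (intro power_mono b) auto
  also have "\<dots> = real DIM('a) ^ k * \<bar>\<xi> \<bullet> b\<bar> ^ k" by (simp add: power_mult_distrib)
  also have "\<bar>\<xi> \<bullet> b\<bar> ^ k \<le> (\<Sum>b\<in>Basis. \<bar>\<xi> \<bullet> b\<bar> ^ k)"
    using b by (intro member_le_sum) auto
  finally show ?thesis by (simp add: mult_left_mono)
qed

text \<open>Decay in position is kept while powers of every frequency coordinate are controlled; the
  product of the decays in \<open>x\<close> and in \<xi> is then bounded by decay in the pair, again
  by Peetre's inequality.\<close>

lemma vstft_decay: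
  fixes \<phi> \<psi> :: "'a::euclidean_space \<Rightarrow> complex"
  assumes \<phi>: "\<phi> \<in> schwartz" and \<psi>: "\<psi> \<in> schwartz"
  obtains C where "0 < C" "\<And>w. norm (vstft \<psi> \<phi> w) \<le> C * decay M w"
proof -
  define k where "k = nat \<lceil>M\<rceil>"
  let ?M = "real k"
  have "\<forall>b\<in>Basis. \<exists>C>0. \<forall>x \<xi>. \<bar>\<xi> \<bullet> b\<bar> ^ k * norm (vstft \<psi> \<phi> (x, \<xi>)) \<le> C * decay ?M x"
    using vstft_decay_direction[OF _ _ \<phi> \<psi>] by simp
  then obtain C where C: "\<And>b. b \<in> Basis \<Longrightarrow> 0 < C b"
     "\<And>b x \<xi>. b \<in> Basis \<Longrightarrow> \<bar>\<xi> \<bullet> b\<bar> ^ k * norm (vstft \<psi> \<phi> (x, \<xi>)) \<le> C b * decay ?M x"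
    by metis
  obtain C0 where C0: "0 < C0" "\<And>x \<xi>. norm (vstft \<psi> \<phi> (x, \<xi>)) \<le> C0 * decay ?M x"
    using vstft_decay_time[OF \<phi> \<psi>, of ?M] by auto
  define K where "K = 2 ^ k * (C0 + real DIM('a) ^ k * (\<Sum>b\<in>Basis. C b))"
  show thesis
  proof
    have "0 \<le> (\<Sum>b\<in>Basis. C b)" using C(1) by (intro sum_nonneg) (auto intro: less_imp_le)
    then show "0 < K" unfolding K_def using C0 by (intro mult_pos_pos add_pos_nonneg mult_nonneg_nonneg) auto
    fix w :: "'a \<times> 'a"
    obtain x \<xi> where w: "w = (x, \<xi>)" by (cases w)
    let ?V = "norm (vstft \<psi> \<phi> (x, \<xi>))"
    have "(1 + norm \<xi>) ^ k * ?V \<le> (2 ^ k * (1 + real DIM('a) ^ k * (\<Sum>b\<in>Basis. \<bar>\<xi> \<bullet> b\<bar> ^ k))) * ?V"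
      by (intro mult_right_mono norm_power_le_sum) auto
    also have "\<dots> = 2 ^ k * (?V + real DIM('a) ^ k * (\<Sum>b\<in>Basis. \<bar>\<xi> \<bullet> b\<bar> ^ k * ?V))"
      unfolding sum_distrib_right[symmetric] by (simp add: algebra_simps)
    also have "\<dots> \<le> 2 ^ k * (C0 * decay ?M x + real DIM('a) ^ k * (\<Sum>b\<in>Basis. C b * decay ?M x))"
      by (intro mult_left_mono add_mono C0 sum_mono C) auto
    also have "\<dots> = K * decay ?M x"
      unfolding sum_distrib_right[symmetric] K_def by (simp add: algebra_simps)
    finally have "?V \<le> K * decay ?M x * decay ?M \<xi>"
      by (simp add: decay_nat[of k \<xi>] field_simps add_pos_nonneg)
    also have "\<dots> \<le> K * decay ?M w"
    proof -
      have "decay ?M x * decay ?M \<xi> = decay ?M (x, 0::'a) * decay ?M (0::'a, \<xi>)"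
        by (simp add: decay_def norm_Pair)
      also have "\<dots> \<le> decay ?M w"
        using decay_mult_le[of ?M "(x, 0::'a)" "(0::'a, \<xi>)"] by (simp add: w)
      finally show ?thesis using \<open>0 < K\<close> by (simp add: mult.assoc)
    qed
    also have "\<dots> \<le> K * decay M w"
      using \<open>0 < K\<close> by (intro mult_left_mono decay_antimono) (auto simp: k_def real_nat_ceiling_ge)
    finally show "norm (vstft \<psi> \<phi> w) \<le> K * decay M w" by (simp add: w)
  qed
qed

text \<open>Translating the integration variable by \<open>y\<close> leaves only a factor of modulus
  1.\<close>

lemma vstft_covariance:
  fixes \<phi> \<psi> :: "'a::euclidean_space \<Rightarrow> complex"
  assumes [measurable]: "\<phi> \<in> borel_measurable borel" "\<psi> \<in> borel_measurable borel"
  shows "norm (vstft \<psi> (modulation \<eta> (translation y \<phi>)) w) = norm (vstft \<psi> \<phi> (w - (y, \<eta>)))"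
proof -
  obtain x \<xi> where w: "w = (x, \<xi>)" by (cases w)
  have "vstft \<psi> (modulation \<eta> (translation y \<phi>)) w
    = (LINT t|lborel. \<phi> (t - y) * cnj (\<psi> (t - x)) * exp (- (2 * pi * \<i> * (t \<bullet> (\<xi> - \<eta>)))))"
    unfolding w vstft_eq modulation_def translation_def
    by (intro Bochner_Integration.integral_cong refl)
      (simp add: inner_diff_right exp_diff exp_minus right_diff_distrib divide_inverse mult_ac)
  also have "\<dots> = (LINT t|lborel. \<phi> (t + y - y) * cnj (\<psi> (t + y - x)) * exp (- (2 * pi * \<i> * ((t + y) \<bullet> (\<xi> - \<eta>)))))"
    by (rule lborel_integral_translate(2)[symmetric]) measurable
  also have "\<dots> = (LINT t|lborel. exp (- (2 * pi * \<i> * (y \<bullet> (\<xi> - \<eta>)))) *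
      (\<phi> t * cnj (\<psi> (t - (x - y))) * exp (- (2 * pi * \<i> * (t \<bullet> (\<xi> - \<eta>))))))"
    by (intro Bochner_Integration.integral_cong refl)
      (simp add: inner_add_left exp_add[symmetric] algebra_simps exp_minus[symmetric])
  also have "\<dots> = exp (- (2 * pi * \<i> * (y \<bullet> (\<xi> - \<eta>)))) * vstft \<psi> \<phi> (x - y, \<xi> - \<eta>)"
    unfolding vstft_eq by (rule integral_mult_right_zero)
  finally show ?thesis by (simp add: w norm_mult)
qed

section \<open>Change of windows\<close>

text \<open>A continuous function that is not identically zero is nonzero on a nonempty open set,
  and such a set is not null. The positive integral is the normalising constant in the change of
  windows.\<close>

lemma schwartz_square_norm_pos:
  assumes "\<phi> \<in> schwartz" "\<phi> \<noteq> (\<lambda>_. 0)"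
  shows "integrable lborel (\<lambda>t. (norm (\<phi> t))\<^sup>2)" "0 < (LINT t|lborel. (norm (\<phi> (t::'a::euclidean_space)))\<^sup>2)"
proof -
  have [measurable]: "\<phi> \<in> borel_measurable borel" using assms(1) by measurable
  obtain B where B: "0 < B" "\<And>x. norm (\<phi> x) \<le> B" using schwartz_bounded[OF assms(1)] by blast
  show i: "integrable lborel (\<lambda>t. (norm (\<phi> t))\<^sup>2)"
  proof (rule Bochner_Integration.integrable_bound[of _ "\<lambda>t. B * norm (\<phi> t)"])
    show "integrable lborel (\<lambda>t. B * norm (\<phi> t))"
      using schwartz_integrable[OF assms(1)] by simp
    show "AE t in lborel. norm ((norm (\<phi> t))\<^sup>2) \<le> norm (B * norm (\<phi> t))"
      using B by (intro AE_I2) (simp add: power2_eq_square abs_mult mult_right_mono)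
  qed simp
  show "0 < (LINT t|lborel. (norm (\<phi> t))\<^sup>2)"
  proof (rule ccontr)
    assume "\<not> 0 < (LINT t|lborel. (norm (\<phi> t))\<^sup>2)"
    moreover have "0 \<le> (LINT t|lborel. (norm (\<phi> t))\<^sup>2)" by (intro integral_nonneg_AE) auto
    ultimately have "AE t in lborel. (norm (\<phi> t))\<^sup>2 = 0"
      using integral_nonneg_eq_0_iff_AE[OF i] by auto
    then have ae: "AE t in lborel. t \<notin> {t. \<phi> t \<noteq> 0}" by (auto elim!: eventually_mono)
    have op: "open {t. \<phi> t \<noteq> 0}"
      using schwartz_continuous[OF assms(1)] by (intro open_Collect_neq continuous_intros) auto
    then have "{t. \<phi> t \<noteq> 0} \<in> null_sets lborel"
      using ae AE_iff_null_sets[of "{t. \<phi> t \<noteq> 0}" lborel] by auto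
    then have "negligible {t. \<phi> t \<noteq> 0}"
      by (simp add: negligible_iff_null_sets null_sets_completionI)
    then have "{t. \<phi> t \<noteq> 0} = {}" using open_not_negligible[OF op] by blast
    then show False using assms(2) by auto
  qed
qed

text \<open>For fixed \<open>x\<close> the integral over \<xi> is Fourier inversion for
  \<open>g\<close> times the conjugate shifted window. This gives g(t) |\<phi>(t - x)|^2, and the
  integral over \<open>x\<close> produces the square norm of \<phi>.\<close>

lemma stft_synthesis:
  fixes \<phi> g :: "'a::euclidean_space \<Rightarrow> complex"
  assumes \<phi>: "\<phi> \<in> schwartz" and g: "continuous_on UNIV g" "integrable lborel g" "\<And>t. norm (g t) \<le> B"
    and V: "\<And>x. integrable lborel (\<lambda>\<xi>. vstft \<phi> g (x, \<xi>))"
  shows "(LINT x|lborel. LINT \<xi>|lborel. vstft \<phi> g (x, \<xi>) * modulation \<xi> (translation x \<phi>) t)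
    = complex_of_real (LINT t|lborel. (norm (\<phi> t))\<^sup>2) * g t"
proof -
  have [measurable]: "\<phi> \<in> borel_measurable borel" using \<phi> by measurable
  obtain B' where B': "0 < B'" "\<And>x. norm (\<phi> x) \<le> B'" using schwartz_bounded[OF \<phi>] by blast
  have inner: "(LINT \<xi>|lborel. vstft \<phi> g (x, \<xi>) * modulation \<xi> (translation x \<phi>) t) = g t * complex_of_real ((norm (\<phi> (t - x)))\<^sup>2)" for x
  proof -
    let ?h = "\<lambda>t. g t * cnj (\<phi> (t - x))"
    have "(LINT \<xi>|lborel. fourier ?h \<xi> * exp (2 * pi * \<i> * (t \<bullet> \<xi>))) = ?h t"
    proof (rule fourier_inversion)
      show "continuous_on UNIV ?h"
        by (intro continuous_intros g continuous_on_compose2[OF schwartz_continuous[OF \<phi>]]) auto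
      show "norm (?h t) \<le> B * B'" for t
        using g(3) B' order_trans[OF norm_ge_zero g(3)[of t]] by (auto simp: norm_mult intro: mult_mono)
      show "integrable lborel ?h"
        using vstft_integrable_factor[OF g(2), of \<phi> B' x 0] B' by simp
      show "integrable lborel (fourier ?h)"
        using V[of x] by (simp add: vstft_fourier[abs_def])
    qed
    then have "(LINT \<xi>|lborel. vstft \<phi> g (x, \<xi>) * exp (2 * pi * \<i> * (t \<bullet> \<xi>))) * \<phi> (t - x) = ?h t * \<phi> (t - x)"
      by (simp add: vstft_fourier)
    also have "?h t * \<phi> (t - x) = g t * complex_of_real ((norm (\<phi> (t - x)))\<^sup>2)"
      using complex_norm_square[of "\<phi> (t - x)"] by (simp add: mult.commute mult.left_commute)
    finally show ?thesis unfolding integral_mult_left_zero[symmetric]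
      by (simp add: modulation_def translation_def mult_ac)
  qed
  have "(LINT x|lborel. (norm (\<phi> (t - x)))\<^sup>2) = (LINT t|lborel. (norm (\<phi> t))\<^sup>2)"
    by (rule lborel_integral_translate(4)) measurable
  then show ?thesis unfolding inner by (simp del: of_real_power)
qed

lemma integrable_vstft:
  fixes \<phi> \<psi> :: "'a::euclidean_space \<Rightarrow> complex"
  assumes \<phi>: "\<phi> \<in> schwartz" and \<psi>: "\<psi> \<in> schwartz"
  shows "integrable lborel (vstft \<psi> \<phi>)" "integrable lborel (\<lambda>\<xi>. vstft \<psi> \<phi> (x, \<xi>))"
proof -
  have [measurable]: "\<phi> \<in> borel_measurable borel" "\<psi> \<in> borel_measurable borel" using \<phi> \<psi> by measurable
  have [measurable]: "vstft \<psi> \<phi> \<in> borel_measurable (borel \<Otimes>\<^sub>M borel)" unfolding borel_prod by measurable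
  let ?M = "real DIM('a \<times> 'a) + 1"
  obtain C where C: "0 < C" "\<And>w. norm (vstft \<psi> \<phi> w) \<le> C * decay ?M w" using vstft_decay[OF \<phi> \<psi>] by blast
  show "integrable lborel (vstft \<psi> \<phi>)"
    by (rule Bochner_Integration.integrable_bound[of _ "\<lambda>w. C * decay ?M w"])
      (use C in \<open>auto intro!: integrable_mult_right decay_integrable simp: abs_of_nonneg simp del: DIM_prod\<close>)
  show "integrable lborel (\<lambda>\<xi>. vstft \<psi> \<phi> (x, \<xi>))"
  proof (rule Bochner_Integration.integrable_bound[of _ "\<lambda>\<xi>. C * decay ?M \<xi>"])
    show "integrable lborel (\<lambda>\<xi>::'a. C * decay ?M \<xi>)"
      by (intro integrable_mult_right decay_integrable) simp
    show "AE \<xi> in lborel. norm (vstft \<psi> \<phi> (x, \<xi>)) \<le> norm (C * decay ?M \<xi>)"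
    proof (rule AE_I2)
      fix \<xi> :: 'a
      have "norm \<xi> \<le> norm (x, \<xi>)" by (simp add: norm_Pair real_le_rsqrt)
      then have "decay ?M (x, \<xi>) \<le> decay ?M \<xi>"
        unfolding decay_def by (intro powr_mono2') (auto simp: add_pos_nonneg)
      then have "C * decay ?M (x, \<xi>) \<le> C * decay ?M \<xi>" using C(1) by (intro mult_left_mono) auto
      with C(2)[of "(x, \<xi>)"] have "norm (vstft \<psi> \<phi> (x, \<xi>)) \<le> C * decay ?M \<xi>"
        by (rule order_trans)
      then show "norm (vstft \<psi> \<phi> (x, \<xi>)) \<le> norm (C * decay ?M \<xi>)"
        using C(1) by (simp add: abs_of_nonneg)
    qed
  qed measurable
qed

text \<open>The time-frequency shift \<open>g\<close> of the new window \<phi>' is synthesised from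
  shifts of \<phi>, and this expansion is paired with \<open>u\<close>. By covariance its
  coefficients have the modulus of the transform of \<phi>' at the difference
  \<open>w - y\<close>.\<close>

lemma vstft_reproducing:
  fixes \<phi> \<phi>' u :: "'a::euclidean_space \<Rightarrow> complex"
  assumes \<phi>: "\<phi> \<in> schwartz" and \<phi>': "\<phi>' \<in> schwartz" and u: "integrable lborel u"
  shows "ennreal ((LINT t|lborel. (norm (\<phi> t))\<^sup>2) * norm (vstft \<phi>' u y))
    \<le> (\<integral>\<^sup>+w. ennreal (norm (vstft \<phi> u w) * norm (vstft \<phi> \<phi>' (w - y))) \<partial>lborel)"
proof -
  obtain y1 y2 where y: "y = (y1, y2)" by (cases y)
  define g where "g = modulation y2 (translation y1 \<phi>')"
  have [measurable]: "\<phi> \<in> borel_measurable borel" "\<phi>' \<in> borel_measurable borel" "u \<in> borel_measurable borel"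
    using \<phi> \<phi>' u by auto
  obtain B where B: "0 < B" "\<And>x. norm (\<phi> x) \<le> B" using schwartz_bounded[OF \<phi>] by blast
  obtain B' where B': "0 < B'" "\<And>x. norm (\<phi>' x) \<le> B'" using schwartz_bounded[OF \<phi>'] by blast
  have ng: "norm (g t) = norm (\<phi>' (t - y1))" for t
    by (simp add: g_def modulation_def translation_def norm_mult)
  have [measurable]: "g \<in> borel_measurable borel"
    unfolding g_def modulation_def translation_def by measurable
  have gc: "continuous_on UNIV g"
    unfolding g_def modulation_def translation_def
    by (intro continuous_intros continuous_on_compose2[OF schwartz_continuous[OF \<phi>']]) auto
  have gi: "integrable lborel g"
    using lborel_integrable_translate(1)[OF schwartz_integrable[OF \<phi>'], of y1]
    by (rule Bochner_Integration.integrable_bound) (auto simp: ng)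
  have gV: "norm (vstft \<phi> g w) = norm (vstft \<phi> \<phi>' (w - y))" for w
    unfolding g_def y by (rule vstft_covariance) auto
  have iV: "integrable lborel (vstft \<phi> g)"
    using lborel_integrable_translate(1)[OF integrable_vstft(1)[OF \<phi>' \<phi>], of y]
    by (rule Bochner_Integration.integrable_bound) (auto simp: gV)
  have [measurable]: "vstft \<phi> g \<in> borel_measurable (borel \<Otimes>\<^sub>M borel)" unfolding borel_prod by measurable
  have iV2: "integrable lborel (\<lambda>\<xi>. vstft \<phi> g (x, \<xi>))" for x
    using lborel_integrable_translate(1)[OF integrable_vstft(2)[OF \<phi>' \<phi>, of "x - y1"], of y2]
    by (rule Bochner_Integration.integrable_bound) (auto simp: gV y)
  define L where "L = (LINT t|lborel. (norm (\<phi> t))\<^sup>2)"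
  have L0: "0 \<le> L" unfolding L_def by (intro integral_nonneg_AE) auto
  have syn: "complex_of_real L * g t = (LINT w|lborel. vstft \<phi> g w * modulation (snd w) (translation (fst w) \<phi>) t)" for t
  proof -
    have "integrable lborel (\<lambda>w. vstft \<phi> g w * modulation (snd w) (translation (fst w) \<phi>) t)"
    proof (rule Bochner_Integration.integrable_bound[of _ "\<lambda>w. B * vstft \<phi> g w"])
      show "AE w in lborel. norm (vstft \<phi> g w * modulation (snd w) (translation (fst w) \<phi>) t) \<le> norm (B * vstft \<phi> g w)"
        using B by (intro AE_I2) (simp add: norm_mult modulation_def translation_def mult_right_mono mult.commute[of _ "norm (\<phi> _)"])
      show "(\<lambda>w. vstft \<phi> g w * modulation (snd w) (translation (fst w) \<phi>) t) \<in> borel_measurable lborel"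
        unfolding modulation_def translation_def by measurable
    qed (use iV in simp)
    from lborel_Fubini(1)[OF this] show ?thesis
      using stft_synthesis[OF \<phi> gc gi _ iV2, of B'] B' by (simp add: ng L_def)
  qed
  let ?F = "\<lambda>z. u (fst z) * cnj (vstft \<phi> g (snd z)) * cnj (modulation (snd (snd z)) (translation (fst (snd z)) \<phi>) (fst z))"
  have iF: "integrable lborel ?F"
  proof (rule Bochner_Integration.integrable_bound[of _ "\<lambda>z. B * (u (fst z) * vstft \<phi> g (snd z))"])
    show "integrable lborel (\<lambda>z. B * (u (fst z) * vstft \<phi> g (snd z)))"
      using integrable_pair_mult[OF u iV] by simp
    show "?F \<in> borel_measurable lborel"
      unfolding modulation_def translation_def by measurable
    show "AE z in lborel. norm (?F z) \<le> norm (B * (u (fst z) * vstft \<phi> g (snd z)))"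
      using B by (intro AE_I2) (simp add: norm_mult modulation_def translation_def mult_right_mono mult.commute[of _ "norm (\<phi> _)"])
  qed
  have "complex_of_real L * vstft \<phi>' u y = (LINT t|lborel. u t * cnj (complex_of_real L * g t))"
    unfolding y vstft_pairing g_def[symmetric] by (simp add: mult_ac)
  also have "\<dots> = (LINT t|lborel. LINT w|lborel. ?F (t, w))"
  proof (intro Bochner_Integration.integral_cong refl)
    fix t
    have "u t * cnj (complex_of_real L * g t)
      = u t * (LINT w|lborel. cnj (vstft \<phi> g w * modulation (snd w) (translation (fst w) \<phi>) t))"
      unfolding syn by (subst Bochner_Integration.integral_cnj) (rule refl)
    then show "u t * cnj (complex_of_real L * g t) = (LINT w|lborel. ?F (t, w))"
      by (simp add: mult.assoc)
  qed
  also have "\<dots> = (LINT w|lborel. LINT t|lborel. ?F (t, w))"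
    by (rule lborel_Fubini(3)[OF iF])
  also have "\<dots> = (LINT w|lborel. cnj (vstft \<phi> g w) * vstft \<phi> u w)"
  proof (intro Bochner_Integration.integral_cong refl)
    fix w
    have "(LINT t|lborel. ?F (t, w)) = (LINT t|lborel. cnj (vstft \<phi> g w) * (u t * cnj (modulation (snd w) (translation (fst w) \<phi>) t)))"
      by (intro Bochner_Integration.integral_cong refl) (simp add: mult_ac)
    also have "\<dots> = cnj (vstft \<phi> g w) * vstft \<phi> u (fst w, snd w)"
      unfolding vstft_pairing by (rule integral_mult_right_zero)
    finally show "(LINT t|lborel. ?F (t, w)) = cnj (vstft \<phi> g w) * vstft \<phi> u w" by simp
  qed
  finally have eq: "complex_of_real L * vstft \<phi>' u y = (LINT w|lborel. cnj (vstft \<phi> g w) * vstft \<phi> u w)" .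
  have iW: "integrable lborel (\<lambda>w. cnj (vstft \<phi> g w) * vstft \<phi> u w)"
  proof (rule Bochner_Integration.integrable_bound[of _ "\<lambda>w. (B * (LINT t|lborel. norm (u t))) * vstft \<phi> g w"])
    show "integrable lborel (\<lambda>w. (B * (LINT t|lborel. norm (u t))) * vstft \<phi> g w)"
      using iV by simp
    show "AE w in lborel. norm (cnj (vstft \<phi> g w) * vstft \<phi> u w) \<le> norm ((B * (LINT t|lborel. norm (u t))) * vstft \<phi> g w)"
    proof (rule AE_I2)
      fix w
      have "norm (vstft \<phi> g w) * norm (vstft \<phi> u w) \<le> norm (vstft \<phi> g w) * \<bar>B * (LINT t|lborel. norm (u t))\<bar>"
        using vstft_bounded[of u \<phi> B w] u B(2) by (intro mult_left_mono) auto
      then show "norm (cnj (vstft \<phi> g w) * vstft \<phi> u w) \<le> norm ((B * (LINT t|lborel. norm (u t))) * vstft \<phi> g w)"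
        by (simp add: norm_mult abs_mult mult_ac)
    qed
  qed measurable
  have "ennreal (L * norm (vstft \<phi>' u y)) = ennreal (norm (LINT w|lborel. cnj (vstft \<phi> g w) * vstft \<phi> u w))"
    unfolding eq[symmetric] using L0 by (simp add: norm_mult)
  also have "\<dots> \<le> (\<integral>\<^sup>+w. norm (cnj (vstft \<phi> g w) * vstft \<phi> u w) \<partial>lborel)"
    by (rule integral_norm_bound_ennreal[OF iW])
  also have "\<dots> = (\<integral>\<^sup>+w. ennreal (norm (vstft \<phi> u w) * norm (vstft \<phi> \<phi>' (w - y))) \<partial>lborel)"
    by (simp add: norm_mult gV mult.commute)
  finally show ?thesis unfolding L_def .
qed

text \<open>The reproducing inequality with the transform of one window against the other replaced
  by its rapid decay. The constant depends on the windows and \<open>M\<close> but not on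
  \<open>u\<close>.\<close>

lemma vstft_window_bound_linear:
  fixes \<phi> \<phi>' :: "'a::euclidean_space \<Rightarrow> complex"
  assumes \<phi>: "\<phi> \<in> schwartz" "\<phi> \<noteq> (\<lambda>_. 0)" and \<phi>': "\<phi>' \<in> schwartz"
  obtains C where "0 < C" "\<And>u y. integrable lborel u \<Longrightarrow>
    ennreal (norm (vstft \<phi>' u y)) \<le> ennreal C * (\<integral>\<^sup>+w. ennreal (norm (vstft \<phi> u w) * decay M (y - w)) \<partial>lborel)"
proof -
  define L where "L = (LINT t|lborel. (norm (\<phi> t))\<^sup>2)"
  have L: "0 < L" unfolding L_def using schwartz_square_norm_pos[OF \<phi>] by simp
  obtain C where C: "0 < C" "\<And>w. norm (vstft \<phi> \<phi>' w) \<le> C * decay M w" using vstft_decay[OF \<phi>' \<phi>(1)] by blast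
  have [measurable]: "\<phi> \<in> borel_measurable borel" using \<phi> by auto
  show thesis
  proof
    show "0 < C / L" using C L by simp
    fix u :: "'a \<Rightarrow> complex" and y assume u: "integrable lborel u"
    then have [measurable]: "u \<in> borel_measurable borel" by auto
    have "ennreal (norm (vstft \<phi>' u y)) = ennreal (1 / L) * ennreal (L * norm (vstft \<phi>' u y))"
      using L by (simp add: ennreal_mult'[symmetric])
    also have "\<dots> \<le> ennreal (1 / L) * (\<integral>\<^sup>+w. ennreal (norm (vstft \<phi> u w) * norm (vstft \<phi> \<phi>' (w - y))) \<partial>lborel)"
      unfolding L_def by (intro mult_left_mono vstft_reproducing \<phi> \<phi>' u) simp
    also have "\<dots> \<le> ennreal (1 / L) * (\<integral>\<^sup>+w. ennreal C * ennreal (norm (vstft \<phi> u w) * decay M (y - w)) \<partial>lborel)"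
    proof (intro mult_left_mono nn_integral_mono)
      fix w
      have "norm (vstft \<phi> u w) * norm (vstft \<phi> \<phi>' (w - y)) \<le> norm (vstft \<phi> u w) * (C * decay M (w - y))"
        by (intro mult_left_mono C) simp
      also have "decay M (w - y) = decay M (y - w)" by (simp add: decay_def norm_minus_commute)
      finally show "ennreal (norm (vstft \<phi> u w) * norm (vstft \<phi> \<phi>' (w - y))) \<le> ennreal C * ennreal (norm (vstft \<phi> u w) * decay M (y - w))"
        using C(1) by (simp add: ennreal_mult'[symmetric] ennreal_leI mult_ac)
    qed simp
    also have "\<dots> = ennreal (1 / L) * (ennreal C * (\<integral>\<^sup>+w. ennreal (norm (vstft \<phi> u w) * decay M (y - w)) \<partial>lborel))"
      by (intro arg_cong2[of _ _ _ _ "(*)"] refl nn_integral_cmult) measurable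
    also have "\<dots> = ennreal (C / L) * (\<integral>\<^sup>+w. ennreal (norm (vstft \<phi> u w) * decay M (y - w)) \<partial>lborel)"
      using C L by (simp add: mult.assoc[symmetric] ennreal_mult'[symmetric])
    finally show "ennreal (norm (vstft \<phi>' u y)) \<le> ennreal (C / L) * (\<integral>\<^sup>+w. ennreal (norm (vstft \<phi> u w) * decay M (y - w)) \<partial>lborel)" .
  qed
qed

text \<open>The dominating function of the overview before weights are attached. Taking
  \<open>r\<close> below \<open>p\<close> and \<open>q\<close> makes Minkowski's inequality
  available for its mixed norm, also where \<open>p\<close> or \<open>q\<close> is less than 1 and
  convolution with an integrable kernel is not bounded.\<close>

definition window_majorant :: "real \<Rightarrow> real \<Rightarrow> ('a::euclidean_space \<Rightarrow> complex) \<Rightarrow> ('a \<Rightarrow> complex) \<Rightarrow> 'a \<times> 'a \<Rightarrow> ennreal" where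
  "window_majorant r M \<phi> u z = Lp_qnorm (ennreal r) (\<lambda>w. ennreal (norm (vstft \<phi> u w) * decay M (z - w)))"

text \<open>For \<open>r < 1\<close> the linear bound is improved by splitting off the maximal function
  \<open>S = sup\<^sub>w |V u(w)| (1 + |z - w|)\<^sup>-\<^sup>M\<close>: this gives \<open>S \<le> C S\<^sup>1\<^sup>-\<^sup>r I\<close> with the integral \<open>I\<close> of the
  \<open>r\<close>-th powers, and \<open>S\<close> is finite, so it can be divided out.\<close>

lemma vstft_le_window_majorant:
  fixes \<phi> \<phi>' :: "'a::euclidean_space \<Rightarrow> complex"
  assumes \<phi>: "\<phi> \<in> schwartz" "\<phi> \<noteq> (\<lambda>_. 0)" and \<phi>': "\<phi>' \<in> schwartz" and r: "0 < r" "r \<le> 1" and M: "0 \<le> M"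
  obtains C where "0 < C" "\<And>u z. integrable lborel u \<Longrightarrow>
    ennreal (norm (vstft \<phi>' u z)) \<le> ennreal C * window_majorant r M \<phi> u z"
proof -
  obtain C0 where C0: "0 < C0" "\<And>u y. integrable lborel u \<Longrightarrow>
    ennreal (norm (vstft \<phi> u y)) \<le> ennreal C0 * (\<integral>\<^sup>+w. ennreal (norm (vstft \<phi> u w) * decay M (y - w)) \<partial>lborel)"
    using vstft_window_bound_linear[OF \<phi> \<phi>(1)] by blast
  obtain C1 where C1: "0 < C1" "\<And>u y. integrable lborel u \<Longrightarrow>
    ennreal (norm (vstft \<phi>' u y)) \<le> ennreal C1 * (\<integral>\<^sup>+w. ennreal (norm (vstft \<phi> u w) * decay M (y - w)) \<partial>lborel)"
    using vstft_window_bound_linear[OF \<phi> \<phi>'] by blast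
  have [measurable]: "\<phi> \<in> borel_measurable borel" using \<phi> by auto
  obtain B where B: "0 < B" "\<And>x. norm (\<phi> x) \<le> B" using schwartz_bounded[OF \<phi>(1)] by blast
  show thesis
  proof
    show "0 < C1 * C0 powr ((1 - r) / r)" using C0 C1 by simp
    fix u :: "'a \<Rightarrow> complex" and z assume u: "integrable lborel u"
    then have [measurable]: "u \<in> borel_measurable borel" by auto
    define a where "a w = norm (vstft \<phi> u w) * decay M (z - w)" for w
    have a0: "0 \<le> a w" for w by (simp add: a_def)
    have [measurable]: "a \<in> borel_measurable borel" unfolding a_def by measurable
    define I where "I = (\<integral>\<^sup>+w. ennreal (a w powr r) \<partial>lborel)"
    have maj: "window_majorant r M \<phi> u z = ennreal_powr I (1 / r)"
      using r by (simp add: window_majorant_def Lp_qnorm_ennreal I_def ennreal_powr_ennreal a_def)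
    show "ennreal (norm (vstft \<phi>' u z)) \<le> ennreal (C1 * C0 powr ((1 - r) / r)) * window_majorant r M \<phi> u z"
    proof (cases I)
      case top
      then show ?thesis using maj C0 C1 by (simp add: ennreal_mult_top)
    next
      case (real i)
      have bdd: "bdd_above (range a)"
      proof (rule bdd_aboveI2)
        fix w
        have "a w \<le> (B * (LINT t|lborel. norm (u t))) * 1"
          unfolding a_def using vstft_bounded[of u \<phi> B w] u B(2) decay_le_one[OF M]
          by (intro mult_mono) (auto intro: order_trans[OF norm_ge_zero])
        then show "a w \<le> B * (LINT t|lborel. norm (u t))" by simp
      qed
      define S where "S = (SUP w. a w)"
      have aS: "a w \<le> S" for w unfolding S_def using bdd by (intro cSUP_upper) auto
      have S0: "0 \<le> S" using order_trans[OF a0 aS] .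
      have split: "a w \<le> a w powr r * S powr (1 - r)" for w
      proof (cases "a w = 0")
        case False
        then have "a w = a w powr r * a w powr (1 - r)" using a0[of w] by (simp add: powr_add[symmetric])
        also have "\<dots> \<le> a w powr r * S powr (1 - r)"
          using aS[of w] a0[of w] r by (intro mult_left_mono powr_mono2) auto
        finally show ?thesis .
      qed simp
      \<comment> \<open>Peetre's inequality recentres the decay from \<open>y\<close> to
        \<open>z\<close>, after which the splitting applies. The bound is used twice: with \<psi> =
        \<phi> and all \<open>y\<close> to estimate \<open>S\<close> by itself, and with \<psi> =
        \<phi>' at \<open>y = z\<close> for the conclusion.\<close>
      have key: "norm (vstft \<psi> u y) * decay M (z - y) \<le> C * (S powr (1 - r) * i)"
        if C: "0 < C" "ennreal (norm (vstft \<psi> u y)) \<le> ennreal C * (\<integral>\<^sup>+w. ennreal (norm (vstft \<phi> u w) * decay M (y - w)) \<partial>lborel)"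
        for C \<psi> y
      proof -
        have "ennreal (norm (vstft \<psi> u y) * decay M (z - y))
          \<le> (ennreal C * (\<integral>\<^sup>+w. ennreal (norm (vstft \<phi> u w) * decay M (y - w)) \<partial>lborel)) * ennreal (decay M (z - y))"
          using C by (simp add: ennreal_mult' mult_right_mono)
        also have "\<dots> = ennreal C * (\<integral>\<^sup>+w. ennreal (norm (vstft \<phi> u w) * decay M (y - w)) * ennreal (decay M (z - y)) \<partial>lborel)"
          by (simp add: nn_integral_multc mult.assoc)
        also have "\<dots> \<le> ennreal C * (\<integral>\<^sup>+w. ennreal (S powr (1 - r)) * ennreal (a w powr r) \<partial>lborel)"
        proof (intro mult_left_mono nn_integral_mono)
          fix w
          have "norm (vstft \<phi> u w) * decay M (y - w) * decay M (z - y) \<le> norm (vstft \<phi> u w) * decay M (z - w)"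
            using decay_mult_le[OF M, of "y - w" "z - y"] by (simp add: mult.assoc mult_left_mono)
          also have "\<dots> \<le> S powr (1 - r) * a w powr r"
            using split[of w] by (simp add: a_def mult.commute)
          finally show "ennreal (norm (vstft \<phi> u w) * decay M (y - w)) * ennreal (decay M (z - y))
            \<le> ennreal (S powr (1 - r)) * ennreal (a w powr r)"
            by (simp add: ennreal_mult'[symmetric] ennreal_leI)
        qed simp
        also have "\<dots> = ennreal C * (ennreal (S powr (1 - r)) * I)"
          unfolding I_def by (intro arg_cong2[of _ _ _ _ "(*)"] refl nn_integral_cmult) measurable
        also have "\<dots> = ennreal (C * (S powr (1 - r) * i))"
          using C real by (simp add: ennreal_mult'[symmetric])
        finally show ?thesis using C real by (simp add: ennreal_le_iff)
      qed
      have SI: "S \<le> (C0 * i) powr (1 / r)"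
      proof (cases "S = 0")
        case False
        then have Sp: "0 < S" using S0 by simp
        have "S \<le> C0 * (S powr (1 - r) * i)"
          unfolding S_def[symmetric] by (subst S_def, rule cSUP_least) (auto simp: a_def intro!: key C0 u)
        then have "S powr r * S powr (1 - r) \<le> (C0 * i) * S powr (1 - r)"
          using Sp by (simp add: powr_add[symmetric] mult_ac)
        then have "S powr r \<le> C0 * i" using Sp by (simp add: mult_le_cancel_right)
        then have "(S powr r) powr (1 / r) \<le> (C0 * i) powr (1 / r)" using r by (intro powr_mono2) auto
        then show ?thesis using r Sp by (simp add: powr_powr)
      qed simp
      have "norm (vstft \<phi>' u z) \<le> C1 * (S powr (1 - r) * i)"
        using key[OF C1(1) C1(2)[OF u], of z] by (simp add: decay_def)
      also have "\<dots> \<le> C1 * (((C0 * i) powr (1 / r)) powr (1 - r) * i)"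
        using C1 real r S0 SI by (intro mult_left_mono mult_right_mono powr_mono2) auto
      also have "\<dots> = C1 * C0 powr ((1 - r) / r) * i powr (1 / r)"
      proof (cases "i = 0")
        case False
        then have i: "0 < i" using real by simp
        have "i powr ((1 - r) / r) * i = i powr ((1 - r) / r + 1)" using i by (simp add: powr_add)
        also have "(1 - r) / r + 1 = 1 / r" using r by (simp add: field_simps)
        finally have "i powr ((1 - r) / r) * i = i powr (1 / r)" .
        then show ?thesis using C0 real by (simp add: powr_powr powr_mult mult_ac)
      qed simp
      finally show ?thesis using C0 C1 real r
        by (simp add: maj ennreal_powr_ennreal ennreal_mult'[symmetric] ennreal_leI)
    qed
  qed
qed

subsection \<open>Weighted mixed norms of the majorant\<close>

text \<open>Weights moderate with respect to a polynomial: \<open>decay (- B)\<close> is the growing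
  function (1 + norm)^B. Such a weight can be moved past the kernel of the change of windows at the
  cost of \<open>B\<close> orders of decay.\<close>

definition moderate :: "real \<Rightarrow> real \<Rightarrow> ('a::euclidean_space \<Rightarrow> real) \<Rightarrow> bool" where
  "moderate A B m \<longleftrightarrow> 0 < A \<and> 0 \<le> B \<and> m \<in> borel_measurable borel \<and> (\<forall>z. 0 \<le> m z) \<and>
     (\<forall>z w. m z \<le> A * decay (- B) (z - w) * m w)"

lemma modulation_qnorm_eq:
  "modulation_qnorm \<phi> p q m (distr_of u) = mixed_qnorm p q (\<lambda>z. ennreal (norm (vstft \<phi> u z) * m z))"
  by (simp add: modulation_qnorm_def mixed_qnorm_def vstft_def)

lemma window_majorant_shift:
  assumes [measurable]: "\<phi> \<in> borel_measurable borel" "u \<in> borel_measurable borel" and "0 < r"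
  shows "window_majorant r M \<phi> u z = Lp_qnorm (ennreal r) (\<lambda>w. ennreal (norm (vstft \<phi> u (z - w)) * decay M w))"
  using Lp_qnorm_translate(3)[of "ennreal r" "\<lambda>w. ennreal (norm (vstft \<phi> u w) * decay M (z - w))" z] assms(3)
  by (simp add: window_majorant_def)

lemma window_majorant_measurable [measurable]:
  assumes [measurable]: "\<phi> \<in> borel_measurable borel" "u \<in> borel_measurable borel"
  shows "window_majorant r M \<phi> u \<in> borel_measurable borel"
  unfolding window_majorant_def by measurable

text \<open>At distance at most 1 the kernel changes by at most the factor \<open>2 powr M\<close>,
  by Peetre's inequality, and the weight by at most \<open>A * 2 powr B\<close>. Neither factor
  depends on \<open>u\<close>, so one embedding constant serves all functions.\<close>

lemma locally_comparable_window_majorant: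
  assumes [measurable]: "\<phi> \<in> borel_measurable borel" "u \<in> borel_measurable borel" and r: "0 < r" and M: "0 \<le> M"
    and m: "moderate A B m"
  shows "locally_comparable (2 powr M * (A * 2 powr B)) (\<lambda>z. window_majorant r M \<phi> u z * ennreal (m z))"
  unfolding locally_comparable_def
proof (intro allI impI)
  fix z z' :: "'a \<times> 'a" assume n: "norm (z - z') \<le> 1"
  have A: "0 < A" "0 \<le> B" "0 \<le> m z'" using m unfolding moderate_def by blast+
  have "decay M (z - w) \<le> 2 powr M * decay M (z' - w)" for w
  proof -
    have "decay M (z - w) * decay M (z' - z) \<le> decay M (z' - w)"
      using decay_mult_le[OF M, of "z - w" "z' - z"] by simp
    moreover have "2 powr (- M) \<le> decay M (z' - z)"
      unfolding decay_def using n M by (intro powr_mono2') (auto simp: add_pos_nonneg norm_minus_commute)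
    ultimately have "decay M (z - w) * 2 powr (- M) \<le> decay M (z' - w)"
      by (meson decay_nonneg mult_left_mono order_trans)
    then show ?thesis by (simp add: powr_minus field_simps)
  qed
  then have "window_majorant r M \<phi> u z \<le> Lp_qnorm (ennreal r) (\<lambda>w. ennreal (2 powr M) * ennreal (norm (vstft \<phi> u w) * decay M (z' - w)))"
    unfolding window_majorant_def using r
    by (intro Lp_qnorm_mono) (auto simp: ennreal_mult'[symmetric] mult.left_commute intro!: ennreal_leI mult_left_mono)
  also have "\<dots> \<le> ennreal (2 powr M) * window_majorant r M \<phi> u z'"
    unfolding window_majorant_def using r by (intro Lp_qnorm_cmult_le) auto
  finally have 1: "window_majorant r M \<phi> u z \<le> ennreal (2 powr M) * window_majorant r M \<phi> u z'" .
  have "m z \<le> A * decay (- B) (z - z') * m z'" using m unfolding moderate_def by blast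
  also have "\<dots> \<le> A * 2 powr B * m z'"
  proof (intro mult_right_mono mult_left_mono)
    show "decay (- B) (z - z') \<le> 2 powr B"
      unfolding decay_def using n A by (simp add: powr_mono2)
  qed (use A in auto)
  finally have "ennreal (m z) \<le> ennreal (A * 2 powr B) * ennreal (m z')"
    using A by (simp add: ennreal_mult'[symmetric] ennreal_leI)
  from mult_mono[OF 1 this]
  show "window_majorant r M \<phi> u z * ennreal (m z) \<le> ennreal (2 powr M * (A * 2 powr B)) * (window_majorant r M \<phi> u z' * ennreal (m z'))"
    using A by (simp add: ennreal_mult mult_ac)
qed

lemma mixed_qnorm_translate:
  fixes h :: "'a::euclidean_space \<times> 'b::euclidean_space \<Rightarrow> ennreal"
  assumes "0 < p" "0 < q" and [measurable]: "h \<in> borel_measurable borel"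
  shows "mixed_qnorm p q (\<lambda>z. h (z - w)) = mixed_qnorm p q h"
proof -
  obtain w1 w2 where w: "w = (w1, w2)" by (cases w)
  have "mixed_qnorm p q (\<lambda>z. h (z - w)) = Lp_qnorm q (\<lambda>\<xi>. Lp_qnorm p (\<lambda>x. h (x - w1, \<xi> - w2)))"
    by (simp add: mixed_qnorm_def w)
  also have "\<dots> = Lp_qnorm q (\<lambda>\<xi>. Lp_qnorm p (\<lambda>x. h (x, \<xi> - w2)))"
    by (intro arg_cong[where f="Lp_qnorm q"] ext, rule Lp_qnorm_translate(2)[OF \<open>0 < p\<close>, of "\<lambda>x. h (x, _)"])
      (rule Lp_qnorm_fst_measurable(2)[OF assms(3)])
  also have "\<dots> = mixed_qnorm p q h"
    unfolding mixed_qnorm_def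
    by (rule Lp_qnorm_translate(2)[OF \<open>0 < q\<close>, of "\<lambda>\<xi>. Lp_qnorm p (\<lambda>x. h (x, \<xi>))"]) (rule Lp_qnorm_fst_measurable(1)[OF assms(3)])
  finally show ?thesis .
qed

lemma Lp_qnorm_decay_finite:
  assumes "0 < r" "real DIM('a::euclidean_space) + 1 \<le> M * r"
  obtains K where "0 < K" "Lp_qnorm (ennreal r) (\<lambda>w::'a. ennreal (decay M w)) \<le> ennreal K"
proof -
  have "(\<integral>\<^sup>+w. ennreal_powr (ennreal (decay M (w::'a))) r \<partial>lborel) = (\<integral>\<^sup>+w. ennreal (decay (M * r) (w::'a)) \<partial>lborel)"
    by (simp add: ennreal_powr_ennreal decay_powr)
  also have "\<dots> < top"
    using decay_integrable[OF assms(2)] by (simp add: integrable_iff_bounded)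
  finally obtain c where c: "0 \<le> c" "(\<integral>\<^sup>+w. ennreal_powr (ennreal (decay M (w::'a))) r \<partial>lborel) = ennreal c"
    by (cases "(\<integral>\<^sup>+w. ennreal_powr (ennreal (decay M (w::'a))) r \<partial>lborel)") auto
  show thesis
    by (rule that[of "c powr (1 / r) + 1"])
      (use assms c in \<open>auto simp: Lp_qnorm_ennreal ennreal_powr_ennreal intro!: ennreal_leI add_nonneg_pos\<close>)
qed

text \<open>Minkowski's inequality, applied first in position and then in frequency, pulls the L^r
  norm over \<open>w\<close> outside. Translation invariance turns what is inside into the
  modulation norm of \<open>u\<close>, and an L^r norm of pure decay is left.\<close>

lemma mixed_qnorm_window_majorant:
  fixes \<phi> :: "'a::euclidean_space \<Rightarrow> complex"
  assumes [measurable]: "\<phi> \<in> borel_measurable borel" and r: "0 < r" "ennreal r \<le> p" "ennreal r \<le> q"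
    and m: "moderate A B m" and M: "real DIM('a \<times> 'a) + 1 \<le> (M - B) * r"
  obtains K where "0 < K" "\<And>u. u \<in> borel_measurable borel \<Longrightarrow>
    mixed_qnorm p q (\<lambda>z. window_majorant r M \<phi> u z * ennreal (m z)) \<le> ennreal K * modulation_qnorm \<phi> p q m (distr_of u)"
proof -
  have A: "0 < A" "0 \<le> B" "\<And>z. 0 \<le> m z" and [measurable]: "m \<in> borel_measurable borel"
    using m by (auto simp: moderate_def)
  have pos: "0 < ennreal r" "0 < p" "0 < q" using r by (auto intro: less_le_trans[of 0 "ennreal r"])
  obtain K where K: "0 < K" "Lp_qnorm (ennreal r) (\<lambda>w::'a \<times> 'a. ennreal (decay (M - B) w)) \<le> ennreal K"
    using Lp_qnorm_decay_finite[OF r(1) M] by blast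
  show thesis
  proof
    show "0 < K * A" using K A by simp
    fix u :: "'a \<Rightarrow> complex" assume [measurable]: "u \<in> borel_measurable borel"
    define h where "h z = ennreal (norm (vstft \<phi> u z) * m z)" for z
    have [measurable]: "h \<in> borel_measurable borel" unfolding h_def by measurable
    \<comment> \<open>The weight at \<open>z\<close> is replaced by the weight at
      \<open>z - w\<close>, where the transform is evaluated; this lowers the order of decay from
      \<open>M\<close> to \<open>M - B\<close>.\<close>
    define F where "F z w = h (z - w) * ennreal (A * decay (M - B) w)" for z w
    have Fm: "case_prod F \<in> borel_measurable (borel \<Otimes>\<^sub>M borel)" unfolding F_def by measurable
    note [measurable] = Fm
    have "window_majorant r M \<phi> u z * ennreal (m z) \<le> Lp_qnorm (ennreal r) (F z)" for z
    proof -
      have "window_majorant r M \<phi> u z * ennreal (m z) =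
        ennreal (m z) * Lp_qnorm (ennreal r) (\<lambda>w. ennreal (norm (vstft \<phi> u (z - w)) * decay M w))"
        using r by (simp add: window_majorant_shift mult.commute)
      also have "\<dots> = Lp_qnorm (ennreal r) (\<lambda>w. ennreal (m z) * ennreal (norm (vstft \<phi> u (z - w)) * decay M w))"
      proof (cases "m z = 0")
        case True
        then show ?thesis using r by (simp add: Lp_qnorm_ennreal)
      next
        case False
        then show ?thesis using A(3)[of z] pos by (intro Lp_qnorm_cmult[symmetric]) auto
      qed
      also have "\<dots> \<le> Lp_qnorm (ennreal r) (F z)"
      proof (intro Lp_qnorm_mono pos)
        fix w
        have "m z \<le> A * decay (- B) (z - (z - w)) * m (z - w)"
          using m unfolding moderate_def by blast
        then have "m z \<le> A * decay (- B) w * m (z - w)" by simp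
        then have "m z * (norm (vstft \<phi> u (z - w)) * decay M w) \<le> (A * decay (- B) w * m (z - w)) * (norm (vstft \<phi> u (z - w)) * decay M w)"
          by (intro mult_right_mono) auto
        also have "\<dots> = (norm (vstft \<phi> u (z - w)) * m (z - w)) * (A * decay (M - B) w)"
          using decay_add[of "- B" M w] by (simp add: mult_ac)
        finally show "ennreal (m z) * ennreal (norm (vstft \<phi> u (z - w)) * decay M w) \<le> F z w"
          using A by (simp add: F_def h_def ennreal_mult'[symmetric] ennreal_mult''[symmetric] ennreal_leI)
      qed measurable
      finally show ?thesis .
    qed
    then have "mixed_qnorm p q (\<lambda>z. window_majorant r M \<phi> u z * ennreal (m z)) \<le> mixed_qnorm p q (\<lambda>z. Lp_qnorm (ennreal r) (F z))"
      using pos by (intro mixed_qnorm_mono) auto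
    also have "\<dots> = Lp_qnorm q (\<lambda>\<xi>. Lp_qnorm p (\<lambda>x. Lp_qnorm (ennreal r) (\<lambda>w. F (x, \<xi>) w)))"
      by (simp add: mixed_qnorm_def)
    also have "\<dots> \<le> Lp_qnorm q (\<lambda>\<xi>. Lp_qnorm (ennreal r) (\<lambda>w. Lp_qnorm p (\<lambda>x. F (x, \<xi>) w)))"
    proof (intro Lp_qnorm_mono Lp_qnorm_Minkowski pos r)
      show "(\<lambda>\<xi>. Lp_qnorm p (\<lambda>x. Lp_qnorm (ennreal r) (\<lambda>w. F (x, \<xi>) w))) \<in> borel_measurable borel"
        unfolding F_def by measurable
      show "(\<lambda>(x, w). F (x, \<xi>) w) \<in> borel_measurable borel" for \<xi>
        by (subst borel_prod[symmetric], unfold F_def) measurable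
    qed
    also have "\<dots> \<le> Lp_qnorm (ennreal r) (\<lambda>w. Lp_qnorm q (\<lambda>\<xi>. Lp_qnorm p (\<lambda>x. F (x, \<xi>) w)))"
    proof (intro Lp_qnorm_Minkowski pos r)
      show "(\<lambda>(\<xi>, w). Lp_qnorm p (\<lambda>x. F (x, \<xi>) w)) \<in> borel_measurable borel"
        by (subst borel_prod[symmetric], unfold F_def) measurable
    qed
    also have "\<dots> \<le> Lp_qnorm (ennreal r) (\<lambda>w. (ennreal A * mixed_qnorm p q h) * ennreal (decay (M - B) (w :: 'a \<times> 'a)))"
    proof (intro Lp_qnorm_mono pos)
      show "(\<lambda>w. Lp_qnorm q (\<lambda>\<xi>. Lp_qnorm p (\<lambda>x. F (x, \<xi>) w))) \<in> borel_measurable borel"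
        unfolding F_def by measurable
      fix w
      have "Lp_qnorm q (\<lambda>\<xi>. Lp_qnorm p (\<lambda>x. F (x, \<xi>) w)) = mixed_qnorm p q (\<lambda>z. ennreal (A * decay (M - B) w) * h (z - w))"
        by (simp add: mixed_qnorm_def F_def mult.commute)
      also have "\<dots> \<le> ennreal (A * decay (M - B) w) * mixed_qnorm p q (\<lambda>z. h (z - w))"
        using pos by (intro mixed_qnorm_cmult_le) auto
      also have "mixed_qnorm p q (\<lambda>z. h (z - w)) = mixed_qnorm p q h"
        using pos by (intro mixed_qnorm_translate) auto
      finally show "Lp_qnorm q (\<lambda>\<xi>. Lp_qnorm p (\<lambda>x. F (x, \<xi>) w)) \<le> (ennreal A * mixed_qnorm p q h) * ennreal (decay (M - B) w)"
        using A by (simp add: ennreal_mult mult_ac)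
    qed
    also have "\<dots> \<le> (ennreal A * mixed_qnorm p q h) * Lp_qnorm (ennreal r) (\<lambda>w::'a \<times> 'a. ennreal (decay (M - B) w))"
      using pos by (intro Lp_qnorm_cmult_le) auto
    also have "\<dots> \<le> (ennreal A * mixed_qnorm p q h) * ennreal K"
      by (intro mult_left_mono K) simp
    also have "\<dots> = ennreal (K * A) * modulation_qnorm \<phi> p q m (distr_of u)"
      using K A by (simp add: modulation_qnorm_eq h_def[abs_def] ennreal_mult mult_ac)
    finally show "mixed_qnorm p q (\<lambda>z. window_majorant r M \<phi> u z * ennreal (m z)) \<le> ennreal (K * A) * modulation_qnorm \<phi> p q m (distr_of u)" .
  qed
qed

lemma small_exponent:
  fixes p q :: ennreal
  assumes "0 < p" "0 < q"
  obtains r where "0 < r" "r \<le> 1" "ennreal r \<le> p" "ennreal r \<le> q"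
proof -
  have "0 < min 1 (min p q)" using assms by simp
  moreover have "min 1 (min p q) < top" by (simp add: min_less_iff_disj)
  ultimately obtain r where r: "min 1 (min p q) = ennreal r" "0 < r"
    by (cases "min 1 (min p q)") auto
  show thesis
  proof (rule that[OF r(2)])
    have "ennreal r \<le> ennreal 1" using r by (metis ennreal_1 min.cobounded1)
    then show "r \<le> 1" by (simp add: ennreal_le_iff)
    show "ennreal r \<le> p" "ennreal r \<le> q" using r by (metis min.cobounded1 min.cobounded2 order_trans)+
  qed
qed

text \<open>Collects what the bilinear estimate takes from the theory of windows. The weight is part
  of \<open>G\<close>, so that weighted estimates later reduce to unweighted ones.\<close>

theorem window_majorant_exists:
  fixes \<phi> \<phi>' :: "'a::euclidean_space \<Rightarrow> complex"
  assumes \<phi>: "\<phi> \<in> schwartz" "\<phi> \<noteq> (\<lambda>_. 0)" and \<phi>': "\<phi>' \<in> schwartz" and pq: "0 < p" "0 < q" and m: "moderate A B m"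
  obtains G C K where "0 < C" "0 < K"
    "\<And>u. integrable lborel u \<Longrightarrow> G u \<in> borel_measurable borel"
    "\<And>u. integrable lborel u \<Longrightarrow> locally_comparable C (G u)"
    "\<And>u z. integrable lborel u \<Longrightarrow> ennreal (norm (vstft \<phi>' u z) * m z) \<le> G u z"
    "\<And>u. integrable lborel u \<Longrightarrow> mixed_qnorm p q (G u) \<le> ennreal K * modulation_qnorm \<phi> p q m (distr_of u)"
proof -
  obtain r where r: "0 < r" "r \<le> 1" "ennreal r \<le> p" "ennreal r \<le> q" using small_exponent[OF pq] by blast
  have A: "0 < A" "0 \<le> B" "\<And>z. 0 \<le> m z" and [measurable]: "m \<in> borel_measurable borel"
    using m by (auto simp: moderate_def)
  \<comment> \<open>Chosen such that \<open>(M - B) * r\<close> equals the dimension of phase space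
    plus 1, where the \<open>r\<close>-th power of the decay is integrable.\<close>
  define M where "M = B + (real DIM('a \<times> 'a) + 1) / r"
  have M: "0 \<le> M" "real DIM('a \<times> 'a) + 1 \<le> (M - B) * r" using A r by (auto simp: M_def)
  have [measurable]: "\<phi> \<in> borel_measurable borel" using \<phi> by auto
  obtain C1 where C1: "0 < C1" "\<And>u z. integrable lborel u \<Longrightarrow>
    ennreal (norm (vstft \<phi>' u z)) \<le> ennreal C1 * window_majorant r M \<phi> u z"
    using vstft_le_window_majorant[OF \<phi> \<phi>' r(1,2) M(1)] by blast
  obtain K where K: "0 < K" "\<And>u. u \<in> borel_measurable borel \<Longrightarrow>
    mixed_qnorm p q (\<lambda>z. window_majorant r M \<phi> u z * ennreal (m z)) \<le> ennreal K * modulation_qnorm \<phi> p q m (distr_of u)"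
    using mixed_qnorm_window_majorant[of \<phi>, OF _ r(1,3,4) m M(2)] by auto
  define H where "H u z = window_majorant r M \<phi> u z * ennreal (m z)" for u z
  show thesis
  proof (rule that[of "2 powr M * (A * 2 powr B)" "C1 * K" "\<lambda>u z. ennreal C1 * H u z"])
    show "0 < 2 powr M * (A * 2 powr B)" "0 < C1 * K" using A C1 K by auto
    fix u :: "'a \<Rightarrow> complex" assume u: "integrable lborel u"
    then have um[measurable]: "u \<in> borel_measurable borel" by auto
    have [measurable]: "H u \<in> borel_measurable borel" unfolding H_def by measurable
    show "(\<lambda>z. ennreal C1 * H u z) \<in> borel_measurable borel" by measurable
    have "locally_comparable (2 powr M * (A * 2 powr B)) (H u)"
      unfolding H_def using r M m by (intro locally_comparable_window_majorant) auto
    then show "locally_comparable (2 powr M * (A * 2 powr B)) (\<lambda>z. ennreal C1 * H u z)"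
      unfolding locally_comparable_def by (auto simp: mult.left_commute intro!: mult_left_mono)
    show "ennreal (norm (vstft \<phi>' u z) * m z) \<le> ennreal C1 * H u z" for z
      using mult_right_mono[OF C1(2)[OF u, of z], of "ennreal (m z)"] A(3)[of z]
      by (simp add: H_def ennreal_mult mult.assoc)
    have "mixed_qnorm p q (\<lambda>z. ennreal C1 * H u z) \<le> ennreal C1 * mixed_qnorm p q (H u)"
      using pq by (intro mixed_qnorm_cmult_le) auto
    also have "\<dots> \<le> ennreal C1 * (ennreal K * modulation_qnorm \<phi> p q m (distr_of u))"
      unfolding H_def by (intro mult_left_mono K um) simp
    finally show "mixed_qnorm p q (\<lambda>z. ennreal C1 * H u z) \<le> ennreal (C1 * K) * modulation_qnorm \<phi> p q m (distr_of u)"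
      using C1 K by (simp add: ennreal_mult mult.assoc)
  qed
qed

corollary modulation_qnorm_change_window:
  fixes \<phi> \<phi>' :: "'a::euclidean_space \<Rightarrow> complex"
  assumes \<phi>: "\<phi> \<in> schwartz" "\<phi> \<noteq> (\<lambda>_. 0)" and \<phi>': "\<phi>' \<in> schwartz" and pq: "0 < p" "0 < q" and m: "moderate A B m"
  obtains K where "0 < K" "\<And>u. integrable lborel u \<Longrightarrow>
    modulation_qnorm \<phi>' p q m (distr_of u) \<le> ennreal K * modulation_qnorm \<phi> p q m (distr_of u)"
proof -
  have [measurable]: "\<phi>' \<in> borel_measurable borel" "m \<in> borel_measurable borel"
    using \<phi>' m by (auto simp: moderate_def)
  show thesis
  proof (rule window_majorant_exists[OF assms])
    fix C K :: real and G :: "('a \<Rightarrow> complex) \<Rightarrow> 'a \<times> 'a \<Rightarrow> ennreal"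
    assume K: "0 < K" and G: "\<And>u. integrable lborel u \<Longrightarrow> G u \<in> borel_measurable borel"
      "\<And>u z. integrable lborel u \<Longrightarrow> ennreal (norm (vstft \<phi>' u z) * m z) \<le> G u z"
      "\<And>u. integrable lborel u \<Longrightarrow> mixed_qnorm p q (G u) \<le> ennreal K * modulation_qnorm \<phi> p q m (distr_of u)"
    show thesis
    proof (rule that[OF K])
      fix u :: "'a \<Rightarrow> complex" assume u: "integrable lborel u"
      then have [measurable]: "u \<in> borel_measurable borel" by auto
      have "modulation_qnorm \<phi>' p q m (distr_of u) \<le> mixed_qnorm p q (G u)"
        unfolding modulation_qnorm_eq using pq G(1,2)[OF u] by (intro mixed_qnorm_mono) auto
      also have "\<dots> \<le> ennreal K * modulation_qnorm \<phi> p q m (distr_of u)" by (rule G(3)[OF u])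
      finally show "modulation_qnorm \<phi>' p q m (distr_of u) \<le> ennreal K * modulation_qnorm \<phi> p q m (distr_of u)" .
    qed
  qed
qed

section \<open>Gaussian windows\<close>

text \<open>Polynomials times the Gaussian of the quadratic form of \<open>L\<close>. The rules are
  just those that make the set stable under directional derivatives, so that iterated derivatives
  never have to be computed.\<close>

inductive_set gaussian_span :: "('a::euclidean_space \<Rightarrow> 'a) \<Rightarrow> ('a \<Rightarrow> complex) set" for L where
  base: "(\<lambda>t. complex_of_real (exp (- (pi * (t \<bullet> L t))))) \<in> gaussian_span L"
| linear: "f \<in> gaussian_span L \<Longrightarrow> (\<lambda>t. complex_of_real (t \<bullet> c) * f t) \<in> gaussian_span L"
| add: "f \<in> gaussian_span L \<Longrightarrow> g \<in> gaussian_span L \<Longrightarrow> (\<lambda>t. f t + g t) \<in> gaussian_span L"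
| scale: "f \<in> gaussian_span L \<Longrightarrow> (\<lambda>t. c * f t) \<in> gaussian_span L"

text \<open>For the Gaussian itself, symmetry of \<open>L\<close> merges the two terms of the
  product rule into the single linear form t \<bullet> L v, which is a factor that the rule
  \<open>linear\<close> admits.\<close>

lemma gaussian_span_derivative:
  assumes L: "linear L" "\<And>x y. x \<bullet> L y = L x \<bullet> y" and "f \<in> gaussian_span L"
  shows "\<exists>f'. (\<forall>t. (f has_derivative f' t) (at t)) \<and> (\<forall>b. (\<lambda>t. f' t b) \<in> gaussian_span L)"
  using assms(3)
proof induction
  case base
  have bl: "bounded_linear L" using L(1) by (simp add: linear_conv_bounded_linear)
  let ?g = "\<lambda>t. complex_of_real (exp (- (pi * (t \<bullet> L t))))"
  have "(?g has_derivative (\<lambda>v. complex_of_real (- (2 * pi)) * (complex_of_real (t \<bullet> L v) * ?g t))) (at t)" for t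
  proof -
    have "((\<lambda>t. exp (- (pi * (t \<bullet> L t)))) has_derivative (\<lambda>v. exp (- (pi * (t \<bullet> L t))) * (- (pi * (t \<bullet> L v + v \<bullet> L t))))) (at t)"
      by (rule derivative_eq_intros bounded_linear.has_derivative[OF bl] refl | simp add: mult.commute)+
    then have "(?g has_derivative (\<lambda>v. complex_of_real (exp (- (pi * (t \<bullet> L t))) * (- (pi * (t \<bullet> L v + v \<bullet> L t)))))) (at t)"
      by (rule has_derivative_of_real)
    moreover have "complex_of_real (exp (- (pi * (t \<bullet> L t))) * (- (pi * (t \<bullet> L v + v \<bullet> L t))))
      = complex_of_real (- (2 * pi)) * (complex_of_real (t \<bullet> L v) * ?g t)" for v
    proof -
      have "v \<bullet> L t = t \<bullet> L v" using L(2)[of v t] inner_commute[of "L v" t] by simp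
      then have "exp (- (pi * (t \<bullet> L t))) * (- (pi * (t \<bullet> L v + v \<bullet> L t))) = (- (2 * pi)) * ((t \<bullet> L v) * exp (- (pi * (t \<bullet> L t))))"
        by (simp only:) (simp add: field_simps)
      then show ?thesis by (simp only: of_real_mult)
    qed
    ultimately show ?thesis by (simp only:)
  qed
  moreover have "(\<lambda>t. complex_of_real (- (2 * pi)) * (complex_of_real (t \<bullet> L b) * ?g t)) \<in> gaussian_span L" for b
    by (intro gaussian_span.intros)
  ultimately show ?case
    by (intro exI[of _ "\<lambda>t v. complex_of_real (- (2 * pi)) * (complex_of_real (t \<bullet> L v) * ?g t)"]) blast
next
  case (linear f c)
  then obtain f' where f': "\<And>t. (f has_derivative f' t) (at t)" "\<And>b. (\<lambda>t. f' t b) \<in> gaussian_span L" by blast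
  have "((\<lambda>t. complex_of_real (t \<bullet> c) * f t) has_derivative (\<lambda>v. complex_of_real (t \<bullet> c) * f' t v + complex_of_real (v \<bullet> c) * f t)) (at t)" for t
    by (rule derivative_eq_intros f' refl | simp)+
  moreover have "(\<lambda>t. complex_of_real (t \<bullet> c) * f' t b + complex_of_real (b \<bullet> c) * f t) \<in> gaussian_span L" for b
    using f'(2) linear by (intro gaussian_span.intros)
  ultimately show ?case by (intro exI[of _ "\<lambda>t v. complex_of_real (t \<bullet> c) * f' t v + complex_of_real (v \<bullet> c) * f t"]) blast
next
  case (add f g)
  then obtain f' g' where "\<And>t. (f has_derivative f' t) (at t)" "\<And>b. (\<lambda>t. f' t b) \<in> gaussian_span L"
    "\<And>t. (g has_derivative g' t) (at t)" "\<And>b. (\<lambda>t. g' t b) \<in> gaussian_span L" by blast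
  then show ?case
    by (intro exI[of _ "\<lambda>t v. f' t v + g' t v"]) (auto intro: gaussian_span.intros has_derivative_add)
next
  case (scale f c)
  then obtain f' where "\<And>t. (f has_derivative f' t) (at t)" "\<And>b. (\<lambda>t. f' t b) \<in> gaussian_span L" by blast
  then show ?case
    by (intro exI[of _ "\<lambda>t v. c * f' t v"]) (auto intro: gaussian_span.intros has_derivative_mult_right)
qed

text \<open>A linear factor costs one power of \<open>1 + norm x\<close>, so the induction
  hypothesis is used with \<open>Suc k\<close> and \<open>k\<close> must stay arbitrary.\<close>

lemma gaussian_span_decay:
  assumes a: "0 < a" "\<And>x. a * (norm x)\<^sup>2 \<le> x \<bullet> L x" and "f \<in> gaussian_span L"
  shows "\<exists>C. \<forall>x. (1 + norm x) ^ k * norm (f x) \<le> C"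
  using assms(3)
proof (induction arbitrary: k)
  case base
  \<comment> \<open>From (1 + s)^k \<le> exp (k s); the constant is the exponential of the maximum
    of k s - \<pi> a s^2, found by completing the square.\<close>
  have "(1 + norm x) ^ k * norm (complex_of_real (exp (- (pi * (x \<bullet> L x))))) \<le> exp ((real k)\<^sup>2 / (4 * pi * a))" for x
  proof -
    let ?s = "norm x"
    have "(1 + ?s) ^ k \<le> exp ?s ^ k" by (intro power_mono) auto
    also have "\<dots> = exp (real k * ?s)" by (simp add: exp_of_nat_mult)
    finally have "(1 + ?s) ^ k * exp (- (pi * (x \<bullet> L x))) \<le> exp (real k * ?s) * exp (- (pi * (a * ?s\<^sup>2)))"
      using a(2)[of x] by (intro mult_mono) (auto intro: mult_left_mono)
    also have "\<dots> = exp (real k * ?s - pi * (a * ?s\<^sup>2))" by (simp add: exp_diff exp_minus divide_inverse)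
    also have "real k * ?s - pi * (a * ?s\<^sup>2) \<le> (real k)\<^sup>2 / (4 * pi * a)"
    proof -
      have "0 \<le> (real k - 2 * pi * a * ?s)\<^sup>2 / (4 * pi * a)" using a(1) by simp
      also have "\<dots> = (real k)\<^sup>2 / (4 * pi * a) - (real k * ?s - pi * (a * ?s\<^sup>2))"
        using a(1) by (simp add: power2_eq_square field_simps)
      finally show ?thesis by simp
    qed
    finally show ?thesis by simp
  qed
  then show ?case by blast
next
  case (linear f c)
  obtain C where C: "\<And>x. (1 + norm x) ^ Suc k * norm (f x) \<le> C" using linear.IH[of "Suc k"] by blast
  have "(1 + norm x) ^ k * norm (complex_of_real (x \<bullet> c) * f x) \<le> norm c * C" for x
  proof -
    have "\<bar>x \<bullet> c\<bar> \<le> norm c * (1 + norm x)"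
      using Cauchy_Schwarz_ineq2[of x c] mult_left_mono[of "norm x" "1 + norm x" "norm c"]
      by (simp add: mult.commute)
    then have "(1 + norm x) ^ k * norm (complex_of_real (x \<bullet> c) * f x) \<le> (1 + norm x) ^ k * (norm c * (1 + norm x) * norm (f x))"
      by (simp add: norm_mult mult_left_mono mult_right_mono)
    also have "\<dots> = norm c * ((1 + norm x) ^ Suc k * norm (f x))" by simp
    also have "\<dots> \<le> norm c * C" by (intro mult_left_mono C) simp
    finally show ?thesis .
  qed
  then show ?case by blast
next
  case (add f g)
  obtain C D where "\<And>x. (1 + norm x) ^ k * norm (f x) \<le> C" "\<And>x. (1 + norm x) ^ k * norm (g x) \<le> D"
    using add.IH[of k] by blast
  moreover have "(1 + norm x) ^ k * norm (f x + g x) \<le> (1 + norm x) ^ k * norm (f x) + (1 + norm x) ^ k * norm (g x)" for x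
    by (simp add: distrib_left[symmetric] mult_left_mono norm_triangle_ineq)
  ultimately show ?case by (intro exI[of _ "C + D"]) (meson add_mono order_trans)
next
  case (scale f c)
  obtain C where "\<And>x. (1 + norm x) ^ k * norm (f x) \<le> C" using scale.IH[of k] by blast
  then show ?case by (intro exI[of _ "norm c * C"]) (auto simp: norm_mult mult.left_commute intro: mult_left_mono)
qed

lemma gaussian_span_schwartz:
  assumes L: "linear L" "\<And>x y. x \<bullet> L y = L x \<bullet> y" and a: "0 < a" "\<And>x. a * (norm x)\<^sup>2 \<le> x \<bullet> L x"
    and f: "f \<in> gaussian_span L"
  shows "f \<in> schwartz"
proof -
  have "iterated_deriv bs f \<in> gaussian_span L" for bs
  proof (induction bs)
    case (Cons b bs)
    obtain f' where f': "\<And>t. (iterated_deriv bs f has_derivative f' t) (at t)" "\<And>b. (\<lambda>t. f' t b) \<in> gaussian_span L"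
      using gaussian_span_derivative[OF L Cons] by blast
    then have "frechet_derivative (iterated_deriv bs f) (at t) = f' t" for t
      using frechet_derivative_at by metis
    then show ?case using f'(2) by simp
  qed (use f in simp)
  moreover have "\<forall>x. h differentiable at x" if "h \<in> gaussian_span L" for h
    using gaussian_span_derivative[OF L that] by (auto simp: differentiable_def)
  ultimately show ?thesis
    unfolding schwartz_def using gaussian_span_decay[OF a] by blast
qed

lemma gaussian_schwartz:
  assumes "0 < a" shows "(\<lambda>t::'a::euclidean_space. complex_of_real (gaussian a t)) \<in> schwartz"
proof -
  have "(\<lambda>t::'a. complex_of_real (exp (- (pi * (t \<bullet> (a *\<^sub>R t)))))) \<in> schwartz"
    by (rule gaussian_span_schwartz[OF _ _ assms _ gaussian_span.base])
      (auto simp: power2_norm_eq_inner intro!: linearI simp: scaleR_add_right)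
  then show ?thesis by (simp add: gaussian_def power2_norm_eq_inner mult.assoc)
qed

text \<open>Provides the window in the ambiguity plane, whose two Gaussians have different widths;
  this is why \<open>gaussian_span\<close> is built on a quadratic form instead of a multiple of the
  norm.\<close>

lemma gaussian_pair_schwartz:
  assumes "0 < a"
  shows "(\<lambda>(x::'a::euclidean_space, y::'b::euclidean_space). complex_of_real (gaussian 1 x * gaussian a y)) \<in> schwartz"
proof -
  let ?L = "\<lambda>z::'a \<times> 'b. (fst z, a *\<^sub>R snd z)"
  have "(\<lambda>t. complex_of_real (exp (- (pi * (t \<bullet> ?L t))))) \<in> schwartz"
  proof (rule gaussian_span_schwartz[OF _ _ _ _ gaussian_span.base])
    show "linear ?L" by (auto intro!: linearI simp: scaleR_add_right)
    show "0 < min 1 a" using assms by simp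
    fix x y :: "'a \<times> 'b"
    show "x \<bullet> ?L y = ?L x \<bullet> y" by (simp add: inner_prod_def)
    have "min 1 a * (fst x \<bullet> fst x) \<le> 1 * (fst x \<bullet> fst x)" "min 1 a * (snd x \<bullet> snd x) \<le> a * (snd x \<bullet> snd x)"
      by (intro mult_right_mono; simp)+
    then show "min 1 a * (norm x)\<^sup>2 \<le> x \<bullet> ?L x"
      by (simp add: power2_norm_eq_inner inner_prod_def distrib_left)
  qed
  moreover have "complex_of_real (exp (- (pi * (t \<bullet> ?L t)))) = (case t of (x, y) \<Rightarrow> complex_of_real (gaussian 1 x * gaussian a y))" for t
    by (cases t) (simp add: gaussian_def power2_norm_eq_inner exp_add[symmetric] distrib_left flip: of_real_mult)
  ultimately show ?thesis by simp
qed

section \<open>The \<open>\<tau>\<close>-Wigner distribution on the Fourier side\<close>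

text \<open>\<open>gaussian 1\<close> has integral 1, so integrating the transform over all
  positions returns the Fourier transform of \<open>g\<close>, and Fubini passes integrability
  on.\<close>

lemma fourier_integrable_of_vstft:
  fixes g :: "'a::euclidean_space \<Rightarrow> complex"
  assumes g: "integrable lborel g" and V: "integrable lborel (vstft (\<lambda>t. complex_of_real (gaussian 1 t)) g)"
  shows "integrable lborel (fourier g)"
proof -
  let ?\<psi> = "\<lambda>t::'a. complex_of_real (gaussian 1 t)"
  have [measurable]: "g \<in> borel_measurable borel" using g by auto
  have "integrable lborel ?\<psi>" using gaussian_integrable(1)[of 1, where 'a='a] by simp
  then have i: "integrable lborel (\<lambda>z. g (fst z) * ?\<psi> (fst z - snd z) * exp (- (2 * pi * \<i> * (fst z \<bullet> \<xi>))))" for \<xi>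
  proof -
    assume \<psi>: "integrable lborel ?\<psi>"
    have "integrable (lborel \<Otimes>\<^sub>M lborel) (\<lambda>z. g (fst z) * ?\<psi> (fst z - snd z) * exp (- (2 * pi * \<i> * (fst z \<bullet> \<xi>))))"
    proof (rule lborel_pair.Fubini_integrable)
      show "AE x in lborel. integrable lborel (\<lambda>y. g (fst (x, y)) * ?\<psi> (fst (x, y) - snd (x, y)) * exp (- (2 * pi * \<i> * (fst (x, y) \<bullet> \<xi>))))"
        using lborel_integrable_translate(2)[OF \<psi>] by auto
      have "(LINT y|lborel. norm (g (fst (x, y)) * ?\<psi> (fst (x, y) - snd (x, y)) * exp (- (2 * pi * \<i> * (fst (x, y) \<bullet> \<xi>)))))
        = norm (g x) * (LINT y|lborel. norm (?\<psi> y))" for x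
      proof -
        have "(LINT y|lborel. norm (?\<psi> (x - y))) = (LINT y|lborel. norm (?\<psi> y))"
          by (rule lborel_integral_translate(4)) measurable
        then show ?thesis by (simp add: norm_mult)
      qed
      then show "integrable lborel (\<lambda>x. LINT y|lborel. norm (g (fst (x, y)) * ?\<psi> (fst (x, y) - snd (x, y)) * exp (- (2 * pi * \<i> * (fst (x, y) \<bullet> \<xi>)))))"
        using g by simp
    qed measurable
    then show ?thesis by (simp add: lborel_prod)
  qed
  have "(LINT x|lborel. vstft ?\<psi> g (x, \<xi>)) = fourier g \<xi>" for \<xi>
  proof -
    have "(LINT x|lborel. vstft ?\<psi> g (x, \<xi>)) = (LINT x|lborel. LINT t|lborel. g t * ?\<psi> (t - x) * exp (- (2 * pi * \<i> * (t \<bullet> \<xi>))))"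
      by (simp add: vstft_eq)
    also have "\<dots> = (LINT t|lborel. LINT x|lborel. g t * ?\<psi> (t - x) * exp (- (2 * pi * \<i> * (t \<bullet> \<xi>))))"
      using lborel_Fubini(3)[OF i[of \<xi>]] by simp
    also have "\<dots> = (LINT t|lborel. g t * exp (- (2 * pi * \<i> * (t \<bullet> \<xi>))))"
    proof (intro Bochner_Integration.integral_cong refl)
      fix t
      have "(LINT x|lborel. g t * ?\<psi> (t - x) * exp (- (2 * pi * \<i> * (t \<bullet> \<xi>))))
        = g t * exp (- (2 * pi * \<i> * (t \<bullet> \<xi>))) * (LINT x|lborel. ?\<psi> (t - x))"
        unfolding integral_mult_right_zero[symmetric] by (simp only: mult_ac)
      also have "(LINT x|lborel. ?\<psi> (t - x)) = (LINT x|lborel. ?\<psi> x)"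
        by (rule lborel_integral_translate(4)) measurable
      also have "\<dots> = 1" using gaussian_integrable(2)[of 1, where 'a='a] by simp
      finally show "(LINT x|lborel. g t * ?\<psi> (t - x) * exp (- (2 * pi * \<i> * (t \<bullet> \<xi>)))) = g t * exp (- (2 * pi * \<i> * (t \<bullet> \<xi>)))"
        by simp
    qed
    finally show ?thesis by (simp add: fourier_def)
  qed
  moreover have "integrable lborel (\<lambda>\<xi>. LINT x|lborel. vstft ?\<psi> g (x, \<xi>))"
    using lborel_pair.integrable_snd[of "\<lambda>x \<xi>. vstft ?\<psi> g (x, \<xi>)"] V by (simp add: lborel_prod)
  ultimately show ?thesis by simp
qed

text \<open>Supplies for the test functions in \<open>stft\<close> the regularity that Parseval's
  formula asks of one of its two functions.\<close>

lemma time_frequency_shift_properties: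
  fixes \<phi> :: "'a::euclidean_space \<Rightarrow> complex"
  assumes \<phi>: "\<phi> \<in> schwartz" and g_def: "g = modulation \<eta> (translation y \<phi>)"
  obtains B where "continuous_on UNIV g" "integrable lborel g" "\<And>t. norm (g t) \<le> B" "integrable lborel (fourier g)"
proof -
  have [measurable]: "\<phi> \<in> borel_measurable borel" using \<phi> by auto
  obtain B where B: "0 < B" "\<And>x. norm (\<phi> x) \<le> B" using schwartz_bounded[OF \<phi>] by blast
  have ng: "norm (g t) = norm (\<phi> (t - y))" for t
    by (simp add: g_def modulation_def translation_def norm_mult)
  have [measurable]: "g \<in> borel_measurable borel"
    unfolding g_def modulation_def translation_def by measurable
  have gi: "integrable lborel g"
    using lborel_integrable_translate(1)[OF schwartz_integrable[OF \<phi>], of y]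
    by (rule Bochner_Integration.integrable_bound) (auto simp: ng)
  have \<psi>: "(\<lambda>t::'a. complex_of_real (gaussian 1 t)) \<in> schwartz" by (rule gaussian_schwartz) simp
  have "integrable lborel (vstft (\<lambda>t. complex_of_real (gaussian 1 t)) g)"
    using lborel_integrable_translate(1)[OF integrable_vstft(1)[OF \<phi> \<psi>], of "(y, \<eta>)"]
  proof (rule Bochner_Integration.integrable_bound)
    show "AE w in lborel. norm (vstft (\<lambda>t. complex_of_real (gaussian 1 t)) g w)
       \<le> norm (vstft (\<lambda>t. complex_of_real (gaussian 1 t)) \<phi> (w - (y, \<eta>)))"
      unfolding g_def by (intro AE_I2 eq_refl vstft_covariance) measurable
  qed measurable
  then have "integrable lborel (fourier g)" by (rule fourier_integrable_of_vstft[OF gi])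
  moreover have "continuous_on UNIV g"
    unfolding g_def modulation_def translation_def
    by (intro continuous_intros continuous_on_compose2[OF schwartz_continuous[OF \<phi>]]) auto
  ultimately show thesis using gi B(2) by (intro that[of B]) (auto simp: ng)
qed

text \<open>Fubini moves the Fourier transform from \<open>u\<close> onto \<open>g\<close>, where
  inversion undoes it. All regularity is placed on \<open>g\<close>, because \<open>u\<close> will
  be an ambiguity function of which only integrability is established.\<close>

lemma fourier_parseval:
  fixes u g :: "'a::euclidean_space \<Rightarrow> complex"
  assumes u: "integrable lborel u" and g: "continuous_on UNIV g" "integrable lborel g" "\<And>t. norm (g t) \<le> B" "integrable lborel (fourier g)"
  shows "(LINT y|lborel. fourier u y * cnj (fourier g y)) = (LINT t|lborel. u t * cnj (g t))"
proof -
  have [measurable]: "u \<in> borel_measurable borel" "fourier g \<in> borel_measurable borel" using u g by auto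
  have ig: "integrable lborel (\<lambda>y. cnj (fourier g y))" using g(4) by simp
  have i: "integrable lborel (\<lambda>z. u (fst z) * cnj (fourier g (snd z)) * exp (- (2 * pi * \<i> * (fst z \<bullet> snd z))))"
    by (rule Bochner_Integration.integrable_bound[OF integrable_pair_mult[OF u ig]]) (auto simp: norm_mult)
  have "(LINT y|lborel. fourier u y * cnj (fourier g y))
    = (LINT y|lborel. LINT t|lborel. u t * cnj (fourier g y) * exp (- (2 * pi * \<i> * (t \<bullet> y))))"
    unfolding fourier_def[of u] integral_mult_left_zero[symmetric] by (simp only: mult_ac)
  also have "\<dots> = (LINT t|lborel. LINT y|lborel. u t * cnj (fourier g y) * exp (- (2 * pi * \<i> * (t \<bullet> y))))"
    using lborel_Fubini(3)[OF i] by simp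
  also have "\<dots> = (LINT t|lborel. u t * cnj (g t))"
  proof (intro Bochner_Integration.integral_cong refl)
    fix t
    have "(LINT y|lborel. u t * cnj (fourier g y) * exp (- (2 * pi * \<i> * (t \<bullet> y))))
      = u t * (LINT y|lborel. cnj (fourier g y * exp (2 * pi * \<i> * (t \<bullet> y))))"
      unfolding integral_mult_right_zero[symmetric]
      by (intro Bochner_Integration.integral_cong refl) (simp add: exp_cnj mult.assoc)
    also have "\<dots> = u t * cnj (g t)"
      unfolding Bochner_Integration.integral_cnj fourier_inversion[OF g(1,3,2,4)] ..
    finally show "(LINT y|lborel. u t * cnj (fourier g y) * exp (- (2 * pi * \<i> * (t \<bullet> y)))) = u t * cnj (g t)" .
  qed
  finally show ?thesis .
qed

text \<open>The kernel whose Fourier transform in \<open>t\<close> is \<open>tau_wigner\<close> is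
  here transformed inversely in \<open>x\<close>, hence the positive sign in the exponent. Undoing
  this one transform and applying the other is the Fourier transform in both variables.\<close>

definition ambiguity :: "real \<Rightarrow> ('a::euclidean_space \<Rightarrow> complex) \<Rightarrow> ('a \<Rightarrow> complex) \<Rightarrow> 'a \<times> 'a \<Rightarrow> complex" where
  "ambiguity \<tau> f1 f2 = (\<lambda>(\<eta>, y). LINT x|lborel. f1 (x + \<tau> *\<^sub>R y) * cnj (f2 (x - (1 - \<tau>) *\<^sub>R y)) * exp (2 * pi * \<i> * (x \<bullet> \<eta>)))"

context
  fixes \<tau> :: real and f1 f2 :: "'a::euclidean_space \<Rightarrow> complex"
  assumes f1: "f1 \<in> schwartz" and f2: "f2 \<in> schwartz"
begin

private lemma meas [measurable]: "f1 \<in> borel_measurable borel" "f2 \<in> borel_measurable borel"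
  using f1 f2 by auto

text \<open>The translation by \<tau> y removes \<tau> up to a phase. Thus the ambiguity function
  inherits measurable bounds and rapid decay from a short-time Fourier transform of
  \<open>f1\<close> with window \<open>f2\<close>.\<close>

lemma norm_ambiguity: "norm (ambiguity \<tau> f1 f2 (\<eta>, y)) = norm (vstft f2 f1 (y, - \<eta>))"
proof -
  have "ambiguity \<tau> f1 f2 (\<eta>, y) = (LINT x|lborel. f1 (x + \<tau> *\<^sub>R y) * cnj (f2 ((x + \<tau> *\<^sub>R y) - y)) * exp (2 * pi * \<i> * (((x + \<tau> *\<^sub>R y) - \<tau> *\<^sub>R y) \<bullet> \<eta>)))"
    by (simp add: ambiguity_def algebra_simps)
  also have "\<dots> = (LINT x|lborel. f1 x * cnj (f2 (x - y)) * exp (2 * pi * \<i> * ((x - \<tau> *\<^sub>R y) \<bullet> \<eta>)))"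
    by (rule lborel_integral_translate(2)) measurable
  also have "\<dots> = (LINT x|lborel. exp (- (2 * pi * \<i> * (\<tau> * (y \<bullet> \<eta>)))) * (f1 x * cnj (f2 (x - y)) * exp (- (2 * pi * \<i> * (x \<bullet> (- \<eta>))))))"
    by (intro Bochner_Integration.integral_cong refl)
      (simp add: inner_diff_left algebra_simps exp_diff exp_minus divide_inverse)
  also have "\<dots> = exp (- (2 * pi * \<i> * (\<tau> * (y \<bullet> \<eta>)))) * vstft f2 f1 (y, - \<eta>)"
    unfolding vstft_eq by (rule integral_mult_right_zero)
  finally show ?thesis by (simp add: norm_mult)
qed

lemma ambiguity_integrable:
  "integrable lborel (ambiguity \<tau> f1 f2)" "integrable lborel (\<lambda>\<eta>. ambiguity \<tau> f1 f2 (\<eta>, y))"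
proof -
  have m: "ambiguity \<tau> f1 f2 \<in> borel_measurable borel"
    unfolding ambiguity_def borel_prod[symmetric] by measurable
  then have [measurable]: "ambiguity \<tau> f1 f2 \<in> borel_measurable (borel \<Otimes>\<^sub>M borel)" by (simp add: borel_prod)
  let ?M = "real DIM('a \<times> 'a) + 1"
  obtain C where C: "0 < C" "\<And>w. norm (vstft f2 f1 w) \<le> C * decay ?M w" using vstft_decay[OF f1 f2] by blast
  have le: "norm (ambiguity \<tau> f1 f2 (\<eta>, y)) \<le> C * decay ?M (\<eta>, y)" for \<eta> y
    using C(2)[of "(y, - \<eta>)"] by (simp add: norm_ambiguity decay_def norm_Pair add.commute del: DIM_prod)
  show "integrable lborel (ambiguity \<tau> f1 f2)"
  proof (rule Bochner_Integration.integrable_bound[of _ "\<lambda>w. C * decay ?M w"])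
    show "integrable lborel (\<lambda>w::'a \<times> 'a. C * decay ?M w)"
      by (intro integrable_mult_right decay_integrable order_refl)
    show "AE w in lborel. norm (ambiguity \<tau> f1 f2 w) \<le> norm (C * decay ?M w)"
      using le C(1) by (intro AE_I2) (auto simp: abs_of_nonneg simp del: DIM_prod)
  qed (use m in simp)
  show "integrable lborel (\<lambda>\<eta>. ambiguity \<tau> f1 f2 (\<eta>, y))"
  proof (rule Bochner_Integration.integrable_bound[of _ "\<lambda>\<eta>. C * decay ?M \<eta>"])
    show "integrable lborel (\<lambda>\<eta>::'a. C * decay ?M \<eta>)"
      by (intro integrable_mult_right decay_integrable) simp
    show "AE \<eta> in lborel. norm (ambiguity \<tau> f1 f2 (\<eta>, y)) \<le> norm (C * decay ?M \<eta>)"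
    proof (rule AE_I2)
      fix \<eta> :: 'a
      have "norm \<eta> \<le> norm (\<eta>, y)" by (simp add: norm_Pair real_le_rsqrt)
      then have "decay ?M (\<eta>, y) \<le> decay ?M \<eta>"
        unfolding decay_def by (intro powr_mono2') (auto simp: add_pos_nonneg)
      then have "C * decay ?M (\<eta>, y) \<le> C * decay ?M \<eta>" using C(1) by (intro mult_left_mono) auto
      with le[of \<eta> y] have "norm (ambiguity \<tau> f1 f2 (\<eta>, y)) \<le> C * decay ?M \<eta>" by (rule order_trans)
      then show "norm (ambiguity \<tau> f1 f2 (\<eta>, y)) \<le> norm (C * decay ?M \<eta>)" using C(1) by (simp add: abs_of_nonneg)
    qed
  qed measurable
qed

lemma integrable_wigner_slice: "integrable lborel (\<lambda>x. f1 (x + \<tau> *\<^sub>R y) * cnj (f2 (x - (1 - \<tau>) *\<^sub>R y)))"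
proof -
  obtain B where B: "0 < B" "\<And>x. norm (f2 x) \<le> B" using schwartz_bounded[OF f2] by blast
  have i: "integrable lborel (\<lambda>x. f1 (x + \<tau> *\<^sub>R y))"
    using lborel_integrable_translate(1)[OF schwartz_integrable[OF f1], of "- (\<tau> *\<^sub>R y)"] by simp
  show ?thesis
    using vstft_integrable_factor[OF i meas(2) B(2), of "(1 - \<tau>) *\<^sub>R y" 0] by simp
qed

text \<open>For fixed \<open>t\<close> the integral over \<eta> is Fourier inversion in
  \<open>x\<close>; what remains is the integral over \<open>t\<close> that defines the Wigner
  distribution.\<close>

lemma fourier_ambiguity: "fourier (ambiguity \<tau> f1 f2) = tau_wigner \<tau> f1 f2"
proof (rule ext)
  fix w :: "'a \<times> 'a"
  obtain x \<xi> where w: "w = (x, \<xi>)" by (cases w)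
  define k where "k t x = f1 (x + \<tau> *\<^sub>R t) * cnj (f2 (x - (1 - \<tau>) *\<^sub>R t))" for t x
  have fk: "fourier (k t) \<eta> = ambiguity \<tau> f1 f2 (- \<eta>, t)" for t \<eta>
    by (simp add: fourier_def ambiguity_def k_def)
  obtain B1 where B1: "0 < B1" "\<And>x. norm (f1 x) \<le> B1" using schwartz_bounded[OF f1] by blast
  obtain B2 where B2: "0 < B2" "\<And>x. norm (f2 x) \<le> B2" using schwartz_bounded[OF f2] by blast
  have inv: "(LINT \<eta>|lborel. ambiguity \<tau> f1 f2 (\<eta>, t) * exp (- (2 * pi * \<i> * (\<eta> \<bullet> x)))) = k t x" for t
  proof -
    have [measurable]: "(\<lambda>\<eta>. ambiguity \<tau> f1 f2 (\<eta>, t)) \<in> borel_measurable borel"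
      using ambiguity_integrable(2)[of t] by auto
    have "(LINT \<eta>|lborel. fourier (k t) \<eta> * exp (2 * pi * \<i> * (x \<bullet> \<eta>))) = k t x"
    proof (rule fourier_inversion)
      show "continuous_on UNIV (k t)" unfolding k_def
        by (intro continuous_intros continuous_on_compose2[OF schwartz_continuous[OF f1]] continuous_on_compose2[OF schwartz_continuous[OF f2]]) auto
      show "norm (k t y) \<le> B1 * B2" for y
        unfolding k_def using B1 B2 by (auto simp: norm_mult intro!: mult_mono less_imp_le[OF B1(1)])
      show "integrable lborel (k t)" unfolding k_def by (rule integrable_wigner_slice)
      show "integrable lborel (fourier (k t))" unfolding fk
        using lborel_integrable_translate(2)[OF ambiguity_integrable(2)[of t], of 0] by simp
    qed
    also have "(LINT \<eta>|lborel. fourier (k t) \<eta> * exp (2 * pi * \<i> * (x \<bullet> \<eta>)))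
      = (LINT \<eta>|lborel. ambiguity \<tau> f1 f2 (0 - \<eta>, t) * exp (- (2 * pi * \<i> * ((0 - \<eta>) \<bullet> x))))"
      unfolding fk by (simp add: inner_commute)
    also have "\<dots> = (LINT \<eta>|lborel. ambiguity \<tau> f1 f2 (\<eta>, t) * exp (- (2 * pi * \<i> * (\<eta> \<bullet> x))))"
      by (rule lborel_integral_translate(4)) measurable
    finally show ?thesis .
  qed
  have [measurable]: "ambiguity \<tau> f1 f2 \<in> borel_measurable borel" using ambiguity_integrable(1) by auto
  have i: "integrable lborel (\<lambda>z. ambiguity \<tau> f1 f2 z * exp (- (2 * pi * \<i> * (z \<bullet> (x, \<xi>)))))"
    by (rule Bochner_Integration.integrable_bound[OF ambiguity_integrable(1)]) (auto simp: norm_mult)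
  have "fourier (ambiguity \<tau> f1 f2) w = (LINT t|lborel. LINT \<eta>|lborel. ambiguity \<tau> f1 f2 (\<eta>, t) * exp (- (2 * pi * \<i> * ((\<eta>, t) \<bullet> (x, \<xi>)))))"
    unfolding fourier_def w by (rule lborel_Fubini(2)[OF i])
  also have "\<dots> = (LINT t|lborel. (LINT \<eta>|lborel. ambiguity \<tau> f1 f2 (\<eta>, t) * exp (- (2 * pi * \<i> * (\<eta> \<bullet> x)))) * exp (- (2 * pi * \<i> * (\<xi> \<bullet> t))))"
    unfolding integral_mult_left_zero[symmetric]
    by (intro Bochner_Integration.integral_cong refl)
      (simp add: inner_commute distrib_left exp_add[symmetric] mult.assoc)
  also have "\<dots> = tau_wigner \<tau> f1 f2 w"
    unfolding inv by (simp add: k_def tau_wigner_def w)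
  finally show "fourier (ambiguity \<tau> f1 f2) w = tau_wigner \<tau> f1 f2 w" .
qed

text \<open>Parseval against every time-frequency shift of \<Phi> shows that the inverse Fourier
  transform of the Wigner distribution and the ambiguity function have the same short-time Fourier
  transform.\<close>

lemma wiener_amalgam_qnorm_tau_wigner:
  assumes \<Phi>: "\<Phi> \<in> schwartz"
  shows "wiener_amalgam_qnorm \<Phi> p q s (distr_of (tau_wigner \<tau> f1 f2))
    = modulation_qnorm \<Phi> p q (\<lambda>(z, \<zeta>). power_weight s \<zeta>) (distr_of (ambiguity \<tau> f1 f2))"
proof -
  have "stft \<Phi> (inverse_fourier_distr (distr_of (tau_wigner \<tau> f1 f2))) z \<zeta> = stft \<Phi> (distr_of (ambiguity \<tau> f1 f2)) z \<zeta>" for z \<zeta>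
  proof -
    obtain B where g: "continuous_on UNIV (modulation \<zeta> (translation z \<Phi>))" "integrable lborel (modulation \<zeta> (translation z \<Phi>))"
      "\<And>t. norm (modulation \<zeta> (translation z \<Phi>) t) \<le> B" "integrable lborel (fourier (modulation \<zeta> (translation z \<Phi>)))"
      using time_frequency_shift_properties[OF \<Phi> refl] by blast
    show ?thesis
      using fourier_parseval[OF ambiguity_integrable(1) g]
      by (simp add: stft_def inverse_fourier_distr_def distr_of_def fourier_ambiguity)
  qed
  then show ?thesis by (simp add: wiener_amalgam_qnorm_def modulation_qnorm_def)
qed

text \<open>For the windows below the two Gaussians in the ambiguity plane decouple in the variables
  \<open>a = x + \<tau> y\<close> and \<open>b = x - (1 - \<tau>) y\<close>, since
  \<open>|x|\<^sup>2 + \<tau> (1 - \<tau>) |y|\<^sup>2 = (1 - \<tau>) |a|\<^sup>2 + \<tau> |b|\<^sup>2\<close>.\<close>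

lemma vstft_ambiguity:
  assumes \<tau>: "0 < \<tau>" "\<tau> < 1"
  shows "norm (vstft (\<lambda>(\<eta>, y). complex_of_real (gaussian 1 \<eta> * gaussian (\<tau> * (1 - \<tau>)) y)) (ambiguity \<tau> f1 f2) (z, \<zeta>)) =
    norm (vstft (\<lambda>t. complex_of_real (gaussian (1 - \<tau>) t)) f1 (fst \<zeta> + \<tau> *\<^sub>R snd z, snd \<zeta> - (1 - \<tau>) *\<^sub>R fst z)) *
    norm (vstft (\<lambda>t. complex_of_real (gaussian \<tau> t)) f2 (fst \<zeta> - (1 - \<tau>) *\<^sub>R snd z, snd \<zeta> + \<tau> *\<^sub>R fst z))"
proof -
  obtain z1 z2 \<zeta>1 \<zeta>2 where z: "z = (z1, z2)" "\<zeta> = (\<zeta>1, \<zeta>2)" by (cases z; cases \<zeta>) auto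
  let ?c = "\<tau> * (1 - \<tau>)"
  define e where "e r = exp (- (2 * pi * \<i> * complex_of_real r))" for r
  have e: "e r * e r' = e (r + r')" "norm (e r) = 1" "cnj (e r) = e (- r)" for r r'
    by (simp_all add: e_def exp_add[symmetric] exp_cnj algebra_simps)
  have [measurable]: "e \<in> borel_measurable borel" unfolding e_def by measurable
  let ?u = "ambiguity \<tau> f1 f2"
  let ?g = "\<lambda>a t. complex_of_real (gaussian a t)"
  have [measurable]: "?u \<in> borel_measurable borel" using ambiguity_integrable(1) by auto
  have g1: "\<bar>gaussian a t\<bar> \<le> 1" if "0 < a" for a and t :: 'a
    using that by (simp add: gaussian_def)
  have c0: "0 < ?c" using \<tau> by simp
  have gc: "\<bar>gaussian 1 x * gaussian ?c y\<bar> \<le> 1" for x y :: 'a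
    using g1[of 1 x] g1[OF c0, of y] by (simp add: abs_mult mult_le_one)
  have iu: "integrable lborel (\<lambda>w. ?u w * ?g 1 (fst w - z1) * ?g ?c (snd w - z2) * e (w \<bullet> (\<zeta>1, \<zeta>2)))"
  proof (rule Bochner_Integration.integrable_bound[OF ambiguity_integrable(1)])
    show "AE w in lborel. norm (?u w * ?g 1 (fst w - z1) * ?g ?c (snd w - z2) * e (w \<bullet> (\<zeta>1, \<zeta>2))) \<le> norm (?u w)"
    proof (rule AE_I2)
      fix w
      have "norm (?u w) * \<bar>gaussian 1 (fst w - z1) * gaussian ?c (snd w - z2)\<bar> \<le> norm (?u w) * 1"
        by (intro mult_left_mono gc) simp
      then show "norm (?u w * ?g 1 (fst w - z1) * ?g ?c (snd w - z2) * e (w \<bullet> (\<zeta>1, \<zeta>2))) \<le> norm (?u w)"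
        by (simp add: norm_mult e abs_mult mult.assoc)
    qed
  qed measurable
  \<comment> \<open>All that remains beside \<open>f1\<close> and \<open>f2\<close> once \<eta> is
    integrated out: two Gaussians and two phases, of modulus at most 1 together.\<close>
  define E where "E x y = ?g 1 (x - \<zeta>1) * ?g ?c (y - z2) * e (z1 \<bullet> (\<zeta>1 - x)) * e (y \<bullet> \<zeta>2)" for x y
  have E1: "norm (E x y) \<le> 1" for x y
    using gc[of "x - \<zeta>1" "y - z2"] by (simp add: E_def norm_mult e abs_mult)
  have [measurable]: "(\<lambda>(x, y). E x y) \<in> borel_measurable (borel \<Otimes>\<^sub>M borel)" unfolding E_def by measurable
  \<comment> \<open>\<open>gaussian 1\<close> is its own Fourier transform, so integrating out
    \<eta> turns the Gaussian centred at \<open>z1\<close> into one in \<open>x\<close> centred at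
    \<zeta>1, with a phase from \<open>z1\<close>.\<close>
  have inner: "(LINT \<eta>|lborel. ?u (\<eta>, y) * ?g 1 (\<eta> - z1) * e (\<eta> \<bullet> \<zeta>1))
    = (LINT x|lborel. f1 (x + \<tau> *\<^sub>R y) * cnj (f2 (x - (1 - \<tau>) *\<^sub>R y)) * (?g 1 (x - \<zeta>1) * e (z1 \<bullet> (\<zeta>1 - x))))" for y
  proof -
    define h where "h x = f1 (x + \<tau> *\<^sub>R y) * cnj (f2 (x - (1 - \<tau>) *\<^sub>R y))" for x
    have ih: "integrable lborel h" unfolding h_def by (rule integrable_wigner_slice)
    then have [measurable]: "h \<in> borel_measurable borel" by auto
    have ig: "integrable lborel (\<lambda>\<eta>. ?g 1 (\<eta> - z1))"
      using lborel_integrable_translate(1)[of "?g 1" z1] gaussian_integrable(1)[of 1, where 'a='a] by simp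
    have i: "integrable lborel (\<lambda>w. h (fst w) * ?g 1 (snd w - z1) * e (snd w \<bullet> (\<zeta>1 - fst w)))"
      by (rule Bochner_Integration.integrable_bound[OF integrable_pair_mult[OF ih ig]]) (auto simp: norm_mult e)
    have "(LINT \<eta>|lborel. ?u (\<eta>, y) * ?g 1 (\<eta> - z1) * e (\<eta> \<bullet> \<zeta>1))
      = (LINT \<eta>|lborel. LINT x|lborel. h x * ?g 1 (\<eta> - z1) * e (\<eta> \<bullet> (\<zeta>1 - x)))"
    proof (intro Bochner_Integration.integral_cong refl)
      fix \<eta>
      have "?u (\<eta>, y) * ?g 1 (\<eta> - z1) * e (\<eta> \<bullet> \<zeta>1) = (LINT x|lborel. h x * e (- (x \<bullet> \<eta>))) * (?g 1 (\<eta> - z1) * e (\<eta> \<bullet> \<zeta>1))"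
        by (simp add: ambiguity_def h_def e_def mult.assoc)
      also have "\<dots> = (LINT x|lborel. h x * ?g 1 (\<eta> - z1) * e (\<eta> \<bullet> (\<zeta>1 - x)))"
        unfolding integral_mult_left_zero[symmetric]
      proof (rule Bochner_Integration.integral_cong[OF refl])
        fix x
        have ee: "e (\<eta> \<bullet> (\<zeta>1 - x)) = e (- (x \<bullet> \<eta>)) * e (\<eta> \<bullet> \<zeta>1)"
          by (simp add: e(1) inner_diff_right inner_commute)
        show "h x * e (- (x \<bullet> \<eta>)) * (?g 1 (\<eta> - z1) * e (\<eta> \<bullet> \<zeta>1)) = h x * ?g 1 (\<eta> - z1) * e (\<eta> \<bullet> (\<zeta>1 - x))"
          unfolding ee by (simp only: mult_ac)
      qed
      finally show "?u (\<eta>, y) * ?g 1 (\<eta> - z1) * e (\<eta> \<bullet> \<zeta>1) = (LINT x|lborel. h x * ?g 1 (\<eta> - z1) * e (\<eta> \<bullet> (\<zeta>1 - x)))" .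
    qed
    also have "\<dots> = (LINT x|lborel. LINT \<eta>|lborel. h x * ?g 1 (\<eta> - z1) * e (\<eta> \<bullet> (\<zeta>1 - x)))"
      using lborel_Fubini(3)[OF i] by simp
    also have "\<dots> = (LINT x|lborel. h x * (?g 1 (x - \<zeta>1) * e (z1 \<bullet> (\<zeta>1 - x))))"
    proof (intro Bochner_Integration.integral_cong refl)
      fix x
      have "(LINT \<eta>|lborel. ?g 1 (\<eta> - z1) * e (\<eta> \<bullet> (\<zeta>1 - x)))
        = (LINT \<eta>|lborel. ?g 1 ((\<eta> + z1) - z1) * e ((\<eta> + z1) \<bullet> (\<zeta>1 - x)))"
        by (rule lborel_integral_translate(2)[symmetric]) measurable
      also have "\<dots> = (LINT \<eta>|lborel. (?g 1 \<eta> * e (\<eta> \<bullet> (\<zeta>1 - x))) * e (z1 \<bullet> (\<zeta>1 - x)))"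
        by (simp add: inner_add_left e(1)[symmetric] mult_ac)
      also have "\<dots> = (LINT \<eta>|lborel. ?g 1 \<eta> * e (\<eta> \<bullet> (\<zeta>1 - x))) * e (z1 \<bullet> (\<zeta>1 - x))"
        by (rule integral_mult_left_zero)
      also have "(LINT \<eta>|lborel. ?g 1 \<eta> * e (\<eta> \<bullet> (\<zeta>1 - x))) = ?g 1 (x - \<zeta>1)"
        using gaussian_fourier(2)[of 1 "\<zeta>1 - x"] by (simp add: e_def gaussian_def norm_minus_commute)
      finally show "(LINT \<eta>|lborel. h x * ?g 1 (\<eta> - z1) * e (\<eta> \<bullet> (\<zeta>1 - x))) = h x * (?g 1 (x - \<zeta>1) * e (z1 \<bullet> (\<zeta>1 - x)))"
        by (simp add: mult.assoc)
    qed
    finally show ?thesis by (simp add: h_def)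
  qed
  have ic: "integrable lborel (\<lambda>w. f1 (fst w) * cnj (f2 (fst w - snd w)) * E (fst w - \<tau> *\<^sub>R snd w) (snd w))"
  proof -
    have i2: "integrable lborel f2" by (rule schwartz_integrable[OF f2])
    have "integrable (lborel \<Otimes>\<^sub>M lborel) (\<lambda>w. f1 (fst w) * f2 (fst w - snd w))"
    proof (rule lborel_pair.Fubini_integrable)
      show "AE x in lborel. integrable lborel (\<lambda>y. f1 (fst (x, y)) * f2 (fst (x, y) - snd (x, y)))"
        using lborel_integrable_translate(2)[OF i2] by auto
      have "(LINT y|lborel. norm (f1 (fst (x, y)) * f2 (fst (x, y) - snd (x, y)))) = norm (f1 x) * (LINT y|lborel. norm (f2 y))" for x
      proof -
        have "(LINT y|lborel. norm (f2 (x - y))) = (LINT y|lborel. norm (f2 y))"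
          by (rule lborel_integral_translate(4)) measurable
        then show ?thesis by (simp add: norm_mult)
      qed
      then show "integrable lborel (\<lambda>x. LINT y|lborel. norm (f1 (fst (x, y)) * f2 (fst (x, y) - snd (x, y))))"
        using schwartz_integrable[OF f1] by simp
    qed measurable
    then have "integrable lborel (\<lambda>w. f1 (fst w) * f2 (fst w - snd w))" by (simp add: lborel_prod)
    then show ?thesis
    proof (rule Bochner_Integration.integrable_bound)
      show "AE w in lborel. norm (f1 (fst w) * cnj (f2 (fst w - snd w)) * E (fst w - \<tau> *\<^sub>R snd w) (snd w)) \<le> norm (f1 (fst w) * f2 (fst w - snd w))"
        using E1 by (intro AE_I2) (simp add: norm_mult mult_left_le)
    qed (unfold E_def, measurable)
  qed
  have split: "E ((1 - \<tau>) *\<^sub>R a + \<tau> *\<^sub>R b) (a - b) = e (z1 \<bullet> \<zeta>1) * ((?g (1 - \<tau>) (a - (\<zeta>1 + \<tau> *\<^sub>R z2)) * e (a \<bullet> (\<zeta>2 - (1 - \<tau>) *\<^sub>R z1)))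
     * cnj (?g \<tau> (b - (\<zeta>1 - (1 - \<tau>) *\<^sub>R z2)) * e (b \<bullet> (\<zeta>2 + \<tau> *\<^sub>R z1))))" for a b
  proof -
    have sq: "(norm ((1 - \<tau>) *\<^sub>R a + \<tau> *\<^sub>R b - \<zeta>1))\<^sup>2 + ?c * (norm (a - b - z2))\<^sup>2
      = (1 - \<tau>) * (norm (a - (\<zeta>1 + \<tau> *\<^sub>R z2)))\<^sup>2 + \<tau> * (norm (b - (\<zeta>1 - (1 - \<tau>) *\<^sub>R z2)))\<^sup>2"
    proof -
      define A B where "A = a - (\<zeta>1 + \<tau> *\<^sub>R z2)" and "B = b - (\<zeta>1 - (1 - \<tau>) *\<^sub>R z2)"
      have AB: "(1 - \<tau>) *\<^sub>R a + \<tau> *\<^sub>R b - \<zeta>1 = (1 - \<tau>) *\<^sub>R A + \<tau> *\<^sub>R B" "a - b - z2 = A - B"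
        by (simp_all add: A_def B_def algebra_simps)
      show ?thesis unfolding AB A_def[symmetric] B_def[symmetric] power2_norm_eq_inner
        by (simp add: inner_add_left inner_add_right inner_diff_left inner_diff_right inner_commute algebra_simps power2_eq_square)
    qed
    have "gaussian 1 ((1 - \<tau>) *\<^sub>R a + \<tau> *\<^sub>R b - \<zeta>1) * gaussian ?c (a - b - z2)
      = gaussian (1 - \<tau>) (a - (\<zeta>1 + \<tau> *\<^sub>R z2)) * gaussian \<tau> (b - (\<zeta>1 - (1 - \<tau>) *\<^sub>R z2))"
      unfolding gaussian_def exp_add[symmetric] using arg_cong[OF sq, of "\<lambda>r. - (pi * r)"]
      by (intro arg_cong[where f=exp]) (simp add: distrib_left mult.assoc)
    then have g: "?g 1 ((1 - \<tau>) *\<^sub>R a + \<tau> *\<^sub>R b - \<zeta>1) * ?g ?c (a - b - z2)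
      = ?g (1 - \<tau>) (a - (\<zeta>1 + \<tau> *\<^sub>R z2)) * ?g \<tau> (b - (\<zeta>1 - (1 - \<tau>) *\<^sub>R z2))"
      by (simp only: of_real_mult[symmetric])
    have ee: "e (z1 \<bullet> (\<zeta>1 - ((1 - \<tau>) *\<^sub>R a + \<tau> *\<^sub>R b))) * e ((a - b) \<bullet> \<zeta>2)
      = e (z1 \<bullet> \<zeta>1) * (e (a \<bullet> (\<zeta>2 - (1 - \<tau>) *\<^sub>R z1)) * e (- (b \<bullet> (\<zeta>2 + \<tau> *\<^sub>R z1))))"
      unfolding e(1) by (rule arg_cong[where f=e])
        (simp add: inner_add_left inner_add_right inner_diff_left inner_diff_right inner_commute algebra_simps)
    have "E ((1 - \<tau>) *\<^sub>R a + \<tau> *\<^sub>R b) (a - b) = (?g 1 ((1 - \<tau>) *\<^sub>R a + \<tau> *\<^sub>R b - \<zeta>1) * ?g ?c (a - b - z2))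
      * (e (z1 \<bullet> (\<zeta>1 - ((1 - \<tau>) *\<^sub>R a + \<tau> *\<^sub>R b))) * e ((a - b) \<bullet> \<zeta>2))"
      unfolding E_def by (simp only: mult.assoc)
    also have "\<dots> = (?g (1 - \<tau>) (a - (\<zeta>1 + \<tau> *\<^sub>R z2)) * ?g \<tau> (b - (\<zeta>1 - (1 - \<tau>) *\<^sub>R z2)))
      * (e (z1 \<bullet> \<zeta>1) * (e (a \<bullet> (\<zeta>2 - (1 - \<tau>) *\<^sub>R z1)) * e (- (b \<bullet> (\<zeta>2 + \<tau> *\<^sub>R z1)))))"
      unfolding g ee ..
    finally show ?thesis unfolding complex_cnj_mult e(3) complex_cnj_complex_of_real
      by (simp only: mult_ac)
  qed
  have "vstft (\<lambda>(\<eta>, y). complex_of_real (gaussian 1 \<eta> * gaussian ?c y)) ?u (z, \<zeta>)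
    = (LINT w|lborel. ?u w * ?g 1 (fst w - z1) * ?g ?c (snd w - z2) * e (w \<bullet> (\<zeta>1, \<zeta>2)))"
    unfolding vstft_eq e_def z
    by (intro Bochner_Integration.integral_cong refl) (auto simp: case_prod_beta mult.assoc)
  also have "\<dots> = (LINT y|lborel. LINT \<eta>|lborel. ?u (\<eta>, y) * ?g 1 (\<eta> - z1) * ?g ?c (y - z2) * e ((\<eta>, y) \<bullet> (\<zeta>1, \<zeta>2)))"
    using lborel_Fubini(2)[OF iu] by simp
  also have "\<dots> = (LINT y|lborel. (LINT \<eta>|lborel. ?u (\<eta>, y) * ?g 1 (\<eta> - z1) * e (\<eta> \<bullet> \<zeta>1)) * (?g ?c (y - z2) * e (y \<bullet> \<zeta>2)))"
    unfolding integral_mult_left_zero[symmetric]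
    by (intro Bochner_Integration.integral_cong refl) (simp add: e(1)[symmetric] mult_ac)
  also have "\<dots> = (LINT y|lborel. LINT x|lborel. f1 (x + \<tau> *\<^sub>R y) * cnj (f2 (x - (1 - \<tau>) *\<^sub>R y)) * E x y)"
    unfolding inner integral_mult_left_zero[symmetric]
    by (intro Bochner_Integration.integral_cong refl) (simp add: E_def mult_ac)
  \<comment> \<open>First a = x + \<tau> y for fixed y, then, after Fubini, b = a - y for fixed a.
    In these variables x = (1 - \<tau>) a + \<tau> b and y = a - b, which is the form in which
    \<open>E\<close> splits.\<close>
  also have "\<dots> = (LINT y|lborel. LINT a|lborel. f1 a * cnj (f2 (a - y)) * E (a - \<tau> *\<^sub>R y) y)"
  proof (rule Bochner_Integration.integral_cong[OF refl])
    fix y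
    have "(LINT x|lborel. f1 (x + \<tau> *\<^sub>R y) * cnj (f2 (x - (1 - \<tau>) *\<^sub>R y)) * E x y)
      = (LINT x|lborel. f1 (x + \<tau> *\<^sub>R y) * cnj (f2 ((x + \<tau> *\<^sub>R y) - y)) * E ((x + \<tau> *\<^sub>R y) - \<tau> *\<^sub>R y) y)"
      by (simp add: algebra_simps)
    also have "\<dots> = (LINT a|lborel. f1 a * cnj (f2 (a - y)) * E (a - \<tau> *\<^sub>R y) y)"
      by (rule lborel_integral_translate(2)) measurable
    finally show "(LINT x|lborel. f1 (x + \<tau> *\<^sub>R y) * cnj (f2 (x - (1 - \<tau>) *\<^sub>R y)) * E x y)
      = (LINT a|lborel. f1 a * cnj (f2 (a - y)) * E (a - \<tau> *\<^sub>R y) y)" .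
  qed
  also have "\<dots> = (LINT a|lborel. LINT y|lborel. f1 a * cnj (f2 (a - y)) * E (a - \<tau> *\<^sub>R y) y)"
    using lborel_Fubini(3)[OF ic] by simp
  also have "\<dots> = (LINT a|lborel. LINT b|lborel. f1 a * cnj (f2 b) * E ((1 - \<tau>) *\<^sub>R a + \<tau> *\<^sub>R b) (a - b))"
  proof (rule Bochner_Integration.integral_cong[OF refl])
    fix a
    have "(LINT y|lborel. f1 a * cnj (f2 (a - y)) * E (a - \<tau> *\<^sub>R y) y)
      = (LINT y|lborel. f1 a * cnj (f2 (a - y)) * E ((1 - \<tau>) *\<^sub>R a + \<tau> *\<^sub>R (a - y)) (a - (a - y)))"
      by (simp add: algebra_simps)
    also have "\<dots> = (LINT b|lborel. f1 a * cnj (f2 b) * E ((1 - \<tau>) *\<^sub>R a + \<tau> *\<^sub>R b) (a - b))"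
      by (rule lborel_integral_translate(4)) measurable
    finally show "(LINT y|lborel. f1 a * cnj (f2 (a - y)) * E (a - \<tau> *\<^sub>R y) y)
      = (LINT b|lborel. f1 a * cnj (f2 b) * E ((1 - \<tau>) *\<^sub>R a + \<tau> *\<^sub>R b) (a - b))" .
  qed
  also have "\<dots> = e (z1 \<bullet> \<zeta>1) * (vstft (?g (1 - \<tau>)) f1 (\<zeta>1 + \<tau> *\<^sub>R z2, \<zeta>2 - (1 - \<tau>) *\<^sub>R z1)
      * cnj (vstft (?g \<tau>) f2 (\<zeta>1 - (1 - \<tau>) *\<^sub>R z2, \<zeta>2 + \<tau> *\<^sub>R z1)))"
  proof -
    define A where "A a = f1 a * ?g (1 - \<tau>) (a - (\<zeta>1 + \<tau> *\<^sub>R z2)) * e (a \<bullet> (\<zeta>2 - (1 - \<tau>) *\<^sub>R z1))" for a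
    define B where "B b = f2 b * ?g \<tau> (b - (\<zeta>1 - (1 - \<tau>) *\<^sub>R z2)) * e (b \<bullet> (\<zeta>2 + \<tau> *\<^sub>R z1))" for b
    have "f1 a * cnj (f2 b) * E ((1 - \<tau>) *\<^sub>R a + \<tau> *\<^sub>R b) (a - b) = e (z1 \<bullet> \<zeta>1) * (A a * cnj (B b))" for a b
      unfolding split A_def B_def by (simp add: mult_ac)
    then have "(LINT a|lborel. LINT b|lborel. f1 a * cnj (f2 b) * E ((1 - \<tau>) *\<^sub>R a + \<tau> *\<^sub>R b) (a - b))
      = e (z1 \<bullet> \<zeta>1) * ((LINT a|lborel. A a) * cnj (LINT b|lborel. B b))"
      by simp
    then show ?thesis by (simp add: A_def B_def vstft_eq e_def)
  qed
  finally show ?thesis by (simp add: z norm_mult e)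
qed

end

section \<open>Sufficiency\<close>

lemma one_plus_norm_power2_neq_zero [simp]: "1 + (norm z)\<^sup>2 \<noteq> 0"
  using zero_le_power2[of "norm z"] by linarith

lemma power_weight_pos: "0 < power_weight s z"
  unfolding power_weight_def by simp

lemma power_weight_nonneg [simp]: "0 \<le> power_weight s z"
  using power_weight_pos[of s z] by simp

lemma power_weight_zero: "power_weight 0 = (\<lambda>_. 1)"
  by (rule ext) (simp add: power_weight_def)

lemma power_weight_measurable [measurable]: "power_weight s \<in> borel_measurable borel"
  unfolding power_weight_def[abs_def] by measurable

lemma power_weight_le_mult:
  assumes "1 + (norm x)\<^sup>2 \<le> K * ((1 + (norm y)\<^sup>2) * (1 + (norm z)\<^sup>2))" "0 \<le> K" "0 \<le> s"
  shows "power_weight s x \<le> K powr (s / 2) * (power_weight s y * power_weight s z)"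
proof -
  have "(1 + (norm x)\<^sup>2) powr (s / 2) \<le> (K * ((1 + (norm y)\<^sup>2) * (1 + (norm z)\<^sup>2))) powr (s / 2)"
    using assms by (intro powr_mono2) auto
  also have "\<dots> = K powr (s / 2) * ((1 + (norm y)\<^sup>2) powr (s / 2) * (1 + (norm z)\<^sup>2) powr (s / 2))"
    using assms(2) by (simp add: powr_mult)
  finally show ?thesis by (simp add: power_weight_def)
qed

lemma power_weight_minus: "power_weight (- s) z = inverse (power_weight s z)"
  by (simp add: power_weight_def powr_minus)

lemma power_weight_le_decay: "0 \<le> s \<Longrightarrow> power_weight s z \<le> decay (- s) z"
proof -
  assume s: "0 \<le> s"
  have "(1 + (norm z)\<^sup>2) powr (s / 2) \<le> ((1 + norm z)\<^sup>2) powr (s / 2)"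
    using s by (intro powr_mono2) (auto simp: power2_sum)
  also have "\<dots> = (1 + norm z) powr s" using powr_powr[of "1 + norm z" 2 "s / 2"] by simp
  finally show ?thesis by (simp add: power_weight_def decay_def)
qed

lemma norm_add_power2_le: "(norm (x + y))\<^sup>2 \<le> 2 * ((norm x)\<^sup>2 + (norm y)\<^sup>2)"
proof -
  have "(norm (x + y))\<^sup>2 \<le> (norm x + norm y)\<^sup>2" by (intro power_mono norm_triangle_ineq) auto
  also have "\<dots> \<le> 2 * ((norm x)\<^sup>2 + (norm y)\<^sup>2)"
    using zero_le_power2[of "norm x - norm y"] by (simp add: power2_eq_square algebra_simps)
  finally show ?thesis .
qed

text \<open>Peetre's inequality for nonnegative exponents. For negative \<open>s\<close> the
  inequality for \<open>-s\<close> is used with the two points exchanged and then inverted, so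
  \<bar>s\<bar> is the order in both cases.\<close>

lemma moderate_power_weight: "moderate (2 powr (\<bar>s\<bar> / 2)) \<bar>s\<bar> (power_weight s)"
proof -
  have le: "power_weight \<bar>s\<bar> (x + y) \<le> 2 powr (\<bar>s\<bar> / 2) * (power_weight \<bar>s\<bar> x * power_weight \<bar>s\<bar> y)" for x y :: 'a
  proof (rule power_weight_le_mult)
    have "0 \<le> (norm x)\<^sup>2 * (norm y)\<^sup>2" by simp
    then show "1 + (norm (x + y))\<^sup>2 \<le> 2 * ((1 + (norm x)\<^sup>2) * (1 + (norm y)\<^sup>2))"
    proof -
      assume nn: "0 \<le> (norm x)\<^sup>2 * (norm y)\<^sup>2"
      have "2 * ((1 + (norm x)\<^sup>2) * (1 + (norm y)\<^sup>2)) = 2 + 2 * ((norm x)\<^sup>2 + (norm y)\<^sup>2) + 2 * ((norm x)\<^sup>2 * (norm y)\<^sup>2)"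
        by (simp add: algebra_simps)
      then show ?thesis using norm_add_power2_le[of x y] nn by linarith
    qed
  qed auto
  have "power_weight s z \<le> 2 powr (\<bar>s\<bar> / 2) * decay (- \<bar>s\<bar>) (z - w) * power_weight s w" for z w :: 'a
  proof (cases "0 \<le> s")
    case True
    have "power_weight s z \<le> 2 powr (s / 2) * (power_weight s (z - w) * power_weight s w)"
      using le[of "z - w" w] True by simp
    also have "\<dots> \<le> 2 powr (s / 2) * (decay (- s) (z - w) * power_weight s w)"
      using power_weight_le_decay[OF True] by (intro mult_left_mono mult_right_mono) auto
    finally show ?thesis using True by (simp add: mult.assoc)
  next
    case False
    have "power_weight (- s) w \<le> 2 powr (- s / 2) * (power_weight (- s) (w - z) * power_weight (- s) z)"
      using le[of "w - z" z] False by simp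
    also have "\<dots> \<le> 2 powr (- s / 2) * (decay s (z - w) * power_weight (- s) z)"
      using power_weight_le_decay[of "- s" "w - z"] False
      by (intro mult_left_mono mult_right_mono) (auto simp: decay_def norm_minus_commute)
    finally have "inverse (power_weight s w) \<le> 2 powr (- s / 2) * (decay s (z - w) * inverse (power_weight s z))"
      by (simp add: power_weight_minus)
    then show ?thesis using False power_weight_pos[of s z] power_weight_pos[of s w]
      by (simp add: field_simps)
  qed
  then show ?thesis by (simp add: moderate_def)
qed

lemma moderate_snd:
  assumes "moderate A B m" shows "moderate A B (\<lambda>(z::'a::euclidean_space, \<zeta>::'b::euclidean_space). m \<zeta>)"
proof -
  have A: "0 < A" "0 \<le> B" "\<And>z. 0 \<le> m z" "\<And>z w. m z \<le> A * decay (- B) (z - w) * m w"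
    and [measurable]: "m \<in> borel_measurable borel"
    using assms unfolding moderate_def by blast+
  have "m \<zeta> \<le> A * decay (- B) ((z, \<zeta>) - (w, \<eta>)) * m \<eta>" for z w :: 'a and \<zeta> \<eta>
  proof -
    have "norm (\<zeta> - \<eta>) \<le> norm ((z, \<zeta>) - (w, \<eta>))" by (simp add: norm_Pair real_le_rsqrt)
    then have "decay (- B) (\<zeta> - \<eta>) \<le> decay (- B) ((z, \<zeta>) - (w, \<eta>))"
      unfolding decay_def using A(2) by (intro powr_mono2) auto
    then have "A * decay (- B) (\<zeta> - \<eta>) * m \<eta> \<le> A * decay (- B) ((z, \<zeta>) - (w, \<eta>)) * m \<eta>"
      using A by (intro mult_right_mono mult_left_mono) auto
    with A(4)[of \<zeta> \<eta>] show ?thesis by (rule order_trans)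
  qed
  then show ?thesis using A by (auto simp: moderate_def case_prod_beta')
qed

lemma moderate_one: "moderate 1 0 (\<lambda>_. 1)"
  by (simp add: moderate_def decay_def)

text \<open>Write a and b for the two shifted arguments. For \<open>s \<ge> 0\<close> each half of
  \<zeta> is a convex combination of the corresponding halves of a and b. For negative
  \<open>s\<close> the claim, once inverted, bounds the weight at b by those at a and \<zeta>, and b
  is recovered from these because neither \<tau> nor 1 - \<tau> is zero. This asymmetry explains
  \<bar>s\<bar> on the first factor.\<close>

lemma power_weight_skew:
  fixes \<tau> :: real
  assumes \<tau>: "0 < \<tau>" "\<tau> < 1"
  obtains W where "0 < W" "\<And>(z::'a::euclidean_space \<times> 'a) \<zeta>. power_weight s \<zeta> \<le> W *
    (power_weight \<bar>s\<bar> (fst \<zeta> + \<tau> *\<^sub>R snd z, snd \<zeta> - (1 - \<tau>) *\<^sub>R fst z) *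
     power_weight s (fst \<zeta> - (1 - \<tau>) *\<^sub>R snd z, snd \<zeta> + \<tau> *\<^sub>R fst z))"
proof -
  define \<mu> where "\<mu> = min \<tau> (1 - \<tau>)"
  have \<mu>: "0 < \<mu>" "\<mu> \<le> 1" using \<tau> by (auto simp: \<mu>_def)
  \<comment> \<open>One constant for both signs: 2 suffices for the convex combination, while
    recovering b divides by \<tau> or 1 - \<tau>, hence by at least \<mu>.\<close>
  define W where "W = (2 / \<mu>\<^sup>2) powr (\<bar>s\<bar> / 2)"
  have K2: "2 \<le> 2 / \<mu>\<^sup>2" using \<mu> by (simp add: field_simps power_le_one)
  have prod: "1 + 2 / \<mu>\<^sup>2 * (X + Y) \<le> 2 / \<mu>\<^sup>2 * ((1 + X) * (1 + Y))" if "0 \<le> X" "0 \<le> Y" for X Y :: real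
  proof -
    have "1 \<le> 2 / \<mu>\<^sup>2 * (1 + X * Y)"
      using mult_mono[OF K2, of 1 "1 + X * Y"] that by simp
    moreover have "k * ((1 + X) * (1 + Y)) = k * (1 + X * Y) + k * (X + Y)" for k :: real
      by (simp add: algebra_simps)
    ultimately show ?thesis by simp
  qed
  show thesis
  proof
    show "0 < W" using \<mu> by (simp add: W_def)
    fix z \<zeta> :: "'a \<times> 'a"
    obtain z1 z2 \<zeta>1 \<zeta>2 where z: "z = (z1, z2)" "\<zeta> = (\<zeta>1, \<zeta>2)" by (cases z; cases \<zeta>) auto
    define a1 a2 b1 b2 where ab: "a1 = \<zeta>1 + \<tau> *\<^sub>R z2" "a2 = \<zeta>2 - (1 - \<tau>) *\<^sub>R z1" "b1 = \<zeta>1 - (1 - \<tau>) *\<^sub>R z2" "b2 = \<zeta>2 + \<tau> *\<^sub>R z1"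
    have rel: "\<zeta>1 = (1 - \<tau>) *\<^sub>R a1 + \<tau> *\<^sub>R b1" "\<zeta>2 = \<tau> *\<^sub>R a2 + (1 - \<tau>) *\<^sub>R b2"
      by (simp_all add: ab algebra_simps)
    have sc: "(norm (r *\<^sub>R v))\<^sup>2 \<le> (norm v)\<^sup>2" if "\<bar>r\<bar> \<le> 1" for r and v :: 'a
      using that by (auto intro!: power_mono mult_left_le_one_le)
    have lin: "P + Q \<le> 2 * ((a + c) + (b + d))" if "P \<le> 2 * (a' + b')" "a' \<le> a" "b' \<le> b" "Q \<le> 2 * (c' + d')" "c' \<le> c" "d' \<le> d"
      for P Q a a' b b' c c' d d' :: real
    proof -
      have "P \<le> 2 * (a + b)" "Q \<le> 2 * (c + d)" using that by (simp_all add: order_trans[of P] order_trans[of Q])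
      then show ?thesis by (simp add: algebra_simps)
    qed
    have n2: "(norm (v, w))\<^sup>2 = (norm v)\<^sup>2 + (norm w)\<^sup>2" for v w :: 'a by (simp add: norm_Pair)
    have "power_weight s (\<zeta>1, \<zeta>2) \<le> W * (power_weight \<bar>s\<bar> (a1, a2) * power_weight s (b1, b2))"
    proof (cases "0 \<le> s")
      case True
      have "(norm (\<zeta>1, \<zeta>2))\<^sup>2 \<le> 2 * ((norm (a1, a2))\<^sup>2 + (norm (b1, b2))\<^sup>2)"
      proof -
        have "(norm ((1 - \<tau>) *\<^sub>R a1))\<^sup>2 \<le> (norm a1)\<^sup>2" "(norm (\<tau> *\<^sub>R b1))\<^sup>2 \<le> (norm b1)\<^sup>2"
          "(norm (\<tau> *\<^sub>R a2))\<^sup>2 \<le> (norm a2)\<^sup>2" "(norm ((1 - \<tau>) *\<^sub>R b2))\<^sup>2 \<le> (norm b2)\<^sup>2"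
          using \<tau> by (intro sc; simp)+
        from lin[OF norm_add_power2_le this(1,2) norm_add_power2_le this(3,4)] show ?thesis
          unfolding n2 rel .
      qed
      also have "\<dots> \<le> 2 / \<mu>\<^sup>2 * ((norm (a1, a2))\<^sup>2 + (norm (b1, b2))\<^sup>2)"
        using K2 by (intro mult_right_mono) auto
      finally have "1 + (norm (\<zeta>1, \<zeta>2))\<^sup>2 \<le> 2 / \<mu>\<^sup>2 * ((1 + (norm (a1, a2))\<^sup>2) * (1 + (norm (b1, b2))\<^sup>2))"
        using prod[of "(norm (a1, a2))\<^sup>2" "(norm (b1, b2))\<^sup>2"] by simp
      from power_weight_le_mult[OF this _ True] show ?thesis using True by (simp add: W_def)
    next
      case False
      \<comment> \<open>Multiplication by \<mu> brings all four coefficients to absolute value at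
        most 1, so that norms can be compared without further constants.\<close>
      have b: "\<mu> *\<^sub>R b1 = (\<mu> / \<tau>) *\<^sub>R \<zeta>1 + (- (\<mu> * (1 - \<tau>) / \<tau>)) *\<^sub>R a1" "\<mu> *\<^sub>R b2 = (\<mu> / (1 - \<tau>)) *\<^sub>R \<zeta>2 + (- (\<mu> * \<tau> / (1 - \<tau>))) *\<^sub>R a2"
      proof -
        have "b1 = (1 / \<tau>) *\<^sub>R (\<zeta>1 - (1 - \<tau>) *\<^sub>R a1)" "b2 = (1 / (1 - \<tau>)) *\<^sub>R (\<zeta>2 - \<tau> *\<^sub>R a2)"
          using rel \<tau> by simp_all
        then show "\<mu> *\<^sub>R b1 = (\<mu> / \<tau>) *\<^sub>R \<zeta>1 + (- (\<mu> * (1 - \<tau>) / \<tau>)) *\<^sub>R a1" "\<mu> *\<^sub>R b2 = (\<mu> / (1 - \<tau>)) *\<^sub>R \<zeta>2 + (- (\<mu> * \<tau> / (1 - \<tau>))) *\<^sub>R a2"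
          by (simp_all add: scaleR_diff_right)
      qed
      have co: "\<mu> / \<tau> \<le> 1" "\<mu> / (1 - \<tau>) \<le> 1" using \<tau> by (auto simp: \<mu>_def)
      have co': "\<mu> * (1 - \<tau>) / \<tau> \<le> 1" "\<mu> * \<tau> / (1 - \<tau>) \<le> 1"
        using mult_mono[OF co(1), of "1 - \<tau>" 1] mult_mono[OF co(2), of \<tau> 1] \<tau> \<mu> by auto
      have "\<mu>\<^sup>2 * (norm (b1, b2))\<^sup>2 = (norm (\<mu> *\<^sub>R b1))\<^sup>2 + (norm (\<mu> *\<^sub>R b2))\<^sup>2"
        by (simp add: n2 power_mult_distrib distrib_left)
      also have "\<dots> \<le> 2 * ((norm (a1, a2))\<^sup>2 + (norm (\<zeta>1, \<zeta>2))\<^sup>2)"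
      proof -
        have "(norm ((\<mu> / \<tau>) *\<^sub>R \<zeta>1))\<^sup>2 \<le> (norm \<zeta>1)\<^sup>2" "(norm ((\<mu> / (1 - \<tau>)) *\<^sub>R \<zeta>2))\<^sup>2 \<le> (norm \<zeta>2)\<^sup>2"
          using \<tau> \<mu> co by (intro sc; simp add: abs_of_nonneg)+
        note A = this
        have "(norm ((- (\<mu> * (1 - \<tau>) / \<tau>)) *\<^sub>R a1))\<^sup>2 \<le> (norm a1)\<^sup>2"
          "(norm ((- (\<mu> * \<tau> / (1 - \<tau>))) *\<^sub>R a2))\<^sup>2 \<le> (norm a2)\<^sup>2"
          using \<tau> \<mu> co' by (intro sc; simp only: abs_minus_cancel; subst abs_of_nonneg; simp)+
        from lin[OF norm_add_power2_le A(1) this(1) norm_add_power2_le A(2) this(2)] show ?thesis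
          unfolding b n2 by (simp only: add.commute)
      qed
      finally have "(norm (b1, b2))\<^sup>2 \<le> 2 / \<mu>\<^sup>2 * ((norm (a1, a2))\<^sup>2 + (norm (\<zeta>1, \<zeta>2))\<^sup>2)"
        using \<mu> by (simp add: field_simps)
      then have "1 + (norm (b1, b2))\<^sup>2 \<le> 2 / \<mu>\<^sup>2 * ((1 + (norm (a1, a2))\<^sup>2) * (1 + (norm (\<zeta>1, \<zeta>2))\<^sup>2))"
        using prod[of "(norm (a1, a2))\<^sup>2" "(norm (\<zeta>1, \<zeta>2))\<^sup>2"] by simp
      from power_weight_le_mult[OF this, of "- s"]
      have "inverse (power_weight s (b1, b2)) \<le> W * (power_weight (- s) (a1, a2) * inverse (power_weight s (\<zeta>1, \<zeta>2)))"
        using False by (simp add: W_def power_weight_minus)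
      then show ?thesis using False power_weight_pos[of s "(b1, b2)"] power_weight_pos[of s "(\<zeta>1, \<zeta>2)"]
        by (simp add: field_simps)
    qed
    then show "power_weight s \<zeta> \<le> W *
      (power_weight \<bar>s\<bar> (fst \<zeta> + \<tau> *\<^sub>R snd z, snd \<zeta> - (1 - \<tau>) *\<^sub>R fst z) *
       power_weight s (fst \<zeta> - (1 - \<tau>) *\<^sub>R snd z, snd \<zeta> + \<tau> *\<^sub>R fst z))"
      by (simp add: z ab)
  qed
qed

lemma locally_comparable_mono:
  "locally_comparable C G \<Longrightarrow> C \<le> C' \<Longrightarrow> locally_comparable C' G"
  unfolding locally_comparable_def by (meson ennreal_leI mult_right_mono order_trans zero_le)

definition ambiguity_window :: "real \<Rightarrow> 'a::euclidean_space \<times> 'a \<Rightarrow> complex" where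
  "ambiguity_window \<tau> = (\<lambda>(\<eta>, y). complex_of_real (gaussian 1 \<eta> * gaussian (\<tau> * (1 - \<tau>)) y))"

lemma gaussian_window:
  assumes "0 < a"
  shows "(\<lambda>t::'a::euclidean_space. complex_of_real (gaussian a t)) \<in> schwartz" "(\<lambda>t::'a. complex_of_real (gaussian a t)) \<noteq> (\<lambda>_. 0)"
  using gaussian_schwartz[OF assms] by (auto simp: gaussian_def fun_eq_iff)

lemma ambiguity_window:
  assumes "0 < \<tau>" "\<tau> < 1"
  shows "ambiguity_window \<tau> \<in> (schwartz :: ('a::euclidean_space \<times> 'a \<Rightarrow> complex) set)" "ambiguity_window \<tau> \<noteq> (\<lambda>_::'a \<times> 'a. 0)"
proof -
  show "ambiguity_window \<tau> \<in> (schwartz :: ('a \<times> 'a \<Rightarrow> complex) set)"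
    unfolding ambiguity_window_def using assms by (intro gaussian_pair_schwartz) simp
  have "ambiguity_window \<tau> (0::'a, 0::'a) \<noteq> 0" by (simp add: ambiguity_window_def gaussian_def)
  then show "ambiguity_window \<tau> \<noteq> (\<lambda>_::'a \<times> 'a. 0)" by metis
qed

text \<open>The target window is changed to the Gaussian one for which the transform factors. The
  weight is distributed over the two factors and hidden in the majorants \<open>G1\<close> and
  \<open>G2\<close>, to which the unweighted estimate for \<open>skew_product\<close>
  applies.\<close>

theorem tau_wigner_bounded_weighted:
  fixes \<phi> :: "'a::euclidean_space \<Rightarrow> complex" and \<Phi> :: "'a \<times> 'a \<Rightarrow> complex"
  assumes pos: "0 < p" "0 < q" "0 < p1" "0 < q1" "0 < p2" "0 < q2" and \<tau>: "0 < \<tau>" "\<tau> < 1"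
    and \<phi>: "\<phi> \<in> schwartz" "\<phi> \<noteq> (\<lambda>_. 0)" and \<Phi>: "\<Phi> \<in> schwartz" and adm: "admissible p q p1 q1 p2 q2"
  shows "tau_wigner_bounded \<phi> \<Phi> \<tau> p1 q1 (power_weight \<bar>s\<bar>) p2 q2 (power_weight s) p q s"
proof -
  let ?g = "\<lambda>a (t::'a). complex_of_real (gaussian a t)"
  let ?m = "\<lambda>(z::'a \<times> 'a, \<zeta>::'a \<times> 'a). power_weight s \<zeta>"
  let ?\<Phi>0 = "ambiguity_window \<tau> :: 'a \<times> 'a \<Rightarrow> complex"
  note mod0 = moderate_snd[OF moderate_power_weight, where 'a="'a \<times> 'a" and 'b="'a \<times> 'a"]
  obtain K0 where K0: "0 < K0" "\<And>u. integrable lborel u \<Longrightarrow>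
    modulation_qnorm \<Phi> p q ?m (distr_of u) \<le> ennreal K0 * modulation_qnorm ?\<Phi>0 p q ?m (distr_of u)"
    using modulation_qnorm_change_window[OF ambiguity_window[OF \<tau>] \<Phi> pos(1,2) mod0] by blast
  have w1: "?g (1 - \<tau>) \<in> schwartz" and w2: "?g \<tau> \<in> schwartz" using \<tau> by (auto intro: gaussian_schwartz)
  show ?thesis
  proof (rule window_majorant_exists[OF \<phi> w1 pos(3,4) moderate_power_weight[of "\<bar>s\<bar>"]])
    fix C1 K1 :: real and G1 :: "('a \<Rightarrow> complex) \<Rightarrow> 'a \<times> 'a \<Rightarrow> ennreal"
    assume C1: "0 < C1" "0 < K1" and G1: "\<And>u. integrable lborel u \<Longrightarrow> G1 u \<in> borel_measurable borel"
      "\<And>u. integrable lborel u \<Longrightarrow> locally_comparable C1 (G1 u)"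
      "\<And>u z. integrable lborel u \<Longrightarrow> ennreal (norm (vstft (?g (1 - \<tau>)) u z) * power_weight \<bar>s\<bar> z) \<le> G1 u z"
      "\<And>u. integrable lborel u \<Longrightarrow> mixed_qnorm p1 q1 (G1 u) \<le> ennreal K1 * modulation_qnorm \<phi> p1 q1 (power_weight \<bar>s\<bar>) (distr_of u)"
    show ?thesis
    proof (rule window_majorant_exists[OF \<phi> w2 pos(5,6) moderate_power_weight[of s]])
      fix C2 K2 :: real and G2 :: "('a \<Rightarrow> complex) \<Rightarrow> 'a \<times> 'a \<Rightarrow> ennreal"
      assume C2: "0 < C2" "0 < K2" and G2: "\<And>u. integrable lborel u \<Longrightarrow> G2 u \<in> borel_measurable borel"
        "\<And>u. integrable lborel u \<Longrightarrow> locally_comparable C2 (G2 u)"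
        "\<And>u z. integrable lborel u \<Longrightarrow> ennreal (norm (vstft (?g \<tau>) u z) * power_weight s z) \<le> G2 u z"
        "\<And>u. integrable lborel u \<Longrightarrow> mixed_qnorm p2 q2 (G2 u) \<le> ennreal K2 * modulation_qnorm \<phi> p2 q2 (power_weight s) (distr_of u)"
      define C where "C = max C1 C2"
      have C: "0 < C" using C1 by (simp add: C_def)
      obtain K where K: "0 < K" "\<And>G1 G2 :: 'a \<times> 'a \<Rightarrow> ennreal.
        G1 \<in> borel_measurable borel \<Longrightarrow> G2 \<in> borel_measurable borel \<Longrightarrow>
        locally_comparable C G1 \<Longrightarrow> locally_comparable C G2 \<Longrightarrow>
        Lp_qnorm q (\<lambda>\<zeta>. Lp_qnorm p (skew_product \<tau> G1 G2 \<zeta>))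
          \<le> ennreal K * mixed_qnorm p1 q1 G1 * mixed_qnorm p2 q2 G2"
        using skew_product_estimate[OF pos \<tau> C adm] by blast
      obtain W where W: "0 < W" "\<And>(z::'a \<times> 'a) \<zeta>. power_weight s \<zeta> \<le> W *
        (power_weight \<bar>s\<bar> (fst \<zeta> + \<tau> *\<^sub>R snd z, snd \<zeta> - (1 - \<tau>) *\<^sub>R fst z) *
         power_weight s (fst \<zeta> - (1 - \<tau>) *\<^sub>R snd z, snd \<zeta> + \<tau> *\<^sub>R fst z))"
        using power_weight_skew[OF \<tau>] by blast
      show ?thesis unfolding tau_wigner_bounded_def
      proof (intro exI conjI ballI)
        show "0 < K0 * (W * (K * (K1 * K2)))" using K0 W K C1 C2 by simp
        fix f1 f2 :: "'a \<Rightarrow> complex" assume f: "f1 \<in> schwartz" "f2 \<in> schwartz"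
        note i = schwartz_integrable[OF f(1)] schwartz_integrable[OF f(2)]
        have [measurable]: "G1 f1 \<in> borel_measurable borel" "G2 f2 \<in> borel_measurable borel"
          using G1(1)[OF i(1)] G2(1)[OF i(2)] by auto
        let ?u = "ambiguity \<tau> f1 f2"
        have iu: "integrable lborel ?u" by (rule ambiguity_integrable(1)[OF f])
        then have [measurable]: "?u \<in> borel_measurable borel" by auto
        have [measurable]: "?\<Phi>0 \<in> borel_measurable borel" by (rule schwartz_measurable[OF ambiguity_window(1)[OF \<tau>]])
        define V where "V w = ennreal (norm (vstft ?\<Phi>0 ?u w) * ?m w)" for w
        have Vm: "V \<in> borel_measurable borel"
          unfolding V_def case_prod_beta' by measurable
        have V: "V (z, \<zeta>) \<le> ennreal W * skew_product \<tau> (G1 f1) (G2 f2) \<zeta> z" for z \<zeta>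
        proof -
          define a b where "a = (fst \<zeta> + \<tau> *\<^sub>R snd z, snd \<zeta> - (1 - \<tau>) *\<^sub>R fst z)"
            and "b = (fst \<zeta> - (1 - \<tau>) *\<^sub>R snd z, snd \<zeta> + \<tau> *\<^sub>R fst z)"
          have "norm (vstft ?\<Phi>0 ?u (z, \<zeta>)) * power_weight s \<zeta> \<le>
            (norm (vstft (?g (1 - \<tau>)) f1 a) * norm (vstft (?g \<tau>) f2 b)) * (W * (power_weight \<bar>s\<bar> a * power_weight s b))"
            unfolding ambiguity_window_def vstft_ambiguity[OF f \<tau>] a_def b_def
            by (intro mult_left_mono W) simp
          also have "\<dots> = W * ((norm (vstft (?g (1 - \<tau>)) f1 a) * power_weight \<bar>s\<bar> a) * (norm (vstft (?g \<tau>) f2 b) * power_weight s b))"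
            by (simp add: mult_ac)
          finally have "V (z, \<zeta>) \<le> ennreal W * (ennreal (norm (vstft (?g (1 - \<tau>)) f1 a) * power_weight \<bar>s\<bar> a) * ennreal (norm (vstft (?g \<tau>) f2 b) * power_weight s b))"
            using W(1) by (simp add: V_def ennreal_mult'[symmetric] ennreal_mult''[symmetric] ennreal_leI)
          also have "\<dots> \<le> ennreal W * (G1 f1 a * G2 f2 b)"
            by (intro mult_left_mono mult_mono G1(3) G2(3) i) auto
          finally show ?thesis by (simp add: skew_product_def a_def b_def)
        qed
        have "wiener_amalgam_qnorm \<Phi> p q s (distr_of (tau_wigner \<tau> f1 f2)) = modulation_qnorm \<Phi> p q ?m (distr_of ?u)"
          by (rule wiener_amalgam_qnorm_tau_wigner[OF f \<Phi>])
        also have "\<dots> \<le> ennreal K0 * modulation_qnorm ?\<Phi>0 p q ?m (distr_of ?u)"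
          by (rule K0(2)[OF iu])
        also have "modulation_qnorm ?\<Phi>0 p q ?m (distr_of ?u) = mixed_qnorm p q V"
          by (simp add: modulation_qnorm_eq V_def[abs_def])
        also have "\<dots> \<le> Lp_qnorm q (\<lambda>\<zeta>. Lp_qnorm p (\<lambda>z. ennreal W * skew_product \<tau> (G1 f1) (G2 f2) \<zeta> z))"
          unfolding mixed_qnorm_def
          by (intro Lp_qnorm_mono pos Lp_qnorm_fst_measurable Vm V)
        also have "\<dots> \<le> Lp_qnorm q (\<lambda>\<zeta>. ennreal W * Lp_qnorm p (skew_product \<tau> (G1 f1) (G2 f2) \<zeta>))"
          by (intro Lp_qnorm_mono Lp_qnorm_cmult_le pos) measurable
        also have "\<dots> \<le> ennreal W * Lp_qnorm q (\<lambda>\<zeta>. Lp_qnorm p (skew_product \<tau> (G1 f1) (G2 f2) \<zeta>))"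
          by (intro Lp_qnorm_cmult_le pos) measurable
        also have "\<dots> \<le> ennreal W * (ennreal K * mixed_qnorm p1 q1 (G1 f1) * mixed_qnorm p2 q2 (G2 f2))"
          by (intro mult_left_mono K G1(1) G2(1) i locally_comparable_mono[OF G1(2)] locally_comparable_mono[OF G2(2)]) (auto simp: C_def)
        also have "\<dots> \<le> ennreal W * (ennreal K * (ennreal K1 * modulation_qnorm \<phi> p1 q1 (power_weight \<bar>s\<bar>) (distr_of f1))
            * (ennreal K2 * modulation_qnorm \<phi> p2 q2 (power_weight s) (distr_of f2)))"
          by (intro mult_left_mono mult_mono G1(4) G2(4) i) auto
        finally have "wiener_amalgam_qnorm \<Phi> p q s (distr_of (tau_wigner \<tau> f1 f2)) \<le> ennreal K0 * (ennreal W *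
            (ennreal K * (ennreal K1 * modulation_qnorm \<phi> p1 q1 (power_weight \<bar>s\<bar>) (distr_of f1))
            * (ennreal K2 * modulation_qnorm \<phi> p2 q2 (power_weight s) (distr_of f2))))"
          by (simp add: mult_left_mono)
        also have "\<dots> = ennreal (K0 * (W * (K * (K1 * K2)))) * modulation_qnorm \<phi> p1 q1 (power_weight \<bar>s\<bar>) (distr_of f1)
            * modulation_qnorm \<phi> p2 q2 (power_weight s) (distr_of f2)"
          using K0 W K C1 C2 by (simp add: ennreal_mult mult_ac)
        finally show "wiener_amalgam_qnorm \<Phi> p q s (distr_of (tau_wigner \<tau> f1 f2))
          \<le> ennreal (K0 * (W * (K * (K1 * K2)))) * modulation_qnorm \<phi> p1 q1 (power_weight \<bar>s\<bar>) (distr_of f1)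
            * modulation_qnorm \<phi> p2 q2 (power_weight s) (distr_of f2)" .
      qed
    qed
  qed
qed

section \<open>Necessity\<close>

text \<open>How the \<open>p\<close>-norm of \<open>gaussian a\<close> in dimension \<open>n\<close>
  depends on \<open>a\<close>. For \<open>p = top\<close> the exponent is 0, as it should be, since
  \<open>enn2real top = 0\<close> and division by zero gives zero.\<close>

definition gaussian_rate :: "nat \<Rightarrow> ennreal \<Rightarrow> real \<Rightarrow> real" where
  "gaussian_rate n p a = a powr (- (real n / 2) * (1 / enn2real p))"

lemma gaussian_rate_pos: "0 < a \<Longrightarrow> 0 < gaussian_rate n p a"
  by (simp add: gaussian_rate_def)

text \<open>The factor \<open>\<kappa>\<close> does not depend on \<open>a\<close>, which is all
  that a comparison of powers requires. For \<open>p = top\<close> its value is not computed: the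
  norm of \<open>gaussian 1\<close> is finite and nonzero, and rescaling does not change it.\<close>

lemma Lp_qnorm_gaussian:
  assumes "0 < p"
  obtains \<kappa> where "0 < \<kappa>" "\<And>a. 0 < a \<Longrightarrow> Lp_qnorm p (\<lambda>t::'a::euclidean_space. ennreal (gaussian a t)) = ennreal (\<kappa> * gaussian_rate DIM('a) p a)"
  using assms
proof (cases p rule: exponent_cases)
  case 1
  define N where "N = Lp_qnorm p (\<lambda>t::'a. ennreal (gaussian 1 t))"
  have "N \<le> 1" unfolding N_def 1 Lp_qnorm_top by (intro esssup_I) (auto simp: gaussian_def)
  moreover have "N \<noteq> 0"
  proof
    assume "N = 0"
    then have "AE t in lborel. ennreal (gaussian 1 (t::'a)) \<le> 0"
      using esssup_AE[of "\<lambda>t::'a. ennreal (gaussian 1 t)" lborel] by (simp add: N_def 1 Lp_qnorm_top)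
    then have "AE t::'a in lborel. False"
    proof (rule eventually_mono)
      fix x :: 'a assume "ennreal (gaussian 1 x) \<le> 0"
      then show False using gaussian_pos[of 1 x] by simp
    qed
    then have "emeasure lborel (space (lborel :: 'a measure)) = 0"
      unfolding ae_filter_eq_bot_iff[symmetric] by (simp add: trivial_limit_def)
    then show False by simp
  qed
  ultimately obtain \<kappa> where \<kappa>: "N = ennreal \<kappa>" "0 < \<kappa>"
    by (cases N) (auto simp: top_unique)
  show thesis
  proof (rule that[OF \<kappa>(2)])
    fix a :: real assume a: "0 < a"
    have "Lp_qnorm p (\<lambda>t::'a. ennreal (gaussian a t)) = Lp_qnorm p (\<lambda>t::'a. ennreal (gaussian 1 (0 + sqrt a *\<^sub>R t)))"
      using a by (simp add: gaussian_scale)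
    also have "\<dots> = N" using a assms
      by (subst Lp_qnorm_affine[where h="\<lambda>t. ennreal (gaussian 1 t)"]) (auto simp: 1 N_def)
    finally show "Lp_qnorm p (\<lambda>t::'a. ennreal (gaussian a t)) = ennreal (\<kappa> * gaussian_rate DIM('a) p a)"
      using a by (simp add: \<kappa> gaussian_rate_def 1)
  qed
next
  case (2 r)
  let ?n = "real DIM('a)"
  show thesis
  proof (rule that[of "r powr (- (?n / 2) * (1 / r))"])
    show "0 < r powr (- (?n / 2) * (1 / r))" using 2 by simp
    fix a :: real assume a: "0 < a"
    have "ennreal_powr (ennreal (gaussian a t)) r = ennreal (gaussian (a * r) t)" for t :: 'a
      by (simp add: ennreal_powr_ennreal less_imp_le[OF gaussian_pos]) (simp add: gaussian_def exp_powr_real mult_ac)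
    then have "(\<integral>\<^sup>+t. ennreal_powr (ennreal (gaussian a (t::'a))) r \<partial>lborel) = (\<integral>\<^sup>+t. ennreal (gaussian (a * r) (t::'a)) \<partial>lborel)"
      by simp
    also have "\<dots> = ennreal ((a * r) powr (- ?n / 2))"
      using gaussian_integrable[of "a * r", where 'a='a] a 2
      by (subst nn_integral_eq_integral) (auto simp: less_imp_le[OF gaussian_pos])
    finally show "Lp_qnorm p (\<lambda>t::'a. ennreal (gaussian a t)) = ennreal (r powr (- (?n / 2) * (1 / r)) * gaussian_rate DIM('a) p a)"
      using a 2 by (simp add: Lp_qnorm_ennreal ennreal_powr_ennreal powr_powr powr_mult gaussian_rate_def mult_ac)
  qed
qed

text \<open>The shifts \<open>s\<close> and \<open>t\<close> anticipate the centres that completing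
  the square produces; translation invariance removes them.\<close>

lemma iterated_Lp_qnorm_gaussian:
  fixes s :: "'a::euclidean_space" and t :: "'b::euclidean_space"
  assumes pq: "0 < p" "0 < q" and k: "0 < k" and ab: "0 < a" "0 < b"
  shows "Lp_qnorm q (\<lambda>y. Lp_qnorm p (\<lambda>x. ennreal (k * (gaussian a (x + s) * gaussian b (y + t)))))
    = ennreal k * (Lp_qnorm p (\<lambda>x::'a. ennreal (gaussian a x)) * Lp_qnorm q (\<lambda>y::'b. ennreal (gaussian b y)))"
proof -
  obtain \<kappa> where \<kappa>: "0 < \<kappa>" "\<And>a. 0 < a \<Longrightarrow> Lp_qnorm p (\<lambda>t::'a. ennreal (gaussian a t)) = ennreal (\<kappa> * gaussian_rate DIM('a) p a)"
    using Lp_qnorm_gaussian[OF pq(1)] by blast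
  define N where "N = \<kappa> * gaussian_rate DIM('a) p a"
  have N: "0 < N" "Lp_qnorm p (\<lambda>t::'a. ennreal (gaussian a t)) = ennreal N"
    using \<kappa> ab by (auto simp: N_def gaussian_rate_pos)
  have inner: "Lp_qnorm p (\<lambda>x. ennreal (k * (gaussian a (x + s) * gaussian b (y + t)))) = ennreal (k * N) * ennreal (gaussian b (y + t))" for y
  proof -
    have "Lp_qnorm p (\<lambda>x. ennreal (k * (gaussian a (x + s) * gaussian b (y + t))))
      = Lp_qnorm p (\<lambda>x. ennreal (k * gaussian b (y + t)) * ennreal (gaussian a (s + x)))"
      using k by (simp add: ennreal_mult'[symmetric] ennreal_mult''[symmetric] less_imp_le[OF gaussian_pos] mult_ac add.commute)
    also have "\<dots> = ennreal (k * gaussian b (y + t)) * Lp_qnorm p (\<lambda>x. ennreal (gaussian a (s + x)))"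
      using pq k by (intro Lp_qnorm_cmult) (auto simp: gaussian_pos)
    also have "Lp_qnorm p (\<lambda>x. ennreal (gaussian a (s + x))) = ennreal N"
      using Lp_qnorm_translate(1)[OF pq(1), of "\<lambda>x. ennreal (gaussian a x)" s] N by simp
    finally show ?thesis using k N by (simp add: ennreal_mult'[symmetric] less_imp_le[OF gaussian_pos] mult_ac)
  qed
  have "Lp_qnorm q (\<lambda>y. ennreal (k * N) * ennreal (gaussian b (y + t))) = ennreal (k * N) * Lp_qnorm q (\<lambda>y. ennreal (gaussian b (t + y)))"
    using pq k N by (subst Lp_qnorm_cmult) (auto simp: add.commute)
  also have "Lp_qnorm q (\<lambda>y. ennreal (gaussian b (t + y))) = Lp_qnorm q (\<lambda>y::'b. ennreal (gaussian b y))"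
    using Lp_qnorm_translate(1)[OF pq(2), of "\<lambda>x. ennreal (gaussian b x)" t] by simp
  finally show ?thesis unfolding inner using k N by (simp add: ennreal_mult mult.assoc)
qed

text \<open>The product of the two Gaussians is a single Gaussian about \<open>x0\<close> times a
  Gaussian in \<open>x\<close>. Recentring at \<open>x0\<close> only adds a phase, and the Fourier
  transform of a Gaussian is known.\<close>

lemma vstft_gaussian:
  fixes x \<xi> :: "'a::euclidean_space"
  assumes "0 < \<epsilon>" "0 < \<alpha>"
  shows "norm (vstft (\<lambda>t. complex_of_real (gaussian \<alpha> t)) (\<lambda>t. complex_of_real (gaussian \<epsilon> t)) (x, \<xi>))
    = (\<epsilon> + \<alpha>) powr (- real DIM('a) / 2) * (gaussian (\<epsilon> * \<alpha> / (\<epsilon> + \<alpha>)) x * gaussian (1 / (\<epsilon> + \<alpha>)) \<xi>)"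
proof -
  define s where "s = \<epsilon> + \<alpha>"
  have s: "0 < s" using assms by (simp add: s_def)
  define x0 where "x0 = (\<alpha> / s) *\<^sub>R x"
  have sq: "gaussian \<epsilon> t * gaussian \<alpha> (t - x) = gaussian (\<epsilon> * \<alpha> / s) x * gaussian s (t - x0)" for t
  proof -
    have "s * (norm (t - x0))\<^sup>2 = s * (t \<bullet> t) - 2 * \<alpha> * (t \<bullet> x) + \<alpha> * \<alpha> / s * (x \<bullet> x)"
      using s by (simp add: x0_def power2_norm_eq_inner inner_diff_left inner_diff_right inner_commute algebra_simps)
    moreover have "\<epsilon> * (norm t)\<^sup>2 + \<alpha> * (norm (t - x))\<^sup>2 = s * (t \<bullet> t) - 2 * \<alpha> * (t \<bullet> x) + \<alpha> * (x \<bullet> x)"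
      by (simp add: s_def power2_norm_eq_inner inner_diff_left inner_diff_right inner_commute algebra_simps)
    moreover have "\<alpha> * (x \<bullet> x) = \<epsilon> * \<alpha> / s * (x \<bullet> x) + \<alpha> * \<alpha> / s * (x \<bullet> x)"
    proof -
      have "\<epsilon> * \<alpha> / s + \<alpha> * \<alpha> / s = s * \<alpha> / s"
        unfolding add_divide_distrib[symmetric] s_def distrib_right ..
      also have "\<dots> = \<alpha>" using s by simp
      finally show ?thesis unfolding distrib_right[symmetric] by (simp only:)
    qed
    ultimately have "\<epsilon> * (norm t)\<^sup>2 + \<alpha> * (norm (t - x))\<^sup>2 = \<epsilon> * \<alpha> / s * (norm x)\<^sup>2 + s * (norm (t - x0))\<^sup>2"
      by (simp add: power2_norm_eq_inner)
    from arg_cong[OF this, of "\<lambda>r. exp (- (pi * r))"] show ?thesis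
      by (simp add: gaussian_def exp_add[symmetric] distrib_left mult.assoc)
  qed
  have "vstft (\<lambda>t. complex_of_real (gaussian \<alpha> t)) (\<lambda>t. complex_of_real (gaussian \<epsilon> t)) (x, \<xi>)
    = (LINT t|lborel. complex_of_real (gaussian (\<epsilon> * \<alpha> / s) x) * (complex_of_real (gaussian s (t - x0)) * exp (- (2 * pi * \<i> * (t \<bullet> \<xi>)))))"
    unfolding vstft_eq by (intro Bochner_Integration.integral_cong refl) (simp add: sq flip: of_real_mult mult.assoc)
  also have "\<dots> = complex_of_real (gaussian (\<epsilon> * \<alpha> / s) x) * (LINT t|lborel. complex_of_real (gaussian s (t - x0)) * exp (- (2 * pi * \<i> * (t \<bullet> \<xi>))))"
    by (rule integral_mult_right_zero)
  also have "(LINT t|lborel. complex_of_real (gaussian s (t - x0)) * exp (- (2 * pi * \<i> * (t \<bullet> \<xi>))))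
    = (LINT t|lborel. complex_of_real (gaussian s (t + x0 - x0)) * exp (- (2 * pi * \<i> * ((t + x0) \<bullet> \<xi>))))"
    by (rule lborel_integral_translate(2)[symmetric]) measurable
  also have "\<dots> = (LINT t|lborel. (complex_of_real (gaussian s t) * exp (- (2 * pi * \<i> * (t \<bullet> \<xi>)))) * exp (- (2 * pi * \<i> * (x0 \<bullet> \<xi>))))"
    by (intro Bochner_Integration.integral_cong refl) (simp add: inner_add_left distrib_left exp_add[symmetric] mult.assoc)
  also have "\<dots> = (LINT t|lborel. complex_of_real (gaussian s t) * exp (- (2 * pi * \<i> * (t \<bullet> \<xi>)))) * exp (- (2 * pi * \<i> * (x0 \<bullet> \<xi>)))"
    by (rule integral_mult_left_zero)
  finally show ?thesis
    unfolding gaussian_fourier(2)[OF s] by (simp add: norm_mult s_def[symmetric] abs_of_pos[OF gaussian_pos] mult_ac)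
qed

text \<open>\<open>C\<close> is the coefficient of |z|^2 in the joint exponent. The coefficient c1
  c2 / C left for \<zeta> comes from the discriminant identity (c1 + c2) C - (c1 \<sigma> - c2
  \<rho>)^2 = c1 c2 (\<sigma> + \<rho>)^2.\<close>

lemma gaussian_complete_square:
  fixes \<zeta> z :: "'a::real_inner"
  assumes "0 < c1" "0 < c2" "\<sigma> + \<rho> = 1" "C = c1 * \<sigma>\<^sup>2 + c2 * \<rho>\<^sup>2" "0 < C"
  shows "gaussian c1 (\<zeta> + \<sigma> *\<^sub>R z) * gaussian c2 (\<zeta> - \<rho> *\<^sub>R z) = gaussian C (z + ((c1 * \<sigma> - c2 * \<rho>) / C) *\<^sub>R \<zeta>) * gaussian (c1 * c2 / C) \<zeta>"
proof -
  define m where "m = c1 * \<sigma> - c2 * \<rho>"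
  have "(c1 + c2) * C - m\<^sup>2 = c1 * c2 * (\<sigma> + \<rho>)\<^sup>2"
    unfolding assms(4) m_def by (simp add: power2_eq_square algebra_simps)
  then have cc: "c1 + c2 = m\<^sup>2 / C + c1 * c2 / C"
    using assms(3,5) by (simp add: add_divide_distrib[symmetric] field_simps)
  have "C * (norm (z + (m / C) *\<^sub>R \<zeta>))\<^sup>2 + c1 * c2 / C * (norm \<zeta>)\<^sup>2 = C * (z \<bullet> z) + 2 * m * (z \<bullet> \<zeta>) + (m\<^sup>2 / C + c1 * c2 / C) * (\<zeta> \<bullet> \<zeta>)"
    unfolding power2_norm_eq_inner using assms(5) by (simp add: inner_add_left inner_add_right inner_commute power2_eq_square algebra_simps)
  also have "\<dots> = C * (z \<bullet> z) + 2 * m * (z \<bullet> \<zeta>) + (c1 + c2) * (\<zeta> \<bullet> \<zeta>)"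
    by (simp only: cc)
  also have "\<dots> = c1 * (norm (\<zeta> + \<sigma> *\<^sub>R z))\<^sup>2 + c2 * (norm (\<zeta> - \<rho> *\<^sub>R z))\<^sup>2"
    unfolding assms(4) m_def power2_norm_eq_inner
    by (simp add: inner_add_left inner_add_right inner_diff_left inner_diff_right inner_commute power2_eq_square algebra_simps)
  finally have "- (pi * (c1 * (norm (\<zeta> + \<sigma> *\<^sub>R z))\<^sup>2 + c2 * (norm (\<zeta> - \<rho> *\<^sub>R z))\<^sup>2))
    = - (pi * (C * (norm (z + (m / C) *\<^sub>R \<zeta>))\<^sup>2 + c1 * c2 / C * (norm \<zeta>)\<^sup>2))" by simp
  then show ?thesis
    unfolding gaussian_def exp_add[symmetric] m_def[symmetric]
    by (intro arg_cong[where f=exp]) (simp only: distrib_left mult.assoc minus_add_distrib)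
qed

text \<open>The assumed bound is tested on two Gaussians. Windows are changed in opposite
  directions, from \<Phi> to the Gaussian window on the target side and from Gaussian windows to
  \<phi> on the source side, so that every norm becomes explicit. Here \<open>c1\<close>,
  \<open>c2\<close> are the rates in position and \<open>d1\<close>, \<open>d2\<close> those in
  frequency.\<close>

lemma gaussian_inequality:
  fixes \<phi> :: "'a::euclidean_space \<Rightarrow> complex" and \<Phi> :: "'a \<times> 'a \<Rightarrow> complex"
  assumes pos: "0 < p" "0 < q" "0 < p1" "0 < q1" "0 < p2" "0 < q2" and \<tau>: "0 < \<tau>" "\<tau> < 1"
    and \<phi>: "\<phi> \<in> schwartz" and \<Phi>: "\<Phi> \<in> schwartz" "\<Phi> \<noteq> (\<lambda>_. 0)"
    and bounded: "tau_wigner_bounded \<phi> \<Phi> \<tau> p1 q1 (\<lambda>_. 1) p2 q2 (\<lambda>_. 1) p q 0"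
  obtains K where "\<And>\<epsilon>1 \<epsilon>2 c1 c2 d1 d2 C D. 0 < \<epsilon>1 \<Longrightarrow> 0 < \<epsilon>2 \<Longrightarrow>
    d1 = 1 / (\<epsilon>1 + (1 - \<tau>)) \<Longrightarrow> d2 = 1 / (\<epsilon>2 + \<tau>) \<Longrightarrow>
    c1 = \<epsilon>1 * (1 - \<tau>) / (\<epsilon>1 + (1 - \<tau>)) \<Longrightarrow> c2 = \<epsilon>2 * \<tau> / (\<epsilon>2 + \<tau>) \<Longrightarrow>
    C = c1 * \<tau>\<^sup>2 + c2 * (1 - \<tau>)\<^sup>2 \<Longrightarrow> D = d2 * \<tau>\<^sup>2 + d1 * (1 - \<tau>)\<^sup>2 \<Longrightarrow>
    gaussian_rate DIM('a) p C * gaussian_rate DIM('a) p D *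
      (gaussian_rate DIM('a) q (c1 * c2 / C) * gaussian_rate DIM('a) q (d2 * d1 / D))
    \<le> K * (gaussian_rate DIM('a) p1 c1 * gaussian_rate DIM('a) q1 d1 * (gaussian_rate DIM('a) p2 c2 * gaussian_rate DIM('a) q2 d2))"
proof -
  let ?g = "\<lambda>a (t::'a). complex_of_real (gaussian a t)"
  let ?r = "gaussian_rate DIM('a)"
  let ?m = "\<lambda>(z::'a \<times> 'a, \<zeta>::'a \<times> 'a). power_weight 0 \<zeta>"
  let ?\<Phi>0 = "ambiguity_window \<tau> :: 'a \<times> 'a \<Rightarrow> complex"
  note mod0 = moderate_snd[OF moderate_power_weight, where 'a="'a \<times> 'a" and 'b="'a \<times> 'a"]
  have w1: "?g (1 - \<tau>) \<in> schwartz" "?g (1 - \<tau>) \<noteq> (\<lambda>_. 0)" and w2: "?g \<tau> \<in> schwartz" "?g \<tau> \<noteq> (\<lambda>_. 0)"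
    using \<tau> gaussian_window[of "1 - \<tau>"] gaussian_window[of \<tau>] by auto
  obtain K0 where K0: "0 < K0" "\<And>u. integrable lborel u \<Longrightarrow>
    modulation_qnorm ?\<Phi>0 p q ?m (distr_of u) \<le> ennreal K0 * modulation_qnorm \<Phi> p q ?m (distr_of u)"
    using modulation_qnorm_change_window[OF \<Phi> ambiguity_window(1)[OF \<tau>] pos(1,2) mod0] by blast
  obtain K1 where K1: "0 < K1" "\<And>u. integrable lborel u \<Longrightarrow>
    modulation_qnorm \<phi> p1 q1 (\<lambda>_. 1) (distr_of u) \<le> ennreal K1 * modulation_qnorm (?g (1 - \<tau>)) p1 q1 (\<lambda>_. 1) (distr_of u)"
    using modulation_qnorm_change_window[OF w1 \<phi> pos(3,4) moderate_one] by blast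
  obtain K2 where K2: "0 < K2" "\<And>u. integrable lborel u \<Longrightarrow>
    modulation_qnorm \<phi> p2 q2 (\<lambda>_. 1) (distr_of u) \<le> ennreal K2 * modulation_qnorm (?g \<tau>) p2 q2 (\<lambda>_. 1) (distr_of u)"
    using modulation_qnorm_change_window[OF w2 \<phi> pos(5,6) moderate_one] by blast
  obtain B where B: "0 < B" "\<And>f1 f2. f1 \<in> schwartz \<Longrightarrow> f2 \<in> schwartz \<Longrightarrow>
    wiener_amalgam_qnorm \<Phi> p q 0 (distr_of (tau_wigner \<tau> f1 f2))
      \<le> ennreal B * modulation_qnorm \<phi> p1 q1 (\<lambda>_. 1) (distr_of f1) * modulation_qnorm \<phi> p2 q2 (\<lambda>_. 1) (distr_of f2)"
    using bounded unfolding tau_wigner_bounded_def by blast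
  obtain kp where kp: "0 < kp" "\<And>a. 0 < a \<Longrightarrow> Lp_qnorm p (\<lambda>t::'a. ennreal (gaussian a t)) = ennreal (kp * ?r p a)"
    using Lp_qnorm_gaussian[OF pos(1)] by blast
  obtain kq where kq: "0 < kq" "\<And>a. 0 < a \<Longrightarrow> Lp_qnorm q (\<lambda>t::'a. ennreal (gaussian a t)) = ennreal (kq * ?r q a)"
    using Lp_qnorm_gaussian[OF pos(2)] by blast
  obtain kp1 where kp1: "0 < kp1" "\<And>a. 0 < a \<Longrightarrow> Lp_qnorm p1 (\<lambda>t::'a. ennreal (gaussian a t)) = ennreal (kp1 * ?r p1 a)"
    using Lp_qnorm_gaussian[OF pos(3)] by blast
  obtain kq1 where kq1: "0 < kq1" "\<And>a. 0 < a \<Longrightarrow> Lp_qnorm q1 (\<lambda>t::'a. ennreal (gaussian a t)) = ennreal (kq1 * ?r q1 a)"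
    using Lp_qnorm_gaussian[OF pos(4)] by blast
  obtain kp2 where kp2: "0 < kp2" "\<And>a. 0 < a \<Longrightarrow> Lp_qnorm p2 (\<lambda>t::'a. ennreal (gaussian a t)) = ennreal (kp2 * ?r p2 a)"
    using Lp_qnorm_gaussian[OF pos(5)] by blast
  obtain kq2 where kq2: "0 < kq2" "\<And>a. 0 < a \<Longrightarrow> Lp_qnorm q2 (\<lambda>t::'a. ennreal (gaussian a t)) = ennreal (kq2 * ?r q2 a)"
    using Lp_qnorm_gaussian[OF pos(6)] by blast
  define K where "K = K0 * B * K1 * K2 * (kp1 * kq1 * kp2 * kq2) / (kp * kp * (kq * kq))"
  show thesis
  proof (rule that[of K])
    fix \<epsilon>1 \<epsilon>2 c1 c2 d1 d2 C D :: real
    assume \<epsilon>: "0 < \<epsilon>1" "0 < \<epsilon>2" and d: "d1 = 1 / (\<epsilon>1 + (1 - \<tau>))" "d2 = 1 / (\<epsilon>2 + \<tau>)"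
      and c: "c1 = \<epsilon>1 * (1 - \<tau>) / (\<epsilon>1 + (1 - \<tau>))" "c2 = \<epsilon>2 * \<tau> / (\<epsilon>2 + \<tau>)"
      and CD: "C = c1 * \<tau>\<^sup>2 + c2 * (1 - \<tau>)\<^sup>2" "D = d2 * \<tau>\<^sup>2 + d1 * (1 - \<tau>)\<^sup>2"
    have p0: "0 < c1" "0 < c2" "0 < d1" "0 < d2" using \<epsilon> \<tau> by (auto simp: c d add_pos_pos)
    then have p1: "0 < C" "0 < D" using \<tau> by (auto simp: CD add_pos_pos)
    define A1 A2 where "A1 = (\<epsilon>1 + (1 - \<tau>)) powr (- real DIM('a) / 2)" and "A2 = (\<epsilon>2 + \<tau>) powr (- real DIM('a) / 2)"
    have A: "0 < A1" "0 < A2" using \<epsilon> \<tau> by (auto simp: A1_def A2_def)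
    let ?f1 = "?g \<epsilon>1" and ?f2 = "?g \<epsilon>2"
    have f: "?f1 \<in> schwartz" "?f2 \<in> schwartz" using \<epsilon> by (auto intro: gaussian_schwartz)
    have V1: "norm (vstft (?g (1 - \<tau>)) ?f1 (x, \<xi>)) = A1 * (gaussian c1 x * gaussian d1 \<xi>)" for x \<xi>
      using vstft_gaussian[of \<epsilon>1 "1 - \<tau>" x \<xi>] \<epsilon> \<tau> by (simp add: A1_def c d)
    have V2: "norm (vstft (?g \<tau>) ?f2 (x, \<xi>)) = A2 * (gaussian c2 x * gaussian d2 \<xi>)" for x \<xi>
      using vstft_gaussian[of \<epsilon>2 \<tau> x \<xi>] \<epsilon> \<tau> by (simp add: A2_def c d)
    have N1: "modulation_qnorm (?g (1 - \<tau>)) p1 q1 (\<lambda>_. 1) (distr_of ?f1) = ennreal (A1 * (kp1 * ?r p1 c1 * (kq1 * ?r q1 d1)))"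
    proof -
      have "modulation_qnorm (?g (1 - \<tau>)) p1 q1 (\<lambda>_. 1) (distr_of ?f1)
        = Lp_qnorm q1 (\<lambda>\<xi>::'a. Lp_qnorm p1 (\<lambda>x::'a. ennreal (A1 * (gaussian c1 (x + 0) * gaussian d1 (\<xi> + 0)))))"
        unfolding modulation_qnorm_eq mixed_qnorm_def V1 by simp
      also have "\<dots> = ennreal (A1 * (kp1 * ?r p1 c1 * (kq1 * ?r q1 d1)))"
        using A p0 kp1 kq1 by (subst iterated_Lp_qnorm_gaussian[OF pos(3,4)])
          (auto simp: ennreal_mult'[symmetric] ennreal_mult''[symmetric] less_imp_le gaussian_rate_pos)
      finally show ?thesis .
    qed
    have N2: "modulation_qnorm (?g \<tau>) p2 q2 (\<lambda>_. 1) (distr_of ?f2) = ennreal (A2 * (kp2 * ?r p2 c2 * (kq2 * ?r q2 d2)))"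
    proof -
      have "modulation_qnorm (?g \<tau>) p2 q2 (\<lambda>_. 1) (distr_of ?f2)
        = Lp_qnorm q2 (\<lambda>\<xi>::'a. Lp_qnorm p2 (\<lambda>x::'a. ennreal (A2 * (gaussian c2 (x + 0) * gaussian d2 (\<xi> + 0)))))"
        unfolding modulation_qnorm_eq mixed_qnorm_def V2 by simp
      also have "\<dots> = ennreal (A2 * (kp2 * ?r p2 c2 * (kq2 * ?r q2 d2)))"
        using A p0 kp2 kq2 by (subst iterated_Lp_qnorm_gaussian[OF pos(5,6)])
          (auto simp: ennreal_mult'[symmetric] ennreal_mult''[symmetric] less_imp_le gaussian_rate_pos)
      finally show ?thesis .
    qed
    define C' D' where "C' = c1 * c2 / C" and "D' = d2 * d1 / D"
    have p2: "0 < C'" "0 < D'" using p0 p1 by (auto simp: C'_def D'_def)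
    have N: "modulation_qnorm ?\<Phi>0 p q ?m (distr_of (ambiguity \<tau> ?f1 ?f2))
      = ennreal (A1 * A2 * (kp * ?r p D * (kp * ?r p C)) * (kq * ?r q C' * (kq * ?r q D')))"
    proof -
      have V: "norm (vstft ?\<Phi>0 (ambiguity \<tau> ?f1 ?f2) ((z1, z2), (\<zeta>1, \<zeta>2))) =
        (A1 * A2 * (gaussian C' \<zeta>1 * gaussian D' \<zeta>2)) * (gaussian D (z1 + ((d2 * \<tau> - d1 * (1 - \<tau>)) / D) *\<^sub>R \<zeta>2) * gaussian C (z2 + ((c1 * \<tau> - c2 * (1 - \<tau>)) / C) *\<^sub>R \<zeta>1))"
        for z1 z2 \<zeta>1 \<zeta>2
      proof -
        have "norm (vstft ?\<Phi>0 (ambiguity \<tau> ?f1 ?f2) ((z1, z2), (\<zeta>1, \<zeta>2))) =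
          A1 * A2 * (gaussian c1 (\<zeta>1 + \<tau> *\<^sub>R z2) * gaussian c2 (\<zeta>1 - (1 - \<tau>) *\<^sub>R z2))
            * (gaussian d2 (\<zeta>2 + \<tau> *\<^sub>R z1) * gaussian d1 (\<zeta>2 - (1 - \<tau>) *\<^sub>R z1))"
          unfolding ambiguity_window_def vstft_ambiguity[OF f \<tau>] by (simp add: V1 V2 mult_ac)
        also have "gaussian c1 (\<zeta>1 + \<tau> *\<^sub>R z2) * gaussian c2 (\<zeta>1 - (1 - \<tau>) *\<^sub>R z2)
          = gaussian C (z2 + ((c1 * \<tau> - c2 * (1 - \<tau>)) / C) *\<^sub>R \<zeta>1) * gaussian C' \<zeta>1"
          unfolding C'_def by (rule gaussian_complete_square[OF p0(1,2) _ CD(1) p1(1)]) simp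
        also have "gaussian d2 (\<zeta>2 + \<tau> *\<^sub>R z1) * gaussian d1 (\<zeta>2 - (1 - \<tau>) *\<^sub>R z1)
          = gaussian D (z1 + ((d2 * \<tau> - d1 * (1 - \<tau>)) / D) *\<^sub>R \<zeta>2) * gaussian D' \<zeta>2"
          unfolding D'_def by (rule gaussian_complete_square[OF p0(4,3) _ CD(2) p1(2)]) simp
        finally show ?thesis by (simp add: mult_ac)
      qed
      have inner: "Lp_qnorm p (\<lambda>z. ennreal (norm (vstft ?\<Phi>0 (ambiguity \<tau> ?f1 ?f2) (z, \<zeta>)) * 1))
         = ennreal ((A1 * A2 * (kp * ?r p D * (kp * ?r p C))) * (gaussian C' (fst \<zeta> + 0) * gaussian D' (snd \<zeta> + 0)))" for \<zeta>
      proof -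
        obtain \<zeta>1 \<zeta>2 where \<zeta>: "\<zeta> = (\<zeta>1, \<zeta>2)" by (cases \<zeta>)
        let ?k = "A1 * A2 * (gaussian C' \<zeta>1 * gaussian D' \<zeta>2)"
        have k: "0 < ?k" using A by (simp add: gaussian_pos)
        have eq: "norm (vstft ?\<Phi>0 (ambiguity \<tau> ?f1 ?f2) (z, \<zeta>)) * 1
          = ?k * (gaussian D (fst z + ((d2 * \<tau> - d1 * (1 - \<tau>)) / D) *\<^sub>R \<zeta>2) * gaussian C (snd z + ((c1 * \<tau> - c2 * (1 - \<tau>)) / C) *\<^sub>R \<zeta>1))" for z
          using V[of "fst z" "snd z"] by (simp add: \<zeta>)
        have "Lp_qnorm p (\<lambda>z. ennreal (norm (vstft ?\<Phi>0 (ambiguity \<tau> ?f1 ?f2) (z, \<zeta>)) * 1))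
          = Lp_qnorm p (\<lambda>z2. Lp_qnorm p (\<lambda>z1. ennreal (?k * (gaussian D (z1 + ((d2 * \<tau> - d1 * (1 - \<tau>)) / D) *\<^sub>R \<zeta>2) * gaussian C (z2 + ((c1 * \<tau> - c2 * (1 - \<tau>)) / C) *\<^sub>R \<zeta>1)))))"
          unfolding eq using pos by (subst Lp_qnorm_pair') auto
        also have "\<dots> = ennreal ?k * (ennreal (kp * ?r p D) * ennreal (kp * ?r p C))"
          using k p1 by (subst iterated_Lp_qnorm_gaussian[OF pos(1,1)]) (auto simp: kp)
        also have "\<dots> = ennreal ((A1 * A2 * (kp * ?r p D * (kp * ?r p C))) * (gaussian C' (fst \<zeta> + 0) * gaussian D' (snd \<zeta> + 0)))"
          using k kp p1 by (simp add: \<zeta> ennreal_mult'[symmetric] ennreal_mult''[symmetric] less_imp_le gaussian_rate_pos mult_ac)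
        finally show ?thesis .
      qed
      have kk: "0 < A1 * A2 * (kp * ?r p D * (kp * ?r p C))" using A kp p1 by (simp add: gaussian_rate_pos)
      have "modulation_qnorm ?\<Phi>0 p q ?m (distr_of (ambiguity \<tau> ?f1 ?f2))
        = Lp_qnorm q (\<lambda>\<zeta>. Lp_qnorm p (\<lambda>z. ennreal (norm (vstft ?\<Phi>0 (ambiguity \<tau> ?f1 ?f2) (z, \<zeta>)) * 1)))"
        unfolding modulation_qnorm_eq mixed_qnorm_def by (simp add: power_weight_zero)
      also have "\<dots> = Lp_qnorm q (\<lambda>y::'a. Lp_qnorm q (\<lambda>x::'a. ennreal ((A1 * A2 * (kp * ?r p D * (kp * ?r p C))) * (gaussian C' (x + 0) * gaussian D' (y + 0)))))"
        unfolding inner using pos by (subst Lp_qnorm_pair') auto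
      also have "\<dots> = ennreal (A1 * A2 * (kp * ?r p D * (kp * ?r p C))) * (ennreal (kq * ?r q C') * ennreal (kq * ?r q D'))"
        using p2 kk by (subst iterated_Lp_qnorm_gaussian[OF pos(2,2)]) (auto simp: kq)
      also have "\<dots> = ennreal (A1 * A2 * (kp * ?r p D * (kp * ?r p C)) * (kq * ?r q C' * (kq * ?r q D')))"
        using kk kq p2 by (simp add: ennreal_mult'[symmetric] ennreal_mult''[symmetric] less_imp_le gaussian_rate_pos)
      finally show ?thesis .
    qed
    have "ennreal (A1 * A2 * (kp * ?r p D * (kp * ?r p C)) * (kq * ?r q C' * (kq * ?r q D')))
      \<le> ennreal K0 * modulation_qnorm \<Phi> p q ?m (distr_of (ambiguity \<tau> ?f1 ?f2))"
      unfolding N[symmetric] by (rule K0(2)[OF ambiguity_integrable(1)[OF f]])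
    also have "modulation_qnorm \<Phi> p q ?m (distr_of (ambiguity \<tau> ?f1 ?f2)) = wiener_amalgam_qnorm \<Phi> p q 0 (distr_of (tau_wigner \<tau> ?f1 ?f2))"
      by (rule wiener_amalgam_qnorm_tau_wigner[OF f \<Phi>(1), symmetric])
    also have "\<dots> \<le> ennreal B * modulation_qnorm \<phi> p1 q1 (\<lambda>_. 1) (distr_of ?f1) * modulation_qnorm \<phi> p2 q2 (\<lambda>_. 1) (distr_of ?f2)"
      by (rule B(2)[OF f])
    also have "\<dots> \<le> ennreal B * (ennreal K1 * ennreal (A1 * (kp1 * ?r p1 c1 * (kq1 * ?r q1 d1)))) * (ennreal K2 * ennreal (A2 * (kp2 * ?r p2 c2 * (kq2 * ?r q2 d2))))"
      unfolding N1[symmetric] N2[symmetric]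
      by (intro mult_mono mult_left_mono K1(2) K2(2) schwartz_integrable f) auto
    finally have "ennreal (A1 * A2 * (kp * ?r p D * (kp * ?r p C)) * (kq * ?r q C' * (kq * ?r q D'))) \<le> ennreal K0 *
      (ennreal B * (ennreal K1 * ennreal (A1 * (kp1 * ?r p1 c1 * (kq1 * ?r q1 d1)))) * (ennreal K2 * ennreal (A2 * (kp2 * ?r p2 c2 * (kq2 * ?r q2 d2)))))"
      by (simp add: mult_left_mono)
    also have "\<dots> = ennreal (K0 * (B * (K1 * (A1 * (kp1 * ?r p1 c1 * (kq1 * ?r q1 d1)))) * (K2 * (A2 * (kp2 * ?r p2 c2 * (kq2 * ?r q2 d2))))))"
      using K0 B K1 K2 A kp1 kq1 kp2 kq2 p0 by (simp add: ennreal_mult'[symmetric] ennreal_mult''[symmetric] less_imp_le gaussian_rate_pos)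
    finally have "A1 * A2 * (kp * ?r p D * (kp * ?r p C)) * (kq * ?r q C' * (kq * ?r q D')) \<le>
      K0 * (B * (K1 * (A1 * (kp1 * ?r p1 c1 * (kq1 * ?r q1 d1)))) * (K2 * (A2 * (kp2 * ?r p2 c2 * (kq2 * ?r q2 d2)))))"
      using K0 B K1 K2 A kp1 kq1 kp2 kq2 p0 by (subst (asm) ennreal_le_iff) (simp_all add: less_imp_le gaussian_rate_pos)
    \<comment> \<open>The normalisations \<open>A1\<close> and \<open>A2\<close> occur on both sides
      and cancel; only the rates depend on the Gaussian parameters from here on.\<close>
    then have "(A1 * A2) * ((kp * kp * (kq * kq)) * (?r p C * ?r p D * (?r q C' * ?r q D'))) \<le>
      (A1 * A2) * (K0 * B * K1 * K2 * (kp1 * kq1 * kp2 * kq2) * (?r p1 c1 * ?r q1 d1 * (?r p2 c2 * ?r q2 d2)))"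
      by (simp add: mult_ac)
    then have "(kp * kp * (kq * kq)) * (?r p C * ?r p D * (?r q C' * ?r q D')) \<le>
      K0 * B * K1 * K2 * (kp1 * kq1 * kp2 * kq2) * (?r p1 c1 * ?r q1 d1 * (?r p2 c2 * ?r q2 d2))"
      by (rule mult_left_le_imp_le) (use A in simp)
    then show "?r p C * ?r p D * (?r q (c1 * c2 / C) * ?r q (d2 * d1 / D)) \<le> K * (?r p1 c1 * ?r q1 d1 * (?r p2 c2 * ?r q2 d2))"
      using kp kq by (simp add: K_def C'_def D'_def pos_le_divide_eq mult_ac)
  qed
qed

section \<open>Two-sided power asymptotics in a small parameter\<close>

definition power_like :: "real \<Rightarrow> (real \<Rightarrow> real) \<Rightarrow> bool" where
  "power_like e F \<longleftrightarrow> (\<exists>l L. 0 < l \<and> (\<forall>\<delta>. 0 < \<delta> \<and> \<delta> \<le> 1 \<longrightarrow> l * \<delta> powr e \<le> F \<delta> \<and> F \<delta> \<le> L * \<delta> powr e))"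

lemma power_likeE:
  assumes "power_like e F"
  obtains l L where "0 < l" "0 < L" "\<And>\<delta>. 0 < \<delta> \<Longrightarrow> \<delta> \<le> 1 \<Longrightarrow> l * \<delta> powr e \<le> F \<delta>" "\<And>\<delta>. 0 < \<delta> \<Longrightarrow> \<delta> \<le> 1 \<Longrightarrow> F \<delta> \<le> L * \<delta> powr e"
proof -
  obtain l L where lL: "0 < l" "\<And>\<delta>. 0 < \<delta> \<Longrightarrow> \<delta> \<le> 1 \<Longrightarrow> l * \<delta> powr e \<le> F \<delta> \<and> F \<delta> \<le> L * \<delta> powr e"
    using assms unfolding power_like_def by blast
  have "l \<le> L" using lL(2)[of 1] by simp
  then show thesis using lL by (intro that[of l L]) auto
qed

lemma power_likeI:
  assumes "0 < l" "\<And>\<delta>. 0 < \<delta> \<Longrightarrow> \<delta> \<le> 1 \<Longrightarrow> l * \<delta> powr e \<le> F \<delta>" "\<And>\<delta>. 0 < \<delta> \<Longrightarrow> \<delta> \<le> 1 \<Longrightarrow> F \<delta> \<le> L * \<delta> powr e"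
  shows "power_like e F"
  using assms unfolding power_like_def by blast

lemma power_like_pos:
  assumes "power_like e F" "0 < \<delta>" "\<delta> \<le> 1" shows "0 < F \<delta>"
proof -
  obtain l where l: "0 < l" "l * \<delta> powr e \<le> F \<delta>"
    using assms unfolding power_like_def by blast
  have "0 < l * \<delta> powr e" using l(1) assms(2) by simp
  also note l(2)
  finally show ?thesis .
qed

lemma power_like_const: "0 < c \<Longrightarrow> power_like 0 (\<lambda>_. c)"
  by (rule power_likeI[of c _ _ c]) auto

lemma power_like_powr_id: "power_like e (\<lambda>\<delta>. \<delta> powr e)"
  by (rule power_likeI[of 1 _ _ 1]) auto

lemma power_like_mult:
  assumes F: "power_like e F" and G: "power_like e' G"
  shows "power_like (e + e') (\<lambda>\<delta>. F \<delta> * G \<delta>)"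
proof -
  obtain l L where F': "0 < l" "0 < L" "\<And>\<delta>. 0 < \<delta> \<Longrightarrow> \<delta> \<le> 1 \<Longrightarrow> l * \<delta> powr e \<le> F \<delta>" "\<And>\<delta>. 0 < \<delta> \<Longrightarrow> \<delta> \<le> 1 \<Longrightarrow> F \<delta> \<le> L * \<delta> powr e"
    using power_likeE[OF F] by metis
  obtain l' L' where G': "0 < l'" "0 < L'" "\<And>\<delta>. 0 < \<delta> \<Longrightarrow> \<delta> \<le> 1 \<Longrightarrow> l' * \<delta> powr e' \<le> G \<delta>" "\<And>\<delta>. 0 < \<delta> \<Longrightarrow> \<delta> \<le> 1 \<Longrightarrow> G \<delta> \<le> L' * \<delta> powr e'"
    using power_likeE[OF G] by metis
  show ?thesis
  proof (rule power_likeI[of "l * l'" _ _ "L * L'"])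
    fix \<delta> :: real assume d: "0 < \<delta>" "\<delta> \<le> 1"
    have "(l * \<delta> powr e) * (l' * \<delta> powr e') \<le> F \<delta> * G \<delta>"
      using F'(1) G'(1) power_like_pos[OF F d] by (intro mult_mono F' G' d) auto
    then show "l * l' * \<delta> powr (e + e') \<le> F \<delta> * G \<delta>" by (simp add: powr_add mult_ac)
    have "F \<delta> * G \<delta> \<le> (L * \<delta> powr e) * (L' * \<delta> powr e')"
      using F'(2) power_like_pos[OF G d] by (intro mult_mono F' G' d) auto
    then show "F \<delta> * G \<delta> \<le> L * L' * \<delta> powr (e + e')" by (simp add: powr_add mult_ac)
  qed (use F' G' in simp)
qed

lemma power_like_powr:
  assumes F: "power_like e F" shows "power_like (e * r) (\<lambda>\<delta>. F \<delta> powr r)"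
proof -
  obtain l L where F': "0 < l" "0 < L" "\<And>\<delta>. 0 < \<delta> \<Longrightarrow> \<delta> \<le> 1 \<Longrightarrow> l * \<delta> powr e \<le> F \<delta>" "\<And>\<delta>. 0 < \<delta> \<Longrightarrow> \<delta> \<le> 1 \<Longrightarrow> F \<delta> \<le> L * \<delta> powr e"
    using power_likeE[OF F] by metis
  have e: "(c * \<delta> powr e) powr r = c powr r * \<delta> powr (e * r)" if "0 < c" for c \<delta>
    using that by (simp add: powr_mult powr_powr)
  show ?thesis
  proof (cases "0 \<le> r")
    case True
    show ?thesis
    proof (rule power_likeI[of "l powr r" _ _ "L powr r"])
      fix \<delta> :: real assume d: "0 < \<delta>" "\<delta> \<le> 1"
      show "l powr r * \<delta> powr (e * r) \<le> F \<delta> powr r" "F \<delta> powr r \<le> L powr r * \<delta> powr (e * r)"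
        unfolding e[OF F'(1), symmetric] e[OF F'(2), symmetric]
        using F' d True power_like_pos[OF F d] by (auto intro!: powr_mono2)
    qed (use F' in simp)
  next
    case False
    show ?thesis
    proof (rule power_likeI[of "L powr r" _ _ "l powr r"])
      fix \<delta> :: real assume d: "0 < \<delta>" "\<delta> \<le> 1"
      show "L powr r * \<delta> powr (e * r) \<le> F \<delta> powr r" "F \<delta> powr r \<le> l powr r * \<delta> powr (e * r)"
        unfolding e[OF F'(1), symmetric] e[OF F'(2), symmetric]
        using F' d False power_like_pos[OF F d] by (auto intro!: powr_mono2')
    qed (use F' in simp)
  qed
qed

lemma power_like_cong:
  assumes "power_like e F" and eq: "\<And>\<delta>. 0 < \<delta> \<Longrightarrow> \<delta> \<le> 1 \<Longrightarrow> F \<delta> = G \<delta>"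
  shows "power_like e G"
proof -
  obtain l L where "0 < l" "\<forall>\<delta>. 0 < \<delta> \<and> \<delta> \<le> 1 \<longrightarrow> l * \<delta> powr e \<le> F \<delta> \<and> F \<delta> \<le> L * \<delta> powr e"
    using assms(1) unfolding power_like_def by blast
  then show ?thesis unfolding power_like_def
    by (intro exI[of _ l] exI[of _ L] conjI) (auto simp: eq)
qed

lemma power_like_divide:
  assumes F: "power_like e F" and G: "power_like e' G"
  shows "power_like (e - e') (\<lambda>\<delta>. F \<delta> / G \<delta>)"
proof -
  have P: "power_like (e - e') (\<lambda>\<delta>. F \<delta> * G \<delta> powr (- 1))"
    using power_like_mult[OF F power_like_powr[OF G, of "- 1"]] by simp
  show ?thesis
  proof (rule power_like_cong[OF P])
    fix \<delta> :: real assume d: "0 < \<delta>" "\<delta> \<le> 1"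
    show "F \<delta> * G \<delta> powr (- 1) = F \<delta> / G \<delta>"
      using power_like_pos[OF G d] by (simp add: powr_minus_divide)
  qed
qed

text \<open>For \<delta> \<le> 1 the smaller exponent gives the larger power, which dominates the
  sum.\<close>

lemma power_like_add:
  assumes F: "power_like e F" and G: "power_like e' G"
  shows "power_like (min e e') (\<lambda>\<delta>. F \<delta> + G \<delta>)"
proof -
  have wlog: "power_like a (\<lambda>\<delta>. A \<delta> + B \<delta>)" if A: "power_like a A" and B: "power_like b B" and "a \<le> b" for a b A B
  proof -
    obtain l L where A': "0 < l" "\<And>\<delta>. 0 < \<delta> \<Longrightarrow> \<delta> \<le> 1 \<Longrightarrow> l * \<delta> powr a \<le> A \<delta>" "\<And>\<delta>. 0 < \<delta> \<Longrightarrow> \<delta> \<le> 1 \<Longrightarrow> A \<delta> \<le> L * \<delta> powr a"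
      using power_likeE[OF A] by metis
    obtain L' where B': "0 < L'" "\<And>\<delta>. 0 < \<delta> \<Longrightarrow> \<delta> \<le> 1 \<Longrightarrow> B \<delta> \<le> L' * \<delta> powr b"
      using power_likeE[OF B] by metis
    show ?thesis
    proof (rule power_likeI[of l _ _ "L + L'"])
      fix \<delta> :: real assume d: "0 < \<delta>" "\<delta> \<le> 1"
      show "l * \<delta> powr a \<le> A \<delta> + B \<delta>" using A'(2)[OF d] power_like_pos[OF B d] by simp
      have "\<delta> powr b \<le> \<delta> powr a" using d \<open>a \<le> b\<close> by (intro powr_mono') auto
      then have "L' * \<delta> powr b \<le> L' * \<delta> powr a" using B'(1) by simp
      then show "A \<delta> + B \<delta> \<le> (L + L') * \<delta> powr a"
        using A'(3)[OF d] B'(2)[OF d] by (simp add: distrib_right)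
    qed fact
  qed
  show ?thesis
  proof (cases "e \<le> e'")
    case True
    then show ?thesis using wlog[OF F G] by (simp add: min_def)
  next
    case False
    then show ?thesis using wlog[OF G F] by (simp add: min_def add.commute)
  qed
qed

text \<open>Otherwise the quotient of the right side by the left would tend to 0 with \<delta>; an
  explicit \<delta> produces the contradiction.\<close>

lemma power_like_exponent_le:
  assumes F: "power_like a F" and G: "power_like b G" and le: "\<And>\<delta>. 0 < \<delta> \<Longrightarrow> \<delta> \<le> 1 \<Longrightarrow> F \<delta> \<le> K * G \<delta>"
  shows "b \<le> a"
proof (rule ccontr)
  assume "\<not> b \<le> a"
  define e where "e = b - a"
  have e: "0 < e" using \<open>\<not> b \<le> a\<close> by (simp add: e_def)
  obtain l where l: "0 < l" "\<And>\<delta>. 0 < \<delta> \<Longrightarrow> \<delta> \<le> 1 \<Longrightarrow> l * \<delta> powr a \<le> F \<delta>"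
    using power_likeE[OF F] by metis
  obtain L where L: "0 < L" "\<And>\<delta>. 0 < \<delta> \<Longrightarrow> \<delta> \<le> 1 \<Longrightarrow> G \<delta> \<le> L * \<delta> powr b"
    using power_likeE[OF G] by metis
  have K: "0 < K" using le[of 1] power_like_pos[OF F, of 1] power_like_pos[OF G, of 1]
    by (metis less_le_trans order_refl zero_less_mult_pos2 zero_less_one)
  \<comment> \<open>The inequality at \<delta> would give l \<le> K L \<delta>^e. With \<delta>^e =
    1/M this means M \<le> K L / l, which the added 1 rules out and which also keeps \<delta> at
    most 1.\<close>
  define M where "M = K * L / l + 1"
  have M: "1 \<le> M" using K L l by (simp add: M_def)
  define \<delta> where "\<delta> = M powr (- 1 / e)"
  have d: "0 < \<delta>" "\<delta> \<le> 1"
    using M e powr_mono[of "- 1 / e" 0 M] by (auto simp: \<delta>_def)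
  have "l * \<delta> powr a \<le> K * (L * \<delta> powr b)"
    using l(2)[OF d] le[OF d] mult_left_mono[OF L(2)[OF d], of K] K by linarith
  also have "\<delta> powr b = \<delta> powr e * \<delta> powr a" by (simp add: powr_add[symmetric] e_def)
  finally have "l * \<delta> powr a \<le> (K * L * \<delta> powr e) * \<delta> powr a" by (simp add: mult_ac)
  then have "l \<le> K * L * \<delta> powr e" using d by (simp add: mult_le_cancel_right)
  also have "\<delta> powr e = 1 / M"
  proof -
    have "\<delta> powr e = M powr (- 1 / e * e)" unfolding \<delta>_def powr_powr ..
    also have "- 1 / e * e = - 1" using e by simp
    finally show ?thesis using M by (simp add: powr_minus_divide)
  qed
  finally have "M \<le> K * L / l" using l M by (simp add: field_simps)
  then show False by (simp add: M_def)
qed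

text \<open>The Gaussian parameters are the powers \<delta>^e1 and \<delta>^e2, so a positive
  exponent lets a parameter tend to 0 and a negative one to infinity. Then \<open>a e\<close> and
  \<open>b e\<close> are the exponents of the position and frequency rates. The sums
  \<open>C\<close> and \<open>D\<close> take minima of exponents, and the quotients c1 c2 / C and d2
  d1 / D therefore take maxima. The common factor -d/2, for dimension d, reverses the comparison of
  exponents.\<close>

lemma gaussian_exponent_condition:
  fixes \<phi> :: "'a::euclidean_space \<Rightarrow> complex" and \<Phi> :: "'a \<times> 'a \<Rightarrow> complex"
  assumes pos: "0 < p" "0 < q" "0 < p1" "0 < q1" "0 < p2" "0 < q2" and \<tau>: "0 < \<tau>" "\<tau> < 1"
    and \<phi>: "\<phi> \<in> schwartz" and \<Phi>: "\<Phi> \<in> schwartz" "\<Phi> \<noteq> (\<lambda>_. 0)"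
    and bounded: "tau_wigner_bounded \<phi> \<Phi> \<tau> p1 q1 (\<lambda>_. 1) p2 q2 (\<lambda>_. 1) p q 0"
  defines "i \<equiv> \<lambda>x::ennreal. 1 / enn2real x" and "b \<equiv> \<lambda>e::real. - min e 0" and "a \<equiv> \<lambda>e::real. max e 0"
  shows "i p * (min (a e1) (a e2) + min (b e1) (b e2)) + i q * (max (a e1) (a e2) + max (b e1) (b e2))
     \<le> i p1 * a e1 + i p2 * a e2 + i q1 * b e1 + i q2 * b e2"
proof -
  let ?n = "real DIM('a) / 2"
  let ?r = "gaussian_rate DIM('a)"
  obtain K where K: "\<And>\<epsilon>1 \<epsilon>2 c1 c2 d1 d2 C D. 0 < \<epsilon>1 \<Longrightarrow> 0 < \<epsilon>2 \<Longrightarrow>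
    d1 = 1 / (\<epsilon>1 + (1 - \<tau>)) \<Longrightarrow> d2 = 1 / (\<epsilon>2 + \<tau>) \<Longrightarrow>
    c1 = \<epsilon>1 * (1 - \<tau>) / (\<epsilon>1 + (1 - \<tau>)) \<Longrightarrow> c2 = \<epsilon>2 * \<tau> / (\<epsilon>2 + \<tau>) \<Longrightarrow>
    C = c1 * \<tau>\<^sup>2 + c2 * (1 - \<tau>)\<^sup>2 \<Longrightarrow> D = d2 * \<tau>\<^sup>2 + d1 * (1 - \<tau>)\<^sup>2 \<Longrightarrow>
    ?r p C * ?r p D * (?r q (c1 * c2 / C) * ?r q (d2 * d1 / D))
    \<le> K * (?r p1 c1 * ?r q1 d1 * (?r p2 c2 * ?r q2 d2))"
    using gaussian_inequality[OF pos \<tau> \<phi> \<Phi> bounded] by blast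
  define d where "d \<alpha> e \<delta> = 1 / (\<delta> powr e + \<alpha>)" for \<alpha> e \<delta> :: real
  define c where "c \<alpha> e \<delta> = \<delta> powr e * \<alpha> / (\<delta> powr e + \<alpha>)" for \<alpha> e \<delta> :: real
  have Pd: "power_like (b e) (d \<alpha> e)" if "0 < \<alpha>" for \<alpha> e
    using power_like_divide[OF power_like_const[of 1] power_like_add[OF power_like_powr_id[of e] power_like_const[OF that]]]
    by (simp add: d_def[abs_def] b_def)
  have Pc: "power_like (a e) (c \<alpha> e)" if "0 < \<alpha>" for \<alpha> e
  proof -
    have "power_like (e + 0 - min e 0) (c \<alpha> e)"
      unfolding c_def by (intro power_like_divide power_like_mult power_like_add power_like_powr_id power_like_const that)
    moreover have "e + 0 - min e 0 = a e" by (simp add: a_def min_def max_def)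
    ultimately show ?thesis by simp
  qed
  define c1 c2 d1 d2 where "c1 = c (1 - \<tau>) e1" and "c2 = c \<tau> e2" and "d1 = d (1 - \<tau>) e1" and "d2 = d \<tau> e2"
  have P: "power_like (a e1) c1" "power_like (a e2) c2" "power_like (b e1) d1" "power_like (b e2) d2"
    unfolding c1_def c2_def d1_def d2_def using \<tau> by (auto intro: Pc Pd)
  define C D where "C \<delta> = c1 \<delta> * \<tau>\<^sup>2 + c2 \<delta> * (1 - \<tau>)\<^sup>2" and "D \<delta> = d2 \<delta> * \<tau>\<^sup>2 + d1 \<delta> * (1 - \<tau>)\<^sup>2" for \<delta>
  have t: "0 < \<tau>\<^sup>2" "0 < (1 - \<tau>)\<^sup>2" using \<tau> by auto
  have PC: "power_like (min (a e1 + 0) (a e2 + 0)) C"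
    unfolding C_def by (intro power_like_add power_like_mult power_like_const t P)
  have PD: "power_like (min (b e2 + 0) (b e1 + 0)) D"
    unfolding D_def by (intro power_like_add power_like_mult power_like_const t P)
  have R: "power_like (e * (- ?n * i x)) (\<lambda>\<delta>. ?r x (F \<delta>))" if "power_like e F" for e x F
    using power_like_powr[OF that, of "- ?n * i x"] by (simp add: gaussian_rate_def i_def)
  define l where "l = min (a e1 + 0) (a e2 + 0) * (- ?n * i p) + min (b e2 + 0) (b e1 + 0) * (- ?n * i p)
    + ((a e1 + a e2 - min (a e1 + 0) (a e2 + 0)) * (- ?n * i q) + (b e2 + b e1 - min (b e2 + 0) (b e1 + 0)) * (- ?n * i q))"
  define r where "r = a e1 * (- ?n * i p1) + b e1 * (- ?n * i q1) + (a e2 * (- ?n * i p2) + b e2 * (- ?n * i q2))"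
  have "r \<le> l"
  proof (rule power_like_exponent_le)
    show "power_like l (\<lambda>\<delta>. ?r p (C \<delta>) * ?r p (D \<delta>) * (?r q (c1 \<delta> * c2 \<delta> / C \<delta>) * ?r q (d2 \<delta> * d1 \<delta> / D \<delta>)))"
      unfolding l_def by (intro power_like_mult R power_like_divide P PC PD)
    show "power_like r (\<lambda>\<delta>. ?r p1 (c1 \<delta>) * ?r q1 (d1 \<delta>) * (?r p2 (c2 \<delta>) * ?r q2 (d2 \<delta>)))"
      unfolding r_def by (intro power_like_mult R P)
    fix \<delta> :: real assume "0 < \<delta>" "\<delta> \<le> 1"
    then show "?r p (C \<delta>) * ?r p (D \<delta>) * (?r q (c1 \<delta> * c2 \<delta> / C \<delta>) * ?r q (d2 \<delta> * d1 \<delta> / D \<delta>))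
      \<le> K * (?r p1 (c1 \<delta>) * ?r q1 (d1 \<delta>) * (?r p2 (c2 \<delta>) * ?r q2 (d2 \<delta>)))"
      by (intro K[of "\<delta> powr e1" "\<delta> powr e2"]) (auto simp: C_def D_def c1_def c2_def d1_def d2_def c_def d_def)
  qed
  define X where "X = i p * (min (a e1) (a e2) + min (b e1) (b e2)) + i q * (max (a e1) (a e2) + max (b e1) (b e2))"
  define Y where "Y = i p1 * a e1 + i p2 * a e2 + i q1 * b e1 + i q2 * b e2"
  have mm: "x + y - min x y = max x y" "min y x = min x y" for x y :: real by (auto simp: min_def max_def)
  have "l = - ?n * X" unfolding l_def X_def using mm(1)[of "a e1" "a e2"] mm(1)[of "b e2" "b e1"]
    by (simp add: mm(2)[of "b e1"] max.commute[of "b e2"] algebra_simps)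
  moreover have "r = - ?n * Y" unfolding r_def Y_def by (simp add: algebra_simps)
  ultimately have "?n * X \<le> ?n * Y" using \<open>r \<le> l\<close> by simp
  then show ?thesis unfolding X_def Y_def by (rule mult_left_le_imp_le) simp
qed

lemma one_divide_eq_ennreal: "0 < x \<Longrightarrow> 1 / x = ennreal (1 / enn2real x)"
  by (cases x) (auto simp: enn2real_inverse_ennreal)

lemma exponent_le_iff:
  assumes "0 < x" "0 < y" shows "x \<le> y \<longleftrightarrow> 1 / enn2real y \<le> 1 / enn2real x"
  using assms by (cases x; cases y) (auto simp: field_simps top_unique)

text \<open>Each of the six conditions is one choice of the exponents \<open>e1\<close> and
  \<open>e2\<close> from -1, 0 and 1.\<close>

lemma tau_wigner_bounded_necessary:
  fixes \<phi> :: "'a::euclidean_space \<Rightarrow> complex" and \<Phi> :: "'a \<times> 'a \<Rightarrow> complex"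
  assumes pos: "0 < p" "0 < q" "0 < p1" "0 < q1" "0 < p2" "0 < q2" and \<tau>: "0 < \<tau>" "\<tau> < 1"
    and \<phi>: "\<phi> \<in> schwartz" and \<Phi>: "\<Phi> \<in> schwartz" "\<Phi> \<noteq> (\<lambda>_. 0)"
    and bounded: "tau_wigner_bounded \<phi> \<Phi> \<tau> p1 q1 (\<lambda>_. 1) p2 q2 (\<lambda>_. 1) p q 0"
  shows "admissible p q p1 q1 p2 q2"
proof -
  note c = gaussian_exponent_condition[OF assms]
  note d = one_divide_eq_ennreal[OF pos(1)] one_divide_eq_ennreal[OF pos(2)] one_divide_eq_ennreal[OF pos(3)]
    one_divide_eq_ennreal[OF pos(4)] one_divide_eq_ennreal[OF pos(5)] one_divide_eq_ennreal[OF pos(6)]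
  show ?thesis unfolding admissible_def d
    \<comment> \<open>Exponents 1 1 and -1 -1 give the two sum conditions, for positions and for
      frequencies. Moving one parameter alone isolates a single exponent: 1 0 and 0 1 bound
      \<open>p1\<close> and \<open>p2\<close> by \<open>q\<close>, and -1 0 and 0 -1 bound
      \<open>q1\<close> and \<open>q2\<close>.\<close>
    using c[of 1 1] c[of 1 0] c[of 0 1] c[of "- 1" "- 1"] c[of "- 1" 0] c[of 0 "- 1"] pos
    by (simp add: exponent_le_iff ennreal_plus[symmetric] add.commute del: ennreal_plus)
qed

theorem theorem5p6:
  fixes p q p\<^sub>1 p\<^sub>2 q\<^sub>1 q\<^sub>2 :: ennreal
    and \<tau> :: real
    and \<phi> :: "real ^ 'd \<Rightarrow> complex"
    and \<Phi> :: "(real ^ 'd) \<times> (real ^ 'd) \<Rightarrow> complex"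
  assumes "0 < p" "0 < q" "0 < p\<^sub>1" "0 < p\<^sub>2" "0 < q\<^sub>1" "0 < q\<^sub>2"
    and "0 < \<tau>" "\<tau> < 1"
    and "\<phi> \<in> schwartz" "\<phi> \<noteq> (\<lambda>_. 0)"
    and "\<Phi> \<in> schwartz" "\<Phi> \<noteq> (\<lambda>_. 0)"
  shows "(tau_wigner_bounded \<phi> \<Phi> \<tau> p\<^sub>1 q\<^sub>1 (\<lambda>_. 1) p\<^sub>2 q\<^sub>2 (\<lambda>_. 1) p q 0 \<longleftrightarrow>
            p\<^sub>1 \<le> q \<and> q\<^sub>1 \<le> q \<and> p\<^sub>2 \<le> q \<and> q\<^sub>2 \<le> q \<and>
            1 / p\<^sub>1 + 1 / p\<^sub>2 \<ge> 1 / p + 1 / q \<and>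
            1 / q\<^sub>1 + 1 / q\<^sub>2 \<ge> 1 / p + 1 / q) \<and>
         (p\<^sub>1 \<le> q \<and> q\<^sub>1 \<le> q \<and> p\<^sub>2 \<le> q \<and> q\<^sub>2 \<le> q \<and>
            1 / p\<^sub>1 + 1 / p\<^sub>2 \<ge> 1 / p + 1 / q \<and>
            1 / q\<^sub>1 + 1 / q\<^sub>2 \<ge> 1 / p + 1 / q \<longrightarrow>
          (\<forall>s::real. tau_wigner_bounded \<phi> \<Phi> \<tau> p\<^sub>1 q\<^sub>1 (power_weight \<bar>s\<bar>) p\<^sub>2 q\<^sub>2 (power_weight s) p q s))"
proof -
  note nec = tau_wigner_bounded_necessary[OF assms(1,2,3,5,4,6,7,8,9,11,12)]
  note suf = tau_wigner_bounded_weighted[OF assms(1,2,3,5,4,6,7,8,9,10,11)]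
  show ?thesis
    \<comment> \<open>Sufficiency in the equivalence is the case \<open>s = 0\<close> of the
      weighted bound, where both weights are constantly 1.\<close>
    unfolding admissible_def[symmetric] using nec suf suf[of 0] by (auto simp: power_weight_zero)
qed

end
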